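(* Let $(M,g)$ be an $N$-dimensional spherically symmetric Riemannian manifold ($N\ge2$) with radius $R\in(0,\infty)$ and warping function $\phi$. Let $\theta\ge0$ and $p\ge1$ be real and $k\ge1$ an integer. Assume that the limit $\lim_{r\to R}\phi^{(j)}(r)\in(0,\infty)$ exists for every $j\ge0$. (1) Every function $u\in W^{k,p}_{\mathrm{rad}}(M)$ is almost everywhere equal to a function $U$ in $C^{k-1}((0,R]\times\mathbb S^{N-1})$. Additionally, all partial derivatives of $U$ of order $k$ (in the classical sense) exist almost everywhere for $x\in M$. (2) If $N>kp$, then the continuous embedding $$W^{k,p}_{\mathrm{rad}}(M)\hookrightarrow L^q_{\phi^\theta}(M)\quad\text{holds if}\quad 1\le q\le p^*_\theta:=\frac{(\theta+N)p}{N-kp}.$$ (3) If $N=kp$ and $p>1$, then the embedding $$W^{k,p}_{\mathrm{rad}}(M)\hookrightarrow L^q_{\phi^\theta}(M)\quad\text{is compact if}\quad 1\le q<\infty.$$ (4) If $N=kp$ and $p=1$, then $W^{N,1}_{\mathrm{rad}}(M)$ is continuously embedded in $C(\overline{B_R})$.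
   Context: A spherically symmetric Riemannian manifold $(M,g)$ of dimension $N\ge2$ is one such that (1) a single chart covers $M$, with image a ball $B_R=\{x\in\mathbb R^N:|x|<R\}$, $R\in(0,\infty]$; the point $o\in M$ corresponding to $0$ is the origin; (2) in polar coordinates $(r,\theta)$ of this chart, $g=\mathrm dr^2+\phi^2(r)\widetilde g$ where $\widetilde g$ is the standard metric of $\mathbb S^{N-1}$ and $\phi$ (the warping function) is a nonnegative smooth function on $[0,R)$, positive on $(0,R)$, with $\phi'(0)=1$ and $\phi^{(i)}(0)=0$ for all even $i\ge0$. One identifies $M=B_R$ and $M\setminus\{o\}=(0,R)\times\mathbb S^{N-1}$; $\overline{B_R}$ is the closed ball. A function $u\colon M\to\mathbb R$ is radial if there is $v\colon(0,R)\to\mathbb R$ with $u(x)=v(r)$ for all $x=(r,\theta)\in M\setminus\{o\}$. $\nabla^j u$ is the $j$-th covariant derivative ($\nabla^0u=u$) and $|\nabla^j u|_g$ its pointwise tensor norm induced by $g$. $W^{k,p}(M)$ is the completion of $\{u\in C^\infty(M):\int_M|\nabla^ju|_g^p\,\mathrm dV_g<\infty,\ j=0,\ldots,k\}$ under $\|u\|_{W^{k,p}(M)}=\sum_{j=0}^k(\int_M|\nabla^ju|_g^p\,\mathrm dV_g)^{1/p}$, regarded as a subspace of $L^p(M)$. $W^{k,p}_{\mathrm{rad}}(M)$ is the subspace of radial functions. $L^q_{\phi^\theta}(M)$ is the space of measurable $u\colon M\to\mathbb R$ with $\|u\|_{L^q_{\phi^\theta}(M)}=\big(\int_M|u(x)|^q\phi(r)^\theta\,\mathrm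 dV_g\big)^{1/q}<\infty$, where $x=(r,\cdot)$ in polar coordinates (the real exponent $\theta$ here is unrelated to the angular variable). *)

theory Defs
  imports "HOL-Analysis.Analysis"
begin

section \<open>Calculus in a chart\<close>

text \<open>Points of the chart are vectors \<open>x :: real^'n\<close>; the dimension \<open>N\<close> is \<open>CARD('n)\<close>.\<close>

definition partial :: "'n::finite \<Rightarrow> (real^'n \<Rightarrow> real) \<Rightarrow> real^'n \<Rightarrow> real" where
  "partial i f x = deriv (\<lambda>t. f (x + t *\<^sub>R axis i 1)) 0"

primrec partials :: "'n::finite list \<Rightarrow> (real^'n \<Rightarrow> real) \<Rightarrow> real^'n \<Rightarrow> real" where
  "partials [] f = f"
| "partials (i # I) f = partial i (partials I f)"

definition has_partial :: "'n::finite \<Rightarrow> (real^'n \<Rightarrow> real) \<Rightarrow> real^'n \<Rightarrow> bool" where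
  "has_partial i f x \<longleftrightarrow> (\<lambda>t. f (x + t *\<^sub>R axis i 1)) differentiable (at 0)"

text \<open>\<open>C\<^sup>m(S)\<close>. For open \<open>S\<close> this is the usual class. If \<open>S\<close> contains boundary points and lies in
  the closure of its interior, the partial derivatives are taken in the interior and are required to
  extend continuously to \<open>S\<close>; \<open>D I\<close> is that extension for the multi-index \<open>I\<close>.\<close>

definition Ck_on :: "nat \<Rightarrow> (real^'n::finite) set \<Rightarrow> (real^'n \<Rightarrow> real) \<Rightarrow> bool" where
  "Ck_on m S f \<longleftrightarrow> (\<exists>D :: 'n list \<Rightarrow> real^'n \<Rightarrow> real.
     (\<forall>x\<in>S. D [] x = f x) \<and>
     (\<forall>I. length I \<le> m \<longrightarrow> continuous_on S (D I)) \<and>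
     (\<forall>I i. length I < m \<longrightarrow> (\<forall>x\<in>interior S.
        ((\<lambda>t. D I (x + t *\<^sub>R axis i 1)) has_real_derivative D (i # I) x) (at 0))))"

section \<open>Riemannian metrics in a single chart\<close>

text \<open>A metric is given by its matrix \<open>g x\<close> in the coordinates of the chart. A covariant
  \<open>j\<close>-tensor field is given by its components: \<open>T I x\<close> is the component with index list \<open>I\<close>,
  \<open>length I = j\<close>; values at lists of other lengths are irrelevant.\<close>

type_synonym 'n metric = "real^'n \<Rightarrow> real^'n^'n"
type_synonym 'n tensor = "'n list \<Rightarrow> real^'n \<Rightarrow> real"

definition christoffel :: "'n::finite metric \<Rightarrow> 'n \<Rightarrow> 'n \<Rightarrow> 'n \<Rightarrow> real^'n \<Rightarrow> real" where
  "christoffel g m i j x = (1/2) * (\<Sum>l\<in>UNIV. matrix_inv (g x) $ m $ l *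
     (partial i (\<lambda>y. g y $ j $ l) x + partial j (\<lambda>y. g y $ i $ l) x
       - partial l (\<lambda>y. g y $ i $ j) x))"

text \<open>The covariant derivative of a \<open>j\<close>-tensor field; the new index is put first.\<close>

definition cov_deriv :: "'n::finite metric \<Rightarrow> nat \<Rightarrow> 'n tensor \<Rightarrow> 'n tensor" where
  "cov_deriv g j T I x = partial (hd I) (T (tl I)) x
     - (\<Sum>l<j. \<Sum>m\<in>UNIV. christoffel g m (hd I) (tl I ! l) x * T ((tl I)[l := m]) x)"

primrec nabla :: "'n::finite metric \<Rightarrow> nat \<Rightarrow> (real^'n \<Rightarrow> real) \<Rightarrow> 'n tensor" where
  "nabla g 0 u = (\<lambda>I. u)"
| "nabla g (Suc j) u = cov_deriv g j (nabla g j u)"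

definition tensor_norm :: "'n::finite metric \<Rightarrow> nat \<Rightarrow> 'n tensor \<Rightarrow> real^'n \<Rightarrow> real" where
  "tensor_norm g j T x = sqrt (\<Sum>I\<in>{I. length I = j}. \<Sum>J\<in>{J. length J = j}.
     (\<Prod>l<j. matrix_inv (g x) $ (I ! l) $ (J ! l)) * T I x * T J x)"

definition vol :: "'n::finite metric \<Rightarrow> (real^'n) set \<Rightarrow> (real^'n) measure" where
  "vol g \<Omega> = density (lebesgue_on \<Omega>) (\<lambda>x. ennreal (sqrt (det (g x))))"

section \<open>Lebesgue and Sobolev spaces\<close>

text \<open>Elements of these spaces are functions rather than classes; the sets are closed under
  changes on null sets. The values of functions outside the domain play no role.\<close>

definition Lw_space :: "'a measure \<Rightarrow> ('a \<Rightarrow> real) \<Rightarrow> real \<Rightarrow> ('a \<Rightarrow> real) set" where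
  "Lw_space M w q = {u \<in> borel_measurable M. integrable M (\<lambda>x. \<bar>u x\<bar> powr q * w x)}"

definition Lw_norm :: "'a measure \<Rightarrow> ('a \<Rightarrow> real) \<Rightarrow> real \<Rightarrow> ('a \<Rightarrow> real) \<Rightarrow> real" where
  "Lw_norm M w q u = (LINT x|M. \<bar>u x\<bar> powr q * w x) powr (1 / q)"

definition smooth_sobolev ::
    "'n::finite metric \<Rightarrow> (real^'n) set \<Rightarrow> nat \<Rightarrow> real \<Rightarrow> (real^'n \<Rightarrow> real) set" where
  "smooth_sobolev g \<Omega> k p = {u. (\<forall>m. Ck_on m \<Omega> u) \<and>
     (\<forall>j\<le>k. integrable (vol g \<Omega>) (\<lambda>x. tensor_norm g j (nabla g j u) x powr p))}"

definition smooth_sobolev_norm ::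
    "'n::finite metric \<Rightarrow> (real^'n) set \<Rightarrow> nat \<Rightarrow> real \<Rightarrow> (real^'n \<Rightarrow> real) \<Rightarrow> real" where
  "smooth_sobolev_norm g \<Omega> k p u =
     (\<Sum>j\<le>k. (LINT x|vol g \<Omega>. tensor_norm g j (nabla g j u) x powr p) powr (1 / p))"

text \<open>The element of \<open>L\<^sup>p\<close> determined by a Cauchy sequence of smooth functions, that is, by an
  element of the completion.\<close>

definition sobolev_rep ::
    "'n::finite metric \<Rightarrow> (real^'n) set \<Rightarrow> nat \<Rightarrow> real \<Rightarrow>
     (nat \<Rightarrow> real^'n \<Rightarrow> real) \<Rightarrow> (real^'n \<Rightarrow> real) \<Rightarrow> bool" where
  "sobolev_rep g \<Omega> k p us u \<longleftrightarrow>
     (\<forall>n. us n \<in> smooth_sobolev g \<Omega> k p) \<and>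
     (\<forall>e>0. \<exists>n0. \<forall>m\<ge>n0. \<forall>n\<ge>n0. smooth_sobolev_norm g \<Omega> k p (\<lambda>x. us m x - us n x) < e) \<and>
     u \<in> Lw_space (vol g \<Omega>) (\<lambda>_. 1) p \<and>
     (\<lambda>n. Lw_norm (vol g \<Omega>) (\<lambda>_. 1) p (\<lambda>x. us n x - u x)) \<longlonglongrightarrow> 0"

definition sobolev_space ::
    "'n::finite metric \<Rightarrow> (real^'n) set \<Rightarrow> nat \<Rightarrow> real \<Rightarrow> (real^'n \<Rightarrow> real) set" where
  "sobolev_space g \<Omega> k p = {u. \<exists>us. sobolev_rep g \<Omega> k p us u}"

text \<open>The norm of the completion: the limit of the norms of a representing Cauchy sequence. The
  covariant derivatives are closable in \<open>L\<^sup>p\<close> (this is why the completion is a subspace of \<open>L\<^sup>p\<close>),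
  so all sequences representing \<open>u\<close> give the same limit and \<open>Inf\<close> only names this number.\<close>

definition sobolev_norm ::
    "'n::finite metric \<Rightarrow> (real^'n) set \<Rightarrow> nat \<Rightarrow> real \<Rightarrow> (real^'n \<Rightarrow> real) \<Rightarrow> real" where
  "sobolev_norm g \<Omega> k p u =
     Inf {c. \<exists>us. sobolev_rep g \<Omega> k p us u \<and> (\<lambda>n. smooth_sobolev_norm g \<Omega> k p (us n)) \<longlonglongrightarrow> c}"

section \<open>Embeddings\<close>

text \<open>\<open>X\<close> and \<open>Y\<close> are spaces of functions considered up to equality almost everywhere in \<open>M\<close>,
  normed by \<open>nX\<close> and \<open>nY\<close>; the embedding sends the class of \<open>u\<close> to itself.\<close>

definition continuously_embedded ::
    "'a measure \<Rightarrow> ('a \<Rightarrow> real) set \<Rightarrow> (('a \<Rightarrow> real) \<Rightarrow> real) \<Rightarrow>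
     ('a \<Rightarrow> real) set \<Rightarrow> (('a \<Rightarrow> real) \<Rightarrow> real) \<Rightarrow> bool" where
  "continuously_embedded M X nX Y nY \<longleftrightarrow>
     (\<exists>C. \<forall>u\<in>X. \<exists>U\<in>Y. (AE x in M. u x = U x) \<and> nY U \<le> C * nX u)"

definition compactly_embedded ::
    "'a measure \<Rightarrow> ('a \<Rightarrow> real) set \<Rightarrow> (('a \<Rightarrow> real) \<Rightarrow> real) \<Rightarrow>
     ('a \<Rightarrow> real) set \<Rightarrow> (('a \<Rightarrow> real) \<Rightarrow> real) \<Rightarrow> bool" where
  "compactly_embedded M X nX Y nY \<longleftrightarrow>
     continuously_embedded M X nX Y nY \<and>
     (\<forall>us Us B. (\<forall>n::nat. us n \<in> X \<and> nX (us n) \<le> B \<and> Us n \<in> Y \<and> (AE x in M. us n x = Us n x)) \<longrightarrow>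
        (\<exists>r::nat \<Rightarrow> nat. \<exists>V\<in>Y. strict_mono r \<and> (\<lambda>n. nY (\<lambda>x. Us (r n) x - V x)) \<longlonglongrightarrow> 0))"

section \<open>Spherically symmetric manifolds\<close>

text \<open>Derivatives of functions of one variable relative to \<open>S\<close>, hence one-sided at end points of
  \<open>S\<close>.\<close>

primrec iter_deriv :: "real set \<Rightarrow> nat \<Rightarrow> (real \<Rightarrow> real) \<Rightarrow> real \<Rightarrow> real" where
  "iter_deriv S 0 f = f"
| "iter_deriv S (Suc j) f = (\<lambda>r. vector_derivative (iter_deriv S j f) (at r within S))"

definition warping_function :: "real \<Rightarrow> (real \<Rightarrow> real) \<Rightarrow> bool" where
  "warping_function R \<phi> \<longleftrightarrow>
     (\<forall>j. \<forall>r\<in>{0..<R}. iter_deriv {0..<R} j \<phi> differentiable (at r within {0..<R})) \<and>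
     (\<forall>r\<in>{0..<R}. \<phi> r \<ge> 0) \<and> (\<forall>r\<in>{0<..<R}. \<phi> r > 0) \<and>
     iter_deriv {0..<R} 1 \<phi> 0 = 1 \<and>
     (\<forall>i. even i \<longrightarrow> iter_deriv {0..<R} i \<phi> 0 = 0)"

text \<open>The metric \<open>dr\<^sup>2 + \<phi>(r)\<^sup>2 g'\<close>, \<open>g'\<close> the round metric of the unit sphere, in the Cartesian
  coordinates \<open>x = r \<omega>\<close>. With \<open>r = norm x\<close> one has \<open>dr(e\<^sub>i) = x\<^sub>i / r\<close> and
  \<open>d\<omega>(e\<^sub>i) = (e\<^sub>i - (x\<^sub>i / r\<^sup>2) x) / r\<close>, so that
  \<open>d\<omega>(e\<^sub>i) \<bullet> d\<omega>(e\<^sub>j) = (\<delta>\<^sub>i\<^sub>j - x\<^sub>i x\<^sub>j / r\<^sup>2) / r\<^sup>2\<close>. The value at the origin is the continuous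
  extension, by \<open>\<phi>(0) = 0\<close> and \<open>\<phi>'(0) = 1\<close>.\<close>

definition warped_metric :: "(real \<Rightarrow> real) \<Rightarrow> 'n::finite metric" where
  "warped_metric \<phi> x = (if x = 0 then mat 1 else
     (\<chi> i j. (x $ i / norm x) * (x $ j / norm x)
        + (\<phi> (norm x))\<^sup>2 * (((if i = j then 1 else 0) - x $ i * x $ j / (norm x)\<^sup>2) / (norm x)\<^sup>2)))"

definition radial :: "real \<Rightarrow> (real^'n::finite \<Rightarrow> real) \<Rightarrow> bool" where
  "radial R u \<longleftrightarrow> (\<exists>v :: real \<Rightarrow> real. \<forall>x\<in>ball 0 R - {0}. u x = v (norm x))"

definition M_vol :: "real \<Rightarrow> (real \<Rightarrow> real) \<Rightarrow> (real^'n::finite) measure" where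
  "M_vol R \<phi> = vol (warped_metric \<phi>) (ball 0 R)"

definition W_rad :: "real \<Rightarrow> (real \<Rightarrow> real) \<Rightarrow> nat \<Rightarrow> real \<Rightarrow> (real^'n::finite \<Rightarrow> real) set" where
  "W_rad R \<phi> k p = {u \<in> sobolev_space (warped_metric \<phi>) (ball 0 R) k p.
     \<exists>w. radial R w \<and> (AE x in M_vol R \<phi>. u x = w x)}"

definition W_norm :: "real \<Rightarrow> (real \<Rightarrow> real) \<Rightarrow> nat \<Rightarrow> real \<Rightarrow> (real^'n::finite \<Rightarrow> real) \<Rightarrow> real" where
  "W_norm R \<phi> k p = sobolev_norm (warped_metric \<phi>) (ball 0 R) k p"

definition L_weighted ::
    "real \<Rightarrow> (real \<Rightarrow> real) \<Rightarrow> real \<Rightarrow> real \<Rightarrow> (real^'n::finite \<Rightarrow> real) set" where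
  "L_weighted R \<phi> \<theta> q = Lw_space (M_vol R \<phi>) (\<lambda>x. \<phi> (norm x) powr \<theta>) q"

definition L_weighted_norm ::
    "real \<Rightarrow> (real \<Rightarrow> real) \<Rightarrow> real \<Rightarrow> real \<Rightarrow> (real^'n::finite \<Rightarrow> real) \<Rightarrow> real" where
  "L_weighted_norm R \<phi> \<theta> q = Lw_norm (M_vol R \<phi>) (\<lambda>x. \<phi> (norm x) powr \<theta>) q"

definition C_cball :: "real \<Rightarrow> (real^'n::finite \<Rightarrow> real) set" where
  "C_cball R = {U. continuous_on (cball 0 R) U}"

definition C_cball_norm :: "real \<Rightarrow> (real^'n::finite \<Rightarrow> real) \<Rightarrow> real" where
  "C_cball_norm R U = (SUP x\<in>cball 0 R. \<bar>U x\<bar>)"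

end

(* Radial lines of a warped metric are geodesics, so contracting the covariant derivative of order j
   with the radial unit vector in every slot gives the j-th radial derivative; hence that derivative
   is bounded by the tensor norm. Given smooth functions converging in the Sobolev norm to a radial
   function u, Fubini in polar coordinates (with Fatou's lemma for the norms) selects one direction
   along which the restrictions to the ray form a Cauchy sequence in the one-dimensional Sobolev space
   with weight r^(N-1) and have the right norm. Their limit is the profile of u, which reduces
   everything to weighted inequalities on (0,R): Hardy's inequality and a pointwise bound give the
   subcritical embedding, pointwise bounds with equicontinuity give compactness in the case N = kp,
   and Hardy's inequality down to weight 0 gives the uniform bound in the case p = 1. The a.e.
   differentiability of the derivative of order k - 1 follows from a weak type estimate. *)

theory Submission
  imports Defs "HOL-Complex_Analysis.Great_Picard"
begin

section \<open>Partial derivatives and smooth functions\<close>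

text \<open>The functions approximating a radial u need not be radial, and averaging them over
  spheres would require commuting covariant derivatives with the average. A single ray avoids this:
  u is radial, so almost every ray carries the same profile, and on a ray each approximant is an
  ordinary smooth function. No weak derivatives are set up: the derivatives of the profile of order
  below k are uniform limits away from the origin, and only the last one needs measure theory. The
  price is that on one ray the norms are controlled only for infinitely many indices, which is why
  estimates pass to the limit under a "frequently" bound. The norm of u is an infimum over
  representing sequences, so each estimate is proved at a level A above the norm, on a ray that may
  depend on A, with a constant that depends on neither A nor u. The conditions on \<phi> at 0 and at
  R combine into two-sided positive bounds for \<phi>(r)/r; these make the volume comparable to
  Lebesgue measure and bound the weight \<phi>^\<theta> by a multiple of r^\<theta>.\<close>

lemma has_derivative_partial:
  fixes f :: "real^'n::finite \<Rightarrow> real"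
  assumes "(f has_derivative D) (at x)"
  shows "((\<lambda>t. f (x + t *\<^sub>R axis i 1)) has_real_derivative D (axis i 1)) (at 0)"
proof -
  have 1: "((\<lambda>t::real. x + t *\<^sub>R axis i (1::real)) has_derivative (\<lambda>t. t *\<^sub>R axis i 1)) (at 0)"
    by (auto intro!: derivative_eq_intros)
  have "((\<lambda>t. f (x + t *\<^sub>R axis i 1)) has_derivative (\<lambda>t. D (t *\<^sub>R axis i 1))) (at 0)"
    using has_derivative_compose[OF 1] assms by simp
  moreover have "D (t *\<^sub>R axis i 1) = D (axis i 1) * t" for t
    using linear_scale[OF has_derivative_linear[OF assms]] by simp
  ultimately show ?thesis by (simp add: has_field_derivative_def)
qed

lemma partial_eq:
  assumes "(f has_derivative D) (at x)"
  shows "partial i f x = D (axis i 1)"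
  unfolding partial_def by (rule DERIV_imp_deriv[OF has_derivative_partial[OF assms]])

lemma partial_cong:
  assumes "open S" "x \<in> S" "\<And>y. y \<in> S \<Longrightarrow> f y = h y"
  shows "partial i f x = partial i h x"
proof -
  have "((\<lambda>t::real. x + t *\<^sub>R axis i (1::real)) \<longlongrightarrow> x + 0 *\<^sub>R axis i 1) (nhds 0)"
    by (intro tendsto_intros filterlim_ident)
  then have "\<forall>\<^sub>F t in nhds (0::real). x + t *\<^sub>R axis i 1 \<in> S"
    using assms(1,2) by (auto simp: tendsto_def)
  then have "\<forall>\<^sub>F t in nhds 0. f (x + t *\<^sub>R axis i 1) = h (x + t *\<^sub>R axis i 1)"
    by (rule eventually_mono) (simp add: assms(3))
  then show ?thesis unfolding partial_def by (rule deriv_cong_ev) simp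
qed

lemma differentiable_cong_open:
  assumes "f differentiable at x" "open S" "x \<in> S" "\<And>y. y \<in> S \<Longrightarrow> f y = h y"
  shows "h differentiable at x"
  using assms by (meson differentiable_def has_derivative_transform_within_open)

text \<open>The increment from x to x + h is taken one coordinate at a time: \<open>P A\<close>
  keeps the coordinates of h in A, and passing to \<open>insert a A\<close> moves along one axis,
  where the one-variable mean value bound applies. Induction over A up to \<open>UNIV\<close> adds
  up the errors.\<close>

lemma differentiable_of_continuous_partials:
  fixes f :: "real^'n::finite \<Rightarrow> real"
  assumes S: "open S"
    and der: "\<And>i x. x \<in> S \<Longrightarrow> ((\<lambda>t. f (x + t *\<^sub>R axis i 1)) has_real_derivative D i x) (at 0)"
    and cont: "\<And>i. continuous_on S (D i)" and x: "x \<in> S"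
  shows "f differentiable (at x)"
proof -
  have *: "\<exists>\<delta>>0. \<forall>h. norm h < \<delta> \<longrightarrow>
      \<bar>f (x + h) - f x - (\<Sum>i\<in>UNIV. D i x * h$i)\<bar> \<le> \<epsilon> * (\<Sum>i\<in>UNIV. \<bar>h$i\<bar>)" if "\<epsilon> > 0" for \<epsilon>
  proof -
    have "\<forall>i. \<exists>\<delta>>0. \<forall>y. dist y x < \<delta> \<longrightarrow> y \<in> S \<and> \<bar>D i y - D i x\<bar> < \<epsilon>"
    proof
      fix i
      obtain d1 where d1: "d1 > 0" "ball x d1 \<subseteq> S" using S x open_contains_ball by blast
      have "isCont (D i) x" using cont S x continuous_on_eq_continuous_at by blast
      then obtain d2 where "d2 > 0" "\<And>y. dist y x < d2 \<Longrightarrow> dist (D i y) (D i x) < \<epsilon>"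
        using \<open>\<epsilon> > 0\<close> unfolding continuous_at_eps_delta by blast
      with d1 show "\<exists>\<delta>>0. \<forall>y. dist y x < \<delta> \<longrightarrow> y \<in> S \<and> \<bar>D i y - D i x\<bar> < \<epsilon>"
        by (intro exI[of _ "min d1 d2"]) (auto simp: dist_real_def dist_commute subset_eq)
    qed
    then obtain \<delta> where \<delta>: "\<And>i. \<delta> i > 0" "\<And>i y. dist y x < \<delta> i \<Longrightarrow> y \<in> S \<and> \<bar>D i y - D i x\<bar> < \<epsilon>"
      by metis
    define d where "d = Min (range \<delta>)"
    have d: "d > 0" "\<And>i. d \<le> \<delta> i" using \<delta>(1) by (auto simp: d_def)
    have "\<bar>f (x + h) - f x - (\<Sum>i\<in>UNIV. D i x * h$i)\<bar> \<le> \<epsilon> * (\<Sum>i\<in>UNIV. \<bar>h$i\<bar>)" if h: "norm h < d" for h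
    proof -
      define P where "P A = (\<chi> i. if i \<in> A then h$i else 0)" for A
      have "\<bar>f (x + P A) - f x - (\<Sum>i\<in>A. D i x * h$i)\<bar> \<le> \<epsilon> * (\<Sum>i\<in>A. \<bar>h$i\<bar>)" if "finite A" for A
        using that
      proof induction
        case empty
        have "P {} = 0" by (simp add: P_def vec_eq_iff)
        then show ?case by simp
      next
        case (insert a A)
        have P: "P (insert a A) = P A + (h$a) *\<^sub>R axis a 1"
          using insert by (auto simp: P_def vec_eq_iff axis_def)
        define \<psi> where "\<psi> t = f (x + P A + t *\<^sub>R axis a 1) - D a x * t" for t
        have "norm (\<psi> (h$a) - \<psi> 0) \<le> \<epsilon> * norm (h$a - 0)"
        proof (rule field_differentiable_bound[where S="closed_segment 0 (h$a)" and f=\<psi>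
            and f'="\<lambda>t. D a (x + P A + t *\<^sub>R axis a 1) - D a x"])
          fix t assume t: "t \<in> closed_segment 0 (h$a)"
          have tb: "\<bar>t\<bar> \<le> \<bar>h$a\<bar>" using t by (auto simp: closed_segment_eq_real_ivl split: if_splits)
          have "norm (P A + t *\<^sub>R axis a 1) \<le> norm h"
            by (rule norm_le_componentwise_cart) (use tb insert in \<open>auto simp: P_def axis_def\<close>)
          then have in_ball: "dist (x + P A + t *\<^sub>R axis a 1) x < \<delta> a"
            using h d(2)[of a] by (simp add: dist_norm add.assoc)
          have "((\<lambda>s. f ((x + P A + t *\<^sub>R axis a 1) + s *\<^sub>R axis a 1)) has_real_derivative
              D a (x + P A + t *\<^sub>R axis a 1)) (at 0)"
            using der \<delta>(2)[OF in_ball] by simp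
          then have "((\<lambda>s. f (x + P A + s *\<^sub>R axis a 1)) has_real_derivative
              D a (x + P A + t *\<^sub>R axis a 1)) (at (0 + t))"
            unfolding DERIV_shift by (simp add: scaleR_add_left algebra_simps)
          then have "((\<lambda>s. f (x + P A + s *\<^sub>R axis a 1)) has_real_derivative
              D a (x + P A + t *\<^sub>R axis a 1)) (at t)" by simp
          then show "(\<psi> has_real_derivative D a (x + P A + t *\<^sub>R axis a 1) - D a x)
              (at t within closed_segment 0 (h$a))"
            unfolding \<psi>_def by (auto intro!: derivative_eq_intros intro: has_field_derivative_at_within)
          show "norm (D a (x + P A + t *\<^sub>R axis a 1) - D a x) \<le> \<epsilon>"
            using \<delta>(2)[OF in_ball] by simp
        qed auto
        then have "\<bar>f (x + P (insert a A)) - f (x + P A) - D a x * h$a\<bar> \<le> \<epsilon> * \<bar>h$a\<bar>"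
          by (simp add: \<psi>_def P algebra_simps)
        with insert show ?case by (simp add: algebra_simps)
      qed
      from this[of UNIV] show ?thesis by (simp add: P_def)
    qed
    with d(1) show ?thesis by blast
  qed
  have "(f has_derivative (\<lambda>h. \<Sum>i\<in>UNIV. D i x * h$i)) (at x)"
    unfolding has_derivative_at_alt
  proof (intro conjI allI impI)
    show "bounded_linear (\<lambda>h. \<Sum>i\<in>UNIV. D i x * h$i)"
      by (intro bounded_linear_sum bounded_linear_mult_right[THEN bounded_linear_compose] bounded_linear_vec_nth)
    fix e :: real assume "e > 0"
    define \<epsilon> where "\<epsilon> = e / CARD('n)"
    have "\<epsilon> > 0" using \<open>e > 0\<close> by (simp add: \<epsilon>_def)
    from *[OF this] obtain d where d: "d > 0" "\<And>h. norm h < d \<Longrightarrow>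
        \<bar>f (x + h) - f x - (\<Sum>i\<in>UNIV. D i x * h$i)\<bar> \<le> \<epsilon> * (\<Sum>i\<in>UNIV. \<bar>h$i\<bar>)" by blast
    show "\<exists>d>0. \<forall>y. norm (y - x) < d \<longrightarrow>
        norm (f y - f x - (\<Sum>i\<in>UNIV. D i x * (y - x) $ i)) \<le> e * norm (y - x)"
    proof (intro exI[of _ d] conjI allI impI d(1))
      fix y assume y: "norm (y - x) < d"
      have "(\<Sum>i\<in>UNIV. \<bar>(y - x)$i\<bar>) \<le> (\<Sum>i\<in>(UNIV::'n set). norm (y - x))"
        by (intro sum_mono component_le_norm_cart)
      then have "\<epsilon> * (\<Sum>i\<in>UNIV. \<bar>(y - x)$i\<bar>) \<le> \<epsilon> * (CARD('n) * norm (y - x))"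
        using \<open>\<epsilon> > 0\<close> by (intro mult_left_mono) auto
      also have "\<dots> = e * norm (y - x)" by (simp add: \<epsilon>_def)
      finally show "norm (f y - f x - (\<Sum>i\<in>UNIV. D i x * (y - x) $ i)) \<le> e * norm (y - x)"
        using d(2)[OF y] by simp
    qed
  qed
  then show ?thesis by (auto simp: differentiable_def)
qed

section \<open>Algebras of functions closed under partial derivatives\<close>

definition smooth_on :: "(real^'n::finite) set \<Rightarrow> (real^'n \<Rightarrow> real) \<Rightarrow> bool" where
  "smooth_on S f \<longleftrightarrow> (\<forall>I. \<forall>x\<in>S. partials I f differentiable (at x))"

text \<open>Replaces Leibniz formulas for multi-indices: if the partial derivatives of the
  generators G are polynomials in G, the whole algebra is closed under partial derivatives, so all
  its members are smooth. The clause \<open>cong\<close> makes membership depend on the values in S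
  only.\<close>

inductive_set poly_alg :: "(real^'n::finite) set \<Rightarrow> (real^'n \<Rightarrow> real) set \<Rightarrow> (real^'n \<Rightarrow> real) set"
  for S G where
  gen: "g \<in> G \<Longrightarrow> g \<in> poly_alg S G"
| const: "(\<lambda>_. c) \<in> poly_alg S G"
| add: "f \<in> poly_alg S G \<Longrightarrow> h \<in> poly_alg S G \<Longrightarrow> (\<lambda>x. f x + h x) \<in> poly_alg S G"
| mult: "f \<in> poly_alg S G \<Longrightarrow> h \<in> poly_alg S G \<Longrightarrow> (\<lambda>x. f x * h x) \<in> poly_alg S G"
| cong: "f \<in> poly_alg S G \<Longrightarrow> (\<And>x. x \<in> S \<Longrightarrow> f x = h x) \<Longrightarrow> h \<in> poly_alg S G"

lemma partial_add:
  assumes "f differentiable (at x)" "h differentiable (at x)"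
  shows "partial i (\<lambda>x. f x + h x) x = partial i f x + partial i h x"
proof -
  obtain D E where "(f has_derivative D) (at x)" "(h has_derivative E) (at x)"
    using assms by (auto simp: differentiable_def)
  then show ?thesis by (simp add: partial_eq partial_eq[OF has_derivative_add])
qed

lemma partial_mult:
  assumes "f differentiable (at x)" "h differentiable (at x)"
  shows "partial i (\<lambda>x. f x * h x) x = f x * partial i h x + partial i f x * h x"
proof -
  obtain D E where "(f has_derivative D) (at x)" "(h has_derivative E) (at x)"
    using assms by (auto simp: differentiable_def)
  then show ?thesis by (simp add: partial_eq partial_eq[OF has_derivative_mult])
qed

lemma partial_const [simp]: "partial i (\<lambda>_. c) x = 0"
  by (rule partial_eq[OF has_derivative_const])

lemma partial_sum:
  assumes "\<And>a. a \<in> A \<Longrightarrow> f a differentiable (at x)"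
  shows "partial i (\<lambda>x. \<Sum>a\<in>A. f a x) x = (\<Sum>a\<in>A. partial i (f a) x)"
  using assms
proof (induction A rule: infinite_finite_induct)
  case (insert a A)
  then have "(\<lambda>x. \<Sum>a\<in>A. f a x) differentiable (at x)" by (intro differentiable_sum) auto
  then show ?case using insert by (simp add: partial_add)
qed auto

lemma poly_alg_partial:
  assumes S: "open S"
    and G: "\<And>g x. g \<in> G \<Longrightarrow> x \<in> S \<Longrightarrow> g differentiable (at x)"
      "\<And>g i. g \<in> G \<Longrightarrow> partial i g \<in> poly_alg S G"
    and f: "f \<in> poly_alg S G"
  shows "(\<forall>x\<in>S. f differentiable (at x)) \<and> (\<forall>i. partial i f \<in> poly_alg S G)"
  using f
proof induction
  case (gen g)
  then show ?case using G by auto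
next
  case (const c)
  have "partial i (\<lambda>_. c) = (\<lambda>_::real^'a. 0)" for i by auto
  then show ?case by (auto intro: poly_alg.const)
next
  case (add f h)
  have "partial i (\<lambda>x. f x + h x) \<in> poly_alg S G" for i
    by (rule poly_alg.cong[OF poly_alg.add[of "partial i f" S G "partial i h"]]) (use add in \<open>auto simp: partial_add\<close>)
  then show ?case using add by auto
next
  case (mult f h)
  have "partial i (\<lambda>x. f x * h x) \<in> poly_alg S G" for i
    by (rule poly_alg.cong[OF poly_alg.add[OF poly_alg.mult[of f S G "partial i h"] poly_alg.mult[of "partial i f" S G h]]])
      (use mult in \<open>auto simp: partial_mult\<close>)
  then show ?case using mult by auto
next
  case (cong f h)
  have "partial i h \<in> poly_alg S G" for i
    by (rule poly_alg.cong[of "partial i f"]) (use cong in \<open>blast intro: partial_cong[OF S]\<close>)+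
  moreover have "\<forall>x\<in>S. h differentiable (at x)"
    using cong differentiable_cong_open[OF _ S] by blast
  ultimately show ?case by blast
qed

lemma poly_alg_smooth:
  assumes S: "open S"
    and G: "\<And>g x. g \<in> G \<Longrightarrow> x \<in> S \<Longrightarrow> g differentiable (at x)"
      "\<And>g i. g \<in> G \<Longrightarrow> partial i g \<in> poly_alg S G"
    and f: "f \<in> poly_alg S G"
  shows "smooth_on S f"
proof -
  have "partials I f \<in> poly_alg S G" for I
    by (induction I) (use f poly_alg_partial[OF S G] in auto)
  then show ?thesis unfolding smooth_on_def using poly_alg_partial[OF S G] by blast
qed

lemma partials_append: "partials (I @ J) f = partials I (partials J f)"
  by (induction I) auto

lemma smooth_on_partials: "smooth_on S f \<Longrightarrow> smooth_on S (partials J f)"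
  unfolding smooth_on_def by (metis partials_append)

lemma smooth_on_partial: "smooth_on S f \<Longrightarrow> smooth_on S (partial i f)"
  using smooth_on_partials[of S f "[i]"] by simp

lemma smooth_on_differentiable: "smooth_on S f \<Longrightarrow> x \<in> S \<Longrightarrow> f differentiable (at x)"
  unfolding smooth_on_def by (metis partials.simps(1))

lemma smooth_on_continuous_on: "smooth_on S f \<Longrightarrow> continuous_on S f"
  by (meson continuous_at_imp_continuous_on differentiable_imp_continuous_within smooth_on_differentiable)

text \<open>All iterated partial derivatives of given smooth functions form the basic admissible set
  of generators; quotients and compositions enlarge it.\<close>

lemma poly_alg_partials_closed:
  assumes F: "\<And>f. f \<in> F \<Longrightarrow> smooth_on S f"
    and G: "G = {partials I f | I f. f \<in> F}" and "g \<in> G"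
  shows "\<And>x. x \<in> S \<Longrightarrow> g differentiable (at x)" "\<And>i. partial i g \<in> poly_alg S G"
  using assms by (auto simp: smooth_on_def intro!: poly_alg.gen) (metis partials.simps(2))

lemma smooth_on_add_mult:
  assumes S: "open S" and "smooth_on S f" "smooth_on S h"
  shows smooth_on_add: "smooth_on S (\<lambda>x. f x + h x)" and smooth_on_mult: "smooth_on S (\<lambda>x. f x * h x)"
proof -
  define G where "G = {partials I g | I g. g \<in> {f, h}}"
  have G: "f \<in> G" "h \<in> G" unfolding G_def by (force intro: exI[of _ "[]"])+
  note c = poly_alg_partials_closed[where F="{f, h}" and S=S, OF _ G_def]
  have "\<And>g x. g \<in> G \<Longrightarrow> x \<in> S \<Longrightarrow> g differentiable (at x)"
      "\<And>g i. g \<in> G \<Longrightarrow> partial i g \<in> poly_alg S G"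
    using c assms by auto
  note sm = poly_alg_smooth[OF S this]
  show "smooth_on S (\<lambda>x. f x + h x)"
    by (rule sm) (use G in \<open>auto intro: poly_alg.intros\<close>)
  show "smooth_on S (\<lambda>x. f x * h x)"
    by (rule sm) (use G in \<open>auto intro: poly_alg.intros\<close>)
qed

lemma smooth_on_cong:
  assumes S: "open S" and f: "smooth_on S f" and eq: "\<And>x. x \<in> S \<Longrightarrow> f x = h x"
  shows "smooth_on S h"
proof -
  have "\<forall>x\<in>S. partials I h x = partials I f x" for I
    by (induction I) (auto simp: eq intro: partial_cong[OF S])
  then show ?thesis using f differentiable_cong_open[OF _ S] unfolding smooth_on_def by metis
qed

lemma smooth_on_const [simp]: "smooth_on S (\<lambda>_. c)"
proof -
  have "\<exists>d. partials I (\<lambda>_. c) = (\<lambda>_::real^'a. d)" for I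
  proof (induction I)
    case (Cons i I)
    then show ?case by (auto intro!: exI[of _ 0] ext)
  qed auto
  then show ?thesis unfolding smooth_on_def by (metis differentiable_const)
qed

lemma smooth_on_sum:
  assumes S: "open S" and "\<And>a. a \<in> A \<Longrightarrow> smooth_on S (f a)"
  shows "smooth_on S (\<lambda>x. \<Sum>a\<in>A. f a x)"
  using assms(2)
  by (induction A rule: infinite_finite_induct) (auto intro: smooth_on_add[OF S])

lemma smooth_on_prod:
  assumes S: "open S" and "\<And>a. a \<in> A \<Longrightarrow> smooth_on S (f a)"
  shows "smooth_on S (\<lambda>x. \<Prod>a\<in>A. f a x)"
  using assms(2)
  by (induction A rule: infinite_finite_induct) (auto intro: smooth_on_mult[OF S])

lemma smooth_on_diff:
  assumes S: "open S" and "smooth_on S f" "smooth_on S h"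
  shows "smooth_on S (\<lambda>x. f x - h x)"
  using smooth_on_add[OF S assms(2) smooth_on_mult[OF S smooth_on_const[where c="-1"] assms(3)]] by simp

text \<open>Adjoining 1/f to the partial derivatives of f keeps the generators admissible, because
  the derivative of 1/f is -f' (1/f)^2, a polynomial in them.\<close>

lemma smooth_on_inverse:
  assumes S: "open S" and f: "smooth_on S f" and nz: "\<And>x. x \<in> S \<Longrightarrow> f x \<noteq> 0"
  shows "smooth_on S (\<lambda>x. 1 / f x)"
proof -
  define G0 where "G0 = {partials I g | I g. g \<in> {f}}"
  define G where "G = insert (\<lambda>x. 1 / f x) G0"
  have mono: "poly_alg S G0 \<subseteq> poly_alg S G"
  proof
    fix g show "g \<in> poly_alg S G0 \<Longrightarrow> g \<in> poly_alg S G"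
      by (induction rule: poly_alg.induct) (auto simp: G_def intro: poly_alg.intros)
  qed
  have c: "\<And>g x. g \<in> G0 \<Longrightarrow> x \<in> S \<Longrightarrow> g differentiable (at x)"
      "\<And>g i. g \<in> G0 \<Longrightarrow> partial i g \<in> poly_alg S G"
    using poly_alg_partials_closed[where F="{f}" and S=S, OF _ G0_def] f mono by auto
  have fG: "f \<in> G0" unfolding G0_def by (force intro: exI[of _ "[]"])
  have 1: "(\<lambda>x. 1 / f x) differentiable (at x)" if "x \<in> S" for x
    using c(1)[OF fG that] nz[OF that] by auto
  have 2: "partial i (\<lambda>x. 1 / f x) x = (-1) * (partial i f x * ((1 / f x) * (1 / f x)))" if x: "x \<in> S" for x i
  proof -
    obtain D where D: "(f has_derivative D) (at x)" using c(1)[OF fG x] by (auto simp: differentiable_def)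
    show ?thesis using partial_eq[OF has_derivative_divide[OF has_derivative_const[of 1] D nz[OF x]]] partial_eq[OF D] nz[OF x]
      by (simp add: field_simps)
  qed
  have "partial i (\<lambda>x. 1 / f x) \<in> poly_alg S G" for i
    by (rule poly_alg.cong[OF poly_alg.mult[OF poly_alg.const[of "-1"] poly_alg.mult[OF c(2)[OF fG] poly_alg.mult[OF poly_alg.gen poly_alg.gen]]]])
      (auto simp: G_def 2)
  with 1 c show ?thesis
    by (intro poly_alg_smooth[OF S, of G]) (auto simp: G_def intro: poly_alg.gen)
qed

section \<open>Coordinates, the norm and functions of the norm\<close>

lemma partial_component: "partial i (\<lambda>x. x $ j) x = (if i = j then 1 else 0)"
  using partial_eq[OF bounded_linear.has_derivative[OF bounded_linear_vec_nth has_derivative_ident], of i j x]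
  by (simp add: axis_def)

lemma smooth_on_component: "open S \<Longrightarrow> smooth_on S (\<lambda>x. x $ j)"
  by (rule poly_alg_smooth[of S "{\<lambda>x. x $ j}"])
    (auto simp: partial_component bounded_linear_vec_nth bounded_linear_imp_differentiable
       intro: poly_alg.gen poly_alg.cong[OF poly_alg.const])

lemma partial_norm:
  assumes "x \<noteq> 0"
  shows "partial i norm x = x $ i * (1 / norm x)"
proof -
  have "(norm has_derivative (\<lambda>h. (x \<bullet> h) / norm x)) (at x)"
    using has_derivative_norm[OF assms] by (simp add: sgn_div_norm inner_commute field_simps)
  from partial_eq[OF this, of i] show ?thesis by (simp add: inner_axis)
qed

text \<open>The norm, its reciprocal and the coordinates are admissible generators: the derivatives
  of the norm are x_i (1/norm x), those of 1/norm follow from them.\<close>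

lemma smooth_on_norm:
  assumes S: "open S" and nz: "0 \<notin> S"
  shows "smooth_on S norm"
proof -
  have n: "norm differentiable (at x)" if "x \<in> S" for x :: "real^'a" using that nz by (auto intro!: differentiable_norm_at)
  define G where "G = {norm, \<lambda>x::real^'a. 1 / norm x} \<union> range (\<lambda>j x. x $ j)"
  have pn: "partial i norm \<in> poly_alg S G" for i
    by (rule poly_alg.cong[OF poly_alg.mult[of "\<lambda>x. x $ i" S G "\<lambda>x. 1 / norm x"]])
      (use nz in \<open>auto simp: G_def intro!: poly_alg.gen, subst partial_norm, auto\<close>)
  have "partial i (\<lambda>x. 1 / norm x) \<in> poly_alg S G" for i
  proof (rule poly_alg.cong[OF poly_alg.mult[OF poly_alg.const[of "-1"] poly_alg.mult[OF pn[of i]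
          poly_alg.mult[OF poly_alg.gen[of "\<lambda>x. 1 / norm x"] poly_alg.gen[of "\<lambda>x. 1 / norm x"]]]]])
    fix x assume "x \<in> S"
    with nz have "x \<noteq> 0" by auto
    obtain D where D: "(norm has_derivative D) (at x)" using n[OF \<open>x \<in> S\<close>] by (auto simp: differentiable_def)
    show "- 1 * (partial i norm x * (1 / norm x * (1 / norm x))) = partial i (\<lambda>x. 1 / norm x) x"
      using partial_eq[OF has_derivative_divide[OF has_derivative_const[of 1] D]] partial_eq[OF D] \<open>x \<noteq> 0\<close>
      by (simp add: field_simps)
  qed (auto simp: G_def)
  moreover have "partial i (\<lambda>x. x $ j) \<in> poly_alg S G" for i j
    by (rule poly_alg.cong[OF poly_alg.const[of "if i = j then 1 else 0"]]) (simp add: partial_component)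
  moreover have "(\<lambda>x. 1 / norm x) differentiable (at x)" if "x \<in> S" for x
    using that nz by (intro differentiable_divide n) auto
  ultimately show ?thesis using n pn
    by (intro poly_alg_smooth[OF S, of G]) (auto simp: G_def bounded_linear_vec_nth bounded_linear_imp_differentiable intro: poly_alg.gen)
qed

lemma has_derivative_compose_norm:
  assumes "x \<noteq> 0" "(f has_real_derivative d) (at (norm x))"
  shows "((\<lambda>x. f (norm x)) has_derivative (\<lambda>h. d * ((x \<bullet> h) / norm x))) (at x)"
proof -
  have 1: "(norm has_derivative (\<lambda>h. (x \<bullet> h) / norm x)) (at x)"
    using has_derivative_norm[OF assms(1)] by (simp add: sgn_div_norm inner_commute field_simps)
  show ?thesis using has_derivative_compose[OF 1, of f "(*) d"] assms(2) by (simp add: has_field_derivative_def)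
qed

lemma partial_compose_norm:
  assumes "x \<noteq> 0" "(f has_real_derivative d) (at (norm x))"
  shows "partial i (\<lambda>x. f (norm x)) x = d * (x $ i / norm x)"
  using partial_eq[OF has_derivative_compose_norm[OF assms]] by (simp add: inner_axis)

text \<open>The hypothesis lists all derivatives of \<open>f 0\<close> as a sequence, so that the
  functions \<open>f j (norm x)\<close> together with the components of the radial unit vector (and
  their derivatives) are admissible generators.\<close>

lemma smooth_on_compose_norm:
  fixes f :: "nat \<Rightarrow> real \<Rightarrow> real" and S :: "(real^'n::finite) set"
  assumes S: "open S" and nz: "0 \<notin> S"
    and der: "\<And>j x. x \<in> S \<Longrightarrow> (f j has_real_derivative f (Suc j) (norm x)) (at (norm x))"
  shows "smooth_on S (\<lambda>x. f 0 (norm x))"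
proof -
  define F where "F = range (\<lambda>i (x::real^'n). x $ i / norm x)"
  have F: "smooth_on S g" if gF: "g \<in> F" for g
  proof -
    obtain i where g: "g = (\<lambda>x::real^'n. x $ i * (1 / norm x))" using gF unfolding F_def by fastforce
    show ?thesis unfolding g by (intro smooth_on_mult[OF S] smooth_on_component[OF S] smooth_on_inverse[OF S] smooth_on_norm[OF S nz]) (use nz in auto)
  qed
  define G0 where "G0 = {partials I g | I g. g \<in> F}"
  define G where "G = range (\<lambda>j x. f j (norm x)) \<union> G0"
  have mono: "poly_alg S G0 \<subseteq> poly_alg S G"
  proof
    fix g show "g \<in> poly_alg S G0 \<Longrightarrow> g \<in> poly_alg S G"
      by (induction rule: poly_alg.induct) (auto simp: G_def intro: poly_alg.intros)
  qed
  have c: "\<And>g x. g \<in> G0 \<Longrightarrow> x \<in> S \<Longrightarrow> g differentiable (at x)"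
      "\<And>g i. g \<in> G0 \<Longrightarrow> partial i g \<in> poly_alg S G"
    using poly_alg_partials_closed[where F=F and S=S, OF _ G0_def] F mono by auto
  have xi: "(\<lambda>x. x $ i / norm x) \<in> G0" for i
    unfolding G0_def F_def by (auto intro!: exI[of _ "[]"])
  have "(\<lambda>x. f j (norm x)) differentiable (at x)" if "x \<in> S" for j x
    using has_derivative_compose_norm[OF _ der[OF that]] that nz unfolding differentiable_def by blast
  moreover have pc: "partial i (\<lambda>x. f j (norm x)) x = f (Suc j) (norm x) * (x $ i / norm x)" if "x \<in> S" for i j x
    using that nz by (intro partial_compose_norm der) auto
  have "partial i (\<lambda>x. f j (norm x)) \<in> poly_alg S G" for i j
    by (rule poly_alg.cong[OF poly_alg.mult[OF poly_alg.gen poly_alg.gen], of "\<lambda>x. f (Suc j) (norm x)" _ "\<lambda>x. x $ i / norm x"])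
      (use xi in \<open>auto simp: G_def pc\<close>)
  ultimately show ?thesis using c
    by (intro poly_alg_smooth[OF S, of G]) (auto simp: G_def intro: poly_alg.gen)
qed

text \<open>Each m comes with its own witness D. For a multi-index I the witness for m = length I +
  1 is used: it agrees with the iterated partial derivatives on S and has continuous first
  derivatives at I, which gives total differentiability.\<close>

lemma Ck_on_all_partials:
  assumes S: "open S" and u: "\<And>m. Ck_on m S u"
  shows "smooth_on S u" and "continuous_on S u"
proof -
  have *: "\<exists>D. (\<forall>x\<in>S. partials I u x = D I x) \<and> continuous_on S (D I) \<and> (\<forall>i. continuous_on S (D (i # I)) \<and>
     (\<forall>x\<in>S. ((\<lambda>t. D I (x + t *\<^sub>R axis i 1)) has_real_derivative D (i # I) x) (at 0)))" for I
  proof -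
    obtain D where D: "\<forall>x\<in>S. D [] x = u x" "\<And>J. length J \<le> Suc (length I) \<Longrightarrow> continuous_on S (D J)"
      "\<And>J i x. length J < Suc (length I) \<Longrightarrow> x \<in> S \<Longrightarrow>
        ((\<lambda>t. D J (x + t *\<^sub>R axis i 1)) has_real_derivative D (i # J) x) (at 0)"
      using u[of "Suc (length I)"] S unfolding Ck_on_def by (auto simp: interior_open)
    have "length J \<le> Suc (length I) \<Longrightarrow> \<forall>x\<in>S. partials J u x = D J x" for J
    proof (induction J)
      case (Cons i J)
      then have "\<forall>x\<in>S. partials J u x = D J x" by simp
      then have "partial i (partials J u) x = partial i (D J) x" if "x \<in> S" for x
        using partial_cong[OF S that] by blast
      then show ?case using D(3)[of J _ i] Cons.prems by (auto simp: partial_def DERIV_imp_deriv)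
    qed (use D in simp)
    then show ?thesis using D by (intro exI[of _ D]) auto
  qed
  show "smooth_on S u" unfolding smooth_on_def
  proof (intro allI ballI)
    fix I x assume x: "x \<in> S"
    obtain D where D: "\<forall>x\<in>S. partials I u x = D I x" "\<And>i. continuous_on S (D (i # I))"
      "\<And>i x. x \<in> S \<Longrightarrow> ((\<lambda>t. D I (x + t *\<^sub>R axis i 1)) has_real_derivative D (i # I) x) (at 0)"
      using *[of I] by blast
    have "D I differentiable (at x)"
      by (rule differentiable_of_continuous_partials[OF S D(3) D(2) x])
    then show "partials I u differentiable at x" using D(1) differentiable_cong_open[OF _ S x] by metis
  qed
  then show "continuous_on S u" by (rule smooth_on_continuous_on)
qed

lemma Ck_on_diff:
  assumes "Ck_on m S u" "Ck_on m S v"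
  shows "Ck_on m S (\<lambda>x. u x - v x)"
proof -
  obtain D where D: "\<forall>x\<in>S. D [] x = u x" "\<forall>I. length I \<le> m \<longrightarrow> continuous_on S (D I)"
     "\<forall>I i. length I < m \<longrightarrow> (\<forall>x\<in>interior S.
        ((\<lambda>t. D I (x + t *\<^sub>R axis i 1)) has_real_derivative D (i # I) x) (at 0))"
    using assms(1) unfolding Ck_on_def by blast
  obtain E where E: "\<forall>x\<in>S. E [] x = v x" "\<forall>I. length I \<le> m \<longrightarrow> continuous_on S (E I)"
     "\<forall>I i. length I < m \<longrightarrow> (\<forall>x\<in>interior S.
        ((\<lambda>t. E I (x + t *\<^sub>R axis i 1)) has_real_derivative E (i # I) x) (at 0))"
    using assms(2) unfolding Ck_on_def by blast
  show ?thesis unfolding Ck_on_def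
    by (rule exI[of _ "\<lambda>I x. D I x - E I x"]) (use D E in \<open>auto intro!: continuous_on_diff DERIV_diff\<close>)
qed

section \<open>The warped metric\<close>

lemma partial_diff:
  assumes "f differentiable (at x)" "h differentiable (at x)"
  shows "partial i (\<lambda>x. f x - h x) x = partial i f x - partial i h x"
proof -
  obtain D E where "(f has_derivative D) (at x)" "(h has_derivative E) (at x)"
    using assms by (auto simp: differentiable_def)
  then show ?thesis by (simp add: partial_eq partial_eq[OF has_derivative_diff])
qed

section \<open>Contractions over lists of indices\<close>

lemma sum_rotate:
  "(\<Sum>i\<in>A. \<Sum>j\<in>B. \<Sum>l\<in>C. f i j l) = (\<Sum>l\<in>C. \<Sum>i\<in>A. \<Sum>j\<in>B. f i j l)"
proof -
  have "(\<Sum>i\<in>A. \<Sum>j\<in>B. \<Sum>l\<in>C. f i j l) = (\<Sum>i\<in>A. \<Sum>l\<in>C. \<Sum>j\<in>B. f i j l)"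
    by (rule sum.cong[OF refl], rule sum.swap)
  also have "\<dots> = (\<Sum>l\<in>C. \<Sum>i\<in>A. \<Sum>j\<in>B. f i j l)" by (rule sum.swap)
  finally show ?thesis .
qed

lemma length_Suc_lists:
  "{I::'a::finite list. length I = Suc j} = (\<lambda>(i, I). i # I) ` (UNIV \<times> {I. length I = j})"
  by (auto simp: image_iff length_Suc_conv)

lemma sum_lists_Suc:
  "(\<Sum>I\<in>{I::'a::finite list. length I = Suc j}. f I) = (\<Sum>i\<in>UNIV. \<Sum>I\<in>{I. length I = j}. f (i # I))"
  unfolding length_Suc_lists
  by (subst sum.reindex) (auto simp: inj_on_def sum.cartesian_product case_prod_unfold)

lemma sum_lists_prod:
  fixes f :: "nat \<Rightarrow> 'a::finite \<Rightarrow> real"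
  shows "(\<Sum>I\<in>{I. length I = j}. \<Prod>l<j. f l (I ! l)) = (\<Prod>l<j. \<Sum>i\<in>UNIV. f l i)"
proof (induction j arbitrary: f)
  case (Suc j)
  have "(\<Sum>I\<in>{I. length I = Suc j}. \<Prod>l<Suc j. f l (I ! l))
      = (\<Sum>i\<in>UNIV. f 0 i * (\<Sum>I\<in>{I. length I = j}. \<Prod>l<j. f (Suc l) (I ! l)))"
    by (simp add: sum_lists_Suc prod.lessThan_Suc_shift sum_distrib_left del: prod.lessThan_Suc)
  also have "\<dots> = (\<Sum>i\<in>UNIV. f 0 i * (\<Prod>l<j. \<Sum>i\<in>UNIV. f (Suc l) i))"
    by (simp add: Suc[of "\<lambda>l. f (Suc l)"])
  finally show ?case by (simp add: prod.lessThan_Suc_shift sum_distrib_right del: prod.lessThan_Suc)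
qed simp

text \<open>If A = B^T B, contracting T with itself through A in every slot is the sum of squares of
  the components of T transformed by B in every slot. With B the root of the inverse metric this
  makes the tensor norm Euclidean.\<close>

lemma tensor_square:
  fixes A B :: "'a::finite \<Rightarrow> 'a \<Rightarrow> real"
  assumes A: "\<And>a b. A a b = (\<Sum>k\<in>UNIV. B k a * B k b)"
  shows "(\<Sum>I\<in>{I. length I = j}. \<Sum>J\<in>{J. length J = j}. (\<Prod>l<j. A (I ! l) (J ! l)) * T I * T J)
    = (\<Sum>K\<in>{K. length K = j}. (\<Sum>I\<in>{I. length I = j}. (\<Prod>l<j. B (K ! l) (I ! l)) * T I)\<^sup>2)"
    (is "?L = ?R")
proof -
  let ?S = "{I::'a list. length I = j}"
  have "?L = (\<Sum>I\<in>?S. \<Sum>J\<in>?S. \<Sum>K\<in>?S.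
      ((\<Prod>l<j. B (K ! l) (I ! l)) * T I) * ((\<Prod>l<j. B (K ! l) (J ! l)) * T J))"
  proof (intro sum.cong refl)
    fix I J
    have "(\<Prod>l<j. A (I ! l) (J ! l)) = (\<Sum>K\<in>?S. \<Prod>l<j. B (K ! l) (I ! l) * B (K ! l) (J ! l))"
      unfolding A using sum_lists_prod[where j=j and f="\<lambda>l k. B k (I ! l) * B k (J ! l)"] by simp
    then show "(\<Prod>l<j. A (I ! l) (J ! l)) * T I * T J = (\<Sum>K\<in>?S.
      ((\<Prod>l<j. B (K ! l) (I ! l)) * T I) * ((\<Prod>l<j. B (K ! l) (J ! l)) * T J))"
      by (simp add: sum_distrib_right sum_distrib_left prod.distrib mult_ac)
  qed
  also have "\<dots> = (\<Sum>K\<in>?S. \<Sum>I\<in>?S. \<Sum>J\<in>?S.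
      ((\<Prod>l<j. B (K ! l) (I ! l)) * T I) * ((\<Prod>l<j. B (K ! l) (J ! l)) * T J))"
    by (rule sum_rotate)
  also have "\<dots> = ?R" by (simp add: power2_eq_square sum_product)
  finally show ?thesis .
qed

text \<open>The map that is the identity on the line of \<open>x\<close> and multiplication by \<open>b\<close> on its orthogonal
  complement; the metric, its inverse and the square root of its inverse are all of this form.\<close>

definition rmat :: "real \<Rightarrow> real^'n::finite \<Rightarrow> real^'n^'n" where
  "rmat b x = (\<chi> i j. (1 - b) * (x $ i / norm x * (x $ j / norm x)) + (if i = j then b else 0))"

lemma rmat_nth: "rmat b x $ i $ j = (1 - b) * (x $ i / norm x * (x $ j / norm x)) + (if i = j then b else 0)"
  by (simp add: rmat_def)

lemma sum_unit_sq:
  assumes "x \<noteq> (0::real^'n::finite)"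
  shows "(\<Sum>i\<in>UNIV. x $ i / norm x * (x $ i / norm x)) = 1"
proof -
  have "(\<Sum>i\<in>UNIV. x $ i / norm x * (x $ i / norm x)) = (\<Sum>i\<in>UNIV. x $ i * x $ i) / (norm x)\<^sup>2"
    by (simp add: sum_divide_distrib power2_eq_square)
  also have "(\<Sum>i\<in>UNIV. x $ i * x $ i) = (norm x)\<^sup>2"
    unfolding power2_norm_eq_inner inner_vec_def by simp
  also have "(norm x)\<^sup>2 / (norm x)\<^sup>2 = 1" using assms by simp
  finally show ?thesis .
qed

text \<open>With n = x / norm x, \<open>rmat b x\<close> is n n^T + b (1 - n n^T), and the two
  summands involve complementary orthogonal projections; products therefore multiply the
  parameters.\<close>

lemma rmat_mult:
  assumes "x \<noteq> 0"
  shows "rmat b x ** rmat c x = rmat (b * c) x"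
proof -
  define n where "n i = x $ i / norm x" for i
  have r: "rmat b x $ i $ j = (1 - b) * (n i * n j) + (if i = j then b else 0)" for b i j
    by (simp add: rmat_nth n_def)
  have n: "(\<Sum>i\<in>UNIV. n i * n i) = 1" unfolding n_def by (rule sum_unit_sq[OF assms])
  have "(\<Sum>k\<in>UNIV. rmat b x $ i $ k * rmat c x $ k $ j) = rmat (b * c) x $ i $ j" for i j
  proof -
    have "(\<Sum>k\<in>UNIV. rmat b x $ i $ k * rmat c x $ k $ j)
      = (\<Sum>k\<in>UNIV. (1 - b) * (1 - c) * (n i * n j) * (n k * n k)
         + (if k = j then (1 - b) * c * (n i * n k) else 0)
         + (if i = k then b * (1 - c) * (n k * n j) + (if i = j then b * c else 0) else 0))"
      by (intro sum.cong) (auto simp: r algebra_simps)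
    also have "\<dots> = (1 - b) * (1 - c) * (n i * n j) * (\<Sum>k\<in>UNIV. n k * n k)
         + (1 - b) * c * (n i * n j) + b * (1 - c) * (n i * n j) + (if i = j then b * c else 0)"
      by (simp add: sum.distrib sum_distrib_left[symmetric])
    also have "\<dots> = rmat (b * c) x $ i $ j"
      unfolding n r by (simp add: algebra_simps)
    finally show ?thesis .
  qed
  then show ?thesis by (simp add: vec_eq_iff matrix_matrix_mult_def)
qed

lemma rmat_one: "rmat 1 x = mat 1"
  by (simp add: vec_eq_iff rmat_nth mat_def)

lemma rmat_sym: "rmat b x $ i $ j = rmat b x $ j $ i"
  by (auto simp: rmat_nth)

lemma rmat_radial:
  assumes "x \<noteq> 0"
  shows "(\<Sum>j\<in>UNIV. rmat b x $ i $ j * x $ j) = x $ i"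
proof -
  let ?n = "\<lambda>i. x $ i / norm x"
  have "(\<Sum>j\<in>UNIV. rmat b x $ i $ j * x $ j)
      = (\<Sum>j\<in>UNIV. (1 - b) * x $ i * (?n j * ?n j) + (if i = j then b * x $ j else 0))"
    using assms by (intro sum.cong) (auto simp: rmat_nth field_simps)
  also have "\<dots> = (1 - b) * x $ i * (\<Sum>j\<in>UNIV. ?n j * ?n j) + b * x $ i"
    by (simp only: sum.distrib sum_distrib_left[symmetric]) simp
  finally show ?thesis unfolding sum_unit_sq[OF assms] by (simp add: algebra_simps)
qed

lemma matrix_inv_unique:
  fixes A B :: "real^'n::finite^'n"
  assumes "A ** B = mat 1" "B ** A = mat 1"
  shows "matrix_inv A = B"
proof -
  have "A ** matrix_inv A = mat 1 \<and> matrix_inv A ** A = mat 1"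
    unfolding matrix_inv_def by (rule someI[of _ B]) (use assms in auto)
  then have "matrix_inv A = matrix_inv A ** (A ** B)" "matrix_inv A ** A = mat 1"
    using assms by simp_all
  then show ?thesis by (metis matrix_mul_assoc matrix_mul_lid)
qed

lemma matrix_inv_rmat:
  assumes "x \<noteq> 0" "b \<noteq> 0"
  shows "matrix_inv (rmat b x) = rmat (1 / b) x"
proof -
  have "rmat b x ** rmat (1 / b) x = mat 1" "rmat (1 / b) x ** rmat b x = mat 1"
    using assms by (simp_all add: rmat_mult rmat_one)
  then show ?thesis by (rule matrix_inv_unique)
qed

lemma warped_metric_eq:
  assumes "x \<noteq> 0"
  shows "warped_metric \<phi> x = rmat ((\<phi> (norm x) / norm x)\<^sup>2) x"
  using assms by (auto simp: vec_eq_iff warped_metric_def rmat_nth field_simps power2_eq_square)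

section \<open>The warped metric away from the origin\<close>

locale warped =
  fixes R :: real and \<phi> :: "real \<Rightarrow> real"
  assumes R: "R > 0" and warping: "warping_function R \<phi>"
    and lim: "\<And>j. \<exists>L>0. (iter_deriv {0..<R} j \<phi> \<longlongrightarrow> L) (at_left R)"
begin

text \<open>The origin is removed because polar expressions such as x / norm x are smooth only away
  from it; it is a null set for all integrals.\<close>

definition M :: "(real^'n::finite) set" where "M = ball 0 R - {0}"

lemma open_M [simp]: "open M" by (simp add: M_def open_delete)

lemma M_I: "0 < norm x \<Longrightarrow> norm x < R \<Longrightarrow> x \<in> M" by (auto simp: M_def)

lemma M_D: assumes "x \<in> M" shows "x \<noteq> 0" "0 < norm x" "norm x < R" using assms by (auto simp: M_def)

lemma iter_deriv_has_derivative:
  assumes "0 < r" "r < R"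
  shows "(iter_deriv {0..<R} j \<phi> has_real_derivative iter_deriv {0..<R} (Suc j) \<phi> r) (at r)"
proof -
  have "at r within {0..<R} = at r" using assms by (intro at_within_interior) simp
  moreover have "iter_deriv {0..<R} j \<phi> differentiable (at r within {0..<R})"
    using warping assms unfolding warping_function_def by auto
  ultimately show ?thesis
    unfolding has_real_derivative_iff_has_vector_derivative
    by (simp add: vector_derivative_works)
qed

lemma phi_pos: "0 < r \<Longrightarrow> r < R \<Longrightarrow> 0 < \<phi> r"
  using warping unfolding warping_function_def by auto

lemma continuous_on_phi: "continuous_on {0<..<R} \<phi>"
  using iter_deriv_has_derivative[of _ 0] by (intro continuous_at_imp_continuous_on ballI) (auto intro: DERIV_isCont)

text \<open>The quotient tends to \<phi>'(0) = 1 at the origin and to L/R > 0 at R, and is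
  continuous and positive in between, so compactness gives both bounds.\<close>

lemma phi_ratio_bounds: "\<exists>b1>0. \<exists>b2>0. \<forall>r. 0 < r \<and> r < R \<longrightarrow> b1 \<le> \<phi> r / r \<and> \<phi> r / r \<le> b2"
proof -
  have at0: "((\<lambda>r. \<phi> r / r) \<longlongrightarrow> 1) (at_right 0)"
  proof -
    have 0: "\<phi> 0 = 0" "iter_deriv {0..<R} 1 \<phi> 0 = 1"
      using warping unfolding warping_function_def by (auto dest!: spec[of _ 0])
    have "\<phi> differentiable (at 0 within {0..<R})"
      using warping R unfolding warping_function_def by (auto dest!: spec[of _ 0])
    then have "(\<phi> has_real_derivative 1) (at 0 within {0..<R})"
      using 0(2) by (simp add: has_real_derivative_iff_has_vector_derivative vector_derivative_works)
    then have "((\<lambda>r. \<phi> r / r) \<longlongrightarrow> 1) (at 0 within {0..<R})"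
      by (simp add: has_field_derivative_iff 0)
    moreover have "at 0 within {0..<R} = at_right 0"
      using R by (intro at_within_nhd[of _ "{-1<..<R}"]) auto
    ultimately show ?thesis by simp
  qed
  obtain L where L: "L > 0" "(\<phi> \<longlongrightarrow> L) (at_left R)" using lim[of 0] by auto
  have atR: "((\<lambda>r. \<phi> r / r) \<longlongrightarrow> L / R) (at_left R)"
    using L R by (intro tendsto_intros) auto
  have "L / R > 0" using L R by simp
  define a b where "a = min (1/2) (L / R / 2)" and "b = max 2 (2 * (L / R))"
  have "\<forall>\<^sub>F r in at_right 0. 1/2 < \<phi> r / r \<and> \<phi> r / r < 2"
    using order_tendstoD[OF at0, of "1/2"] order_tendstoD[OF at0, of "2"] by (auto intro: eventually_conj)
  then obtain d1 where d1: "d1 > 0" "\<And>r. 0 < r \<Longrightarrow> r < d1 \<Longrightarrow> 1/2 < \<phi> r / r \<and> \<phi> r / r < 2"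
    by (auto simp: eventually_at_right_field)
  have "\<forall>\<^sub>F r in at_left R. L/R/2 < \<phi> r / r \<and> \<phi> r / r < 2 * (L/R)"
    using order_tendstoD[OF atR, of "L/R/2"] order_tendstoD[OF atR, of "2*(L/R)"] \<open>L/R > 0\<close> by (auto intro: eventually_conj)
  then obtain d2 where d2: "d2 < R" "\<And>r. d2 < r \<Longrightarrow> r < R \<Longrightarrow> L/R/2 < \<phi> r / r \<and> \<phi> r / r < 2 * (L/R)"
    by (auto simp: eventually_at_left_field)
  \<comment> \<open>As c < d1 and d \<ge> d2, the pieces (0,d1), [c,d] and (d2,R) cover (0,R); c
    \<le> R/4 and d \<ge> R/2 keep the middle interval nonempty.\<close>
  define c d where "c = min d1 (R/2) / 2" and "d = max d2 (R/2)"
  have cd: "0 < c" "c < d1" "c \<le> d" "d < R" using d1(1) d2(1) R by (auto simp: c_def d_def min_def max_def)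
  have cont: "continuous_on {c..d} (\<lambda>r. \<phi> r / r)"
    using cd by (intro continuous_intros continuous_on_subset[OF continuous_on_phi]) auto
  obtain m where m: "m \<in> {c..d}" "\<And>r. r \<in> {c..d} \<Longrightarrow> \<phi> m / m \<le> \<phi> r / r"
    using continuous_attains_inf[OF _ _ cont] cd by auto
  obtain m' where m': "m' \<in> {c..d}" "\<And>r. r \<in> {c..d} \<Longrightarrow> \<phi> r / r \<le> \<phi> m' / m'"
    using continuous_attains_sup[OF _ _ cont] cd by auto
  define b1 b2 where "b1 = min a (\<phi> m / m)" and "b2 = max b (\<phi> m' / m')"
  have "0 < a" "0 < b" "0 < \<phi> m / m" using phi_pos[of m] m(1) cd \<open>L/R > 0\<close> by (auto simp: a_def b_def)
  then have b: "b1 > 0" "b2 > 0" by (auto simp: b1_def b2_def)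
  have bb: "b1 \<le> 1/2" "b1 \<le> L/R/2" "b1 \<le> \<phi> m / m" "2 \<le> b2" "2 * (L/R) \<le> b2" "\<phi> m' / m' \<le> b2"
    unfolding b1_def b2_def a_def b_def by linarith+
  have "b1 \<le> \<phi> r / r \<and> \<phi> r / r \<le> b2" if "0 < r" "r < R" for r
  proof -
    consider "r < d1" | "r \<in> {c..d}" | "d2 < r" using cd that by (cases "r < d1"; cases "r \<le> d") (auto simp: d_def)
    then show ?thesis
    proof cases
      case 1
      then show ?thesis using d1(2)[OF that(1) 1] bb by linarith
    next
      case 2
      then show ?thesis using m(2)[OF 2] m'(2)[OF 2] bb by linarith
    next
      case 3
      then show ?thesis using d2(2)[OF 3 that(2)] bb by linarith
    qed
  qed
  with b show ?thesis by blast
qed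

abbreviation \<rho> :: "real^'n::finite \<Rightarrow> real" where "\<rho> x \<equiv> \<phi> (norm x) / norm x"

lemma rho_pos: "x \<in> M \<Longrightarrow> 0 < \<rho> x" by (auto simp: M_def phi_pos)

lemma metric_eq: "x \<in> M \<Longrightarrow> warped_metric \<phi> x = rmat ((\<rho> x)\<^sup>2) x"
  by (rule warped_metric_eq) (auto simp: M_def)

lemma metric_inv: "x \<in> M \<Longrightarrow> matrix_inv (warped_metric \<phi> x) = rmat (1 / (\<rho> x)\<^sup>2) x"
  unfolding metric_eq by (rule matrix_inv_rmat) (use rho_pos[of x] M_D[of x] in auto)

lemma smooth_rho: "smooth_on M (\<rho> :: real^'n::finite \<Rightarrow> real)"
proof -
  have "smooth_on M (\<lambda>x::real^'n. iter_deriv {0..<R} 0 \<phi> (norm x))"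
    by (rule smooth_on_compose_norm) (auto simp: M_def simp del: iter_deriv.simps intro!: iter_deriv_has_derivative)
  then have "smooth_on M (\<lambda>x::real^'n. \<phi> (norm x) * (1 / norm x))"
    by (intro smooth_on_mult smooth_on_inverse smooth_on_norm) (auto simp: M_def)
  then show ?thesis by simp
qed

lemma smooth_rmat:
  assumes "smooth_on M b"
  shows "smooth_on M (\<lambda>x::real^'n::finite. rmat (b x) x $ i $ j)"
proof -
  define p where "p i x = x $ i * (1 / norm x)" for i and x :: "real^'n"
  have 1: "smooth_on M (p i)" for i unfolding p_def
    by (intro smooth_on_mult smooth_on_inverse smooth_on_norm smooth_on_component) (auto simp: M_def)
  have "smooth_on M (\<lambda>x. (1 - b x) * (p i x * p j x))"
    by (intro smooth_on_mult smooth_on_diff smooth_on_const 1 assms open_M)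
  then have "smooth_on M (\<lambda>x. (1 - b x) * (p i x * p j x) + (if i = j then b x else 0))"
    using assms by (cases "i = j") (auto intro: smooth_on_add)
  then show ?thesis by (simp add: rmat_nth p_def)
qed

lemma smooth_metric: "smooth_on M (\<lambda>x::real^'n::finite. warped_metric \<phi> x $ i $ j)"
proof -
  have "smooth_on M (\<lambda>x::real^'n. rmat (\<rho> x * \<rho> x) x $ i $ j)"
    by (intro smooth_rmat smooth_on_mult smooth_rho) simp_all
  then show ?thesis by (rule smooth_on_cong[OF open_M]) (simp add: metric_eq power2_eq_square)
qed

lemma smooth_metric_inv: "smooth_on M (\<lambda>x::real^'n::finite. matrix_inv (warped_metric \<phi> x) $ i $ j)"
proof -
  have "smooth_on M (\<lambda>x::real^'n. rmat (1 / (\<rho> x * \<rho> x)) x $ i $ j)"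
    using rho_pos by (intro smooth_rmat smooth_on_inverse smooth_on_mult smooth_rho) (auto dest: rho_pos)
  then show ?thesis by (rule smooth_on_cong[OF open_M]) (simp add: metric_inv power2_eq_square)
qed

lemma smooth_christoffel: "smooth_on M (christoffel (warped_metric \<phi>) m i j :: real^'n::finite \<Rightarrow> real)"
  unfolding christoffel_def[abs_def]
  by (intro smooth_on_mult smooth_on_sum smooth_on_const smooth_on_diff smooth_on_add smooth_metric_inv
      smooth_on_partial smooth_metric open_M)

lemma smooth_nabla:
  assumes "smooth_on M u"
  shows "smooth_on M (nabla (warped_metric \<phi>) j u I :: real^'n::finite \<Rightarrow> real)"
proof (induction j arbitrary: I)
  case (Suc j)
  show ?case unfolding nabla.simps cov_deriv_def[abs_def]
    by (intro smooth_on_mult smooth_on_sum smooth_on_diff Suc smooth_christoffel smooth_on_partial open_M)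
qed (use assms in simp)

text \<open>\<open>partial\<close> is built on \<open>deriv\<close>, which is additive only at
  points of differentiability. Linearity is therefore proved for smooth u and v, and on the open set
  M, so that the induction hypothesis can be differentiated.\<close>

lemma nabla_diff:
  assumes "smooth_on M u" "smooth_on M v" "(x::real^'n::finite) \<in> M"
  shows "nabla (warped_metric \<phi>) j (\<lambda>x. u x - v x) I x = nabla (warped_metric \<phi>) j u I x - nabla (warped_metric \<phi>) j v I x"
  using assms(3)
proof (induction j arbitrary: I x)
  case (Suc j)
  let ?n = "nabla (warped_metric \<phi>) j"
  have "partial i (?n (\<lambda>x. u x - v x) J) x = partial i (?n u J) x - partial i (?n v J) x" for i J
  proof -
    have "partial i (?n (\<lambda>x. u x - v x) J) x = partial i (\<lambda>x. ?n u J x - ?n v J x) x"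
      by (rule partial_cong[OF open_M Suc.prems]) (simp add: Suc.IH)
    also have "\<dots> = partial i (?n u J) x - partial i (?n v J) x"
      using smooth_on_differentiable[OF smooth_nabla[OF assms(1)] Suc.prems] smooth_on_differentiable[OF smooth_nabla[OF assms(2)] Suc.prems]
      by (rule partial_diff)
    finally show ?thesis .
  qed
  then show ?case using Suc.IH[OF Suc.prems]
    by (simp add: cov_deriv_def right_diff_distrib sum_subtractf)
qed simp

text \<open>Radial lines are geodesics. The identity behind this is the derivative of
  \<open>\<Sum>\<^sub>j g\<^sub>l\<^sub>j x\<^sub>j = x\<^sub>l\<close>.\<close>

lemma metric_partial_radial:
  assumes x: "(x::real^'n::finite) \<in> M"
  shows "(\<Sum>j\<in>UNIV. partial i (\<lambda>y. warped_metric \<phi> y $ l $ j) x * x $ j)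
    = (if i = l then 1 else 0) - warped_metric \<phi> x $ l $ i"
proof -
  let ?g = "\<lambda>l j y. warped_metric \<phi> (y::real^'n) $ l $ j"
  note d = smooth_on_differentiable[OF smooth_metric x]
  have c: "(\<lambda>y. y $ j) differentiable (at x)" for j
    by (simp add: bounded_linear_vec_nth bounded_linear_imp_differentiable)
  have "partial i (\<lambda>y. \<Sum>j\<in>UNIV. ?g l j y * y $ j) x = partial i (\<lambda>y. y $ l) x"
    by (rule partial_cong[OF open_M x]) (auto simp: metric_eq rmat_radial M_D)
  moreover have "partial i (\<lambda>y. \<Sum>j\<in>UNIV. ?g l j y * y $ j) x
      = (\<Sum>j\<in>UNIV. (if i = j then ?g l j x else 0) + partial i (?g l j) x * x $ j)"
    by (subst partial_sum) (auto intro!: sum.cong differentiable_mult d c simp: partial_mult d c partial_component)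
  ultimately show ?thesis by (simp add: partial_component sum.distrib)
qed

text \<open>Each of the three derivatives of the metric in the Christoffel symbol vanishes when
  contracted twice with x: a first contraction gives the identity minus the metric, and the second
  gives x - g x = 0.\<close>

lemma christoffel_radial:
  assumes x: "(x::real^'n::finite) \<in> M"
  shows "(\<Sum>i\<in>UNIV. \<Sum>j\<in>UNIV. x $ i * x $ j * christoffel (warped_metric \<phi>) m i j x) = 0"
proof -
  let ?g = "\<lambda>l j y. warped_metric \<phi> (y::real^'n) $ l $ j"
  have sym: "?g i j y = ?g j i y" for i j y
    by (auto simp: warped_metric_def mat_def mult.commute)
  have sym': "partial l (?g i j) x = partial l (?g j i) x" for i j l
    by (rule arg_cong[where f="\<lambda>f. partial l f x"]) (auto intro: sym)
  have rad: "(\<Sum>i\<in>UNIV. ?g l i x * x $ i) = x $ l" for l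
    using x by (simp add: metric_eq rmat_radial M_D)
  have dl: "(\<Sum>i\<in>UNIV. x $ i * (if i = l then 1 else 0)) = x $ l" for l
    by (simp add: if_distrib cong: if_cong)
  have A: "(\<Sum>i\<in>UNIV. \<Sum>j\<in>UNIV. x $ i * x $ j * partial i (?g j l) x) = 0" for l
  proof -
    have "(\<Sum>i\<in>UNIV. \<Sum>j\<in>UNIV. x $ i * x $ j * partial i (?g j l) x)
      = (\<Sum>i\<in>UNIV. x $ i * (\<Sum>j\<in>UNIV. partial i (?g l j) x * x $ j))"
      by (simp add: sum_distrib_left sym'[of _ _ l] mult_ac)
    also have "\<dots> = (\<Sum>i\<in>UNIV. x $ i * (if i = l then 1 else 0)) - (\<Sum>i\<in>UNIV. ?g l i x * x $ i)"
      unfolding metric_partial_radial[OF x] by (simp add: algebra_simps sum_subtractf)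
    finally show ?thesis by (simp add: rad dl)
  qed
  have B: "(\<Sum>i\<in>UNIV. \<Sum>j\<in>UNIV. x $ i * x $ j * partial j (?g i l) x) = 0" for l
    using A[of l] by (subst sum.swap) (simp add: mult_ac)
  have C: "(\<Sum>i\<in>UNIV. \<Sum>j\<in>UNIV. x $ i * x $ j * partial l (?g i j) x) = 0" for l
  proof -
    have "(\<Sum>i\<in>UNIV. \<Sum>j\<in>UNIV. x $ i * x $ j * partial l (?g i j) x)
      = (\<Sum>i\<in>UNIV. x $ i * (\<Sum>j\<in>UNIV. partial l (?g i j) x * x $ j))"
      by (simp add: sum_distrib_left mult_ac)
    also have "\<dots> = (\<Sum>i\<in>UNIV. x $ i * (if i = l then 1 else 0)) - (\<Sum>i\<in>UNIV. ?g l i x * x $ i)"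
      unfolding metric_partial_radial[OF x] by (simp add: algebra_simps sum_subtractf sym[of _ l] eq_commute[of l])
    finally show ?thesis by (simp add: rad dl)
  qed
  have "(\<Sum>i\<in>UNIV. \<Sum>j\<in>UNIV. x $ i * x $ j * christoffel (warped_metric \<phi>) m i j x)
    = (\<Sum>i\<in>UNIV. \<Sum>j\<in>UNIV. \<Sum>l\<in>UNIV. (1/2) * matrix_inv (warped_metric \<phi> x) $ m $ l *
       (x $ i * x $ j * partial i (?g j l) x + x $ i * x $ j * partial j (?g i l) x - x $ i * x $ j * partial l (?g i j) x))"
    by (simp add: christoffel_def sum_distrib_left sum_divide_distrib algebra_simps)
  also have "\<dots> = (\<Sum>l\<in>UNIV. \<Sum>i\<in>UNIV. \<Sum>j\<in>UNIV. (1/2) * matrix_inv (warped_metric \<phi> x) $ m $ l *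
       (x $ i * x $ j * partial i (?g j l) x + x $ i * x $ j * partial j (?g i l) x - x $ i * x $ j * partial l (?g i j) x))"
    by (rule sum_rotate)
  also have "\<dots> = (\<Sum>l\<in>UNIV. (1/2) * matrix_inv (warped_metric \<phi> x) $ m $ l *
       ((\<Sum>i\<in>UNIV. \<Sum>j\<in>UNIV. x $ i * x $ j * partial i (?g j l) x) + (\<Sum>i\<in>UNIV. \<Sum>j\<in>UNIV. x $ i * x $ j * partial j (?g i l) x)
        - (\<Sum>i\<in>UNIV. \<Sum>j\<in>UNIV. x $ i * x $ j * partial l (?g i j) x)))"
    by (simp only: sum_distrib_left[symmetric] sum.distrib sum_subtractf)
  finally show ?thesis by (simp add: A B C)
qed

section \<open>Radial derivatives and the tensor norm\<close>

definition rad_deriv :: "nat \<Rightarrow> (real^'n::finite \<Rightarrow> real) \<Rightarrow> real^'n \<Rightarrow> real" where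
  "rad_deriv j u x = (\<Sum>I\<in>{I. length I = j}. (\<Prod>l<j. x $ (I ! l) / norm x) * nabla (warped_metric \<phi>) j u I x)"

lemma rad_deriv_0: "rad_deriv 0 u = u"
proof -
  have "{I::'n list. length I = 0} = {[]}" by auto
  then show ?thesis by (simp add: rad_deriv_def fun_eq_iff)
qed

lemma rad_deriv_smooth:
  assumes "smooth_on M u"
  shows "smooth_on M (rad_deriv j u :: real^'n::finite \<Rightarrow> real)"
proof -
  have "smooth_on M (\<lambda>x::real^'n. x $ i * (1 / norm x))" for i
    by (intro smooth_on_mult smooth_on_inverse smooth_on_norm smooth_on_component) (auto simp: M_def)
  then show ?thesis unfolding rad_deriv_def[abs_def]
    by (intro smooth_on_sum smooth_on_mult smooth_on_prod smooth_nabla assms open_M) simp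
qed

lemma rad_deriv_diff:
  assumes "smooth_on M u" "smooth_on M v" "(x::real^'n::finite) \<in> M"
  shows "rad_deriv j (\<lambda>x. u x - v x) x = rad_deriv j u x - rad_deriv j v x"
  unfolding rad_deriv_def by (simp add: nabla_diff[OF assms] algebra_simps sum_subtractf)

text \<open>The map exchanging the entry at l with the free index m is an involution on pairs of a
  list and an index. It moves the correction terms of the covariant derivative off the tensor and
  onto the contracting vectors.\<close>

lemma sum_replace_index:
  fixes h :: "'a::finite \<Rightarrow> 'a list \<Rightarrow> real"
  assumes "l < j"
  shows "(\<Sum>I\<in>{I. length I = j}. \<Sum>m\<in>UNIV. h (I ! l) (I[l := m])) = (\<Sum>I\<in>{I. length I = j}. \<Sum>a\<in>UNIV. h a I)"
  unfolding sum.cartesian_product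
  by (rule sum.reindex_bij_witness[of _ "\<lambda>(J, a). (J[l := a], J ! l)" "\<lambda>(I, m). (I[l := m], I ! l)"])
    (use assms in \<open>auto simp: list_update_same_conv\<close>)

text \<open>Contracting \<open>\<nabla>\<^sup>j u\<close> with the radial unit vector in every slot gives the \<open>j\<close>-th radial
  derivative, since the radial vector is parallel along radial lines.\<close>

lemma rad_deriv_has_derivative:
  fixes u :: "real^'n::finite \<Rightarrow> real"
  assumes u: "smooth_on M u" and w: "norm w = 1" and r: "0 < r" "r < R"
  shows "((\<lambda>r. rad_deriv j u (r *\<^sub>R w)) has_real_derivative rad_deriv (Suc j) u (r *\<^sub>R w)) (at r)"
proof -
  let ?g = "warped_metric \<phi> :: 'n metric"
  let ?T = "nabla ?g j u" and ?x = "r *\<^sub>R w"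
  let ?L = "{I::'n list. length I = j}"
  define W where "W I = (\<Prod>l<j. w $ (I ! l))" for I
  have x: "?x \<in> M" using w r by (auto intro: M_I)
  have chain: "((\<lambda>r. ?T I (r *\<^sub>R w)) has_real_derivative (\<Sum>i\<in>UNIV. w $ i * partial i (?T I) ?x)) (at r)" for I
  proof -
    obtain D where D: "(?T I has_derivative D) (at ?x)"
      using smooth_on_differentiable[OF smooth_nabla[OF u] x] by (auto simp: differentiable_def)
    have 1: "((\<lambda>r::real. r *\<^sub>R w) has_derivative (\<lambda>t. t *\<^sub>R w)) (at r)"
      by (auto intro!: derivative_eq_intros)
    have lin: "linear D" by (rule has_derivative_linear[OF D])
    have "D w = D (\<Sum>i\<in>UNIV. w $ i *\<^sub>R axis i 1)"
      using basis_expansion[of w] by (simp add: scalar_mult_eq_scaleR)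
    also have "\<dots> = (\<Sum>i\<in>UNIV. w $ i * partial i (?T I) ?x)"
      by (simp add: linear_sum[OF lin] linear_scale[OF lin] partial_eq[OF D])
    finally have "D (t *\<^sub>R w) = (\<Sum>i\<in>UNIV. w $ i * partial i (?T I) ?x) * t" for t
      by (simp add: linear_scale[OF lin])
    then show ?thesis using has_derivative_compose[OF 1 D] by (simp add: has_field_derivative_def)
  qed
  have "((\<lambda>r. \<Sum>I\<in>?L. W I * ?T I (r *\<^sub>R w)) has_real_derivative
      (\<Sum>I\<in>?L. W I * (\<Sum>i\<in>UNIV. w $ i * partial i (?T I) ?x))) (at r)"
    by (auto intro!: DERIV_sum DERIV_cmult chain)
  \<comment> \<open>Along the ray, for positive radius, the radial unit vector is the constant w, so
    only the tensor components have to be differentiated.\<close>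
  moreover have ev: "\<forall>\<^sub>F s in nhds r. rad_deriv j u (s *\<^sub>R w) = (\<Sum>I\<in>?L. W I * ?T I (s *\<^sub>R w))"
  proof -
    have "\<forall>\<^sub>F s in nhds r. s \<in> {0<..}" using r by (intro eventually_nhds_in_open) auto
    then show ?thesis
      by eventually_elim (use w in \<open>auto simp: rad_deriv_def W_def\<close>)
  qed
  moreover have "(\<Sum>I\<in>?L. W I * (\<Sum>i\<in>UNIV. w $ i * partial i (?T I) ?x)) = rad_deriv (Suc j) u ?x"
  proof -
    define G where "G m i a = christoffel ?g m i a ?x" for m i a
    have G0: "(\<Sum>i\<in>UNIV. \<Sum>a\<in>UNIV. w $ i * (w $ a * G m i a)) = 0" for m
    proof -
      have "r * r * (\<Sum>i\<in>UNIV. \<Sum>a\<in>UNIV. w $ i * (w $ a * G m i a)) = 0"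
        using christoffel_radial[OF x, of m] by (simp add: G_def sum_distrib_left mult_ac)
      then show ?thesis using r by simp
    qed
    \<comment> \<open>The correction in slot l drops out: V, the product of the other slots, does
      not see the entry at l, so after exchanging indices the Christoffel symbol is contracted twice
      with w, which is zero by \<open>G0\<close>.\<close>
    have Z: "(\<Sum>i\<in>UNIV. w $ i * (\<Sum>I\<in>?L. W I * (\<Sum>m\<in>UNIV. G m i (I ! l) * ?T (I[l := m]) ?x))) = 0" if l: "l < j" for l
    proof -
      define V where "V I = (\<Prod>k\<in>{..<j}-{l}. w $ (I ! k))" for I
      have WV: "W I = w $ (I ! l) * V I" for I
        unfolding W_def V_def using l by (simp add: prod.remove[of "{..<j}" l])
      have VV: "V I = V (I[l := m])" for I m
        unfolding V_def by (intro prod.cong) auto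
      have "(\<Sum>I\<in>?L. W I * (\<Sum>m\<in>UNIV. G m i (I ! l) * ?T (I[l := m]) ?x))
        = (\<Sum>I\<in>?L. \<Sum>m\<in>UNIV. w $ (I ! l) * V (I[l := m]) * (G (I[l := m] ! l) i (I ! l) * ?T (I[l := m]) ?x))" for i
        using l by (auto intro!: sum.cong simp: sum_distrib_left WV VV[symmetric])
      also have "\<dots>i = (\<Sum>I\<in>?L. \<Sum>a\<in>UNIV. w $ a * V I * (G (I ! l) i a * ?T I ?x))" for i
        by (rule sum_replace_index[OF l, where h="\<lambda>a I. w $ a * V I * (G (I ! l) i a * ?T I ?x)"])
      finally have "(\<Sum>i\<in>UNIV. w $ i * (\<Sum>I\<in>?L. W I * (\<Sum>m\<in>UNIV. G m i (I ! l) * ?T (I[l := m]) ?x)))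
        = (\<Sum>i\<in>UNIV. \<Sum>I\<in>?L. \<Sum>a\<in>UNIV. V I * ?T I ?x * (w $ i * (w $ a * G (I ! l) i a)))"
        by (simp add: sum_distrib_left mult_ac)
      also have "\<dots> = (\<Sum>I\<in>?L. V I * ?T I ?x * (\<Sum>i\<in>UNIV. \<Sum>a\<in>UNIV. w $ i * (w $ a * G (I ! l) i a)))"
        by (subst sum.swap) (simp add: sum_distrib_left)
      finally show ?thesis by (simp add: G0)
    qed
    have "rad_deriv (Suc j) u ?x = (\<Sum>i\<in>UNIV. \<Sum>I\<in>?L. w $ i * W I * (partial i (?T I) ?x
        - (\<Sum>l<j. \<Sum>m\<in>UNIV. G m i (I ! l) * ?T (I[l := m]) ?x)))"
      using w r by (simp add: rad_deriv_def sum_lists_Suc prod.lessThan_Suc_shift W_def cov_deriv_def G_def del: prod.lessThan_Suc)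
    also have "\<dots> = (\<Sum>i\<in>UNIV. \<Sum>I\<in>?L. w $ i * W I * partial i (?T I) ?x)
        - (\<Sum>i\<in>UNIV. \<Sum>I\<in>?L. \<Sum>l<j. w $ i * (W I * (\<Sum>m\<in>UNIV. G m i (I ! l) * ?T (I[l := m]) ?x)))"
      by (simp add: right_diff_distrib sum_subtractf sum_distrib_left mult.assoc)
    also have "(\<Sum>i\<in>UNIV. \<Sum>I\<in>?L. \<Sum>l<j. w $ i * (W I * (\<Sum>m\<in>UNIV. G m i (I ! l) * ?T (I[l := m]) ?x)))
       = (\<Sum>l<j. \<Sum>i\<in>UNIV. w $ i * (\<Sum>I\<in>?L. W I * (\<Sum>m\<in>UNIV. G m i (I ! l) * ?T (I[l := m]) ?x)))"
      by (subst sum_rotate) (simp only: sum_distrib_left)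
    also have "\<dots> = 0" using Z by simp
    also have "(\<Sum>i\<in>UNIV. \<Sum>I\<in>?L. w $ i * W I * partial i (?T I) ?x) = (\<Sum>I\<in>?L. W I * (\<Sum>i\<in>UNIV. w $ i * partial i (?T I) ?x))"
      by (subst sum.swap) (simp add: sum_distrib_left mult_ac)
    finally show ?thesis by simp
  qed
  ultimately show ?thesis unfolding DERIV_cong_ev[OF refl ev refl] by simp
qed

text \<open>The inverse metric is the square of the symmetric matrix
  \<open>rmat (1 / \<rho> x) x\<close>. In this form nonnegativity and the triangle inequality are
  those of \<open>L2_set\<close>.\<close>

lemma tensor_norm_L2:
  assumes x: "(x::real^'n::finite) \<in> M"
  shows "tensor_norm (warped_metric \<phi>) j T x
    = L2_set (\<lambda>K. \<Sum>I\<in>{I. length I = j}. (\<Prod>l<j. rmat (1 / \<rho> x) x $ (K ! l) $ (I ! l)) * T I x) {K. length K = j}"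
proof -
  have "matrix_inv (warped_metric \<phi> x) = rmat (1 / \<rho> x) x ** rmat (1 / \<rho> x) x"
    using x by (simp add: metric_inv rmat_mult M_D power2_eq_square)
  then have "matrix_inv (warped_metric \<phi> x) $ a $ b = (\<Sum>k\<in>UNIV. rmat (1 / \<rho> x) x $ k $ a * rmat (1 / \<rho> x) x $ k $ b)" for a b
    by (simp add: matrix_matrix_mult_def rmat_sym[of _ _ a])
  from tensor_square[of "\<lambda>a b. matrix_inv (warped_metric \<phi> x) $ a $ b" "\<lambda>a b. rmat (1 / \<rho> x) x $ a $ b", OF this, of j "\<lambda>I. T I x"]
  show ?thesis unfolding tensor_norm_def L2_set_def by simp
qed

lemma tensor_norm_nonneg: "(x::real^'n::finite) \<in> M \<Longrightarrow> 0 \<le> tensor_norm (warped_metric \<phi>) j T x"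
  by (simp add: tensor_norm_L2)

lemma tensor_norm_diff:
  assumes x: "(x::real^'n::finite) \<in> M" and eq: "\<And>I. T I x = T1 I x - T2 I x"
  shows "tensor_norm (warped_metric \<phi>) j T x \<le> tensor_norm (warped_metric \<phi>) j T1 x + tensor_norm (warped_metric \<phi>) j T2 x"
proof -
  define F where "F T K = (\<Sum>I\<in>{I. length I = j}. (\<Prod>l<j. rmat (1 / \<rho> x) x $ (K ! l) $ (I ! l)) * T I x)" for T :: "'n tensor" and K
  have "F T = (\<lambda>K. F T1 K + - F T2 K)" by (simp add: F_def eq algebra_simps sum_subtractf fun_eq_iff)
  moreover have "L2_set (\<lambda>K. - F T2 K) A = L2_set (F T2) A" for A by (simp add: L2_set_def)
  ultimately have "L2_set (F T) A \<le> L2_set (F T1) A + L2_set (F T2) A" for A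
    using L2_set_triangle_ineq[of "F T1" "\<lambda>K. - F T2 K" A] by simp
  then show ?thesis unfolding tensor_norm_L2[OF x] F_def .
qed

text \<open>The radial unit vector n is fixed by the root of the inverse metric, so contracting with
  n gives the same result before and after transforming the components. Cauchy-Schwarz finishes,
  since the tensor power of n has norm 1.\<close>

lemma rad_deriv_le:
  assumes x: "(x::real^'n::finite) \<in> M"
  shows "\<bar>rad_deriv j u x\<bar> \<le> tensor_norm (warped_metric \<phi>) j (nabla (warped_metric \<phi>) j u) x"
proof -
  let ?n = "\<lambda>i. x $ i / norm x" and ?L = "{I::'n list. length I = j}" and ?T = "nabla (warped_metric \<phi>) j u"
  define B where "B a b = rmat (1 / \<rho> x) x $ a $ b" for a b
  define F where "F K = (\<Sum>I\<in>?L. (\<Prod>l<j. B (K ! l) (I ! l)) * ?T I x)" for K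
  have x0: "x \<noteq> 0" using x by (rule M_D)
  have rad: "(\<Sum>k\<in>UNIV. ?n k * B k a) = ?n a" for a
  proof -
    have "(\<Sum>k\<in>UNIV. ?n k * B k a) = (\<Sum>k\<in>UNIV. rmat (1 / \<rho> x) x $ a $ k * x $ k) / norm x"
      by (simp add: B_def sum_divide_distrib rmat_sym[of _ _ _ a] mult_ac)
    then show ?thesis by (simp add: rmat_radial[OF x0])
  qed
  have "rad_deriv j u x = (\<Sum>I\<in>?L. (\<Sum>K\<in>?L. \<Prod>l<j. ?n (K ! l) * B (K ! l) (I ! l)) * ?T I x)"
  proof -
    have "(\<Sum>K\<in>?L. \<Prod>l<j. ?n (K ! l) * B (K ! l) (I ! l)) = (\<Prod>l<j. ?n (I ! l))" for I
      using sum_lists_prod[where j=j and f="\<lambda>l k. ?n k * B k (I ! l)"] unfolding rad .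
    then show ?thesis unfolding rad_deriv_def by simp
  qed
  also have "\<dots> = (\<Sum>K\<in>?L. (\<Prod>l<j. ?n (K ! l)) * F K)"
    unfolding F_def sum_distrib_left sum_distrib_right
    by (subst sum.swap) (simp only: prod.distrib mult.assoc)
  finally have "\<bar>rad_deriv j u x\<bar> \<le> (\<Sum>K\<in>?L. \<bar>\<Prod>l<j. ?n (K ! l)\<bar> * \<bar>F K\<bar>)"
    by (simp only: abs_mult[symmetric] sum_abs)
  also have "\<dots> \<le> L2_set (\<lambda>K. \<Prod>l<j. ?n (K ! l)) ?L * L2_set F ?L"
    by (rule L2_set_mult_ineq)
  also have "L2_set (\<lambda>K. \<Prod>l<j. ?n (K ! l)) ?L = 1"
    using sum_lists_prod[where j=j and f="\<lambda>l k. ?n k * ?n k"] sum_unit_sq[OF x0]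
    by (simp add: L2_set_def power2_eq_square prod.distrib[symmetric])
  finally show ?thesis unfolding tensor_norm_L2[OF x] F_def B_def by simp
qed

lemma continuous_on_tensor_norm:
  assumes "smooth_on M u"
  shows "continuous_on M (\<lambda>x::real^'n::finite. tensor_norm (warped_metric \<phi>) j (nabla (warped_metric \<phi>) j u) x)"
  unfolding tensor_norm_def
  by (intro continuous_intros smooth_on_continuous_on smooth_on_sum smooth_on_mult smooth_on_prod smooth_metric_inv smooth_nabla assms open_M)

end

section \<open>Polar coordinates\<close>

text \<open>The surface measure of a subset of the unit sphere is \<open>N\<close> times the volume of the cone over it.\<close>

definition sphere_measure :: "'a::euclidean_space measure" where
  "sphere_measure = distr (density lborel (\<lambda>x. ennreal DIM('a) * indicator (cball 0 1) x)) borel (\<lambda>x. x /\<^sub>R norm x)"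

definition radial_measure :: "nat \<Rightarrow> real \<Rightarrow> real measure" where
  "radial_measure N R = density lborel (\<lambda>r. ennreal (r ^ (N - 1)) * indicator {0<..<R} r)"

text \<open>The cone over B cut off at radius s. The direction of the origin is 0, by division by
  zero, so the origin belongs to it exactly when 0 is in B; this single point has measure
  zero.\<close>

definition sector :: "real \<Rightarrow> 'a::euclidean_space set \<Rightarrow> 'a set" where
  "sector s B = {x. norm x \<le> s \<and> x /\<^sub>R norm x \<in> B}"

lemma indicator_ball_measurable:
  "(\<lambda>x::'a::euclidean_space. ennreal c * indicator (cball 0 s) x) \<in> borel_measurable borel"
  "(indicator (ball 0 s) :: 'a \<Rightarrow> ennreal) \<in> borel_measurable borel"
proof -
  have [measurable]: "cball 0 s \<in> sets (borel :: 'a measure)" by simp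
  show "(\<lambda>x::'a. ennreal c * indicator (cball 0 s) x) \<in> borel_measurable borel"
    by measurable
  show "(indicator (ball 0 s) :: 'a \<Rightarrow> ennreal) \<in> borel_measurable borel"
    by (intro borel_measurable_indicator borel_open open_ball)
qed

lemma sets_sphere_measure [simp, measurable_cong]: "sets sphere_measure = sets borel"
  by (simp add: sphere_measure_def)

lemma space_sphere_measure [simp]: "space sphere_measure = UNIV"
  by (simp add: sphere_measure_def)

lemma sets_radial_measure [simp, measurable_cong]: "sets (radial_measure N R) = sets borel"
  by (simp add: radial_measure_def)

lemma direction_measurable [measurable]: "(\<lambda>x::'a::euclidean_space. x /\<^sub>R norm x) \<in> borel \<rightarrow>\<^sub>M borel"
  by measurable

lemma sector_measurable [measurable]:
  assumes [measurable]: "B \<in> sets borel"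
  shows "sector s B \<in> sets borel"
proof -
  have "sector s B = cball 0 s \<inter> ((\<lambda>x. x /\<^sub>R norm x) -` B)" by (auto simp: sector_def)
  then show ?thesis using measurable_sets_borel[OF direction_measurable assms] by auto
qed

lemma emeasure_sphere_measure:
  assumes B: "B \<in> sets borel"
  shows "emeasure (sphere_measure :: 'a::euclidean_space measure) B = ennreal DIM('a) * emeasure lborel (sector 1 B)"
proof -
  have "emeasure (sphere_measure :: 'a measure) B
      = emeasure (density lborel (\<lambda>x. ennreal DIM('a) * indicator (cball 0 1) x)) ((\<lambda>x. x /\<^sub>R norm x) -` B)"
    unfolding sphere_measure_def using B by (subst emeasure_distr) auto
  also have "\<dots> = (\<integral>\<^sup>+x. ennreal DIM('a) * indicator (sector 1 B) x \<partial>lborel)"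
    using measurable_sets_borel[OF direction_measurable B]
    by (subst emeasure_density) (auto simp: indicator_ball_measurable sector_def intro!: nn_integral_cong split: split_indicator)
  also have "\<dots> = ennreal DIM('a) * emeasure lborel (sector 1 B)"
    using sector_measurable[OF B] by (subst nn_integral_cmult_indicator) auto
  finally show ?thesis .
qed

lemma emeasure_sector_finite: "emeasure lborel (sector s (B :: 'a::euclidean_space set)) < \<infinity>"
proof -
  have "emeasure lborel (sector s B) \<le> emeasure lborel (cball 0 s :: 'a set)"
    by (intro emeasure_mono) (auto simp: sector_def)
  also have "\<dots> < \<infinity>" by (rule emeasure_lborel_cball_finite)
  finally show ?thesis .
qed

lemma finite_sphere_measure: "finite_measure (sphere_measure :: 'a::euclidean_space measure)"
proof
  have "emeasure (sphere_measure :: 'a measure) UNIV < \<infinity>"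
    using emeasure_sector_finite[of 1 "UNIV :: 'a set"]
    by (subst emeasure_sphere_measure) (auto simp: ennreal_mult_less_top less_top[symmetric] ennreal_mult_eq_top_iff)
  then show "emeasure (sphere_measure :: 'a measure) (space sphere_measure) \<noteq> \<infinity>" by simp
qed

lemma sphere_measure_pos: "emeasure (sphere_measure :: 'a::euclidean_space measure) UNIV > 0"
proof -
  have "sector 1 UNIV = (cball 0 1 :: 'a set)" by (auto simp: sector_def)
  moreover have "emeasure lborel (cball 0 1 :: 'a set) > 0"
    by (simp add: emeasure_cball unit_ball_vol_pos)
  ultimately show ?thesis
    by (simp add: emeasure_sphere_measure ennreal_zero_less_mult_iff)
qed

lemma AE_lborel_nonzero: "AE x in lborel. (x::'a::euclidean_space) \<noteq> 0"
proof -
  have "{0::'a} \<in> null_sets lborel" by (auto simp: null_sets_def)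
  from AE_not_in[OF this] show ?thesis by simp
qed

lemma AE_sphere_measure: "AE w in (sphere_measure :: 'a::euclidean_space measure). norm w = 1"
proof -
  have "AE x in density lborel (\<lambda>x. ennreal DIM('a) * indicator (cball 0 1) x). norm (x /\<^sub>R norm x :: 'a) = 1"
    by (subst AE_density) (use AE_lborel_nonzero in \<open>auto simp: indicator_ball_measurable elim: eventually_mono\<close>)
  then show ?thesis unfolding sphere_measure_def by (subst AE_distr_iff) auto
qed

text \<open>Dilation by s maps the unit sector onto the sector of radius s and multiplies volume by
  s^N. For s = 0 the sector lies in the null set {0}.\<close>

lemma emeasure_sector:
  fixes B :: "'a::euclidean_space set"
  assumes s: "s \<ge> 0" and B: "B \<in> sets borel"
  shows "emeasure lborel (sector s B) = ennreal (s ^ DIM('a)) * emeasure lborel (sector 1 B)"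
proof (cases "s = 0")
  case True
  have "emeasure lborel (sector 0 B) \<le> emeasure lborel {0::'a}"
    by (intro emeasure_mono) (auto simp: sector_def)
  then show ?thesis using True by simp
next
  case False
  with s have s: "s > 0" by simp
  have "emeasure lborel (sector s B)
      = emeasure (density (distr lborel borel (\<lambda>x. 0 + s *\<^sub>R x)) (\<lambda>_. \<bar>s\<bar>^DIM('a))) (sector s B)"
    using lborel_affine[of s "0::'a"] s by simp
  also have "\<dots> = (\<integral>\<^sup>+x. ennreal (s ^ DIM('a)) * indicator (sector s B) x \<partial>distr lborel borel (\<lambda>x. 0 + s *\<^sub>R x))"
    using B s by (subst emeasure_density) auto
  also have "\<dots> = ennreal (s ^ DIM('a)) * emeasure (distr lborel borel (\<lambda>x. 0 + s *\<^sub>R x)) (sector s B)"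
    using B by (subst nn_integral_cmult_indicator) auto
  also have "emeasure (distr lborel borel (\<lambda>x. 0 + s *\<^sub>R x)) (sector s B) = emeasure lborel (sector 1 B)"
  proof -
    have "(\<lambda>x. 0 + s *\<^sub>R x) -` sector s B = sector 1 B" proof -
      have "inverse (s * n) * s = inverse n" for n using s by (simp add: field_simps)
      then have "(s *\<^sub>R x) /\<^sub>R norm (s *\<^sub>R x) = x /\<^sub>R norm x" for x :: 'a using s by simp
      moreover have "norm (s *\<^sub>R x) \<le> s \<longleftrightarrow> norm x \<le> 1" for x :: 'a using s by simp
      ultimately show ?thesis unfolding sector_def vimage_def mem_Collect_eq add_0 by (simp only:)
    qed
    then show ?thesis using B by (subst emeasure_distr) auto
  qed
  finally show ?thesis .
qed

lemma AE_lborel_not_sphere: "AE x in lborel. norm (x::'a::euclidean_space) \<noteq> s"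
proof -
  have "sphere (0::'a) s \<in> null_sets lborel"
    using negligible_sphere[of "0::'a" s] by (simp add: negligible_iff_null_sets null_sets_completion_iff)
  from AE_not_in[OF this] show ?thesis by simp
qed

lemma emeasure_radial_measure:
  assumes x: "0 \<le> x" "x \<le> R" and N: "N > 0"
  shows "emeasure (radial_measure N R) {x<..} = ennreal ((R ^ N - x ^ N) / N)"
proof -
  have "emeasure (radial_measure N R) {x<..}
      = (\<integral>\<^sup>+r. ennreal (r ^ (N - 1)) * indicator {0<..<R} r * indicator {x<..} r \<partial>lborel)"
    unfolding radial_measure_def by (subst emeasure_density) auto
  also have "\<dots> = (\<integral>\<^sup>+r. ennreal (r ^ (N - 1)) * indicator {x..R} r \<partial>lborel)"
    using AE_lborel_not_sphere[of R, where 'a=real] AE_lborel_not_sphere[of x, where 'a=real] x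
    by (intro nn_integral_cong_AE) (auto elim!: eventually_elim2 split: split_indicator)
  also have "\<dots> = ennreal (R ^ N / N - x ^ N / N)"
  proof (rule nn_integral_FTC_Icc)
    fix r :: real assume r: "r \<in> {x..R}"
    have "((\<lambda>r. r ^ N / N) has_real_derivative (N * r ^ (N - 1)) / N) (at r)"
      by (auto intro!: derivative_eq_intros)
    then show "((\<lambda>r. r ^ N / N) has_real_derivative r ^ (N - 1)) (at r)" using N by simp
    show "0 \<le> r ^ (N - 1)" using r x by simp
  qed (use x in auto)
  finally show ?thesis by (simp add: diff_divide_distrib)
qed

lemma sigma_finite_radial_measure: "sigma_finite_measure (radial_measure N R)"
  unfolding radial_measure_def
  by (subst sigma_finite_measure.sigma_finite_iff_density_finite[OF sigma_finite_lborel]) (auto simp: ennreal_mult_eq_top_iff split: split_indicator)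

lemma polar_rectangle_measurable [measurable]:
  fixes B :: "'a::euclidean_space set"
  assumes "A \<in> sets borel" "B \<in> sets borel"
  shows "{x \<in> ball 0 R. norm x \<in> A \<and> x /\<^sub>R norm x \<in> B} \<in> sets borel"
proof -
  have "{x \<in> ball 0 R. norm x \<in> A \<and> x /\<^sub>R norm x \<in> B} = ball 0 R \<inter> (norm -` A) \<inter> ((\<lambda>x. x /\<^sub>R norm x) -` B)" by auto
  moreover have "(\<lambda>x::'a. x /\<^sub>R norm x) -` B \<in> sets borel" "norm -` A \<in> sets (borel :: 'a measure)"
    using assms by (auto intro: measurable_sets_borel[OF direction_measurable] measurable_sets_borel[OF borel_measurable_continuous_onI[OF continuous_on_norm_id]])
  ultimately show ?thesis by (simp only:) (blast intro: sets.Int borel_open open_ball)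
qed

text \<open>For fixed B both sides are measures in A, so it suffices to compare them on the
  half-lines {t<..}. There the left side is the volume of a difference of two sectors and the right
  side is the integral of r^(N-1); the factor N in \<open>sphere_measure\<close> cancels the 1/N of
  this integral.\<close>

lemma emeasure_polar_rectangle:
  fixes B :: "'a::euclidean_space set"
  assumes R: "R > 0" and A: "A \<in> sets borel" and B: "B \<in> sets borel"
  shows "emeasure lborel {x \<in> ball 0 R. norm x \<in> A \<and> x /\<^sub>R norm x \<in> B}
    = emeasure (radial_measure DIM('a) R) A * emeasure sphere_measure B"
proof -
  let ?N = "DIM('a)"
  let ?f = "\<lambda>x::'a. indicator {x \<in> ball 0 R. x /\<^sub>R norm x \<in> B} x :: ennreal"
  note [measurable] = B
  have meas [measurable]: "{x \<in> ball 0 R. x /\<^sub>R norm x \<in> B} \<in> sets borel"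
  proof -
    have "{x \<in> ball 0 R. x /\<^sub>R norm x \<in> B} = ball 0 R \<inter> ((\<lambda>x. x /\<^sub>R norm x) -` B)" by auto
    then show ?thesis using measurable_sets_borel[OF direction_measurable B] by auto
  qed
  have e1: "emeasure (distr (density lborel ?f) borel norm) A
      = emeasure lborel {x \<in> ball 0 R. norm x \<in> A \<and> x /\<^sub>R norm x \<in> B}" if A[measurable]: "A \<in> sets borel" for A
  proof -
    note m = polar_rectangle_measurable[OF A B, of R]
    have "emeasure (distr (density lborel ?f) borel norm) A
      = (\<integral>\<^sup>+x. ?f x * indicator (norm -` A) x \<partial>lborel)"
      by (subst emeasure_distr, simp, simp, subst emeasure_density) (auto intro!: measurable_sets_borel[OF _ A])
    also have "\<dots> = (\<integral>\<^sup>+x. indicator {x \<in> ball 0 R. norm x \<in> A \<and> x /\<^sub>R norm x \<in> B} x \<partial>lborel)"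
      by (intro nn_integral_cong) (auto split: split_indicator)
    finally show ?thesis using m by simp
  qed
  have e2: "emeasure (density (radial_measure ?N R) (\<lambda>_. emeasure sphere_measure B)) A
      = emeasure (radial_measure ?N R) A * emeasure sphere_measure B" if A[measurable]: "A \<in> sets borel" for A
    using A by (subst emeasure_density) (simp_all add: nn_integral_multc mult.commute)
  \<comment> \<open>The part of a cone between radii t and R; the sphere of radius R, which belongs
    to the sector but not to the open ball, is null.\<close>
  have sec: "emeasure lborel {x \<in> ball 0 R. norm x \<in> {t<..} \<and> x /\<^sub>R norm x \<in> B} =
      ennreal (R ^ ?N - (max 0 t) ^ ?N) * emeasure lborel (sector 1 B)" if t: "t < R" for t
  proof (cases "t < 0")
    case True
    have "emeasure lborel {x \<in> ball 0 R. norm x \<in> {t<..} \<and> x /\<^sub>R norm x \<in> B} = emeasure lborel (sector R B)"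
    proof (rule emeasure_eq_AE)
      have t: "t < norm x" for x :: 'a using True norm_ge_zero[of x] by linarith
      show "AE x in lborel. (x \<in> {x \<in> ball 0 R. norm x \<in> {t<..} \<and> x /\<^sub>R norm x \<in> B}) = (x \<in> sector R B)"
        using AE_lborel_not_sphere[of R, where 'a='a] by eventually_elim (auto simp: sector_def t)
    qed measurable
    then show ?thesis using True R using emeasure_sector[OF _ B, of R] by (simp add: power_0_left)
  next
    case False
    have "emeasure lborel {x \<in> ball 0 R. norm x \<in> {t<..} \<and> x /\<^sub>R norm x \<in> B} = emeasure lborel (sector R B - sector t B)"
    proof (rule emeasure_eq_AE)
      show "AE x in lborel. (x \<in> {x \<in> ball 0 R. norm x \<in> {t<..} \<and> x /\<^sub>R norm x \<in> B}) = (x \<in> sector R B - sector t B)"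
        using AE_lborel_not_sphere[of R, where 'a='a] by eventually_elim (auto simp: sector_def)
    qed measurable
    also have "\<dots> = emeasure lborel (sector R B) - emeasure lborel (sector t B)"
      using emeasure_sector_finite[of t B] B t by (intro emeasure_Diff) (auto simp: sector_def less_top)
    also have "\<dots> = (ennreal (R ^ ?N) - ennreal (t ^ ?N)) * emeasure lborel (sector 1 B)"
    proof -
      have fin: "emeasure lborel (sector 1 B) \<noteq> top" using emeasure_sector_finite[of 1 B] by simp
      have "(a - b) * emeasure lborel (sector 1 B) = a * emeasure lborel (sector 1 B) - b * emeasure lborel (sector 1 B)" for a b
        using ennreal_right_diff_distrib[OF fin] by (simp add: mult.commute)
      then show ?thesis
        using False R emeasure_sector[OF _ B, of R] emeasure_sector[OF _ B, of t] by simp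
    qed
    finally show ?thesis using False by (simp add: ennreal_minus)
  qed
  have tail: "emeasure (radial_measure ?N R) {t<..} = ennreal ((R ^ ?N - (max 0 t) ^ ?N) / ?N)" if "t < R" for t
  proof (cases "t < 0")
    case True
    have "emeasure (radial_measure ?N R) {t<..} = emeasure (radial_measure ?N R) {0<..}"
      unfolding radial_measure_def using True by (auto simp: emeasure_density intro!: nn_integral_cong split: split_indicator)
    then show ?thesis using True R by (simp add: emeasure_radial_measure)
  qed (use that in \<open>simp add: emeasure_radial_measure\<close>)
  have eq: "emeasure lborel {x \<in> ball 0 R. norm x \<in> {t<..} \<and> x /\<^sub>R norm x \<in> B}
      = emeasure (radial_measure ?N R) {t<..} * emeasure sphere_measure B" for t
  proof (cases "t < R")
    case True
    have "max 0 t ^ ?N \<le> R ^ ?N" using True R by (intro power_mono) auto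
    then have "ennreal (R ^ ?N - (max 0 t) ^ ?N) = ennreal ((R ^ ?N - (max 0 t) ^ ?N) / ?N) * ennreal ?N"
      by (subst ennreal_mult[symmetric]) auto
    then show ?thesis
      unfolding sec[OF True] tail[OF True] emeasure_sphere_measure[OF B] by (simp add: mult.assoc)
  next
    case False
    then have "{x \<in> ball 0 R. norm x \<in> {t<..} \<and> x /\<^sub>R norm x \<in> B} = {}" by auto
    moreover have "emeasure (radial_measure ?N R) {t<..} = 0"
    proof -
      have z: "ennreal (r ^ (?N - 1)) * indicator {0<..<R} r * indicator {t<..} r = 0" for r
        using False by (auto split: split_indicator)
      show ?thesis unfolding radial_measure_def
        by (subst emeasure_density, simp, simp, unfold z, simp)
    qed
    ultimately show ?thesis by (simp only: emeasure_empty) simp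
  qed
  have "distr (density lborel ?f) borel norm = density (radial_measure ?N R) (\<lambda>_. emeasure sphere_measure B)"
  proof (rule measure_eqI_lessThan)
    fix t
    show "emeasure (distr (density lborel ?f) borel norm) {t<..} < \<infinity>"
    proof -
      have "emeasure (distr (density lborel ?f) borel norm) {t<..} \<le> emeasure lborel (sector R B)"
        by (subst e1, simp, rule emeasure_mono) (use B in \<open>auto simp: sector_def\<close>)
      then show ?thesis using emeasure_sector_finite[of R B] by (rule le_less_trans)
    qed
    show "emeasure (distr (density lborel ?f) borel norm) {t<..}
        = emeasure (density (radial_measure ?N R) (\<lambda>_. emeasure sphere_measure B)) {t<..}"
    proof -
      have t: "{t<..} \<in> sets borel" by simp
      show ?thesis unfolding e1[OF t] e2[OF t] by (rule eq)
    qed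
  qed auto
  then show ?thesis using e1[OF A] e2[OF A] by simp
qed

text \<open>A product of sigma-finite measures is determined by its values on rectangles, and these
  are known from \<open>emeasure_polar_rectangle\<close>.\<close>

lemma polar_measure:
  assumes R: "R > 0"
  shows "radial_measure DIM('a) R \<Otimes>\<^sub>M sphere_measure
    = distr (density lborel (indicator (ball 0 R))) (borel \<Otimes>\<^sub>M borel) (\<lambda>x::'a::euclidean_space. (norm x, x /\<^sub>R norm x))"
proof (rule pair_measure_eqI)
  interpret S: finite_measure "sphere_measure :: 'a measure" by (rule finite_sphere_measure)
  show "sigma_finite_measure (sphere_measure :: 'a measure)" ..
  show "sets (radial_measure DIM('a) R \<Otimes>\<^sub>M (sphere_measure :: 'a measure))
    = sets (distr (density lborel (indicator (ball 0 R))) (borel \<Otimes>\<^sub>M borel) (\<lambda>x::'a. (norm x, x /\<^sub>R norm x)))"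
    unfolding sets_distr by (rule sets_pair_measure_cong) simp_all
  fix A and B :: "'a set" assume "A \<in> sets (radial_measure DIM('a) R)" "B \<in> sets sphere_measure"
  then have [measurable]: "A \<in> sets borel" "B \<in> sets borel" by auto
  note m = polar_rectangle_measurable[OF \<open>A \<in> sets borel\<close> \<open>B \<in> sets borel\<close>, of R]
  have "emeasure (distr (density lborel (indicator (ball 0 R))) (borel \<Otimes>\<^sub>M borel) (\<lambda>x::'a. (norm x, x /\<^sub>R norm x))) (A \<times> B)
    = (\<integral>\<^sup>+x. indicator (ball 0 R) x * indicator ((\<lambda>x. (norm x, x /\<^sub>R norm x)) -` (A \<times> B)) x \<partial>lborel)"
    using measurable_sets[of "\<lambda>x::'a. (norm x, x /\<^sub>R norm x)" borel "borel \<Otimes>\<^sub>M borel" "A \<times> B"]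
    by (subst emeasure_distr, simp, simp, subst emeasure_density) (simp_all add: indicator_ball_measurable)
  also have "\<dots> = (\<integral>\<^sup>+x. indicator {x \<in> ball 0 R. norm x \<in> A \<and> x /\<^sub>R norm x \<in> B} x \<partial>lborel)"
    by (intro nn_integral_cong) (auto split: split_indicator)
  also have "\<dots> = emeasure lborel {x \<in> ball 0 R. norm x \<in> A \<and> x /\<^sub>R norm x \<in> B}"
    using m by (intro nn_integral_indicator) simp
  finally show "emeasure (radial_measure DIM('a) R) A * emeasure sphere_measure B =
    emeasure (distr (density lborel (indicator (ball 0 R))) (borel \<Otimes>\<^sub>M borel) (\<lambda>x::'a. (norm x, x /\<^sub>R norm x))) (A \<times> B)"
    using emeasure_polar_rectangle[OF R, of A B] by simp
qed (rule sigma_finite_radial_measure)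

text \<open>The direction is the outer variable, since almost-everywhere statements about directions
  are what allows one ray to be picked.\<close>

lemma nn_integral_polar:
  fixes F :: "'a::euclidean_space \<Rightarrow> ennreal"
  assumes R: "R > 0" and F[measurable]: "F \<in> borel_measurable borel"
  shows "(\<integral>\<^sup>+x. F x * indicator (ball 0 R) x \<partial>lborel)
    = (\<integral>\<^sup>+w. (\<integral>\<^sup>+r. ennreal (r ^ (DIM('a) - 1)) * F (r *\<^sub>R w) * indicator {0<..<R} r \<partial>lborel) \<partial>sphere_measure)"
    and nn_integral_polar_measurable:
      "(\<lambda>w. \<integral>\<^sup>+r. ennreal (r ^ (DIM('a) - 1)) * F (r *\<^sub>R w) * indicator {0<..<R} r \<partial>lborel) \<in> borel_measurable borel"
proof -
  interpret S: finite_measure "sphere_measure :: 'a measure" by (rule finite_sphere_measure)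
  interpret pair_sigma_finite "radial_measure DIM('a) R" "sphere_measure :: 'a measure"
    by (intro pair_sigma_finite.intro sigma_finite_radial_measure S.sigma_finite_measure_axioms)
  have "(\<integral>\<^sup>+x. F x * indicator (ball 0 R) x \<partial>lborel) = (\<integral>\<^sup>+x. F x \<partial>density lborel (indicator (ball 0 R)))"
    by (subst nn_integral_density) (auto simp: indicator_ball_measurable mult.commute)
  also have "\<dots> = (\<integral>\<^sup>+x. F (norm x *\<^sub>R (x /\<^sub>R norm x)) \<partial>density lborel (indicator (ball 0 R)))"
  proof (intro nn_integral_cong arg_cong[where f=F])
    fix x :: 'a show "x = norm x *\<^sub>R (x /\<^sub>R norm x)" by (cases "x = 0") auto
  qed
  also have "\<dots> = (\<integral>\<^sup>+z. F (fst z *\<^sub>R snd z) \<partial>distr (density lborel (indicator (ball 0 R))) (borel \<Otimes>\<^sub>M borel) (\<lambda>x::'a. (norm x, x /\<^sub>R norm x)))"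
    by (subst nn_integral_distr) auto
  also have "\<dots> = (\<integral>\<^sup>+z. F (fst z *\<^sub>R snd z) \<partial>(radial_measure DIM('a) R \<Otimes>\<^sub>M sphere_measure))"
    by (simp add: polar_measure[OF R])
  also have "\<dots> = (\<integral>\<^sup>+w. \<integral>\<^sup>+r. F (r *\<^sub>R w) \<partial>radial_measure DIM('a) R \<partial>sphere_measure)"
    by (subst nn_integral_snd[symmetric]) auto
  finally have 1: "(\<integral>\<^sup>+x. F x * indicator (ball 0 R) x \<partial>lborel) = (\<integral>\<^sup>+w. \<integral>\<^sup>+r. F (r *\<^sub>R w) \<partial>radial_measure DIM('a) R \<partial>sphere_measure)" .
  have 2: "(\<integral>\<^sup>+r. F (r *\<^sub>R w) \<partial>radial_measure DIM('a) R)
      = (\<integral>\<^sup>+r. ennreal (r ^ (DIM('a) - 1)) * F (r *\<^sub>R w) * indicator {0<..<R} r \<partial>lborel)" for w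
    unfolding radial_measure_def by (subst nn_integral_density) (auto simp: mult_ac)
  show "(\<integral>\<^sup>+x. F x * indicator (ball 0 R) x \<partial>lborel)
    = (\<integral>\<^sup>+w. (\<integral>\<^sup>+r. ennreal (r ^ (DIM('a) - 1)) * F (r *\<^sub>R w) * indicator {0<..<R} r \<partial>lborel) \<partial>sphere_measure)"
    using 1 unfolding 2 .
  show "(\<lambda>w. \<integral>\<^sup>+r. ennreal (r ^ (DIM('a) - 1)) * F (r *\<^sub>R w) * indicator {0<..<R} r \<partial>lborel) \<in> borel_measurable borel"
    by measurable
qed

text \<open>A Borel null set containing the exceptions is integrated in polar coordinates; for
  almost every direction its trace on the ray is null, because r^(N-1) > 0 for r > 0.\<close>

lemma AE_polar:
  assumes R: "R > 0" and P: "AE x in lborel. x \<in> ball 0 R \<longrightarrow> P (x::'a::euclidean_space)"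
  shows "AE w in sphere_measure. AE r in lborel. 0 < r \<and> r < R \<longrightarrow> P (r *\<^sub>R w)"
proof -
  obtain Z where Z: "{x \<in> space lborel. \<not> (x \<in> ball 0 R \<longrightarrow> P x)} \<subseteq> Z" "Z \<in> null_sets lborel"
    using P by (auto simp: eventually_ae_filter)
  then have [measurable]: "Z \<in> sets borel" by auto
  have "(\<integral>\<^sup>+x. indicator Z x * indicator (ball 0 R) x \<partial>lborel) = 0"
    using AE_not_in[OF Z(2)]
    by (subst nn_integral_0_iff_AE) (measurable, auto elim!: eventually_mono split: split_indicator)
  then have "(\<integral>\<^sup>+w. (\<integral>\<^sup>+r. ennreal (r ^ (DIM('a) - 1)) * indicator Z (r *\<^sub>R w) * indicator {0<..<R} r \<partial>lborel) \<partial>sphere_measure) = 0"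
    using nn_integral_polar[OF R, of "indicator Z"] by simp
  then have "AE w in sphere_measure. (\<integral>\<^sup>+r. ennreal (r ^ (DIM('a) - 1)) * indicator Z (r *\<^sub>R w) * indicator {0<..<R} r \<partial>lborel) = 0"
    by (subst (asm) nn_integral_0_iff_AE)
      (use nn_integral_polar_measurable[OF R, of "indicator Z"] in \<open>auto simp: measurable_cong_sets[OF sets_sphere_measure refl]\<close>)
  from AE_sphere_measure this show ?thesis
  proof eventually_elim
    case (elim w)
    note aw = elim(1)
    from elim(2) have "AE r in lborel. ennreal (r ^ (DIM('a) - 1)) * indicator Z (r *\<^sub>R w) * indicator {0<..<R} r = 0"
      by (subst (asm) nn_integral_0_iff_AE) auto
    then show ?case
    proof eventually_elim
      case (elim r)
      show ?case
      proof (intro impI, rule ccontr)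
        assume r: "0 < r \<and> r < R" and "\<not> P (r *\<^sub>R w)"
        then have "r *\<^sub>R w \<in> Z" using Z(1) aw by (auto simp: subset_eq)
        then show False using elim r by simp
      qed
    qed
  qed
qed

text \<open>The converse direction for radial properties: a null set of radii sweeps out a null set
  of points, since every ray meets it in that same null set.\<close>

lemma AE_norm:
  assumes R: "R > 0" and P: "AE r in lborel. 0 < r \<and> r < R \<longrightarrow> P r"
  shows "AE x in lborel. x \<in> ball 0 R \<longrightarrow> P (norm (x::'a::euclidean_space))"
proof -
  obtain Z where Z: "{r \<in> space lborel. \<not> (0 < r \<and> r < R \<longrightarrow> P r)} \<subseteq> Z" "Z \<in> null_sets lborel"
    using P by (auto simp: eventually_ae_filter)
  then have [measurable]: "Z \<in> sets borel" by auto
  have m: "(\<lambda>x::'a. indicator Z (norm x)) \<in> borel_measurable borel" by measurable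
  have "AE w in (sphere_measure :: 'a measure).
      (\<integral>\<^sup>+r. ennreal (r ^ (DIM('a) - 1)) * indicator Z (norm (r *\<^sub>R w)) * indicator {0<..<R} r \<partial>lborel) = (\<integral>\<^sup>+r. 0 \<partial>(lborel :: real measure))"
    using AE_sphere_measure
  proof eventually_elim
    case (elim w)
    show ?case
      by (intro nn_integral_cong_AE) (use AE_not_in[OF Z(2)] elim in \<open>auto elim!: eventually_mono split: split_indicator\<close>)
  qed
  then have "(\<integral>\<^sup>+w. (\<integral>\<^sup>+r. ennreal (r ^ (DIM('a) - 1)) * indicator Z (norm (r *\<^sub>R w)) * indicator {0<..<R} r \<partial>lborel) \<partial>(sphere_measure :: 'a measure))
     = (\<integral>\<^sup>+w. 0 \<partial>(sphere_measure :: 'a measure))"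
    by (intro nn_integral_cong_AE) simp
  then have "(\<integral>\<^sup>+x. indicator Z (norm (x::'a)) * indicator (ball 0 R) x \<partial>lborel) = 0"
    using nn_integral_polar(1)[OF R m] by simp
  moreover have "(\<lambda>x. indicator Z (norm (x::'a)) * indicator (ball 0 R) x :: ennreal) \<in> borel_measurable lborel"
    using m indicator_ball_measurable(2) by (intro borel_measurable_times_ennreal) simp_all
  ultimately have "AE x in lborel. indicator Z (norm (x::'a)) * indicator (ball 0 R) x = (0::ennreal)"
    by (subst (asm) nn_integral_0_iff_AE) auto
  with AE_lborel_nonzero show ?thesis
  proof eventually_elim
    case (elim x)
    show ?case
    proof (intro impI, rule ccontr)
      assume "x \<in> ball 0 R" "\<not> P (norm x)"
      then have "norm x \<in> Z" using Z(1) elim(1) by (auto simp: subset_eq)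
      then show False using elim(2) \<open>x \<in> ball 0 R\<close> by simp
    qed
  qed
qed

section \<open>One-dimensional inequalities\<close>

lemma powr_add_le:
  fixes x y p :: real
  assumes "0 \<le> x" "0 \<le> y" "0 \<le> p"
  shows "(x + y) powr p \<le> 2 powr p * (x powr p + y powr p)"
proof -
  have "(x + y) powr p \<le> (2 * max x y) powr p" using assms by (intro powr_mono2) auto
  also have "\<dots> = 2 powr p * max x y powr p" using assms by (simp add: powr_mult)
  also have "\<dots> \<le> 2 powr p * (x powr p + y powr p)"
    by (intro mult_left_mono) (auto simp: max_def)
  finally show ?thesis .
qed

lemma powr_add3_le:
  fixes x y z p :: real
  assumes "0 \<le> x" "0 \<le> y" "0 \<le> z" "0 \<le> p"
  shows "(x + y + z) powr p \<le> 3 powr p * (x powr p + y powr p + z powr p)"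
proof -
  have "(x + y + z) powr p \<le> (3 * max x (max y z)) powr p" using assms by (intro powr_mono2) auto
  also have "\<dots> = 3 powr p * max x (max y z) powr p" using assms by (simp add: powr_mult)
  also have "\<dots> \<le> 3 powr p * (x powr p + y powr p + z powr p)"
    by (intro mult_left_mono) (auto simp: max_def)
  finally show ?thesis .
qed

text \<open>Removes the regularization parameter from an estimate once z no longer depends on
  it.\<close>

lemma le_of_le_add_small:
  fixes x y z :: real
  assumes "\<And>\<delta>. 0 < \<delta> \<Longrightarrow> \<delta> \<le> 1 \<Longrightarrow> x \<le> y + \<delta> * z" "0 \<le> z"
  shows "x \<le> y"
proof (rule field_le_epsilon)
  fix e :: real assume e: "e > 0"
  define \<delta> where "\<delta> = min 1 (e / (z + 1))"
  have \<delta>: "0 < \<delta>" "\<delta> \<le> 1" "\<delta> \<le> e / (z + 1)" using e assms(2) by (auto simp: \<delta>_def)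
  have "\<delta> * z \<le> e / (z + 1) * (z + 1)" using \<delta> assms(2) by (intro mult_mono) auto
  also have "\<dots> = e" using assms(2) by simp
  finally show "x \<le> y + e" using assms(1)[OF \<delta>(1,2)] by simp
qed

text \<open>A crude Young inequality, obtained by comparing y with \<eta> m. It avoids the conjugate
  exponent and so includes p = 1.\<close>

lemma young_powr:
  fixes m y \<eta> p :: real
  assumes "0 < m" "0 \<le> y" "0 < \<eta>" "1 \<le> p"
  shows "m powr (p - 1) * y \<le> \<eta> * m powr p + \<eta> powr (1 - p) * y powr p"
proof (cases "y \<le> \<eta> * m")
  case True
  have "m powr (p - 1) * y \<le> m powr (p - 1) * (\<eta> * m)" using True by (intro mult_left_mono) auto
  also have "\<dots> = \<eta> * m powr p" using assms by (simp add: powr_diff)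
  also have "\<dots> \<le> \<eta> * m powr p + \<eta> powr (1 - p) * y powr p" by simp
  finally show ?thesis .
next
  case False
  then have y: "0 < y" using assms by (smt (verit) mult_pos_pos)
  have "m powr (p - 1) \<le> (y / \<eta>) powr (p - 1)"
    using False assms by (intro powr_mono2) (auto simp: field_simps)
  then have "m powr (p - 1) * y \<le> (y / \<eta>) powr (p - 1) * y" using y by (intro mult_right_mono) auto
  also have "\<dots> = \<eta> powr (1 - p) * y powr p"
    using y assms by (simp add: powr_divide powr_diff field_simps)
  also have "\<dots> \<le> \<eta> * m powr p + \<eta> powr (1 - p) * y powr p" using assms by simp
  finally show ?thesis .
qed

lemma nn_integral_continuous:
  fixes g :: "real \<Rightarrow> real"
  assumes "continuous_on {a..b} g" "\<And>x. x \<in> {a..b} \<Longrightarrow> 0 \<le> g x"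
  shows "(\<integral>\<^sup>+x. ennreal (g x) * indicator {a..b} x \<partial>lborel) = ennreal (integral {a..b} g)"
proof -
  have si: "set_integrable lborel {a..b} g" by (rule borel_integrable_atLeastAtMost'[OF assms(1)])
  have "(\<integral>\<^sup>+x. ennreal (g x) * indicator {a..b} x \<partial>lborel) = (\<integral>\<^sup>+x. ennreal (indicator {a..b} x *\<^sub>R g x) \<partial>lborel)"
    by (intro nn_integral_cong) (auto split: split_indicator)
  also have "\<dots> = ennreal (LINT x:{a..b}|lborel. g x)"
    unfolding set_lebesgue_integral_def using si assms(2) unfolding set_integrable_def
    by (intro nn_integral_eq_integral) (auto split: split_indicator)
  finally show ?thesis using set_borel_integral_eq_integral(2)[OF si] by simp
qed

text \<open>Monotone convergence along compact intervals. The bound is demanded only when t \<ge> b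
  because the constants of the compact estimates blow up if the right end approaches 0.\<close>

lemma nn_integral_exhaust:
  fixes F :: "real \<Rightarrow> ennreal"
  assumes [measurable]: "F \<in> borel_measurable borel" and R: "R > 0" and b: "b < R"
    and le: "\<And>s t. 0 < s \<Longrightarrow> s < t \<Longrightarrow> t < R \<Longrightarrow> b \<le> t \<Longrightarrow> (\<integral>\<^sup>+x. F x * indicator {s..t} x \<partial>lborel) \<le> A"
  shows "(\<integral>\<^sup>+x. F x * indicator {0<..<R} x \<partial>lborel) \<le> A"
proof -
  \<comment> \<open>With n + 3 the interval is nondegenerate already for n = 0, where it is
    [R/3, 2R/3].\<close>
  define I where "I n = {R / (real n + 3)..R - R / (real n + 3)}" for n
  have inc: "incseq I"
  proof (rule incseq_SucI)
    fix n
    have "R / (real (Suc n) + 3) \<le> R / (real n + 3)" using R by (intro divide_left_mono) auto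
    then show "I n \<subseteq> I (Suc n)" by (auto simp: I_def)
  qed
  have lim: "(\<lambda>n. R / (real n + 3)) \<longlonglongrightarrow> 0"
    by (intro real_tendsto_divide_at_top tendsto_const filterlim_tendsto_add_at_top[of "\<lambda>_. 3", simplified add.commute]) (auto simp: filterlim_real_sequentially add.commute)
  have U: "(\<Union>n. I n) = {0<..<R}"
  proof (intro equalityI subsetI)
    fix x assume "x \<in> (\<Union>n. I n)"
    then obtain n where "x \<in> I n" by auto
    moreover have "0 < R / (real n + 3)" using R by simp
    ultimately show "x \<in> {0<..<R}" by (auto simp: I_def)
  next
    fix x assume "x \<in> {0<..<R}"
    then have "\<forall>\<^sub>F n in sequentially. R / (real n + 3) < min x (R - x)"
      by (intro order_tendstoD(2)[OF lim]) auto
    then obtain n where "R / (real n + 3) < min x (R - x)" by (auto simp: eventually_sequentially)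
    then show "x \<in> (\<Union>n. I n)" by (auto simp: I_def intro!: exI[of _ n])
  qed
  have "(\<integral>\<^sup>+x. F x * indicator {0<..<R} x \<partial>lborel) = emeasure (density lborel F) (\<Union>n. I n)"
    unfolding U by (subst emeasure_density) auto
  also have "\<dots> = (SUP n. emeasure (density lborel F) (I n))"
    by (rule SUP_emeasure_incseq[symmetric]) (auto simp: I_def inc[unfolded I_def])
  also have "\<dots> \<le> A"
  proof (rule SUP_least)
    fix n
    have "\<forall>\<^sub>F m in sequentially. R / (real m + 3) < R - b"
      using order_tendstoD(2)[OF lim] b by auto
    moreover have "\<forall>\<^sub>F m in sequentially. n \<le> m" by (rule eventually_ge_at_top)
    ultimately have "\<forall>\<^sub>F m in sequentially. R / (real m + 3) < R - b \<and> n \<le> m" by eventually_elim simp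
    then obtain m where m: "R / (real m + 3) < R - b" "n \<le> m" by (auto simp: eventually_sequentially)
    have "R / (real m + 3) \<le> R / 3" using R by (intro divide_left_mono) auto
    moreover have "0 < R / (real m + 3)" using R by simp
    ultimately have *: "0 < R / (real m + 3)" "R / (real m + 3) < R - R / (real m + 3)" "R - R / (real m + 3) < R" using R by linarith+
    have "emeasure (density lborel F) (I n) \<le> emeasure (density lborel F) (I m)"
      using inc m(2) by (intro emeasure_mono) (auto simp: incseq_def I_def)
    also have "\<dots> \<le> A"
      using le[OF *] m(1) unfolding I_def by (subst emeasure_density) auto
    finally show "emeasure (density lborel F) (I n) \<le> A" .
  qed
  finally show ?thesis .
qed

text \<open>Valued in \<open>ennreal\<close>, so that estimates can be stated without integrability
  hypotheses and infinite right sides are harmless.\<close>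

definition wint :: "real \<Rightarrow> real \<Rightarrow> real \<Rightarrow> (real \<Rightarrow> real) \<Rightarrow> ennreal" where
  "wint R c p f = (\<integral>\<^sup>+r. ennreal (r powr c * \<bar>f r\<bar> powr p) * indicator {0<..<R} r \<partial>lborel)"

lemma wint_measurable:
  assumes "continuous_on {0<..<R} f"
  shows "(\<lambda>r. ennreal (r powr c * \<bar>f r\<bar> powr p) * indicator {0<..<R} r) \<in> borel_measurable borel"
proof -
  have "(\<lambda>r. indicator {0<..<R} r *\<^sub>R f r) \<in> borel_measurable borel"
    using borel_measurable_continuous_on_indicator[OF _ assms] by simp
  then have "(\<lambda>r. ennreal (r powr c * \<bar>indicator {0<..<R} r *\<^sub>R f r\<bar> powr p) * indicator {0<..<R} r) \<in> borel_measurable borel"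
    by measurable
  also have "(\<lambda>r. ennreal (r powr c * \<bar>indicator {0<..<R} r *\<^sub>R f r\<bar> powr p) * indicator {0<..<R} r)
    = (\<lambda>r. ennreal (r powr c * \<bar>f r\<bar> powr p) * indicator {0<..<R} r)"
    by (auto split: split_indicator)
  finally show ?thesis .
qed

lemma wint_ge_integral:
  assumes cont: "continuous_on {0<..<R} f" and ab: "0 < a" "b < R" and p: "p \<ge> 1"
  shows "ennreal (integral {a..b} (\<lambda>r. r powr c * \<bar>f r\<bar> powr p)) \<le> wint R c p f"
proof -
  have "continuous_on {a..b} (\<lambda>r. r powr c * \<bar>f r\<bar> powr p)"
    using p ab by (intro continuous_intros continuous_on_subset[OF cont] continuous_on_powr') auto
  from nn_integral_continuous[OF this]
  have "ennreal (integral {a..b} (\<lambda>r. r powr c * \<bar>f r\<bar> powr p))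
      = (\<integral>\<^sup>+r. ennreal (r powr c * \<bar>f r\<bar> powr p) * indicator {a..b} r \<partial>lborel)" by simp
  also have "\<dots> \<le> wint R c p f"
    unfolding wint_def using ab by (intro nn_integral_mono) (auto split: split_indicator)
  finally show ?thesis .
qed

text \<open>\<open>\<bar>f\<bar>\<close> is replaced by the differentiable positive function \<open>sqrt (f\<^sup>2 + \<delta>\<^sup>2)\<close>.\<close>

lemma regularized_abs:
  fixes f f' :: "real \<Rightarrow> real"
  assumes \<delta>: "\<delta> > 0" and der: "(f has_real_derivative f' r) (at r)"
  defines "m \<equiv> \<lambda>r. sqrt ((f r)\<^sup>2 + \<delta>\<^sup>2)"
  shows "0 < m r" "\<bar>f r\<bar> \<le> m r" "m r \<le> \<bar>f r\<bar> + \<delta>"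
    "(m has_real_derivative f r * f' r / m r) (at r)" "\<bar>f r * f' r / m r\<bar> \<le> \<bar>f' r\<bar>"
proof -
  have pos: "0 < (f r)\<^sup>2 + \<delta>\<^sup>2" using \<delta> by (intro add_nonneg_pos) auto
  then show m: "0 < m r" by (simp add: m_def)
  show fm: "\<bar>f r\<bar> \<le> m r" unfolding m_def using real_sqrt_le_mono[of "(f r)\<^sup>2" "(f r)\<^sup>2 + \<delta>\<^sup>2"] by simp
  show "m r \<le> \<bar>f r\<bar> + \<delta>" unfolding m_def using \<delta> by (intro real_le_lsqrt) (auto simp: power2_sum)
  show "(m has_real_derivative f r * f' r / m r) (at r)" unfolding m_def
    using pos by (auto intro!: derivative_eq_intros der simp: field_simps)
  have "\<bar>f r\<bar> * \<bar>f' r\<bar> \<le> m r * \<bar>f' r\<bar>" by (rule mult_right_mono[OF fm]) simp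
  then show "\<bar>f r * f' r / m r\<bar> \<le> \<bar>f' r\<bar>" using m by (simp add: abs_mult field_simps)
qed

text \<open>The function r^(c+1) (1 - r/b) |f|^p vanishes at b and is nonnegative at a, so the
  integral of its derivative is at most 0 and no boundary value of f is required. The derivative
  contains the main term (c+1) r^c |f|^p; the others carry an extra factor r, and Young's inequality
  turns them into weight r^(c+p). K dominates both (c+2)/b, by b \<ge> R/2, and p, so the constant
  does not depend on a and b.\<close>

lemma hardy_compact:
  fixes f f' :: "real \<Rightarrow> real"
  assumes R: "R > 0" and der: "\<And>r. 0 < r \<Longrightarrow> r < R \<Longrightarrow> (f has_real_derivative f' r) (at r)"
    and cont': "continuous_on {0<..<R} f'"
    and p: "p \<ge> 1" and c: "c > -1" and ab: "0 < a" "a < b" "b < R" "R / 2 \<le> b"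
  defines "K \<equiv> (c + 2) * 2 / R + p" and "\<eta> \<equiv> (c + 1) / 2"
  shows "integral {a..b} (\<lambda>r. r powr c * \<bar>f r\<bar> powr p)
    \<le> \<eta> powr (1 - p) * K powr p * 3 powr p / \<eta> * (integral {a..b} (\<lambda>r. r powr (c + p) * \<bar>f r\<bar> powr p)
        + integral {a..b} (\<lambda>r. r powr (c + p) * \<bar>f' r\<bar> powr p))"
proof -
  define C where "C = \<eta> powr (1 - p) * K powr p * 3 powr p"
  have \<eta>: "\<eta> > 0" and K: "K > 0" using c R p by (auto simp: \<eta>_def K_def intro!: add_pos_pos)
  have contf: "continuous_on {0<..<R} f"
    using der by (intro continuous_at_imp_continuous_on ballI DERIV_isCont) auto
  have sub: "{a..b} \<subseteq> {0<..<R}" using ab by auto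
  note ci = continuous_intros continuous_on_subset[OF contf sub] continuous_on_subset[OF cont' sub] continuous_on_powr'
  have i1: "(\<lambda>r. r powr c * \<bar>f r\<bar> powr p) integrable_on {a..b}"
    and i2: "(\<lambda>r. r powr (c + p) * \<bar>f r\<bar> powr p) integrable_on {a..b}"
    and i3: "(\<lambda>r. r powr (c + p) * \<bar>f' r\<bar> powr p) integrable_on {a..b}"
    and i4: "(\<lambda>r. r powr (c + p)) integrable_on {a..b}"
    using ab p by (intro integrable_continuous_real ci; auto)+
  let ?J = "integral {a..b} (\<lambda>r. r powr (c + p))"
  have J: "?J \<ge> 0" by (intro integral_nonneg i4) auto
  have main: "\<eta> * integral {a..b} (\<lambda>r. r powr c * \<bar>f r\<bar> powr p)
    \<le> C * (integral {a..b} (\<lambda>r. r powr (c + p) * \<bar>f r\<bar> powr p)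
        + integral {a..b} (\<lambda>r. r powr (c + p) * \<bar>f' r\<bar> powr p)) + \<delta> * (C * ?J)" if \<delta>: "0 < \<delta>" "\<delta> \<le> 1" for \<delta>
  proof -
    define m where "m r = sqrt ((f r)\<^sup>2 + \<delta>\<^sup>2)" for r
    note reg = regularized_abs[where f=f and f'=f', OF \<delta>(1) der, folded m_def]
    define F where "F r = r powr (c + 1) * (1 - r / b) * m r powr p" for r
    define F' where "F' r = ((c + 1) * r powr c * (1 - r / b) - r powr (c + 1) / b) * m r powr p
        + r powr (c + 1) * (1 - r / b) * (p * m r powr (p - 1) * (f r * f' r / m r))" for r
    have dF: "(F has_real_derivative F' r) (at r)" if r: "0 < r" "r < R" for r
      unfolding F_def F'_def using r reg(1,4)[OF r] ab
      by (auto intro!: derivative_eq_intros simp: field_simps powr_diff)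
    have "(F' has_integral F b - F a) {a..b}"
      using ab by (intro fundamental_theorem_of_calculus)
        (auto simp flip: has_real_derivative_iff_has_vector_derivative intro!: has_field_derivative_at_within[OF dF])
    moreover have "F b - F a \<le> 0"
    proof -
      have "F b = 0" using ab by (simp add: F_def)
      moreover have "F a \<ge> 0" unfolding F_def using ab by (intro mult_nonneg_nonneg) (auto simp: field_simps)
      ultimately show ?thesis by simp
    qed
    moreover have "\<eta> * (r powr c * \<bar>f r\<bar> powr p) - C * (r powr (c + p) * \<bar>f r\<bar> powr p + r powr (c + p) * \<bar>f' r\<bar> powr p)
        - \<delta> * (C * r powr (c + p)) \<le> F' r" if r: "r \<in> {a..b}" for r
    proof -
      have r': "0 < r" "r < R" using r ab by auto
      note reg = reg[OF r']
      let ?M = "m r powr (p - 1)" and ?d = "\<bar>f' r\<bar>"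
      have Mp: "m r powr p = ?M * m r" using reg(1) by (simp add: powr_diff)
      have rb: "0 \<le> 1 - r / b" "1 - r / b \<le> 1" using r ab by auto
      have "- (r powr (c + 1) * (1 - r / b) * (p * ?M * (f r * f' r / m r)))
          \<le> \<bar>r powr (c + 1) * (1 - r / b) * (p * ?M * (f r * f' r / m r))\<bar>" by (rule abs_ge_minus_self)
      also have "\<dots> = (r powr (c + 1) * (p * ?M)) * ((1 - r / b) * \<bar>f r * f' r / m r\<bar>)"
        using rb p by (simp add: abs_mult)
      also have "\<dots> \<le> (r powr (c + 1) * (p * ?M)) * (1 * ?d)"
        using rb p reg(5) by (intro mult_left_mono mult_mono) auto
      finally have 1: "- (r powr (c + 1) * (1 - r / b) * (p * ?M * (f r * f' r / m r))) \<le> r powr (c + 1) * (p * ?M) * ?d" by simp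
      have "F' r = (c + 1) * r powr c * m r powr p - (c + 2) / b * r powr (c + 1) * m r powr p
          + r powr (c + 1) * (1 - r / b) * (p * ?M * (f r * f' r / m r))"
        using r' ab by (simp add: F'_def powr_add field_simps)
      with 1 have 2: "F' r \<ge> (c + 1) * r powr c * m r powr p
          - r powr c * ((c + 2) / b * (r * ?M * m r) + p * (r * ?M * ?d))"
        using r' by (simp add: Mp powr_add algebra_simps)
      have "(c + 2) / b \<le> K" "p \<le> K"
      proof -
        have "(c + 2) / b \<le> (c + 2) / (R / 2)" using c R ab by (intro divide_left_mono) auto
        then show "(c + 2) / b \<le> K" using p by (simp add: K_def)
        show "p \<le> K" using c R by (simp add: K_def)
      qed
      then have "(c + 2) / b * (r * ?M * m r) + p * (r * ?M * ?d) \<le> K * (r * ?M * m r) + K * (r * ?M * ?d)"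
        using r' reg(1) by (intro add_mono mult_right_mono) auto
      also have "\<dots> = ?M * (K * r * (m r + ?d))" by (simp add: algebra_simps)
      \<comment> \<open>\<eta> is half of c + 1: the term \<eta> m^p is absorbed by the main term,
        half of which survives on the left.\<close>
      also have "\<dots> \<le> \<eta> * m r powr p + \<eta> powr (1 - p) * (K * r * (m r + ?d)) powr p"
        using reg(1) K r' \<eta> p by (intro young_powr) auto
      finally have 3: "(c + 2) / b * (r * ?M * m r) + p * (r * ?M * ?d) \<le> \<eta> * m r powr p + \<eta> powr (1 - p) * (K * r * (m r + ?d)) powr p" .
      have "(m r + ?d) powr p \<le> (\<bar>f r\<bar> + ?d + \<delta>) powr p"
        using reg \<delta> p by (intro powr_mono2) auto
      also have "\<dots> \<le> 3 powr p * (\<bar>f r\<bar> powr p + ?d powr p + \<delta> powr p)"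
        using \<delta> p by (intro powr_add3_le) auto
      also have "\<delta> powr p \<le> \<delta>" using powr_mono'[of 1 p \<delta>] \<delta> p by simp
      finally have 4: "(m r + ?d) powr p \<le> 3 powr p * (\<bar>f r\<bar> powr p + ?d powr p + \<delta>)" by simp
      have "\<eta> powr (1 - p) * (K * r * (m r + ?d)) powr p
          = \<eta> powr (1 - p) * K powr p * r powr p * (m r + ?d) powr p"
        using K r' reg(1) by (simp add: powr_mult)
      also have "\<dots> \<le> \<eta> powr (1 - p) * K powr p * r powr p * (3 powr p * (\<bar>f r\<bar> powr p + ?d powr p + \<delta>))"
        using 4 by (intro mult_left_mono) auto
      also have "\<dots> = C * r powr p * (\<bar>f r\<bar> powr p + ?d powr p + \<delta>)" by (simp add: C_def)
      finally have 5: "\<eta> powr (1 - p) * (K * r * (m r + ?d)) powr p \<le> C * r powr p * (\<bar>f r\<bar> powr p + ?d powr p + \<delta>)" .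
      have "\<eta> * (r powr c * \<bar>f r\<bar> powr p) \<le> \<eta> * (r powr c * m r powr p)"
        using reg \<eta> p by (intro mult_left_mono powr_mono2) auto
      also have "\<dots> = (c + 1) * r powr c * m r powr p - r powr c * (\<eta> * m r powr p)"
        by (simp add: \<eta>_def field_simps)
      also have "\<dots> \<le> F' r + r powr c * ((c + 2) / b * (r * ?M * m r) + p * (r * ?M * ?d)) - r powr c * (\<eta> * m r powr p)"
        using 2 by simp
      also have "\<dots> \<le> F' r + r powr c * (C * r powr p * (\<bar>f r\<bar> powr p + ?d powr p + \<delta>))"
      proof -
        have "r powr c * ((c + 2) / b * (r * ?M * m r) + p * (r * ?M * ?d))
          \<le> r powr c * (\<eta> * m r powr p + C * r powr p * (\<bar>f r\<bar> powr p + ?d powr p + \<delta>))"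
          using 3 5 by (intro mult_left_mono) auto
        then show ?thesis by (simp add: algebra_simps)
      qed
      also have "r powr c * (C * r powr p * (\<bar>f r\<bar> powr p + ?d powr p + \<delta>))
         = C * (r powr (c + p) * \<bar>f r\<bar> powr p + r powr (c + p) * ?d powr p) + \<delta> * (C * r powr (c + p))"
        by (simp add: powr_add algebra_simps)
      finally show ?thesis by simp
    qed
    ultimately have "integral {a..b} (\<lambda>r. \<eta> * (r powr c * \<bar>f r\<bar> powr p)
        - C * (r powr (c + p) * \<bar>f r\<bar> powr p + r powr (c + p) * \<bar>f' r\<bar> powr p) - \<delta> * (C * r powr (c + p))) \<le> 0"
      by (intro order.trans[OF has_integral_le[OF integrable_integral]])
        (auto intro!: integrable_diff integrable_add integrable_on_mult_right i1 i2 i3 i4)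
    also have "integral {a..b} (\<lambda>r. \<eta> * (r powr c * \<bar>f r\<bar> powr p)
        - C * (r powr (c + p) * \<bar>f r\<bar> powr p + r powr (c + p) * \<bar>f' r\<bar> powr p) - \<delta> * (C * r powr (c + p)))
      = \<eta> * integral {a..b} (\<lambda>r. r powr c * \<bar>f r\<bar> powr p) - C * (integral {a..b} (\<lambda>r. r powr (c + p) * \<bar>f r\<bar> powr p)
        + integral {a..b} (\<lambda>r. r powr (c + p) * \<bar>f' r\<bar> powr p)) - \<delta> * (C * ?J)"
      by (simp add: integral_diff integral_add integrable_diff integrable_add integrable_on_mult_right i1 i2 i3 i4)
    finally show ?thesis by simp
  qed
  have "\<eta> * integral {a..b} (\<lambda>r. r powr c * \<bar>f r\<bar> powr p)
    \<le> C * (integral {a..b} (\<lambda>r. r powr (c + p) * \<bar>f r\<bar> powr p)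
        + integral {a..b} (\<lambda>r. r powr (c + p) * \<bar>f' r\<bar> powr p))"
    by (rule le_of_le_add_small[OF main]) (use J in \<open>auto simp: C_def\<close>)
  then show ?thesis using \<eta> by (simp add: C_def field_simps)
qed

text \<open>The compact estimate is uniform over intervals whose right end is at least R/2;
  exhausting (0,R) by them gives a constant depending only on R, p and c.\<close>

lemma wint_hardy:
  assumes R: "R > 0" and p: "p \<ge> 1" and c: "c > -1"
  obtains C where "C \<ge> 0" "\<And>f f'. (\<And>r. 0 < r \<Longrightarrow> r < R \<Longrightarrow> (f has_real_derivative f' r) (at r)) \<Longrightarrow>
    continuous_on {0<..<R} f' \<Longrightarrow> wint R c p f \<le> ennreal C * (wint R (c + p) p f + wint R (c + p) p f')"
proof
  define C where "C = ((c + 1) / 2) powr (1 - p) * ((c + 2) * 2 / R + p) powr p * 3 powr p / ((c + 1) / 2)"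
  show C: "C \<ge> 0" using c by (simp add: C_def)
  fix f f' :: "real \<Rightarrow> real"
  assume der: "\<And>r. 0 < r \<Longrightarrow> r < R \<Longrightarrow> (f has_real_derivative f' r) (at r)" and cont': "continuous_on {0<..<R} f'"
  have cont: "continuous_on {0<..<R} f"
    using der by (intro continuous_at_imp_continuous_on ballI DERIV_isCont) auto
  have m0: "(\<lambda>r. ennreal (r powr c * \<bar>f r\<bar> powr p) * indicator {0<..<R} r) \<in> borel_measurable borel"
    by (rule wint_measurable[OF cont])
  have "wint R c p f = (\<integral>\<^sup>+r. (ennreal (r powr c * \<bar>f r\<bar> powr p) * indicator {0<..<R} r) * indicator {0<..<R} r \<partial>lborel)"
    unfolding wint_def by (intro nn_integral_cong) (auto split: split_indicator)
  also have "\<dots> \<le> ennreal C * (wint R (c + p) p f + wint R (c + p) p f')"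
  proof (rule nn_integral_exhaust[OF m0 R, of "R/2"])
    fix s t assume st: "0 < s" "s < t" "t < R" "R / 2 \<le> t"
    have sub: "{s..t} \<subseteq> {0<..<R}" using st by auto
    let ?I = "\<lambda>c g. integral {s..t} (\<lambda>r. r powr c * \<bar>g r\<bar> powr p)"
    have cI: "continuous_on {s..t} (\<lambda>r. r powr c * \<bar>g r\<bar> powr p)" if "continuous_on {0<..<R} g" for g c
      using st p by (intro continuous_intros continuous_on_subset[OF that sub] continuous_on_powr') auto
    have I0: "0 \<le> ?I c g" if "continuous_on {0<..<R} g" for c g
      by (intro integral_nonneg integrable_continuous_real cI that) auto
    have "(\<integral>\<^sup>+r. (ennreal (r powr c * \<bar>f r\<bar> powr p) * indicator {0<..<R} r) * indicator {s..t} r \<partial>lborel)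
      = (\<integral>\<^sup>+r. ennreal (r powr c * \<bar>f r\<bar> powr p) * indicator {s..t} r \<partial>lborel)"
      using st by (intro nn_integral_cong) (auto split: split_indicator)
    also have "\<dots> = ennreal (?I c f)" by (rule nn_integral_continuous[OF cI[OF cont]]) auto
    also have "\<dots> \<le> ennreal (C * (?I (c + p) f + ?I (c + p) f'))"
      unfolding C_def by (intro ennreal_leI hardy_compact[OF R der cont' p c st]) auto
    also have "\<dots> = ennreal C * (ennreal (?I (c + p) f) + ennreal (?I (c + p) f'))"
      using C I0[OF cont] I0[OF cont'] by (simp add: ennreal_mult ennreal_plus)
    also have "\<dots> \<le> ennreal C * (wint R (c + p) p f + wint R (c + p) p f')"
      using st p cont cont' by (intro mult_left_mono add_mono wint_ge_integral) auto
    finally show "(\<integral>\<^sup>+r. (ennreal (r powr c * \<bar>f r\<bar> powr p) * indicator {0<..<R} r) * indicator {s..t} r \<partial>lborel)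
      \<le> ennreal C * (wint R (c + p) p f + wint R (c + p) p f')" .
  qed (use R in auto)
  finally show "wint R c p f \<le> ennreal C * (wint R (c + p) p f + wint R (c + p) p f')" .
qed

text \<open>The derivative of F = r^(c+1) |f|^p is bounded by an integrand G made of the two terms
  on the right, so F oscillates by at most the integral of G. Averaging F(r) \<le> F(s) + integral
  of G over s turns F(s) into the first term; the summand 4 in K comes from b - a \<ge> R/4.\<close>

lemma pointwise_compact:
  fixes f f' :: "real \<Rightarrow> real" and c :: real
  assumes R: "R > 0" and der: "\<And>r. 0 < r \<Longrightarrow> r < R \<Longrightarrow> (f has_real_derivative f' r) (at r)"
    and cont': "continuous_on {0<..<R} f'"
    and p: "p \<ge> 1" and ab: "0 < a" "a + R / 4 \<le> b" "b < R" and r: "r \<in> {a..b}"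
  defines "K \<equiv> \<bar>c + 1\<bar> + p + 4"
  shows "r powr (c + 1) * \<bar>f r\<bar> powr p
    \<le> K * 2 powr p * (integral {a..b} (\<lambda>r. r powr c * \<bar>f r\<bar> powr p)
        + integral {a..b} (\<lambda>r. r powr (c + p) * \<bar>f' r\<bar> powr p))"
proof -
  have K: "K \<ge> 1" using p by (simp add: K_def)
  have contf: "continuous_on {0<..<R} f"
    using der by (intro continuous_at_imp_continuous_on ballI DERIV_isCont) auto
  have sub: "{a..b} \<subseteq> {0<..<R}" using ab by auto
  note ci = continuous_intros continuous_on_subset[OF contf sub] continuous_on_subset[OF cont' sub] continuous_on_powr'
  have i1: "(\<lambda>r. r powr c * \<bar>f r\<bar> powr p) integrable_on {a..b}"
    and i3: "(\<lambda>r. r powr (c + p) * \<bar>f' r\<bar> powr p) integrable_on {a..b}"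
    and i4: "(\<lambda>r. r powr c) integrable_on {a..b}"
    using ab p by (intro integrable_continuous_real ci; auto)+
  let ?J = "integral {a..b} (\<lambda>r. r powr c)"
  let ?I1 = "integral {a..b} (\<lambda>r. r powr c * \<bar>f r\<bar> powr p)"
  let ?I3 = "integral {a..b} (\<lambda>r. r powr (c + p) * \<bar>f' r\<bar> powr p)"
  have J: "?J \<ge> 0" by (intro integral_nonneg i4) auto
  have I: "?I1 \<ge> 0" "?I3 \<ge> 0" by (intro integral_nonneg i1 i3; auto)+
  have "r powr (c + 1) * \<bar>f r\<bar> powr p \<le> K * (2 powr p * (?I1 + \<delta> * ?J) + ?I3)" if \<delta>: "0 < \<delta>" "\<delta> \<le> 1" for \<delta>
  proof -
    define m where "m r = sqrt ((f r)\<^sup>2 + \<delta>\<^sup>2)" for r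
    note reg = regularized_abs[where f=f and f'=f', OF \<delta>(1) der, folded m_def]
    have cm: "continuous_on {a..b} m"
      unfolding m_def by (intro ci) 
    define Im where "Im = integral {a..b} (\<lambda>r. r powr c * m r powr p)"
    have im: "(\<lambda>r. r powr c * m r powr p) integrable_on {a..b}"
    proof -
      have "s \<in> {a..b} \<Longrightarrow> m s \<noteq> 0" for s using reg(1)[of s] ab by auto
      then show ?thesis using ab
        by (intro integrable_continuous_real continuous_on_mult continuous_on_powr continuous_on_const continuous_on_id cm) auto
    qed
    have Im: "Im \<le> 2 powr p * (?I1 + \<delta> * ?J)"
    proof -
      have "Im \<le> integral {a..b} (\<lambda>r. 2 powr p * (r powr c * \<bar>f r\<bar> powr p + \<delta> * r powr c))"
        unfolding Im_def
      proof (rule integral_le[OF im])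
        show "(\<lambda>r. 2 powr p * (r powr c * \<bar>f r\<bar> powr p + \<delta> * r powr c)) integrable_on {a..b}"
          by (intro integrable_on_mult_right integrable_add i1 i4)
        fix s assume "s \<in> {a..b}"
        then have s: "0 < s" "s < R" using ab by auto
        have "m s powr p \<le> (\<bar>f s\<bar> + \<delta>) powr p" using reg[OF s] p by (intro powr_mono2) auto
        also have "\<dots> \<le> 2 powr p * (\<bar>f s\<bar> powr p + \<delta> powr p)" using \<delta> p by (intro powr_add_le) auto
        also have "\<delta> powr p \<le> \<delta>" using powr_mono'[of 1 p \<delta>] \<delta> p by simp
        finally have "m s powr p \<le> 2 powr p * (\<bar>f s\<bar> powr p + \<delta>)" by simp
        from mult_left_mono[OF this, of "s powr c"]
        show "s powr c * m s powr p \<le> 2 powr p * (s powr c * \<bar>f s\<bar> powr p + \<delta> * s powr c)"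
          by (simp add: algebra_simps)
      qed
      also have "\<dots> = 2 powr p * (?I1 + \<delta> * ?J)"
        by (simp add: integral_add integrable_on_mult_right i1 i4)
      finally show ?thesis .
    qed
    define F where "F r = r powr (c + 1) * m r powr p" for r
    define F' where "F' r = (c + 1) * r powr c * m r powr p + r powr (c + 1) * (p * m r powr (p - 1) * (f r * f' r / m r))" for r
    define G where "G r = (\<bar>c + 1\<bar> + p) * (r powr c * m r powr p) + p * (r powr (c + p) * \<bar>f' r\<bar> powr p)" for r
    have dF: "(F has_real_derivative F' r) (at r)" if r: "0 < r" "r < R" for r
      unfolding F_def F'_def using r reg(1,4)[OF r] ab
      by (auto intro!: derivative_eq_intros simp: field_simps powr_diff)
    have F'G: "\<bar>F' r\<bar> \<le> G r" if r: "0 < r" "r < R" for r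
    proof -
      have "\<bar>F' r\<bar> \<le> \<bar>(c + 1) * r powr c * m r powr p\<bar> + \<bar>r powr (c + 1) * (p * m r powr (p - 1) * (f r * f' r / m r))\<bar>"
        unfolding F'_def by (rule abs_triangle_ineq)
      also have "\<dots> = \<bar>c + 1\<bar> * r powr c * m r powr p + r powr (c + 1) * (p * m r powr (p - 1) * \<bar>f r * f' r / m r\<bar>)"
        using p by (simp add: abs_mult)
      also have "\<dots> \<le> \<bar>c + 1\<bar> * r powr c * m r powr p + r powr (c + 1) * (p * m r powr (p - 1) * \<bar>f' r\<bar>)"
        using reg(5)[OF r] p by (intro add_left_mono mult_left_mono) auto
      also have "r powr (c + 1) * (p * m r powr (p - 1) * \<bar>f' r\<bar>) = r powr c * p * (m r powr (p - 1) * (r * \<bar>f' r\<bar>))"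
        using r by (simp add: powr_add)
      also have "\<dots> \<le> r powr c * p * (1 * m r powr p + 1 powr (1 - p) * (r * \<bar>f' r\<bar>) powr p)"
        using reg(1)[OF r] r p by (intro mult_left_mono young_powr) auto
      also have "\<bar>c + 1\<bar> * r powr c * m r powr p + \<dots> = G r"
        using r by (simp add: G_def powr_mult powr_add algebra_simps)
      finally show ?thesis by simp
    qed
    have iG: "G integrable_on {s..t}" if "a \<le> s" "t \<le> b" for s t
      unfolding G_def by (rule integrable_on_subinterval[of _ "{a..b}"])
        (use that in \<open>auto intro!: integrable_add integrable_on_mult_right im i3\<close>)
    have G0: "0 \<le> G r" for r using p by (auto simp: G_def)
    have dist: "F t - F s \<le> integral {a..b} G \<and> F s - F t \<le> integral {a..b} G" if "a \<le> s" "s \<le> t" "t \<le> b" for s t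
    proof -
      have "(F' has_integral F t - F s) {s..t}"
        using that ab by (intro fundamental_theorem_of_calculus)
          (auto simp flip: has_real_derivative_iff_has_vector_derivative intro!: has_field_derivative_at_within[OF dF])
      then have eq: "integral {s..t} F' = F t - F s" and int: "F' integrable_on {s..t}"
        by (auto simp: integral_unique)
      have "norm (integral {s..t} F') \<le> integral {s..t} G"
        using that ab by (intro integral_norm_bound_integral[OF int iG]) (auto intro: F'G)
      then have "norm (F t - F s) \<le> integral {s..t} G" by (simp add: eq)
      also have "\<dots> \<le> integral {a..b} G"
        using that by (intro integral_subset_le iG) (auto simp: G0)
      finally show ?thesis by auto
    qed
    have Fle: "F r \<le> F s + integral {a..b} G" if "s \<in> {a..b}" for s
      using dist[of r s] dist[of s r] r that by (cases "r \<le> s") auto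
    have "(b - a) * F r = integral {a..b} (\<lambda>s. F r)" using ab R by simp
    also have "\<dots> \<le> integral {a..b} (\<lambda>s. R * (s powr c * m s powr p) + integral {a..b} G)"
    proof (rule integral_le)
      fix s assume s: "s \<in> {a..b}"
      have "F s = s * (s powr c * m s powr p)" using s ab by (simp add: F_def powr_add)
      also have "\<dots> \<le> R * (s powr c * m s powr p)" using s ab by (intro mult_right_mono) auto
      finally show "F r \<le> R * (s powr c * m s powr p) + integral {a..b} G" using Fle[OF s] by simp
    qed (auto intro!: integrable_add integrable_on_mult_right im)
    also have "\<dots> = R * Im + (b - a) * integral {a..b} G"
      unfolding Im_def using ab R by (subst integral_add) (auto intro!: integrable_on_mult_right im)
    finally have "(b - a) * F r \<le> R * Im + (b - a) * integral {a..b} G" .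
    moreover have "R * Im \<le> (b - a) * (4 * Im)"
    proof -
      have "0 \<le> Im" unfolding Im_def by (intro integral_nonneg im) auto
      then have "R * Im \<le> ((b - a) * 4) * Im" using ab by (intro mult_right_mono) auto
      then show ?thesis by (simp only: mult.assoc)
    qed
    ultimately have "(b - a) * F r \<le> (b - a) * (4 * Im + integral {a..b} G)"
      by (simp add: algebra_simps)
    then have "F r \<le> 4 * Im + integral {a..b} G" using ab R by simp
    also have "integral {a..b} G = (\<bar>c + 1\<bar> + p) * Im + p * ?I3"
      unfolding G_def Im_def by (subst integral_add) (auto intro!: integrable_on_mult_right im i3)
    also have "4 * Im + ((\<bar>c + 1\<bar> + p) * Im + p * ?I3) \<le> K * Im + K * ?I3"
      using I by (simp add: K_def algebra_simps) 
    also have "\<dots> \<le> K * (2 powr p * (?I1 + \<delta> * ?J) + ?I3)"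
      using mult_left_mono[OF Im, of K] K by (simp add: algebra_simps) 
    finally have "F r \<le> K * (2 powr p * (?I1 + \<delta> * ?J) + ?I3)" .
    moreover have "r powr (c + 1) * \<bar>f r\<bar> powr p \<le> F r"
      unfolding F_def using reg[of r] r ab p by (intro mult_left_mono powr_mono2) auto
    ultimately show ?thesis by simp
  qed
  note est = this
  have "r powr (c + 1) * \<bar>f r\<bar> powr p \<le> K * (2 powr p * ?I1 + ?I3) + \<delta> * (K * 2 powr p * ?J)" if "0 < \<delta>" "\<delta> \<le> 1" for \<delta>
    using est[OF that] by (simp add: algebra_simps)
  then have "r powr (c + 1) * \<bar>f r\<bar> powr p \<le> K * (2 powr p * ?I1 + ?I3)"
    by (rule le_of_le_add_small) (use K J in auto)
  also have "\<dots> \<le> K * (2 powr p * ?I1 + 2 powr p * ?I3)"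
  proof -
    have "1 * ?I3 \<le> 2 powr p * ?I3" using I p by (intro mult_right_mono ge_one_powr_ge_zero) auto
    then show ?thesis using K by (intro mult_left_mono add_left_mono) auto
  qed
  finally show ?thesis by (simp add: algebra_simps)
qed

lemma wint_pointwise:
  assumes R: "R > 0" and p: "p \<ge> 1"
  obtains C where "C \<ge> 0" "\<And>f f' r. (\<And>r. 0 < r \<Longrightarrow> r < R \<Longrightarrow> (f has_real_derivative f' r) (at r)) \<Longrightarrow>
    continuous_on {0<..<R} f' \<Longrightarrow> 0 < r \<Longrightarrow> r < R \<Longrightarrow>
    ennreal (r powr (c + 1) * \<bar>f r\<bar> powr p) \<le> ennreal C * (wint R c p f + wint R (c + p) p f')"
proof
  define C where "C = (\<bar>c + 1\<bar> + p + 4) * 2 powr p"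
  show C: "C \<ge> 0" using p by (simp add: C_def)
  fix f f' :: "real \<Rightarrow> real" and r
  assume der: "\<And>r. 0 < r \<Longrightarrow> r < R \<Longrightarrow> (f has_real_derivative f' r) (at r)" and cont': "continuous_on {0<..<R} f'"
    and r: "0 < r" "r < R"
  have cont: "continuous_on {0<..<R} f"
    using der by (intro continuous_at_imp_continuous_on ballI DERIV_isCont) auto
  \<comment> \<open>Chosen so that [a,b] contains r and has length at least R/4, wherever r lies in
    (0,R).\<close>
  define a b where "a = min r (R / 4)" and "b = max r (R / 2)"
  have ab: "0 < a" "a + R / 4 \<le> b" "b < R" "r \<in> {a..b}" using r R by (auto simp: a_def b_def)
  have sub: "{a..b} \<subseteq> {0<..<R}" using ab by auto
  let ?I = "\<lambda>c g. integral {a..b} (\<lambda>r. r powr c * \<bar>g r\<bar> powr p)"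
  have I0: "0 \<le> ?I c g" if "continuous_on {0<..<R} g" for c g
    using ab p by (intro integral_nonneg integrable_continuous_real continuous_intros continuous_on_subset[OF that sub] continuous_on_powr') auto
  have "ennreal (r powr (c + 1) * \<bar>f r\<bar> powr p) \<le> ennreal (C * (?I c f + ?I (c + p) f'))"
    unfolding C_def by (intro ennreal_leI pointwise_compact[OF R der cont' p ab]) auto
  also have "\<dots> = ennreal C * (ennreal (?I c f) + ennreal (?I (c + p) f'))"
    using C I0[OF cont] I0[OF cont'] by (simp add: ennreal_mult ennreal_plus)
  also have "\<dots> \<le> ennreal C * (wint R c p f + wint R (c + p) p f')"
    using ab p cont cont' by (intro mult_left_mono add_mono wint_ge_integral) auto
  finally show "ennreal (r powr (c + 1) * \<bar>f r\<bar> powr p) \<le> ennreal C * (wint R c p f + wint R (c + p) p f')" .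
qed

text \<open>The index runs up to j = k inclusive, so \<open>h k\<close> is itself differentiable and
  hence continuous; thus \<open>h 0\<close> to \<open>h k\<close> are all continuous.\<close>

definition deriv_chain :: "real \<Rightarrow> nat \<Rightarrow> (nat \<Rightarrow> real \<Rightarrow> real) \<Rightarrow> bool" where
  "deriv_chain R k h \<longleftrightarrow> (\<forall>j\<le>k. \<forall>r. 0 < r \<longrightarrow> r < R \<longrightarrow> (h j has_real_derivative h (Suc j) r) (at r))"

lemma deriv_chainD: "deriv_chain R k h \<Longrightarrow> j \<le> k \<Longrightarrow> 0 < r \<Longrightarrow> r < R \<Longrightarrow> (h j has_real_derivative h (Suc j) r) (at r)"
  by (auto simp: deriv_chain_def)

lemma deriv_chain_continuous_on:
  assumes "deriv_chain R k h" "j \<le> k"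
  shows "continuous_on {0<..<R} (h j)"
  using deriv_chainD[OF assms] by (intro continuous_at_imp_continuous_on ballI DERIV_isCont) auto

lemma deriv_chain_diff:
  assumes "deriv_chain R k h" "deriv_chain R k h'"
  shows "deriv_chain R k (\<lambda>j r. h j r - h' j r)"
  using assms unfolding deriv_chain_def by (auto intro!: DERIV_diff)

text \<open>Each application of Hardy's inequality lowers the weight exponent by p at the cost of
  one derivative. The condition i p < N says that all exponents reached stay above -1, which is what
  Hardy's inequality needs.\<close>

lemma wint_hardy_iter:
  assumes R: "R > 0" and p: "p \<ge> 1" and i: "real i * p < N"
  obtains C where "C \<ge> 0" "\<And>k h j. deriv_chain R k h \<Longrightarrow> j + i \<le> k \<Longrightarrow>
    wint R (N - 1 - real i * p) p (h j) \<le> ennreal C * (\<Sum>l\<le>k. wint R (N - 1) p (h l))"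
proof -
  have "\<exists>C\<ge>0. \<forall>k h j. deriv_chain R k h \<longrightarrow> j + i \<le> k \<longrightarrow>
    wint R (N - 1 - real i * p) p (h j) \<le> ennreal C * (\<Sum>l\<le>k. wint R (N - 1) p (h l))"
    using i
  proof (induction i)
    case 0
    have "wint R (N - 1) p (h j) \<le> (\<Sum>l\<le>k. wint R (N - 1) p (h l))" if "j \<le> k" for h and j k :: nat
      using that by (intro member_le_sum) auto
    then show ?case by (intro exI[of _ 1]) auto
  next
    case (Suc i)
    have "real i * p < N" using Suc.prems p by (simp add: algebra_simps)
    from Suc.IH[OF this] obtain C where C: "C \<ge> 0" "\<And>k h j. deriv_chain R k h \<Longrightarrow> j + i \<le> k \<Longrightarrow>
      wint R (N - 1 - real i * p) p (h j) \<le> ennreal C * (\<Sum>l\<le>k. wint R (N - 1) p (h l))" by blast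
    define c where "c = N - 1 - real (Suc i) * p"
    have c: "c > -1" "c + p = N - 1 - real i * p" using Suc.prems by (simp_all add: c_def algebra_simps)
    obtain C' where C': "C' \<ge> 0" "\<And>f f'. (\<And>r. 0 < r \<Longrightarrow> r < R \<Longrightarrow> (f has_real_derivative f' r) (at r)) \<Longrightarrow>
      continuous_on {0<..<R} f' \<Longrightarrow> wint R c p f \<le> ennreal C' * (wint R (c + p) p f + wint R (c + p) p f')"
      using wint_hardy[OF R p c(1)] by metis
    have "wint R c p (h j) \<le> ennreal (C' * (C + C)) * (\<Sum>l\<le>k. wint R (N - 1) p (h l))"
      if h: "deriv_chain R k h" "j + Suc i \<le> k" for k h j
    proof -
      let ?S = "\<Sum>l\<le>k. wint R (N - 1) p (h l)"
      have "wint R c p (h j) \<le> ennreal C' * (wint R (c + p) p (h j) + wint R (c + p) p (h (Suc j)))"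
        using h by (intro C'(2) deriv_chainD[OF h(1)] deriv_chain_continuous_on[OF h(1)]) auto
      also have "\<dots> \<le> ennreal C' * (ennreal C * ?S + ennreal C * ?S)"
        unfolding c(2) using h by (intro mult_left_mono add_mono C(2)) auto
      also have "\<dots> = ennreal (C' * (C + C)) * ?S"
      proof -
        have "ennreal (C' * (C + C)) = ennreal C' * (ennreal C + ennreal C)"
          using C(1) C'(1) by (simp only: ennreal_mult ennreal_plus add_nonneg_nonneg)
        then show ?thesis by (simp only: distrib_right distrib_left mult.assoc)
      qed
      finally show ?thesis .
    qed
    then show ?case using C(1) C'(1) unfolding c_def by (intro exI[of _ "C' * (C + C)"]) auto
  qed
  then show ?thesis using that by blast
qed

lemma wint_weight_mono:
  assumes "c \<le> d" "continuous_on {0<..<R} f"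
  shows "wint R d p f \<le> ennreal (R powr (d - c)) * wint R c p f"
proof -
  have "wint R d p f \<le> (\<integral>\<^sup>+r. ennreal (R powr (d - c)) * (ennreal (r powr c * \<bar>f r\<bar> powr p) * indicator {0<..<R} r) \<partial>lborel)"
    unfolding wint_def
  proof (rule nn_integral_mono)
    fix r :: real
    have "r powr d * \<bar>f r\<bar> powr p \<le> R powr (d - c) * (r powr c * \<bar>f r\<bar> powr p)" if "0 < r" "r < R"
    proof -
      have "r powr d = r powr (d - c) * r powr c" using that by (simp add: powr_add[symmetric])
      also have "\<dots> \<le> R powr (d - c) * r powr c" using that assms by (intro mult_right_mono powr_mono2) auto
      finally show ?thesis using mult_right_mono[of _ _ "\<bar>f r\<bar> powr p"] by (fastforce simp: mult.assoc)
    qed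
    then show "ennreal (r powr d * \<bar>f r\<bar> powr p) * indicator {0<..<R} r
      \<le> ennreal (R powr (d - c)) * (ennreal (r powr c * \<bar>f r\<bar> powr p) * indicator {0<..<R} r)"
      by (auto split: split_indicator simp: ennreal_mult[symmetric] intro!: ennreal_leI)
  qed
  also have "\<dots> = ennreal (R powr (d - c)) * wint R c p f"
    unfolding wint_def using wint_measurable[OF assms(2), of c p] by (subst nn_integral_cmult) simp_all
  finally show ?thesis .
qed

section \<open>Almost everywhere differentiability\<close>

text \<open>H is where a maximal function of M exceeds c. Vitali's lemma selects disjoint balls of
  radius |y - x| around points x of H whose fivefold enlargements cover H; each ball contains the
  interval between x and y, so disjointness bounds the total length by 10/c times the mass. A
  measurable superset T is produced, so measurability of H itself does not arise.\<close>

lemma weak_type_estimate: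
  fixes M :: "real measure" and a b c :: real
  assumes fin: "finite_measure M" and sets: "sets M = sets borel" and l: "c > 0"
  defines "H \<equiv> {x \<in> {a<..<b}. \<exists>y\<in>{a<..<b}. y \<noteq> x \<and> c * \<bar>y - x\<bar> < measure M {min x y..max x y}}"
  shows "\<exists>T. H \<subseteq> T \<and> T \<in> lmeasurable \<and> measure lebesgue T \<le> 10 / c * measure M UNIV"
proof -
  interpret finite_measure M by (rule fin)
  have spM: "space M = UNIV" using sets_eq_imp_space_eq[OF sets] by simp
  have "\<forall>x\<in>H. \<exists>y. y \<in> {a<..<b} \<and> y \<noteq> x \<and> c * \<bar>y - x\<bar> < measure M {min x y..max x y}" by (auto simp: H_def)
  then obtain y where y: "\<And>x. x \<in> H \<Longrightarrow> y x \<in> {a<..<b} \<and> y x \<noteq> x \<and> c * \<bar>y x - x\<bar> < measure M {min x (y x)..max x (y x)}"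
    by metis
  define r where "r x = \<bar>y x - x\<bar>" for x
  have r: "0 < r x \<and> r x \<le> b - a" if "x \<in> H" for x
    using y[OF that] that by (auto simp: H_def r_def)
  have sub: "H \<subseteq> (\<Union>x\<in>H. cball x (r x))" using r by (force simp: less_imp_le)
  obtain C where C: "countable C" "C \<subseteq> H"
     "pairwise (\<lambda>i j. disjnt (cball i (r i)) (cball j (r j))) C"
     "H \<subseteq> (\<Union>i\<in>C. cball i (5 * r i))"
    by (rule Vitali_covering_lemma_cballs[OF sub r]) (assumption | rule that)+
  have bound: "measure lebesgue (\<Union>i\<in>D. cball i (5 * r i)) \<le> 10 / c * measure M UNIV" if D: "D \<subseteq> C" "finite D" for D
  proof -
    have "measure lebesgue (\<Union>i\<in>D. cball i (5 * r i)) \<le> (\<Sum>i\<in>D. measure lebesgue (cball i (5 * r i)))"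
      using D(2) by (intro measure_UNION_le) auto
    also have "\<dots> = (\<Sum>i\<in>D. 10 / c * (c * r i))"
    proof (intro sum.cong refl)
      fix i assume "i \<in> D"
      then have "0 < r i" using D C(2) r by auto
      then show "measure lebesgue (cball i (5 * r i)) = 10 / c * (c * r i)"
        using l by (simp add: cball_eq_atLeastAtMost)
    qed
    also have "\<dots> \<le> (\<Sum>i\<in>D. 10 / c * measure M {min i (y i)..max i (y i)})"
      using D C(2) y l by (intro sum_mono mult_left_mono) (auto simp: r_def less_imp_le subset_eq)
    also have "\<dots> = 10 / c * (\<Sum>i\<in>D. measure M {min i (y i)..max i (y i)})"
      by (simp add: sum_distrib_left)
    also have "(\<Sum>i\<in>D. measure M {min i (y i)..max i (y i)}) = measure M (\<Union>i\<in>D. {min i (y i)..max i (y i)})"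
    proof (rule finite_measure_finite_Union[symmetric, OF D(2)])
      show "disjoint_family_on (\<lambda>i. {min i (y i)..max i (y i)}) D"
        unfolding disjoint_family_on_def
      proof (intro ballI impI)
        fix i j assume ij: "i \<in> D" "j \<in> D" "i \<noteq> j"
        have "{min i (y i)..max i (y i)} \<subseteq> cball i (r i)" for i
          by (auto simp: cball_eq_atLeastAtMost r_def)
        then show "{min i (y i)..max i (y i)} \<inter> {min j (y j)..max j (y j)} = {}"
          using C(3) ij D(1) unfolding pairwise_def disjnt_def by blast
      qed
    qed (auto simp: sets)
    also have "\<dots> \<le> measure M UNIV" using finite_measure_mono[of _ UNIV] sets by simp
    finally show ?thesis using l by (simp add: mult_left_mono divide_right_mono)
  qed
  show ?thesis
  proof (intro exI conjI)
    show "(\<Union>i\<in>C. cball i (5 * r i)) \<in> lmeasurable"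
      by (rule fmeasurable_UN_bound[OF C(1) _ bound]) auto
    show "measure lebesgue (\<Union>i\<in>C. cball i (5 * r i)) \<le> 10 / c * measure M UNIV"
      by (rule measure_UN_bound[OF C(1) _ bound]) auto
  qed (rule C)
qed

lemma tendsto_of_Cauchy_filter:
  fixes f :: "'a \<Rightarrow> real"
  assumes "F \<noteq> bot" "\<And>e. e > 0 \<Longrightarrow> \<exists>P. eventually P F \<and> (\<forall>x y. P x \<longrightarrow> P y \<longrightarrow> \<bar>f x - f y\<bar> \<le> e)"
  shows "\<exists>L. (f \<longlongrightarrow> L) F"
proof -
  have "cauchy_filter (filtermap f F)"
    unfolding cauchy_filter_metric_filtermap
  proof (intro allI impI)
    fix e :: real assume "e > 0"
    then obtain P where "eventually P F" "\<forall>x y. P x \<longrightarrow> P y \<longrightarrow> \<bar>f x - f y\<bar> \<le> e / 2"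
      using assms(2)[of "e/2"] by auto
    then show "\<exists>P. eventually P F \<and> (\<forall>x y. P x \<and> P y \<longrightarrow> dist (f x) (f y) < e)"
      using \<open>e > 0\<close> by (intro exI[of _ P]) (fastforce simp: dist_real_def)
  qed
  then have "\<exists>L\<in>UNIV. filtermap f F \<le> nhds L"
    using complete_UNIV assms(1) unfolding complete_uniform by (auto dest!: spec[of _ "filtermap f F"] simp: filtermap_bot_iff)
  then show ?thesis by (auto simp: filterlim_def)
qed

text \<open>Up to an error bounded by the maximal function of \<open>M n\<close>, the difference quotients of \<open>v\<close> are
  those of the differentiable function \<open>G n\<close>; by the weak type estimate the error is small off a set
  of small measure.\<close>

lemma negligible_nondifferentiable:
  fixes v :: "real \<Rightarrow> real" and G :: "nat \<Rightarrow> real \<Rightarrow> real" and M :: "nat \<Rightarrow> real measure"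
  assumes G: "\<And>n x. a < x \<Longrightarrow> x < b \<Longrightarrow> G n differentiable (at x)"
    and fin: "\<And>n. finite_measure (M n)" and sets: "\<And>n. sets (M n) = sets borel"
    and small: "(\<lambda>n. measure (M n) UNIV) \<longlonglongrightarrow> 0"
    and bd: "\<And>n s t. a < s \<Longrightarrow> s < t \<Longrightarrow> t < b \<Longrightarrow> \<bar>(v t - G n t) - (v s - G n s)\<bar> \<le> measure (M n) {s..t}"
  shows "negligible {x \<in> {a<..<b}. \<not> v differentiable (at x)}"
proof -
  define Q where "Q f x y = (f y - f x) / (y - x)" for f and x y :: real
  \<comment> \<open>Points where the difference quotients of v keep oscillating by more than 3 l.
    The number 3 adds one l for the error v - G n at each of two points and twice l/2 for the
    quotients of G n near their limit. \<open>Bad l\<close> does not depend on n, while the sets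
    \<open>H n l\<close> containing it have measure tending to 0.\<close>
  define Bad where "Bad l = {x \<in> {a<..<b}. \<not> (\<exists>d>0. \<forall>y z. y \<noteq> x \<longrightarrow> z \<noteq> x \<longrightarrow> \<bar>y - x\<bar> < d \<longrightarrow> \<bar>z - x\<bar> < d \<longrightarrow> \<bar>Q v x y - Q v x z\<bar> \<le> 3 * l)}" for l
  define H where "H n l = {x \<in> {a<..<b}. \<exists>y\<in>{a<..<b}. y \<noteq> x \<and> l * \<bar>y - x\<bar> < measure (M n) {min x y..max x y}}" for n l
  have BH: "Bad l \<subseteq> H n l" if l: "l > 0" for l n
  proof
    fix x assume x: "x \<in> Bad l"
    show "x \<in> H n l"
    proof (rule ccontr)
      assume nH: "x \<notin> H n l"
      have xab: "a < x" "x < b" using x by (auto simp: Bad_def)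
      have 1: "\<bar>Q v x y - Q (G n) x y\<bar> \<le> l" if y: "y \<in> {a<..<b}" "y \<noteq> x" for y
      proof -
        have "measure (M n) {min x y..max x y} \<le> l * \<bar>y - x\<bar>"
          using nH xab y unfolding H_def by force
        moreover have "\<bar>(v y - G n y) - (v x - G n x)\<bar> \<le> measure (M n) {min x y..max x y}"
          using bd[of x y n] bd[of y x n] xab y by (cases "x < y") (auto simp: min_def max_def)
        ultimately have "\<bar>(v y - G n y) - (v x - G n x)\<bar> \<le> l * \<bar>y - x\<bar>" by linarith
        then have "\<bar>((v y - G n y) - (v x - G n x)) / (y - x)\<bar> \<le> l"
          using y by (simp add: abs_divide divide_le_eq)
        then show ?thesis by (simp add: Q_def diff_divide_distrib[symmetric] algebra_simps)
      qed
      obtain g where "(G n has_real_derivative g) (at x)"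
        using G[OF xab] by (auto simp: real_differentiable_def)
      then have "(Q (G n) x \<longlongrightarrow> g) (at x)" unfolding has_field_derivative_iff Q_def .
      then have "\<forall>\<^sub>F y in at x. dist (Q (G n) x y) g < l / 2" using tendstoD[of _ _ _ "l / 2"] l by auto
      then obtain d where d: "d > 0" "\<And>y. y \<noteq> x \<Longrightarrow> dist y x < d \<Longrightarrow> dist (Q (G n) x y) g < l / 2"
        by (auto simp: eventually_at)
      define d' where "d' = min d (min (x - a) (b - x))"
      have "d' > 0" using d xab by (auto simp: d'_def)
      moreover have "\<bar>Q v x y - Q v x z\<bar> \<le> 3 * l" if "y \<noteq> x" "z \<noteq> x" "\<bar>y - x\<bar> < d'" "\<bar>z - x\<bar> < d'" for y z
      proof -
        have "\<bar>Q v x y - Q (G n) x y\<bar> \<le> l" "\<bar>Q v x z - Q (G n) x z\<bar> \<le> l"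
          using that by (intro 1; auto simp: d'_def abs_if split: if_splits)+
        moreover have "\<bar>Q (G n) x y - g\<bar> < l / 2" "\<bar>Q (G n) x z - g\<bar> < l / 2"
          using d(2)[of y] d(2)[of z] that by (auto simp: dist_real_def d'_def)
        ultimately show ?thesis by linarith
      qed
      ultimately show False using x unfolding Bad_def by blast
    qed
  qed
  have negB: "negligible (Bad l)" if l: "l > 0" for l
    unfolding negligible_outer_le
  proof (intro allI impI)
    fix e :: real assume "e > 0"
    have "(\<lambda>n. 10 / l * measure (M n) UNIV) \<longlonglongrightarrow> 10 / l * 0" by (intro tendsto_intros small)
    then have "\<forall>\<^sub>F n in sequentially. 10 / l * measure (M n) UNIV < e"
      using \<open>e > 0\<close> by (intro order_tendstoD(2)) auto
    then obtain n where n: "10 / l * measure (M n) UNIV < e" by (auto simp: eventually_sequentially)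
    obtain T where "H n l \<subseteq> T" "T \<in> lmeasurable" "measure lebesgue T \<le> 10 / l * measure (M n) UNIV"
      using weak_type_estimate[OF fin[of n] sets[of n] l, of a b] unfolding H_def by blast
    then show "\<exists>T. Bad l \<subseteq> T \<and> T \<in> lmeasurable \<and> measure lebesgue T \<le> e"
      using BH[OF l, of n] n by (intro exI[of _ T]) auto
  qed
  have "{x \<in> {a<..<b}. \<not> v differentiable (at x)} \<subseteq> (\<Union>m::nat. Bad (1 / (real m + 1)))"
  proof (rule subsetI, rule ccontr)
    fix x assume x: "x \<in> {x \<in> {a<..<b}. \<not> v differentiable (at x)}" and nb: "x \<notin> (\<Union>m::nat. Bad (1 / (real m + 1)))"
    have "\<exists>L. (Q v x \<longlongrightarrow> L) (at x)"
    proof (rule tendsto_of_Cauchy_filter)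
      fix e :: real assume "e > 0"
      then obtain m :: nat where "3 / e < m" using reals_Archimedean2 by blast
      then have m: "3 * (1 / (real m + 1)) \<le> e" using \<open>e > 0\<close> by (simp add: field_simps)
      obtain d where d: "d > 0" "\<And>y z. y \<noteq> x \<Longrightarrow> z \<noteq> x \<Longrightarrow> \<bar>y - x\<bar> < d \<Longrightarrow> \<bar>z - x\<bar> < d \<Longrightarrow> \<bar>Q v x y - Q v x z\<bar> \<le> 3 * (1 / (real m + 1))"
        using nb x unfolding Bad_def by blast
      show "\<exists>P. eventually P (at x) \<and> (\<forall>y z. P y \<longrightarrow> P z \<longrightarrow> \<bar>Q v x y - Q v x z\<bar> \<le> e)"
      proof (intro exI conjI allI impI)
        show "\<forall>\<^sub>F y in at x. y \<noteq> x \<and> \<bar>y - x\<bar> < d"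
          using d(1) by (auto simp: eventually_at dist_real_def)
        fix y z assume "y \<noteq> x \<and> \<bar>y - x\<bar> < d" "z \<noteq> x \<and> \<bar>z - x\<bar> < d"
        then show "\<bar>Q v x y - Q v x z\<bar> \<le> e" using d(2)[of y z] m by linarith
      qed
    qed simp
    then have "\<exists>L. (v has_real_derivative L) (at x)" unfolding has_field_derivative_iff Q_def .
    then show False using x by (auto simp: real_differentiable_def)
  qed
  moreover have "negligible (\<Union>m::nat. Bad (1 / (real m + 1)))"
    by (intro negligible_countable_Union[OF countable_image[OF countableI_type]]) (auto intro!: negB)
  ultimately show ?thesis by (rule negligible_subset[rotated])
qed

lemma ftc_bound:
  fixes f f' :: "real \<Rightarrow> real"
  assumes der: "\<And>r. 0 < r \<Longrightarrow> r < R \<Longrightarrow> (f has_real_derivative f' r) (at r)" and cont': "continuous_on {0<..<R} f'"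
    and st: "0 < s" "s \<le> t" "t < R"
  shows "ennreal \<bar>f t - f s\<bar> \<le> (\<integral>\<^sup>+r. ennreal \<bar>f' r\<bar> * indicator {s..t} r \<partial>lborel)"
    and "\<bar>f t - f s\<bar> \<le> integral {s..t} (\<lambda>r. \<bar>f' r\<bar>)"
proof -
  have c: "continuous_on {s..t} f'" using st by (intro continuous_on_subset[OF cont']) auto
  have "(f' has_integral f t - f s) {s..t}"
    using st by (intro fundamental_theorem_of_calculus)
      (auto simp flip: has_real_derivative_iff_has_vector_derivative intro!: has_field_derivative_at_within[OF der])
  then have eq: "integral {s..t} f' = f t - f s" by (rule integral_unique)
  have "norm (integral {s..t} f') \<le> integral {s..t} (\<lambda>r. \<bar>f' r\<bar>)"
    by (intro integral_norm_bound_integral integrable_continuous_real c continuous_intros) auto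
  then show 1: "\<bar>f t - f s\<bar> \<le> integral {s..t} (\<lambda>r. \<bar>f' r\<bar>)" by (simp add: eq)
  have "(\<integral>\<^sup>+r. ennreal \<bar>f' r\<bar> * indicator {s..t} r \<partial>lborel) = ennreal (integral {s..t} (\<lambda>r. \<bar>f' r\<bar>))"
    by (intro nn_integral_continuous continuous_intros c) auto
  then show "ennreal \<bar>f t - f s\<bar> \<le> (\<integral>\<^sup>+r. ennreal \<bar>f' r\<bar> * indicator {s..t} r \<partial>lborel)"
    using 1 by (simp add: ennreal_leI)
qed

text \<open>The pointwise bound for p = 1 and c = N - 1, with the weight r^N of f' replaced by R
  r^(N-1), so that both terms carry the same weight.\<close>

lemma wint_sup_bound:
  assumes R: "R > 0"
  obtains C where "C \<ge> 0" "\<And>f f' r. (\<And>r. 0 < r \<Longrightarrow> r < R \<Longrightarrow> (f has_real_derivative f' r) (at r)) \<Longrightarrow>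
    continuous_on {0<..<R} f' \<Longrightarrow> 0 < r \<Longrightarrow> r < R \<Longrightarrow>
    ennreal (r powr N * \<bar>f r\<bar>) \<le> ennreal C * (wint R (N - 1) 1 f + wint R (N - 1) 1 f')"
proof -
  obtain C where C: "C \<ge> 0" "\<And>f f' r. (\<And>r. 0 < r \<Longrightarrow> r < R \<Longrightarrow> (f has_real_derivative f' r) (at r)) \<Longrightarrow>
    continuous_on {0<..<R} f' \<Longrightarrow> 0 < r \<Longrightarrow> r < R \<Longrightarrow>
    ennreal (r powr (N - 1 + 1) * \<bar>f r\<bar> powr 1) \<le> ennreal C * (wint R (N - 1) 1 f + wint R (N - 1 + 1) 1 f')"
    using wint_pointwise[OF R, of 1 "N - 1"] by auto
  show ?thesis
  proof (rule that[of "C * (1 + R)"])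
    show "0 \<le> C * (1 + R)" using C R by simp
    fix f f' :: "real \<Rightarrow> real" and r
    assume a: "\<And>r. 0 < r \<Longrightarrow> r < R \<Longrightarrow> (f has_real_derivative f' r) (at r)" "continuous_on {0<..<R} f'" "0 < r" "r < R"
    have "ennreal (r powr N * \<bar>f r\<bar>) = ennreal (r powr (N - 1 + 1) * \<bar>f r\<bar> powr 1)" by simp
    also have "\<dots> \<le> ennreal C * (wint R (N - 1) 1 f + wint R (N - 1 + 1) 1 f')" using C(2)[OF a] .
    also have "\<dots> \<le> ennreal C * (ennreal (1 + R) * wint R (N - 1) 1 f + ennreal (1 + R) * wint R (N - 1) 1 f')"
    proof (intro mult_left_mono add_mono)
      have "1 * wint R (N - 1) 1 f \<le> ennreal (1 + R) * wint R (N - 1) 1 f"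
        using R by (intro mult_right_mono) auto
      then show "wint R (N - 1) 1 f \<le> ennreal (1 + R) * wint R (N - 1) 1 f" by simp
      have "wint R (N - 1 + 1) 1 f' \<le> ennreal (R powr 1) * wint R (N - 1) 1 f'"
        using wint_weight_mono[of "N - 1" "N - 1 + 1" R f' 1] a(2) by simp
      also have "\<dots> \<le> ennreal (1 + R) * wint R (N - 1) 1 f'" using R by (intro mult_right_mono ennreal_leI) auto
      finally show "wint R (N - 1 + 1) 1 f' \<le> ennreal (1 + R) * wint R (N - 1) 1 f'" .
    qed auto
    also have "\<dots> = ennreal (C * (1 + R)) * (wint R (N - 1) 1 f + wint R (N - 1) 1 f')"
    proof -
      have "ennreal (C * (1 + R)) = ennreal C * ennreal (1 + R)" using C R by (intro ennreal_mult) auto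
      then show ?thesis by (simp only: distrib_left mult.assoc)
    qed
    finally show "ennreal (r powr N * \<bar>f r\<bar>) \<le> ennreal (C * (1 + R)) * (wint R (N - 1) 1 f + wint R (N - 1) 1 f')" .
  qed
qed

section \<open>Limits of Cauchy sequences of smooth functions on an interval\<close>

lemma finite_measure_left_tail:
  fixes M :: "real measure"
  assumes fin: "finite_measure M" and sets: "sets M = sets borel" and e: "e > 0"
  shows "\<exists>d<R. measure M {d<..<R} \<le> e"
proof -
  interpret finite_measure M by (rule fin)
  define A where "A n = {R - 1 / (real n + 1)<..<R}" for n
  have "(\<lambda>n. measure M (A n)) \<longlonglongrightarrow> measure M (\<Inter>n. A n)"
  proof (rule finite_Lim_measure_decseq)
    show "range A \<subseteq> sets M" by (auto simp: A_def sets)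
    show "decseq A"
    proof (rule decseq_SucI)
      fix n
      have "1 / (real (Suc n) + 1) \<le> 1 / (real n + 1)" by (intro divide_left_mono) auto
      then show "A (Suc n) \<subseteq> A n" by (auto simp: A_def)
    qed
  qed
  also have "(\<Inter>n. A n) = {}"
  proof (rule equals0I)
    fix x assume x: "x \<in> (\<Inter>n. A n)"
    then have "x < R" by (auto simp: A_def)
    obtain n :: nat where "1 / (R - x) < n" using reals_Archimedean2 by blast
    then have "1 / (real n + 1) < R - x" using \<open>x < R\<close> by (simp add: field_simps)
    moreover have "R - 1 / (real n + 1) < x" using x by (auto simp: A_def)
    ultimately show False by linarith
  qed
  finally have "\<forall>\<^sub>F n in sequentially. measure M (A n) < e" using e by (intro order_tendstoD(2)) auto
  then obtain n where "measure M (A n) < e" by (auto simp: eventually_sequentially)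
  then show ?thesis by (intro exI[of _ "R - 1 / (real n + 1)"]) (auto simp: A_def)
qed

text \<open>Away from the origin the weight r^(N-1) is at least \<epsilon>^(N-1), so a bounded
  weighted integral makes f dr a finite measure on (\<epsilon>,R). The maximum with 0 is there
  because \<open>ennreal\<close> sends negative numbers to 0.\<close>

lemma density_interval:
  fixes f :: "real \<Rightarrow> ennreal"
  assumes R: "0 < \<epsilon>" "\<epsilon> < R" and N: "N \<ge> 1" and m: "(\<lambda>r. f r * indicator {0<..<R} r) \<in> borel_measurable borel"
    and le: "(\<integral>\<^sup>+r. ennreal (r powr (N - 1)) * f r * indicator {0<..<R} r \<partial>lborel) \<le> ennreal B"
  defines "M \<equiv> density lborel (\<lambda>r. f r * indicator {\<epsilon><..<R} r)"
  shows "sets M = sets borel" "finite_measure M" "measure M UNIV \<le> \<epsilon> powr (1 - N) * max 0 B"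
    "\<And>s t. \<epsilon> < s \<Longrightarrow> t < R \<Longrightarrow> (\<integral>\<^sup>+r. f r * indicator {s..t} r \<partial>lborel) = ennreal (measure M {s..t})"
proof -
  show sets: "sets M = sets borel" by (simp add: M_def)
  have m': "(\<lambda>r. f r * indicator {\<epsilon><..<R} r) \<in> borel_measurable borel"
  proof -
    have "(\<lambda>r. (f r * indicator {0<..<R} r) * indicator {\<epsilon><..<R} r) \<in> borel_measurable borel"
      by (intro borel_measurable_times_ennreal m) auto
    also have "(\<lambda>r. (f r * indicator {0<..<R} r) * indicator {\<epsilon><..<R} r) = (\<lambda>r. f r * indicator {\<epsilon><..<R} r)"
      using R by (auto split: split_indicator)
    finally show ?thesis .
  qed
  have m'': "(\<lambda>r. ennreal (r powr (N - 1)) * f r * indicator {0<..<R} r) \<in> borel_measurable borel"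
  proof -
    have "(\<lambda>r. ennreal (r powr (N - 1)) * (f r * indicator {0<..<R} r)) \<in> borel_measurable borel"
      by (intro borel_measurable_times_ennreal m) auto
    then show ?thesis by (simp add: mult.assoc)
  qed
  have "emeasure M UNIV = (\<integral>\<^sup>+r. f r * indicator {\<epsilon><..<R} r \<partial>lborel)"
    unfolding M_def using m' by (subst emeasure_density) auto
  also have "\<dots> \<le> (\<integral>\<^sup>+r. ennreal (\<epsilon> powr (1 - N)) * (ennreal (r powr (N - 1)) * f r * indicator {0<..<R} r) \<partial>lborel)"
  proof (rule nn_integral_mono)
    fix r :: real
    have "1 \<le> \<epsilon> powr (1 - N) * r powr (N - 1)" if "\<epsilon> < r"
    proof -
      have "1 = \<epsilon> powr (1 - N) * \<epsilon> powr (N - 1)" using R by (simp add: powr_add[symmetric])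
      also have "\<dots> \<le> \<epsilon> powr (1 - N) * r powr (N - 1)" using that R N by (intro mult_left_mono powr_mono2) auto
      finally show ?thesis .
    qed
    then have "ennreal 1 * f r \<le> ennreal (\<epsilon> powr (1 - N) * r powr (N - 1)) * f r" if "\<epsilon> < r"
      using that by (intro mult_right_mono ennreal_leI) auto
    then show "f r * indicator {\<epsilon><..<R} r \<le> ennreal (\<epsilon> powr (1 - N)) * (ennreal (r powr (N - 1)) * f r * indicator {0<..<R} r)"
      using R by (auto split: split_indicator simp: ennreal_mult mult.assoc)
  qed
  also have "\<dots> \<le> ennreal (\<epsilon> powr (1 - N)) * ennreal B"
    using m'' le by (subst nn_integral_cmult) (auto intro: mult_left_mono)
  also have "\<dots> = ennreal (\<epsilon> powr (1 - N) * max 0 B)"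
    by (cases "B \<ge> 0") (auto simp: ennreal_mult ennreal_neg)
  finally have le': "emeasure M UNIV \<le> ennreal (\<epsilon> powr (1 - N) * max 0 B)" .
  have spM: "space M = UNIV" by (simp add: M_def)
  show fin: "finite_measure M"
    by standard (use le' spM in \<open>auto simp: top_unique\<close>)
  show "measure M UNIV \<le> \<epsilon> powr (1 - N) * max 0 B"
    using le' unfolding measure_def by (intro enn2real_leI) auto
  fix s t assume st: "\<epsilon> < s" "t < R"
  have "emeasure M {s..t} = (\<integral>\<^sup>+r. f r * indicator {\<epsilon><..<R} r * indicator {s..t} r \<partial>lborel)"
    unfolding M_def using m' by (subst emeasure_density) auto
  also have "\<dots> = (\<integral>\<^sup>+r. f r * indicator {s..t} r \<partial>lborel)"
    using st by (intro nn_integral_cong) (auto split: split_indicator)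
  finally show "(\<integral>\<^sup>+r. f r * indicator {s..t} r \<partial>lborel) = ennreal (measure M {s..t})"
    using finite_measure.emeasure_eq_measure[OF fin] by simp
qed

text \<open>The data left on one ray: \<open>h n j\<close> is the j-th derivative of the n-th
  approximant, with summable increments. The exponent is 1 for every p: on a bounded domain L^p
  bounds imply L^1 bounds, and in L^1 the increments of the derivatives can simply be added
  up.\<close>

locale cauchy_chain =
  fixes R N :: real and k :: nat and h :: "nat \<Rightarrow> nat \<Rightarrow> real \<Rightarrow> real" and a :: "nat \<Rightarrow> real"
  assumes R: "R > 0" and N: "N \<ge> 1"
    and chain: "\<And>n. deriv_chain R k (h n)"
    and fin: "\<And>j. j \<le> k \<Longrightarrow> wint R (N - 1) 1 (h 0 j) < \<infinity>"
    and small: "\<And>n j. j \<le> k \<Longrightarrow> wint R (N - 1) 1 (\<lambda>r. h (Suc n) j r - h n j r) \<le> ennreal (a n)"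
    and a: "summable a" "\<And>n. 0 \<le> a n"
begin

definition d where "d n j r = h (Suc n) j r - h n j r"

definition tl where "tl n = suminf a - sum a {..<n}"

lemma tl_tendsto: "tl \<longlonglongrightarrow> 0"
proof -
  have "(\<lambda>n. suminf a - sum a {..<n}) \<longlonglongrightarrow> suminf a - suminf a"
    by (intro tendsto_intros summable_LIMSEQ a)
  then show ?thesis by (simp add: tl_def[abs_def])
qed

lemma tl_eq: "tl n = (\<Sum>i. a (i + n))"
  unfolding tl_def using suminf_minus_initial_segment[OF a(1), of n] by simp

lemma tl_nonneg: "0 \<le> tl n"
  unfolding tl_eq by (intro suminf_nonneg summable_ignore_initial_segment a)

lemma chain_d: "deriv_chain R k (d n)"
  unfolding d_def[abs_def] by (intro deriv_chain_diff chain)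

lemma small_d: "j \<le> k \<Longrightarrow> wint R (N - 1) 1 (d n j) \<le> ennreal (a n)"
  using small by (simp add: d_def[abs_def])

lemma h_eq: "h n j r = h 0 j r + (\<Sum>i<n. d i j r)"
  using sum_lessThan_telescope[of "\<lambda>i. h i j r" n] by (simp add: d_def)

text \<open>The limit of \<open>h n j\<close> as a telescoping series. Pointwise convergence is
  established for j < k, where one more derivative of the increments is controlled.\<close>

definition v where "v j r = h 0 j r + (\<Sum>i. d i j r)"

lemma uniform_d:
  obtains C where "C \<ge> 0" "\<And>n j r. j < k \<Longrightarrow> 0 < r \<Longrightarrow> r < R \<Longrightarrow> \<bar>d n j r\<bar> \<le> C * r powr (- N) * a n"
proof -
  obtain C where C: "C \<ge> 0" "\<And>f f' r. (\<And>r. 0 < r \<Longrightarrow> r < R \<Longrightarrow> (f has_real_derivative f' r) (at r)) \<Longrightarrow>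
    continuous_on {0<..<R} f' \<Longrightarrow> 0 < r \<Longrightarrow> r < R \<Longrightarrow>
    ennreal (r powr N * \<bar>f r\<bar>) \<le> ennreal C * (wint R (N - 1) 1 f + wint R (N - 1) 1 f')"
    using wint_sup_bound[OF R, of N] by auto
  show ?thesis
  proof (rule that[of "2 * C"])
    fix n j r assume j: "j < k" and r: "0 < r" "r < R"
    have "ennreal (r powr N * \<bar>d n j r\<bar>) \<le> ennreal C * (wint R (N - 1) 1 (d n j) + wint R (N - 1) 1 (d n (Suc j)))"
      using j r by (intro C(2) deriv_chainD[OF chain_d] deriv_chain_continuous_on[OF chain_d]) auto
    also have "\<dots> \<le> ennreal C * (ennreal (a n) + ennreal (a n))"
      using j by (intro mult_left_mono add_mono small_d) auto
    also have "\<dots> = ennreal (C * (a n + a n))" using C(1) a(2)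
      by (simp only: ennreal_mult ennreal_plus add_nonneg_nonneg)
    finally have "r powr N * \<bar>d n j r\<bar> \<le> C * (a n + a n)"
      using C(1) a(2) by (subst (asm) ennreal_le_iff) auto
    then have "r powr (-N) * (r powr N * \<bar>d n j r\<bar>) \<le> r powr (-N) * (C * (a n + a n))"
      by (rule mult_left_mono) simp
    moreover have "r powr (-N) * (r powr N * \<bar>d n j r\<bar>) = \<bar>d n j r\<bar>"
      using r by (simp add: mult.assoc[symmetric] powr_add[symmetric])
    ultimately have "\<bar>d n j r\<bar> \<le> r powr (-N) * (C * (a n + a n))" by (simp only:)
    then show "\<bar>d n j r\<bar> \<le> 2 * C * r powr (- N) * a n" by (simp add: algebra_simps)
  qed (use C in auto)
qed

text \<open>The factor B is left open for two uses: C r^(-N) in general, and a constant independent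
  of r in the endpoint case.\<close>

lemma v_dist_le:
  assumes le: "\<And>n. \<bar>d n j r\<bar> \<le> B * a n"
  shows "\<bar>v j r - h n j r\<bar> \<le> B * tl n"
proof -
  have s: "summable (\<lambda>i. B * a i)" by (intro summable_mult a)
  have s2: "summable (\<lambda>i. \<bar>d i j r\<bar>)"
    by (rule summable_comparison_test'[OF s, of 0]) (use le in auto)
  have s3: "summable (\<lambda>i. d i j r)" using s2 by (rule summable_rabs_cancel)
  have "v j r - h n j r = (\<Sum>i. d (i + n) j r)"
    unfolding v_def h_eq[of n] using suminf_minus_initial_segment[OF s3, of n] by simp
  also have "\<bar>\<dots>\<bar> \<le> (\<Sum>i. \<bar>d (i + n) j r\<bar>)"
    by (rule summable_rabs) (use summable_ignore_initial_segment[OF s2] in simp)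
  also have "\<dots> \<le> (\<Sum>i. B * a (i + n))"
    using summable_ignore_initial_segment[OF s2, of n] summable_ignore_initial_segment[OF s, of n] le
    by (intro suminf_le) auto
  also have "\<dots> = B * tl n"
    unfolding tl_eq using summable_ignore_initial_segment[OF a(1), of n] by (rule suminf_mult)
  finally show ?thesis .
qed

lemma v_limit:
  obtains C where "C \<ge> 0" "\<And>n j r. j < k \<Longrightarrow> 0 < r \<Longrightarrow> r < R \<Longrightarrow> \<bar>v j r - h n j r\<bar> \<le> C * r powr (- N) * tl n"
proof -
  obtain C where C: "C \<ge> 0" "\<And>n j r. j < k \<Longrightarrow> 0 < r \<Longrightarrow> r < R \<Longrightarrow> \<bar>d n j r\<bar> \<le> C * r powr (- N) * a n"
    using uniform_d by blast
  show ?thesis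
    by (rule that[OF C(1)]) (use C(2) in \<open>blast intro: v_dist_le\<close>)
qed

lemma v_tendsto:
  assumes "j < k" "0 < r" "r < R"
  shows "(\<lambda>n. h n j r) \<longlonglongrightarrow> v j r"
proof -
  obtain C where C': "C \<ge> 0" "\<And>n j r. j < k \<Longrightarrow> 0 < r \<Longrightarrow> r < R \<Longrightarrow> \<bar>v j r - h n j r\<bar> \<le> C * r powr (- N) * tl n"
    by (rule v_limit) (assumption | rule that)+
  have C: "\<bar>v j r - h n j r\<bar> \<le> C * r powr (- N) * tl n" for n using C'(2)[OF assms] .
  have "(\<lambda>n. C * r powr (- N) * tl n) \<longlonglongrightarrow> C * r powr (- N) * 0" by (intro tendsto_intros tl_tendsto)
  then have l0: "(\<lambda>n. C * r powr (- N) * tl n) \<longlonglongrightarrow> 0" by simp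
  have "(\<lambda>n. h n j r - v j r) \<longlonglongrightarrow> 0"
  proof (rule Lim_null_comparison[OF _ l0])
    have "norm (h n j r - v j r) \<le> C * r powr (- N) * tl n" for n
      using C[of n] by (simp add: abs_minus_commute[of "h n j r"])
    then show "\<forall>\<^sub>F n in sequentially. norm (h n j r - v j r) \<le> C * r powr (- N) * tl n" by simp
  qed
  then show ?thesis by (simp add: LIM_zero_iff)
qed

lemma uniform_limit_v:
  assumes "j < k" "0 < \<epsilon>"
  shows "uniform_limit {\<epsilon><..<R} (\<lambda>n. h n j) (v j) sequentially"
proof (rule uniform_limitI)
  fix e :: real assume "e > 0"
  obtain C where C': "C \<ge> 0" "\<And>n j r. j < k \<Longrightarrow> 0 < r \<Longrightarrow> r < R \<Longrightarrow> \<bar>v j r - h n j r\<bar> \<le> C * r powr (- N) * tl n"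
    by (rule v_limit) (assumption | rule that)+
  have C: "C \<ge> 0" "\<And>n r. 0 < r \<Longrightarrow> r < R \<Longrightarrow> \<bar>v j r - h n j r\<bar> \<le> C * r powr (- N) * tl n"
    using C' assms by auto
  have "(\<lambda>n. C * \<epsilon> powr (- N) * tl n) \<longlonglongrightarrow> C * \<epsilon> powr (- N) * 0" by (intro tendsto_intros tl_tendsto)
  then have "\<forall>\<^sub>F n in sequentially. C * \<epsilon> powr (- N) * tl n < e" using \<open>e > 0\<close> by (intro order_tendstoD(2)) auto
  then show "\<forall>\<^sub>F n in sequentially. \<forall>x\<in>{\<epsilon><..<R}. dist (h n j x) (v j x) < e"
  proof eventually_elim
    case (elim n)
    show ?case
    proof
      fix x assume x: "x \<in> {\<epsilon><..<R}"
      have "x powr (- N) \<le> \<epsilon> powr (- N)" using x assms N by (intro powr_mono2') auto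
      then have "C * x powr (- N) * tl n \<le> C * \<epsilon> powr (- N) * tl n"
        using C(1) tl_nonneg by (intro mult_left_mono mult_right_mono) auto
      then show "dist (h n j x) (v j x) < e" using C(2)[of x n] x assms elim by (auto simp: dist_real_def)
    qed
  qed
qed

lemma continuous_v: "j < k \<Longrightarrow> continuous_on {0<..<R} (v j)"
proof (rule continuous_at_imp_continuous_on, intro ballI)
  fix r assume j: "j < k" and r: "r \<in> {0<..<R}"
  have "continuous_on {r/2<..<R} (v j)"
  proof (rule uniform_limit_theorem[OF _ uniform_limit_v[OF j]])
    have "continuous_on {r/2<..<R} (h n j)" for n
      by (rule continuous_on_subset[OF deriv_chain_continuous_on[OF chain, of j]]) (use j r in auto)
    then show "\<forall>\<^sub>F n in sequentially. continuous_on {r/2<..<R} (h n j)" by simp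
  qed (use r in auto)
  then show "isCont (v j) r" using r by (intro continuous_on_interior) auto
qed

text \<open>Termwise differentiation under uniform convergence of the next derivatives, on (r/2,R),
  where the factor r^(-N) is bounded.\<close>

lemma v_derivative:
  assumes j: "Suc j < k" and r: "0 < r" "r < R"
  shows "(v j has_real_derivative v (Suc j) r) (at r)"
proof -
  let ?S = "{r/2<..<R}"
  have "\<exists>g. \<forall>x\<in>?S. (\<lambda>n. h n j x) \<longlonglongrightarrow> g x \<and> (g has_derivative (*) (v (Suc j) x)) (at x within ?S)"
  proof (rule has_derivative_sequence)
    fix n x assume "x \<in> ?S"
    then have "(h n j has_real_derivative h n (Suc j) x) (at x)" using j r by (intro deriv_chainD[OF chain]) auto
    then show "(h n j has_derivative (*) (h n (Suc j) x)) (at x within ?S)"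
      unfolding has_field_derivative_def by (rule has_derivative_at_withinI)
  next
    fix e :: real assume "e > 0"
    have "\<forall>\<^sub>F n in sequentially. \<forall>x\<in>?S. dist (h n (Suc j) x) (v (Suc j) x) < e"
      using uniform_limitD[OF uniform_limit_v[OF j, of "r/2"] \<open>e > 0\<close>] r by simp
    then show "\<forall>\<^sub>F n in sequentially. \<forall>x\<in>?S. \<forall>y. norm (h n (Suc j) x * y - v (Suc j) x * y) \<le> e * norm y"
    proof eventually_elim
      case (elim n)
      show ?case
      proof (intro ballI allI)
        fix x y assume "x \<in> ?S"
        then have "\<bar>h n (Suc j) x - v (Suc j) x\<bar> \<le> e" using elim by (auto simp: dist_real_def less_imp_le)
        then have "\<bar>h n (Suc j) x - v (Suc j) x\<bar> * \<bar>y\<bar> \<le> e * \<bar>y\<bar>" by (rule mult_right_mono) simp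
        then show "norm (h n (Suc j) x * y - v (Suc j) x * y) \<le> e * norm y"
          by (simp add: left_diff_distrib[symmetric] abs_mult)
      qed
    qed
  next
    show "(\<lambda>n. h n j r) \<longlonglongrightarrow> v j r" "r \<in> ?S" using v_tendsto j r by auto
  qed (rule convex_real_interval)
  then obtain g where g: "\<And>x. x \<in> ?S \<Longrightarrow> (\<lambda>n. h n j x) \<longlonglongrightarrow> g x" "\<And>x. x \<in> ?S \<Longrightarrow> (g has_derivative (*) (v (Suc j) x)) (at x within ?S)"
    by blast
  have eq: "g x = v j x" if "x \<in> ?S" for x
    using LIMSEQ_unique[OF g(1)[OF that] v_tendsto[of j x]] that j r by auto
  have "(g has_real_derivative v (Suc j) r) (at r)"
    using g(2)[of r] r at_within_interior[of r ?S] by (simp add: has_field_derivative_def)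
  then show ?thesis
    by (rule has_field_derivative_transform_within_open[of _ _ _ ?S]) (use r eq in auto)
qed

text \<open>Substitute for a derivative of v j that also works at j = k - 1: the density of M n is
  the sum of |d i (j+1)| over all i \<ge> n, which majorizes the derivative of every later
  \<open>h m j - h n j\<close>. The total mass is a remainder of a convergent series and tends to
  0.\<close>

lemma increment_bound:
  assumes j: "j < k" and e: "0 < \<epsilon>" "\<epsilon> < R"
  obtains M where "\<And>n. sets (M n) = sets borel" "\<And>n. finite_measure (M n)"
    "\<And>n. measure (M n) UNIV \<le> \<epsilon> powr (1 - N) * tl n"
    "\<And>n s t. \<epsilon> < s \<Longrightarrow> s \<le> t \<Longrightarrow> t < R \<Longrightarrow> \<bar>(v j t - h n j t) - (v j s - h n j s)\<bar> \<le> measure (M n) {s..t}"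
proof -
  have cd: "continuous_on {0<..<R} (d n (Suc j))" for n
    using j by (intro deriv_chain_continuous_on[OF chain_d]) auto
  have md: "(\<lambda>r. ennreal \<bar>d n (Suc j) r\<bar> * indicator {0<..<R} r) \<in> borel_measurable borel" for n
  proof -
    have "(\<lambda>r. ennreal (r powr 0 * \<bar>d n (Suc j) r\<bar> powr 1) * indicator {0<..<R} r) \<in> borel_measurable borel"
      by (rule wint_measurable[OF cd])
    also have "(\<lambda>r. ennreal (r powr 0 * \<bar>d n (Suc j) r\<bar> powr 1) * indicator {0<..<R} r)
      = (\<lambda>r. ennreal \<bar>d n (Suc j) r\<bar> * indicator {0<..<R} r)"
      by (auto split: split_indicator)
    finally show ?thesis .
  qed
  define F where "F n r = (\<Sum>i. ennreal \<bar>d (i + n) (Suc j) r\<bar>)" for n r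
  have mF: "(\<lambda>r. F n r * indicator {0<..<R} r) \<in> borel_measurable borel" for n
  proof -
    have "(\<lambda>r. \<Sum>i. ennreal \<bar>d (i + n) (Suc j) r\<bar> * indicator {0<..<R} r) \<in> borel_measurable borel"
      by (intro borel_measurable_suminf_order md)
    then show ?thesis by (simp add: F_def)
  qed
  have leF: "(\<integral>\<^sup>+r. ennreal (r powr (N - 1)) * F n r * indicator {0<..<R} r \<partial>lborel) \<le> ennreal (tl n)" for n
  proof -
    have "(\<integral>\<^sup>+r. ennreal (r powr (N - 1)) * F n r * indicator {0<..<R} r \<partial>lborel)
      = (\<integral>\<^sup>+r. (\<Sum>i. ennreal (r powr (N - 1) * \<bar>d (i + n) (Suc j) r\<bar> powr 1) * indicator {0<..<R} r) \<partial>lborel)"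
    proof (rule nn_integral_cong)
      fix r :: real
      have "ennreal (r powr (N - 1) * \<bar>d (i + n) (Suc j) r\<bar> powr 1) * indicator {0<..<R} r
          = (ennreal (r powr (N - 1)) * indicator {0<..<R} r) * ennreal \<bar>d (i + n) (Suc j) r\<bar>" for i
        by (simp add: ennreal_mult mult_ac)
      then show "ennreal (r powr (N - 1)) * F n r * indicator {0<..<R} r
          = (\<Sum>i. ennreal (r powr (N - 1) * \<bar>d (i + n) (Suc j) r\<bar> powr 1) * indicator {0<..<R} r)"
        unfolding F_def by (simp only: ennreal_suminf_cmult) (simp add: mult_ac)
    qed
    also have "\<dots> = (\<Sum>i. wint R (N - 1) 1 (d (i + n) (Suc j)))"
      unfolding wint_def by (intro nn_integral_suminf) (use wint_measurable[OF cd, where c="N - 1" and p=1] in simp)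
    also have "\<dots> \<le> (\<Sum>i. ennreal (a (i + n)))"
      using j by (intro suminf_le small_d) auto
    also have "\<dots> = ennreal (tl n)"
      unfolding tl_eq by (intro suminf_ennreal2 a summable_ignore_initial_segment)
    finally show ?thesis .
  qed
  define M where "M n = density lborel (\<lambda>r. F n r * indicator {\<epsilon><..<R} r)" for n
  note dens = density_interval[OF e N mF leF, folded M_def]
  show ?thesis
  proof (rule that[of M])
    fix n s t assume st: "\<epsilon> < s" "s \<le> t" "t < R"
    have bd: "\<bar>(h (m + n) j t - h n j t) - (h (m + n) j s - h n j s)\<bar> \<le> measure (M n) {s..t}" for m
    proof -
      have e: "h (m + n) j r - h n j r = (\<Sum>i<m. d (i + n) j r)" for r
        by (induction m) (auto simp: d_def)
      have "ennreal \<bar>(h (m + n) j t - h n j t) - (h (m + n) j s - h n j s)\<bar> = ennreal \<bar>\<Sum>i<m. d (i + n) j t - d (i + n) j s\<bar>"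
        unfolding e by (simp add: sum_subtractf)
      also have "\<dots> \<le> ennreal (\<Sum>i<m. \<bar>d (i + n) j t - d (i + n) j s\<bar>)" by (intro ennreal_leI sum_abs)
      also have "\<dots> = (\<Sum>i<m. ennreal \<bar>d (i + n) j t - d (i + n) j s\<bar>)" by simp
      also have "\<dots> \<le> (\<Sum>i<m. \<integral>\<^sup>+r. ennreal \<bar>d (i + n) (Suc j) r\<bar> * indicator {s..t} r \<partial>lborel)"
        using st \<open>0 < \<epsilon>\<close> j by (intro sum_mono ftc_bound(1)[where R=R] deriv_chainD[OF chain_d] cd) auto
      also have "\<dots> \<le> (\<Sum>i. \<integral>\<^sup>+r. ennreal \<bar>d (i + n) (Suc j) r\<bar> * indicator {s..t} r \<partial>lborel)"
        by (intro sum_le_suminf) auto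
      also have "\<dots> = (\<integral>\<^sup>+r. (\<Sum>i. ennreal \<bar>d (i + n) (Suc j) r\<bar> * indicator {s..t} r) \<partial>lborel)"
      proof (intro nn_integral_suminf[symmetric])
        fix i
        have "(\<lambda>r. (ennreal \<bar>d (i + n) (Suc j) r\<bar> * indicator {0<..<R} r) * indicator {s..t} r) \<in> borel_measurable borel"
          by (intro borel_measurable_times_ennreal md) auto
        also have "(\<lambda>r. (ennreal \<bar>d (i + n) (Suc j) r\<bar> * indicator {0<..<R} r) * indicator {s..t} r)
          = (\<lambda>r. ennreal \<bar>d (i + n) (Suc j) r\<bar> * indicator {s..t} r)"
          using st \<open>0 < \<epsilon>\<close> by (auto split: split_indicator)
        finally show "(\<lambda>r. ennreal \<bar>d (i + n) (Suc j) r\<bar> * indicator {s..t} r) \<in> borel_measurable lborel" by simp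
      qed
      also have "\<dots> = ennreal (measure (M n) {s..t})"
        using dens(4)[OF st(1,3)] by (simp add: F_def)
      finally show ?thesis by (subst (asm) ennreal_le_iff) auto
    qed
    have lim: "(\<lambda>m. h (m + n) j r) \<longlonglongrightarrow> v j r" if "\<epsilon> < r" "r < R" for r
      using LIMSEQ_ignore_initial_segment[OF v_tendsto[OF j, of r]] that \<open>0 < \<epsilon>\<close> by auto
    have "(\<lambda>m. \<bar>(h (m + n) j t - h n j t) - (h (m + n) j s - h n j s)\<bar>) \<longlonglongrightarrow> \<bar>(v j t - h n j t) - (v j s - h n j s)\<bar>"
      using st by (intro tendsto_intros lim) auto
    then show "\<bar>(v j t - h n j t) - (v j s - h n j s)\<bar> \<le> measure (M n) {s..t}"
      by (rule LIMSEQ_le_const2) (use bd in auto)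
  qed (use dens tl_nonneg in \<open>auto simp: max_def\<close>)
qed

text \<open>Near R the increments of v j are at most the M 0 mass plus the integral of |h 0 (j+1)|
  over the same interval. Both are finite measures away from the origin, so their tails at R vanish
  and v j is Cauchy there.\<close>

lemma v_left_limit:
  assumes j: "j < k"
  shows "\<exists>L. (v j \<longlongrightarrow> L) (at_left R)"
proof (rule tendsto_of_Cauchy_filter)
  fix e :: real assume e: "e > 0"
  have e2: "0 < R / 2" "R / 2 < R" using R by auto
  obtain M where M: "\<And>n. sets (M n) = sets borel" "\<And>n. finite_measure (M n)"
    "\<And>n s t. R / 2 < s \<Longrightarrow> s \<le> t \<Longrightarrow> t < R \<Longrightarrow> \<bar>(v j t - h n j t) - (v j s - h n j s)\<bar> \<le> measure (M n) {s..t}"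
    using increment_bound[OF j e2] by metis
  have c0: "continuous_on {0<..<R} (h 0 (Suc j))"
    using j by (intro deriv_chain_continuous_on[OF chain]) auto
  have mh: "(\<lambda>r. ennreal \<bar>h 0 (Suc j) r\<bar> * indicator {0<..<R} r) \<in> borel_measurable borel"
  proof -
    have "(\<lambda>r. ennreal (r powr 0 * \<bar>h 0 (Suc j) r\<bar> powr 1) * indicator {0<..<R} r) \<in> borel_measurable borel"
      by (rule wint_measurable[OF c0])
    also have "(\<lambda>r. ennreal (r powr 0 * \<bar>h 0 (Suc j) r\<bar> powr 1) * indicator {0<..<R} r)
      = (\<lambda>r. ennreal \<bar>h 0 (Suc j) r\<bar> * indicator {0<..<R} r)"
      by (auto split: split_indicator)
    finally show ?thesis .
  qed
  have leh: "(\<integral>\<^sup>+r. ennreal (r powr (N - 1)) * ennreal \<bar>h 0 (Suc j) r\<bar> * indicator {0<..<R} r \<partial>lborel)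
    \<le> ennreal (enn2real (wint R (N - 1) 1 (h 0 (Suc j))))"
    using fin[of "Suc j"] j by (auto simp: wint_def ennreal_mult[symmetric] less_top)
  define M' where "M' = density lborel (\<lambda>r. ennreal \<bar>h 0 (Suc j) r\<bar> * indicator {R / 2<..<R} r)"
  note dens = density_interval[OF e2 N mh leh, folded M'_def]
  obtain d1 where d1: "d1 < R" "measure (M 0) {d1<..<R} \<le> e / 2" using finite_measure_left_tail[OF M(2,1), of "e/2"] e by auto
  obtain d2 where d2: "d2 < R" "measure M' {d2<..<R} \<le> e / 2" using finite_measure_left_tail[OF dens(2,1), of "e/2"] e by auto
  define D where "D = max (R / 2) (max d1 d2)"
  have D: "D < R" "R / 2 \<le> D" "d1 \<le> D" "d2 \<le> D" using R d1 d2 by (auto simp: D_def)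
  have main: "\<bar>v j t - v j s\<bar> \<le> e" if st: "D < s" "s \<le> t" "t < R" for s t
  proof -
    have 1: "\<bar>(v j t - h 0 j t) - (v j s - h 0 j s)\<bar> \<le> measure (M 0) {s..t}"
      using st D by (intro M(3)) auto
    also have "\<dots> \<le> measure (M 0) {d1<..<R}"
      using st D by (intro finite_measure.finite_measure_mono[OF M(2)]) (auto simp: M(1))
    finally have 2: "\<bar>(v j t - h 0 j t) - (v j s - h 0 j s)\<bar> \<le> e / 2" using d1 by simp
    have "ennreal \<bar>h 0 j t - h 0 j s\<bar> \<le> (\<integral>\<^sup>+r. ennreal \<bar>h 0 (Suc j) r\<bar> * indicator {s..t} r \<partial>lborel)"
      using st D R j by (intro ftc_bound(1)[where R=R] deriv_chainD[OF chain] c0) auto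
    also have "\<dots> = ennreal (measure M' {s..t})" using st D by (intro dens(4)) auto
    finally have "\<bar>h 0 j t - h 0 j s\<bar> \<le> measure M' {s..t}" by (subst (asm) ennreal_le_iff) auto
    also have "\<dots> \<le> measure M' {d2<..<R}"
      using st D by (intro finite_measure.finite_measure_mono[OF dens(2)]) (auto simp: dens(1))
    finally have "\<bar>h 0 j t - h 0 j s\<bar> \<le> e / 2" using d2 by simp
    with 2 show ?thesis by linarith
  qed
  show "\<exists>P. eventually P (at_left R) \<and> (\<forall>x y. P x \<longrightarrow> P y \<longrightarrow> \<bar>v j x - v j y\<bar> \<le> e)"
  proof (intro exI conjI allI impI)
    show "\<forall>\<^sub>F x in at_left R. D < x \<and> x < R" using D(1) by (auto simp: eventually_at_left_field)
    fix x y assume "D < x \<and> x < R" "D < y \<and> y < R"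
    then show "\<bar>v j x - v j y\<bar> \<le> e" using main[of x y] main[of y x] by (cases "x \<le> y") auto
  qed
qed simp

section \<open>Extension to the outer boundary\<close>

definition w where "w j r = (if r = R then Lim (at_left R) (v j) else v j r)"

lemma w_eq: "r < R \<Longrightarrow> w j r = v j r" by (simp add: w_def)

lemma continuous_w:
  assumes j: "j < k"
  shows "continuous_on {0<..R} (w j)"
  unfolding continuous_on_def
proof
  fix r assume r: "r \<in> {0<..R}"
  show "(w j \<longlongrightarrow> w j r) (at r within {0<..R})"
  proof (cases "r = R")
    case True
    obtain L where L: "(v j \<longlongrightarrow> L) (at_left R)" using v_left_limit[OF j] by blast
    have "w j R = L" using L by (simp add: w_def tendsto_Lim)
    moreover have "at R within {0<..R} = at_left R"
      using R by (intro at_within_nhd[of _ "{0<..}"]) auto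
    moreover have "(w j \<longlongrightarrow> L) (at_left R)"
      by (rule tendsto_cong[THEN iffD1, OF _ L]) (auto simp: eventually_at_left_field w_def intro!: exI[of _ "R - 1"])
    ultimately show ?thesis using True by simp
  next
    case False
    with r have r: "0 < r" "r < R" by auto
    have "(v j \<longlongrightarrow> v j r) (at r)"
      using continuous_v[OF j] r by (simp add: continuous_on_eq_continuous_at isCont_def)
    then have "(w j \<longlongrightarrow> w j r) (at r)"
      unfolding w_eq[OF r(2)]
      by (rule Lim_transform_within_open[of _ _ _ _ "{..<R}"]) (use r in \<open>auto simp: w_def\<close>)
    then show ?thesis by (rule tendsto_within_subset) auto
  qed
qed

lemma w_derivative:
  assumes j: "Suc j < k" and r: "0 < r" "r < R"
  shows "(w j has_real_derivative w (Suc j) r) (at r)"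
  unfolding w_eq[OF r(2)]
  by (rule has_field_derivative_transform_within_open[OF v_derivative[OF j r], of "{..<R}"]) (use r in \<open>auto simp: w_def\<close>)

lemma w_AE_differentiable:
  assumes j: "j < k"
  shows "AE r in lborel. 0 < r \<and> r < R \<longrightarrow> w j differentiable (at r)"
proof -
  have neg: "negligible {x \<in> {\<epsilon><..<R}. \<not> v j differentiable (at x)}" if e: "0 < \<epsilon>" "\<epsilon> < R" for \<epsilon>
  proof -
    obtain M where M: "\<And>n. sets (M n) = sets borel" "\<And>n. finite_measure (M n)"
      "\<And>n. measure (M n) UNIV \<le> \<epsilon> powr (1 - N) * tl n"
      "\<And>n s t. \<epsilon> < s \<Longrightarrow> s \<le> t \<Longrightarrow> t < R \<Longrightarrow> \<bar>(v j t - h n j t) - (v j s - h n j s)\<bar> \<le> measure (M n) {s..t}"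
      using increment_bound[OF j e] by blast
    have "(\<lambda>n. \<epsilon> powr (1 - N) * tl n) \<longlonglongrightarrow> \<epsilon> powr (1 - N) * 0" by (intro tendsto_intros tl_tendsto)
    then have l0: "(\<lambda>n. \<epsilon> powr (1 - N) * tl n) \<longlonglongrightarrow> 0" by simp
    have "(\<lambda>n. measure (M n) UNIV) \<longlonglongrightarrow> 0"
    proof (rule Lim_null_comparison[OF _ l0])
      have "norm (measure (M n) UNIV) \<le> \<epsilon> powr (1 - N) * tl n" for n using M(3)[of n] by simp
      then show "\<forall>\<^sub>F n in sequentially. norm (measure (M n) UNIV) \<le> \<epsilon> powr (1 - N) * tl n" by simp
    qed
    moreover have "h n j differentiable (at x)" if "\<epsilon> < x" "x < R" for n x
      using deriv_chainD[OF chain, of j x] that e j by (auto simp: real_differentiable_def)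
    ultimately show ?thesis
      by (intro negligible_nondifferentiable[of \<epsilon> R "\<lambda>n. h n j" M "v j"] M) auto
  qed
  \<comment> \<open>With m + 2 the left end lies strictly between 0 and R for every m, and these
    intervals exhaust (0,R).\<close>
  have nm: "negligible {x \<in> {R / (real m + 2)<..<R}. \<not> v j differentiable (at x)}" for m :: nat
    using R by (intro neg) (auto simp: divide_less_eq)
  have "negligible (\<Union>m::nat. {x \<in> {R / (real m + 2)<..<R}. \<not> v j differentiable (at x)})"
    by (intro negligible_countable_Union[OF countable_image[OF countableI_type]]) (elim imageE, simp only: nm)
  then have "AE x in lebesgue. x \<notin> (\<Union>m::nat. {x \<in> {R / (real m + 2)<..<R}. \<not> v j differentiable (at x)})"
    unfolding negligible_iff_null_sets by (rule AE_not_in)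
  then have "AE x in lborel. x \<notin> (\<Union>m::nat. {x \<in> {R / (real m + 2)<..<R}. \<not> v j differentiable (at x)})"
    by (simp add: AE_completion_iff)
  then show ?thesis
  proof eventually_elim
    case (elim r)
    show ?case
    proof (intro impI)
      assume r: "0 < r \<and> r < R"
      obtain m :: nat where "R / r < m" using reals_Archimedean2 by blast
      then have "R / r < real m + 2" by linarith
      then have "R / (real m + 2) < r" using r by (simp add: pos_divide_less_eq mult.commute)
      then have "v j differentiable (at r)" using elim r by auto
      then show "w j differentiable (at r)"
        by (rule differentiable_transform_within[of _ _ _ "R - r"]) (use r in \<open>auto simp: w_def dist_real_def\<close>)
    qed
  qed
qed

end

section \<open>Estimates for limits of smooth functions\<close>

definition energy :: "real \<Rightarrow> real \<Rightarrow> real \<Rightarrow> nat \<Rightarrow> (nat \<Rightarrow> real \<Rightarrow> real) \<Rightarrow> ennreal" where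
  "energy R N p k h = (\<Sum>l\<le>k. wint R (N - 1) p (h l))"

text \<open>The energy bound is asked for infinitely many n only, since selecting a ray by Fatou's
  lemma controls a lower limit. The level enters as A^p, so A scales like a norm.\<close>

definition approx :: "real \<Rightarrow> real \<Rightarrow> real \<Rightarrow> nat \<Rightarrow> real \<Rightarrow> (real \<Rightarrow> real) \<Rightarrow> (nat \<Rightarrow> nat \<Rightarrow> real \<Rightarrow> real) \<Rightarrow> bool" where
  "approx R N p k A f h \<longleftrightarrow> (\<forall>n. deriv_chain R k (h n)) \<and>
     (\<exists>\<^sub>F n in sequentially. energy R N p k (h n) \<le> ennreal (A powr p)) \<and>
     (\<forall>r. 0 < r \<longrightarrow> r < R \<longrightarrow> (\<lambda>n. h n 0 r) \<longlonglongrightarrow> f r)"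

lemma tendsto_frequently_le:
  fixes g :: "'a \<Rightarrow> real"
  assumes "(g \<longlongrightarrow> L) F" "\<exists>\<^sub>F n in F. g n \<le> B"
  shows "L \<le> B"
proof (rule ccontr)
  assume "\<not> L \<le> B"
  then have "\<forall>\<^sub>F n in F. B < g n" using order_tendstoD(1)[OF assms(1), of B] by simp
  then show False using assms(2) by (simp add: frequently_def not_le)
qed

lemma liminf_frequently_le:
  fixes x :: "nat \<Rightarrow> ennreal"
  assumes "\<exists>\<^sub>F n in sequentially. x n \<le> K"
  shows "liminf x \<le> K"
proof (rule ccontr)
  assume "\<not> liminf x \<le> K"
  then have "\<forall>\<^sub>F n in sequentially. K < x n"
    using le_Liminf_iff[of "liminf x" sequentially x] by auto
  then show False using assms by (simp add: frequently_def not_le)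
qed

text \<open>A non-strict inequality survives in the limit as soon as it holds infinitely often along
  a convergent sequence.\<close>

lemma approx_pointwise_transfer:
  assumes ap: "approx R N p k A f h" and r: "0 < r" "r < R" and C: "C \<ge> 0" and p: "p \<ge> 1"
    and le: "\<And>g. deriv_chain R k g \<Longrightarrow> ennreal (c * \<bar>g 0 r\<bar> powr p) \<le> ennreal C * energy R N p k g"
  shows "c * \<bar>f r\<bar> powr p \<le> C * A powr p"
proof (rule tendsto_frequently_le)
  show "(\<lambda>n. c * \<bar>h n 0 r\<bar> powr p) \<longlonglongrightarrow> c * \<bar>f r\<bar> powr p"
    using ap r p unfolding approx_def by (intro tendsto_intros tendsto_powr') auto
  have "\<exists>\<^sub>F n in sequentially. energy R N p k (h n) \<le> ennreal (A powr p)" using ap by (simp add: approx_def)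
  then show "\<exists>\<^sub>F n in sequentially. c * \<bar>h n 0 r\<bar> powr p \<le> C * A powr p"
  proof (rule frequently_elim1)
    fix n assume n: "energy R N p k (h n) \<le> ennreal (A powr p)"
    have "ennreal (c * \<bar>h n 0 r\<bar> powr p) \<le> ennreal C * energy R N p k (h n)"
      using ap by (intro le) (simp add: approx_def)
    also have "\<dots> \<le> ennreal C * ennreal (A powr p)" using n by (rule mult_left_mono) simp
    also have "\<dots> = ennreal (C * A powr p)" using C by (simp add: ennreal_mult)
    finally show "c * \<bar>h n 0 r\<bar> powr p \<le> C * A powr p"
      using C by (subst (asm) ennreal_le_iff) auto
  qed
qed

text \<open>The pointwise bound at c = N - 1 - k p, whose right side needs f with k Hardy steps and
  f' with k - 1; the latter matches because c + p = N - 1 - (k - 1) p.\<close>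

lemma approx_pointwise:
  assumes R: "R > 0" and p: "p \<ge> 1" and k: "k \<ge> 1" and N: "real k * p < N"
  obtains C where "C \<ge> 0" "\<And>f h A r. approx R N p k A f h \<Longrightarrow> 0 < r \<Longrightarrow> r < R \<Longrightarrow>
    r powr (N - real k * p) * \<bar>f r\<bar> powr p \<le> C * A powr p"
proof -
  define c where "c = N - 1 - real k * p"
  have c: "c + p = N - 1 - real (k - 1) * p" using k by (simp add: c_def of_nat_diff algebra_simps)
  have N': "real (k - 1) * p < N" using N p by (smt (verit) mult_right_mono of_nat_mono diff_le_self)
  obtain C0 where C0: "C0 \<ge> 0" "\<And>f f' r. (\<And>r. 0 < r \<Longrightarrow> r < R \<Longrightarrow> (f has_real_derivative f' r) (at r)) \<Longrightarrow>
    continuous_on {0<..<R} f' \<Longrightarrow> 0 < r \<Longrightarrow> r < R \<Longrightarrow>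
    ennreal (r powr (c + 1) * \<bar>f r\<bar> powr p) \<le> ennreal C0 * (wint R c p f + wint R (c + p) p f')"
    using wint_pointwise[OF R p, of c] by auto
  obtain C1 where C1: "C1 \<ge> 0" "\<And>k' h j. deriv_chain R k' h \<Longrightarrow> j + k \<le> k' \<Longrightarrow>
    wint R (N - 1 - real k * p) p (h j) \<le> ennreal C1 * (\<Sum>l\<le>k'. wint R (N - 1) p (h l))"
    using wint_hardy_iter[OF R p N] by auto
  obtain C2 where C2: "C2 \<ge> 0" "\<And>k' h j. deriv_chain R k' h \<Longrightarrow> j + (k - 1) \<le> k' \<Longrightarrow>
    wint R (N - 1 - real (k - 1) * p) p (h j) \<le> ennreal C2 * (\<Sum>l\<le>k'. wint R (N - 1) p (h l))"
    using wint_hardy_iter[OF R p N'] by auto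
  show ?thesis
  proof (rule that[of "C0 * (C1 + C2)"])
    fix f h A r assume ap: "approx R N p k A f h" and r: "0 < r" "r < R"
    have "r powr (c + 1) * \<bar>f r\<bar> powr p \<le> C0 * (C1 + C2) * A powr p"
    proof (rule approx_pointwise_transfer[OF ap r _ p])
      fix g assume g: "deriv_chain R k g"
      have "ennreal (r powr (c + 1) * \<bar>g 0 r\<bar> powr p) \<le> ennreal C0 * (wint R c p (g 0) + wint R (c + p) p (g (Suc 0)))"
        using k r by (intro C0(2) deriv_chainD[OF g] deriv_chain_continuous_on[OF g]) auto
      also have "\<dots> \<le> ennreal C0 * (ennreal C1 * energy R N p k g + ennreal C2 * energy R N p k g)"
        unfolding c unfolding c_def energy_def using k by (intro mult_left_mono add_mono C1(2)[OF g] C2(2)[OF g]) auto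
      also have "\<dots> = ennreal (C0 * (C1 + C2)) * energy R N p k g"
      proof -
        have "ennreal (C0 * (C1 + C2)) = ennreal C0 * (ennreal C1 + ennreal C2)"
          using C0 C1 C2 by (simp only: ennreal_mult ennreal_plus add_nonneg_nonneg)
        then show ?thesis by (simp only: distrib_left distrib_right mult.assoc)
      qed
      finally show "ennreal (r powr (c + 1) * \<bar>g 0 r\<bar> powr p) \<le> ennreal (C0 * (C1 + C2)) * energy R N p k g" .
    qed (use C0 C1 C2 in auto)
    then show "r powr (N - real k * p) * \<bar>f r\<bar> powr p \<le> C0 * (C1 + C2) * A powr p" by (simp add: c_def)
  qed (use C0 C1 C2 in auto)
qed

text \<open>The limit f is not known to be a chain of k derivatives, so Hardy's inequality is
  applied to the approximants and passed on by Fatou's lemma.\<close>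

lemma approx_hardy:
  assumes R: "R > 0" and p: "p \<ge> 1" and k: "k \<ge> 1" and N: "real k * p < N"
  obtains C where "C \<ge> 0" "\<And>f h A. approx R N p k A f h \<Longrightarrow>
    wint R (N - 1 - real k * p) p f \<le> ennreal (C * A powr p)"
proof -
  obtain C1 where C1: "C1 \<ge> 0" "\<And>k' h j. deriv_chain R k' h \<Longrightarrow> j + k \<le> k' \<Longrightarrow>
    wint R (N - 1 - real k * p) p (h j) \<le> ennreal C1 * (\<Sum>l\<le>k'. wint R (N - 1) p (h l))"
    using wint_hardy_iter[OF R p N] by auto
  show ?thesis
  proof (rule that[OF C1(1)])
    fix f h A assume ap: "approx R N p k A f h"
    let ?c = "N - 1 - real k * p"
    have ch: "\<And>n. deriv_chain R k (h n)" using ap by (simp add: approx_def)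
    have "wint R ?c p f \<le> (\<integral>\<^sup>+r. liminf (\<lambda>n. ennreal (r powr ?c * \<bar>h n 0 r\<bar> powr p) * indicator {0<..<R} r) \<partial>lborel)"
      unfolding wint_def
    proof (rule nn_integral_mono)
      fix r :: real
      show "ennreal (r powr ?c * \<bar>f r\<bar> powr p) * indicator {0<..<R} r
        \<le> liminf (\<lambda>n. ennreal (r powr ?c * \<bar>h n 0 r\<bar> powr p) * indicator {0<..<R} r)"
      proof (cases "r \<in> {0<..<R}")
        case True
        then have "(\<lambda>n. ennreal (r powr ?c * \<bar>h n 0 r\<bar> powr p)) \<longlonglongrightarrow> ennreal (r powr ?c * \<bar>f r\<bar> powr p)"
          using ap p unfolding approx_def by (intro tendsto_ennrealI tendsto_intros tendsto_powr') auto
        then have "liminf (\<lambda>n. ennreal (r powr ?c * \<bar>h n 0 r\<bar> powr p)) = ennreal (r powr ?c * \<bar>f r\<bar> powr p)"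
          by (intro lim_imp_Liminf) auto
        then show ?thesis using True by simp
      qed simp
    qed
    also have "\<dots> \<le> liminf (\<lambda>n. wint R ?c p (h n 0))"
      unfolding wint_def
      by (intro nn_integral_liminf) (use wint_measurable[OF deriv_chain_continuous_on[OF ch]] in simp)
    also have "\<dots> \<le> ennreal (C1 * A powr p)"
    proof (rule liminf_frequently_le)
      have "\<exists>\<^sub>F n in sequentially. energy R N p k (h n) \<le> ennreal (A powr p)" using ap by (simp add: approx_def)
      then show "\<exists>\<^sub>F n in sequentially. wint R ?c p (h n 0) \<le> ennreal (C1 * A powr p)"
      proof (rule frequently_elim1)
        fix n assume n: "energy R N p k (h n) \<le> ennreal (A powr p)"
        have "wint R ?c p (h n 0) \<le> ennreal C1 * energy R N p k (h n)"
          unfolding energy_def by (intro C1(2) ch) auto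
        also have "\<dots> \<le> ennreal C1 * ennreal (A powr p)" using n by (rule mult_left_mono) simp
        finally show "wint R ?c p (h n 0) \<le> ennreal (C1 * A powr p)" using C1(1) by (simp add: ennreal_mult)
      qed
    qed
    finally show "wint R ?c p f \<le> ennreal (C1 * A powr p)" .
  qed
qed

lemma wint_const_le:
  assumes "c \<ge> 0" "R > 0" "\<And>r. 0 < r \<Longrightarrow> r < R \<Longrightarrow> r powr c * \<bar>f r\<bar> powr q \<le> B" "B \<ge> 0"
  shows "wint R c q f \<le> ennreal (B * R)"
proof -
  have "wint R c q f \<le> (\<integral>\<^sup>+r. ennreal B * indicator {0<..<R} r \<partial>lborel)"
    unfolding wint_def by (intro nn_integral_mono) (auto split: split_indicator intro!: ennreal_leI assms(3))
  also have "\<dots> = ennreal (B * R)" using assms by (simp add: nn_integral_cmult_indicator ennreal_mult)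
  finally show ?thesis .
qed

lemma powr_interpolate:
  fixes t A q s :: real
  assumes "A > 0" "t \<ge> 0" "q \<le> s" "q > 0"
  shows "t powr q \<le> A powr q + A powr (q - s) * t powr s"
proof (cases "t \<le> A")
  case True
  then have "t powr q \<le> A powr q" using assms by (intro powr_mono2) auto
  then show ?thesis by (smt (verit) mult_nonneg_nonneg powr_ge_zero)
next
  case False
  then have "t powr q = t powr (q - s) * t powr s" using assms by (simp add: powr_add[symmetric])
  also have "\<dots> \<le> A powr (q - s) * t powr s" using False assms by (intro mult_right_mono powr_mono2') auto
  finally show ?thesis by (smt (verit) powr_ge_zero)
qed

text \<open>At the largest exponent s the integrand r^(\<theta>+N-1) |f|^s factors as (r^D |f|^p)^t
  times r^(N-1-kp) |f|^p, with D = N - k p and t = (\<theta> + k p)/D. The first factor is bounded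
  pointwise, the second is integrated by Hardy's inequality. Smaller q follow from
  \<open>powr_interpolate\<close> with threshold A.\<close>

lemma approx_subcritical:
  assumes R: "R > 0" and p: "p \<ge> 1" and k: "k \<ge> 1" and N: "real k * p < N" "N \<ge> 1"
    and \<theta>: "\<theta> \<ge> 0" and q: "1 \<le> q" "q \<le> (\<theta> + N) * p / (N - real k * p)"
  obtains C where "C \<ge> 0" "\<And>f h A. approx R N p k A f h \<Longrightarrow> continuous_on {0<..<R} f \<Longrightarrow> A > 0 \<Longrightarrow>
    wint R (\<theta> + N - 1) q f \<le> ennreal (C * A powr q)"
proof -
  obtain C1 where C1: "C1 \<ge> 0" "\<And>f h A r. approx R N p k A f h \<Longrightarrow> 0 < r \<Longrightarrow> r < R \<Longrightarrow>
    r powr (N - real k * p) * \<bar>f r\<bar> powr p \<le> C1 * A powr p"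
    using approx_pointwise[OF R p k N(1)] by auto
  obtain C2 where C2: "C2 \<ge> 0" "\<And>f h A. approx R N p k A f h \<Longrightarrow>
    wint R (N - 1 - real k * p) p f \<le> ennreal (C2 * A powr p)"
    using approx_hardy[OF R p k N(1)] by auto
  define D where "D = N - real k * p"
  define s where "s = (\<theta> + N) * p / D"
  define t where "t = (\<theta> + real k * p) / D"
  have D: "D > 0" using N by (simp add: D_def)
  have t: "t \<ge> 0" using D \<theta> p by (simp add: t_def)
  have ts: "p * t = s - p" "D * t = \<theta> + real k * p" using D by (simp_all add: t_def s_def D_def field_simps)
  have s: "q \<le> s" using q by (simp add: s_def D_def)
  show ?thesis
  proof (rule that[of "R powr (\<theta> + N - 1) * R + C1 powr t * C2"])
    fix f h A assume ap: "approx R N p k A f h" and cf: "continuous_on {0<..<R} f" and A: "A > 0"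
    have pt: "r powr (\<theta> + N - 1) * \<bar>f r\<bar> powr s \<le> (C1 * A powr p) powr t * (r powr (N - 1 - real k * p) * \<bar>f r\<bar> powr p)"
      if r: "0 < r" "r < R" for r
    proof -
      have "(r powr D * \<bar>f r\<bar> powr p) powr t \<le> (C1 * A powr p) powr t"
        using C1(2)[OF ap r] t by (intro powr_mono2) (auto simp: D_def)
      then have "(r powr D * \<bar>f r\<bar> powr p) powr t * (r powr (N - 1 - real k * p) * \<bar>f r\<bar> powr p)
        \<le> (C1 * A powr p) powr t * (r powr (N - 1 - real k * p) * \<bar>f r\<bar> powr p)"
        by (rule mult_right_mono) simp
      moreover have "(r powr D * \<bar>f r\<bar> powr p) powr t * (r powr (N - 1 - real k * p) * \<bar>f r\<bar> powr p)
        = (r powr (D * t) * r powr (N - 1 - real k * p)) * (\<bar>f r\<bar> powr (p * t) * \<bar>f r\<bar> powr p)"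
        by (simp add: powr_mult powr_powr mult_ac)
      moreover have "r powr (D * t) * r powr (N - 1 - real k * p) = r powr (\<theta> + N - 1)"
      proof -
        have "D * t + (N - 1 - real k * p) = \<theta> + N - 1" by (simp add: ts)
        then show ?thesis by (simp only: powr_add[symmetric])
      qed
      moreover have "\<bar>f r\<bar> powr (p * t) * \<bar>f r\<bar> powr p = \<bar>f r\<bar> powr s"
        by (simp add: powr_add[symmetric] ts)
      ultimately show ?thesis by simp
    qed
    let ?w = "\<lambda>r. ennreal (r powr (N - 1 - real k * p) * \<bar>f r\<bar> powr p) * indicator {0<..<R} r"
    have mw: "?w \<in> borel_measurable lborel" using wint_measurable[OF cf] by simp
    have "wint R (\<theta> + N - 1) q f \<le> (\<integral>\<^sup>+r. ennreal (R powr (\<theta> + N - 1) * A powr q) * indicator {0<..<R} r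
       + ennreal (A powr (q - s) * (C1 * A powr p) powr t) * ?w r \<partial>lborel)"
      unfolding wint_def
    proof (rule nn_integral_mono)
      fix r :: real
      have "r powr (\<theta> + N - 1) * \<bar>f r\<bar> powr q \<le> R powr (\<theta> + N - 1) * A powr q
          + A powr (q - s) * (C1 * A powr p) powr t * (r powr (N - 1 - real k * p) * \<bar>f r\<bar> powr p)" if r: "0 < r" "r < R"
      proof -
        have "r powr (\<theta> + N - 1) * \<bar>f r\<bar> powr q \<le> r powr (\<theta> + N - 1) * (A powr q + A powr (q - s) * \<bar>f r\<bar> powr s)"
          using A q s by (intro mult_left_mono powr_interpolate) auto
        also have "\<dots> = r powr (\<theta> + N - 1) * A powr q + A powr (q - s) * (r powr (\<theta> + N - 1) * \<bar>f r\<bar> powr s)"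
          by (simp add: algebra_simps)
        also have "\<dots> \<le> R powr (\<theta> + N - 1) * A powr q
          + A powr (q - s) * ((C1 * A powr p) powr t * (r powr (N - 1 - real k * p) * \<bar>f r\<bar> powr p))"
          using r \<theta> N pt[OF r] by (intro add_mono mult_right_mono mult_left_mono powr_mono2) auto
        finally show ?thesis by (simp add: mult.assoc)
      qed
      then have "ennreal (r powr (\<theta> + N - 1) * \<bar>f r\<bar> powr q) \<le> ennreal (R powr (\<theta> + N - 1) * A powr q)
          + ennreal (A powr (q - s) * (C1 * A powr p) powr t) * ennreal (r powr (N - 1 - real k * p) * \<bar>f r\<bar> powr p)" if r: "0 < r" "r < R"
        using r by (subst ennreal_mult[symmetric], simp, simp, subst ennreal_plus[symmetric]) (auto intro!: ennreal_leI simp del: ennreal_plus)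
      then show "ennreal (r powr (\<theta> + N - 1) * \<bar>f r\<bar> powr q) * indicator {0<..<R} r
        \<le> ennreal (R powr (\<theta> + N - 1) * A powr q) * indicator {0<..<R} r
         + ennreal (A powr (q - s) * (C1 * A powr p) powr t) * ?w r"
        by (auto split: split_indicator)
    qed
    also have "\<dots> = ennreal (R powr (\<theta> + N - 1) * A powr q) * ennreal R
        + ennreal (A powr (q - s) * (C1 * A powr p) powr t) * wint R (N - 1 - real k * p) p f"
      unfolding wint_def using mw R by (subst nn_integral_add) (auto simp: nn_integral_cmult nn_integral_cmult_indicator)
    also have "\<dots> \<le> ennreal (R powr (\<theta> + N - 1) * A powr q) * ennreal R
        + ennreal (A powr (q - s) * (C1 * A powr p) powr t) * ennreal (C2 * A powr p)"
      by (intro add_left_mono mult_left_mono C2(2)[OF ap]) auto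
    also have "\<dots> = ennreal (R powr (\<theta> + N - 1) * A powr q * R
        + A powr (q - s) * (C1 * A powr p) powr t * (C2 * A powr p))"
      using R C2(1) by (subst ennreal_plus) (auto simp: ennreal_mult)
    also have "A powr (q - s) * (C1 * A powr p) powr t * (C2 * A powr p) = C1 powr t * C2 * (A powr (q - s) * A powr (p * t) * A powr p)"
      using C1(1) by (simp add: powr_mult powr_powr mult_ac)
    also have "A powr (q - s) * A powr (p * t) * A powr p = A powr q"
      using A by (simp add: powr_add[symmetric] ts)
    finally show "wint R (\<theta> + N - 1) q f \<le> ennreal ((R powr (\<theta> + N - 1) * R + C1 powr t * C2) * A powr q)"
      by (simp add: algebra_simps)
  qed (use R C2(1) in auto)
qed

text \<open>For N = k p Hardy's inequality just fails to reach weight -1. Stopping at c = -1 +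
  \<eta> with \<eta> = p/q costs a factor r^\<eta>; raising the resulting bound to the power q/p
  turns this factor into r.\<close>

lemma approx_critical_pointwise:
  assumes R: "R > 0" and p: "p \<ge> 1" and k: "k \<ge> 1" and N: "N = real k * p" and q: "q \<ge> 1"
  obtains C where "C \<ge> 0" "\<And>f h A r. approx R N p k A f h \<Longrightarrow> A > 0 \<Longrightarrow> 0 < r \<Longrightarrow> r < R \<Longrightarrow>
    r * \<bar>f r\<bar> powr q \<le> C * A powr q"
proof -
  define \<eta> where "\<eta> = p / q"
  have \<eta>: "\<eta> > 0" using p q by (simp add: \<eta>_def)
  define c where "c = -1 + \<eta>"
  have c: "c > -1" using \<eta> by (simp add: c_def)
  have e: "N - 1 - real (k - 1) * p = p - 1" using k by (simp add: N of_nat_diff algebra_simps)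
  have N': "real (k - 1) * p < N" using k p by (simp add: N of_nat_diff algebra_simps)
  obtain C0 where C0: "C0 \<ge> 0" "\<And>f f' r. (\<And>r. 0 < r \<Longrightarrow> r < R \<Longrightarrow> (f has_real_derivative f' r) (at r)) \<Longrightarrow>
    continuous_on {0<..<R} f' \<Longrightarrow> 0 < r \<Longrightarrow> r < R \<Longrightarrow>
    ennreal (r powr (c + 1) * \<bar>f r\<bar> powr p) \<le> ennreal C0 * (wint R c p f + wint R (c + p) p f')"
    using wint_pointwise[OF R p, of c] by auto
  obtain C1 where C1: "C1 \<ge> 0" "\<And>f f'. (\<And>r. 0 < r \<Longrightarrow> r < R \<Longrightarrow> (f has_real_derivative f' r) (at r)) \<Longrightarrow>
      continuous_on {0<..<R} f' \<Longrightarrow> wint R c p f \<le> ennreal C1 * (wint R (c + p) p f + wint R (c + p) p f')"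
    using wint_hardy[OF R p c] by auto
  obtain C2 where C2: "C2 \<ge> 0" "\<And>k' h j. deriv_chain R k' h \<Longrightarrow> j + (k - 1) \<le> k' \<Longrightarrow>
    wint R (N - 1 - real (k - 1) * p) p (h j) \<le> ennreal C2 * (\<Sum>l\<le>k'. wint R (N - 1) p (h l))"
    using wint_hardy_iter[OF R p N'] by auto
  define K where "K = C0 * (C1 * (R powr \<eta> * C2 + R powr \<eta> * C2) + R powr \<eta> * C2)"
  have K: "K \<ge> 0" using C0 C1 C2 by (simp add: K_def)
  have pt: "r powr \<eta> * \<bar>f r\<bar> powr p \<le> K * A powr p" if ap: "approx R N p k A f h" and r: "0 < r" "r < R" for f h A r
  proof (rule approx_pointwise_transfer[OF ap r K p])
    fix g assume g: "deriv_chain R k g"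
    let ?E = "energy R N p k g"
    have w: "wint R (c + p) p (g j) \<le> ennreal (R powr \<eta> * C2) * ?E" if "j \<le> 1" for j
    proof -
      have "wint R (c + p) p (g j) \<le> ennreal (R powr (c + p - (p - 1))) * wint R (p - 1) p (g j)"
        using that k \<eta> by (intro wint_weight_mono deriv_chain_continuous_on[OF g]) (auto simp: c_def)
      also have "\<dots> \<le> ennreal (R powr \<eta>) * (ennreal C2 * ?E)"
        using C2(2)[OF g, of j] that k unfolding e energy_def by (intro mult_mono) (auto simp: c_def)
      finally show ?thesis using C2(1) by (simp add: ennreal_mult mult.assoc)
    qed
    have "ennreal (r powr (c + 1) * \<bar>g 0 r\<bar> powr p) \<le> ennreal C0 * (wint R c p (g 0) + wint R (c + p) p (g (Suc 0)))"
      using k r by (intro C0(2) deriv_chainD[OF g] deriv_chain_continuous_on[OF g]) auto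
    also have "\<dots> \<le> ennreal C0 * (ennreal C1 * (wint R (c + p) p (g 0) + wint R (c + p) p (g (Suc 0))) + wint R (c + p) p (g (Suc 0)))"
      using k by (intro mult_left_mono add_right_mono C1(2) deriv_chainD[OF g] deriv_chain_continuous_on[OF g]) auto
    also have "\<dots> \<le> ennreal C0 * (ennreal C1 * (ennreal (R powr \<eta> * C2) * ?E + ennreal (R powr \<eta> * C2) * ?E) + ennreal (R powr \<eta> * C2) * ?E)"
      by (intro mult_left_mono add_mono w) auto
    also have "\<dots> = ennreal K * ?E"
    proof -
      have "ennreal K = ennreal C0 * (ennreal C1 * (ennreal (R powr \<eta> * C2) + ennreal (R powr \<eta> * C2)) + ennreal (R powr \<eta> * C2))"
        unfolding K_def using C0(1) C1(1) C2(1)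
        by (simp only: ennreal_mult[of C0] ennreal_mult[of C1] ennreal_plus add_nonneg_nonneg mult_nonneg_nonneg powr_ge_zero)
      then show ?thesis by (simp only: distrib_left distrib_right mult.assoc)
    qed
    finally show "ennreal (r powr \<eta> * \<bar>g 0 r\<bar> powr p) \<le> ennreal K * ?E" by (simp add: c_def)
  qed
  show ?thesis
  proof (rule that[of "K powr (q / p)"])
    fix f h A r assume ap: "approx R N p k A f h" "A > 0" and r: "0 < r" "r < R"
    have "(r powr \<eta> * \<bar>f r\<bar> powr p) powr (q / p) \<le> (K * A powr p) powr (q / p)"
      using pt[OF ap(1) r] p q by (intro powr_mono2) auto
    moreover have "(r powr \<eta> * \<bar>f r\<bar> powr p) powr (q / p) = r * \<bar>f r\<bar> powr q"
      using r p q by (simp add: powr_mult powr_powr \<eta>_def)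
    moreover have "(K * A powr p) powr (q / p) = K powr (q / p) * A powr q"
      using K p by (simp add: powr_mult powr_powr)
    ultimately show "r * \<bar>f r\<bar> powr q \<le> K powr (q / p) * A powr q" by simp
  qed simp
qed

lemma approx_critical_equicontinuous:
  assumes R: "R > 0" and p: "p \<ge> 1" and k: "k \<ge> 1" and N: "N = real k * p"
  obtains C where "C \<ge> 0" "\<And>f h A s r D. approx R N p k A f h \<Longrightarrow> A > 0 \<Longrightarrow> 0 < s \<Longrightarrow> s \<le> r \<Longrightarrow> r < R \<Longrightarrow> D > 0 \<Longrightarrow>
    \<bar>f r - f s\<bar> \<le> D * (r - s) + D powr (1 - p) * s powr (1 - p) * (C * A powr p)"
proof -
  have e: "N - 1 - real (k - 1) * p = p - 1" using k by (simp add: N of_nat_diff algebra_simps)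
  have N': "real (k - 1) * p < N" using k p by (simp add: N of_nat_diff algebra_simps)
  obtain C2 where C2: "C2 \<ge> 0" "\<And>k' h j. deriv_chain R k' h \<Longrightarrow> j + (k - 1) \<le> k' \<Longrightarrow>
    wint R (N - 1 - real (k - 1) * p) p (h j) \<le> ennreal C2 * (\<Sum>l\<le>k'. wint R (N - 1) p (h l))"
    using wint_hardy_iter[OF R p N'] by auto
  show ?thesis
  proof (rule that[OF C2(1)])
    fix f h A s r D assume ap: "approx R N p k A f h" and A: "A > 0" and sr: "0 < s" "s \<le> r" "r < R" and D: "D > (0::real)"
    show "\<bar>f r - f s\<bar> \<le> D * (r - s) + D powr (1 - p) * s powr (1 - p) * (C2 * A powr p)"
    proof (rule tendsto_frequently_le)
      show "(\<lambda>n. \<bar>h n 0 r - h n 0 s\<bar>) \<longlonglongrightarrow> \<bar>f r - f s\<bar>"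
        using ap sr unfolding approx_def by (intro tendsto_intros) auto
      have "\<exists>\<^sub>F n in sequentially. energy R N p k (h n) \<le> ennreal (A powr p)" using ap by (simp add: approx_def)
      then show "\<exists>\<^sub>F n in sequentially. \<bar>h n 0 r - h n 0 s\<bar> \<le> D * (r - s) + D powr (1 - p) * s powr (1 - p) * (C2 * A powr p)"
      proof (rule frequently_elim1)
        fix n assume n: "energy R N p k (h n) \<le> ennreal (A powr p)"
        have ch: "deriv_chain R k (h n)" using ap by (simp add: approx_def)
        let ?g = "h n (Suc 0)"
        have c1: "continuous_on {0<..<R} ?g" using k by (intro deriv_chain_continuous_on[OF ch]) auto
        have c: "continuous_on {s..r} ?g" using sr by (intro continuous_on_subset[OF c1]) auto
        have ip: "(\<lambda>t. t powr (p - 1) * \<bar>?g t\<bar> powr p) integrable_on {s..r}"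
          using sr p by (intro integrable_continuous_real continuous_intros continuous_on_powr' c) auto
        have "\<bar>h n 0 r - h n 0 s\<bar> \<le> integral {s..r} (\<lambda>t. \<bar>?g t\<bar>)"
          using sr k by (intro ftc_bound(2)[where R=R] deriv_chainD[OF ch] c1) auto
        also have "\<dots> \<le> integral {s..r} (\<lambda>t. D + D powr (1 - p) * s powr (1 - p) * (t powr (p - 1) * \<bar>?g t\<bar> powr p))"
        proof (rule integral_le)
          show "(\<lambda>t. \<bar>?g t\<bar>) integrable_on {s..r}" by (intro integrable_continuous_real continuous_intros c)
          show "(\<lambda>t. D + D powr (1 - p) * s powr (1 - p) * (t powr (p - 1) * \<bar>?g t\<bar> powr p)) integrable_on {s..r}"
            by (intro integrable_add integrable_on_mult_right ip) auto
          fix t assume t: "t \<in> {s..r}"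
          have "\<bar>?g t\<bar> powr 1 \<le> D powr 1 + D powr (1 - p) * \<bar>?g t\<bar> powr p"
            using D p by (intro powr_interpolate) auto
          then have "\<bar>?g t\<bar> \<le> D + D powr (1 - p) * \<bar>?g t\<bar> powr p" using D by simp
          also have "\<dots> \<le> D + D powr (1 - p) * (s powr (1 - p) * (t powr (p - 1) * \<bar>?g t\<bar> powr p))"
          proof -
            have "1 = s powr (1 - p) * s powr (p - 1)" using sr by (simp add: powr_add[symmetric])
            also have "\<dots> \<le> s powr (1 - p) * t powr (p - 1)" using sr t p by (intro mult_left_mono powr_mono2) auto
            finally have "1 * \<bar>?g t\<bar> powr p \<le> (s powr (1 - p) * t powr (p - 1)) * \<bar>?g t\<bar> powr p"
              by (rule mult_right_mono) simp
            then show ?thesis by (intro add_left_mono mult_left_mono) (auto simp: mult.assoc)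
          qed
          finally show "\<bar>?g t\<bar> \<le> D + D powr (1 - p) * s powr (1 - p) * (t powr (p - 1) * \<bar>?g t\<bar> powr p)" by (simp add: mult.assoc)
        qed
        also have "\<dots> = D * (r - s) + D powr (1 - p) * s powr (1 - p) * integral {s..r} (\<lambda>t. t powr (p - 1) * \<bar>?g t\<bar> powr p)"
          using sr by (subst integral_add) (auto intro!: integrable_on_mult_right ip)
        also have "\<dots> \<le> D * (r - s) + D powr (1 - p) * s powr (1 - p) * (C2 * A powr p)"
        proof (intro add_left_mono mult_left_mono)
          have "ennreal (integral {s..r} (\<lambda>t. t powr (p - 1) * \<bar>?g t\<bar> powr p)) \<le> wint R (p - 1) p ?g"
            using sr p by (intro wint_ge_integral c1) auto
          also have "\<dots> \<le> ennreal C2 * energy R N p k (h n)"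
            using C2(2)[OF ch, of "Suc 0"] k unfolding e energy_def by simp
          also have "\<dots> \<le> ennreal C2 * ennreal (A powr p)" using n by (rule mult_left_mono) simp
          also have "\<dots> = ennreal (C2 * A powr p)" using C2(1) by (simp add: ennreal_mult)
          finally show "integral {s..r} (\<lambda>t. t powr (p - 1) * \<bar>?g t\<bar> powr p) \<le> C2 * A powr p"
            using C2(1) by (subst (asm) ennreal_le_iff) auto
        qed auto
        finally show "\<bar>h n 0 r - h n 0 s\<bar> \<le> D * (r - s) + D powr (1 - p) * s powr (1 - p) * (C2 * A powr p)" .
      qed
    qed
  qed
qed

section \<open>The volume measure\<close>

context warped
begin

lemma continuous_on_det:
  fixes A :: "'a::topological_space \<Rightarrow> real^'n::finite^'n"
  assumes "\<And>i j. continuous_on S (\<lambda>x. A x $ i $ j)"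
  shows "continuous_on S (\<lambda>x. det (A x))"
  unfolding det_def by (intro continuous_intros assms)

lemma sqrt_det_metric:
  assumes x: "(x::real^'n::finite) \<in> M"
  shows "sqrt (det (warped_metric \<phi> x)) = \<bar>det (rmat (\<rho> x) x)\<bar>"
proof -
  have "warped_metric \<phi> x = rmat (\<rho> x) x ** rmat (\<rho> x) x"
    using x by (simp add: metric_eq rmat_mult M_D power2_eq_square)
  then have "det (warped_metric \<phi> x) = (det (rmat (\<rho> x) x))\<^sup>2" by (simp add: det_mul power2_eq_square)
  then show ?thesis by simp
qed

text \<open>The determinant is not computed: \<open>rmat b x\<close> depends only on b and the
  direction of x, it is invertible, and (b, direction) ranges over the compact set Q, so its
  determinant is bounded above and away from 0.\<close>

lemma volume_density_bounds:
  "\<exists>c1>0. \<exists>c2>0. \<forall>x\<in>M. c1 \<le> sqrt (det (warped_metric \<phi> (x::real^'n::finite))) \<and> sqrt (det (warped_metric \<phi> x)) \<le> c2"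
proof -
  obtain b1 b2 where b: "b1 > 0" "b2 > 0" "\<And>r. 0 < r \<Longrightarrow> r < R \<Longrightarrow> b1 \<le> \<phi> r / r \<and> \<phi> r / r \<le> b2"
    using phi_ratio_bounds by blast
  have "b1 \<le> b2" using b(3)[of "R/2"] R by auto
  define Q where "Q = {b1..b2} \<times> sphere (0::real^'n) 1"
  define F where "F z = \<bar>det (rmat (fst z) (snd z :: real^'n))\<bar>" for z
  have Q: "compact Q" unfolding Q_def by (intro compact_Times) auto
  obtain i :: 'n where True by simp
  have ne: "Q \<noteq> {}"
    using \<open>b1 \<le> b2\<close> unfolding Q_def by (auto intro!: exI[of _ "axis i 1"])
  have cont: "continuous_on Q F" unfolding F_def
  proof (intro continuous_on_rabs continuous_on_det)
    fix i j
    show "continuous_on Q (\<lambda>z. rmat (fst z) (snd z) $ i $ j)" unfolding rmat_nth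
      by (cases "i = j") (auto simp: Q_def intro!: continuous_intros)
  qed
  have pos: "F z > 0" if z: "z \<in> Q" for z
  proof -
    have nz: "snd z \<noteq> 0" "fst z > 0" using z b by (auto simp: Q_def)
    have "rmat (fst z) (snd z) ** rmat (1 / fst z) (snd z) = mat 1"
      using nz by (simp add: rmat_mult rmat_one)
    then have "det (rmat (fst z) (snd z)) * det (rmat (1 / fst z) (snd z)) = 1"
      by (metis det_I det_mul)
    then show ?thesis by (auto simp: F_def)
  qed
  obtain z1 where z1: "z1 \<in> Q" "\<And>z. z \<in> Q \<Longrightarrow> F z1 \<le> F z" using continuous_attains_inf[OF Q ne cont] by blast
  obtain z2 where z2: "z2 \<in> Q" "\<And>z. z \<in> Q \<Longrightarrow> F z \<le> F z2" using continuous_attains_sup[OF Q ne cont] by blast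
  have "F z1 \<le> sqrt (det (warped_metric \<phi> x)) \<and> sqrt (det (warped_metric \<phi> x)) \<le> F z2" if x: "x \<in> M" for x :: "real^'n"
  proof -
    have "rmat (\<rho> x) x = rmat (\<rho> x) (x /\<^sub>R norm x)"
      using M_D[OF x] by (simp add: vec_eq_iff rmat_nth divide_inverse mult_ac)
    then have "sqrt (det (warped_metric \<phi> x)) = F (\<rho> x, x /\<^sub>R norm x)"
      by (simp add: sqrt_det_metric[OF x] F_def)
    moreover have "(\<rho> x, x /\<^sub>R norm x) \<in> Q" using M_D[OF x] b(3)[of "norm x"] by (auto simp: Q_def)
    ultimately show ?thesis using z1(2) z2(2) by auto
  qed
  then show ?thesis using pos[OF z1(1)] pos[OF z2(1)] by blast
qed

lemma measurable_of_continuous_on_M: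
  fixes f :: "real^'n::finite \<Rightarrow> real"
  assumes "continuous_on M f"
  shows "f \<in> borel_measurable (lebesgue_on (ball 0 R))"
proof -
  have "(\<lambda>x. indicator M x *\<^sub>R f x + indicator {0} x * f 0) \<in> borel_measurable borel"
    using borel_measurable_continuous_on_indicator[OF _ assms] by (intro borel_measurable_add borel_measurable_times) auto
  then have "(\<lambda>x. indicator M x *\<^sub>R f x + indicator {0} x * f 0) \<in> borel_measurable lborel" by simp
  then have "(\<lambda>x. indicator M x *\<^sub>R f x + indicator {0} x * f 0) \<in> borel_measurable (lebesgue_on (ball 0 R))"
    by (intro measurable_restrict_space1 measurable_completion)
  then show ?thesis
    by (rule measurable_cong[THEN iffD1, rotated]) (auto simp: M_def split: split_indicator)
qed

lemma sqrt_det_measurable: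
  "(\<lambda>x::real^'n::finite. sqrt (det (warped_metric \<phi> x))) \<in> borel_measurable (lebesgue_on (ball 0 R))"
  by (intro measurable_of_continuous_on_M continuous_intros continuous_on_det smooth_on_continuous_on smooth_metric)

lemma ennreal_sqrt_det_measurable:
  "(\<lambda>x::real^'n::finite. ennreal (sqrt (det (warped_metric \<phi> x)))) \<in> borel_measurable (lebesgue_on (ball 0 R))"
  by (rule measurable_compose[OF sqrt_det_measurable measurable_ennreal])

lemma space_M_vol [simp]: "space (M_vol R \<phi> :: (real^'n::finite) measure) = ball 0 R"
  by (simp add: M_vol_def vol_def)

lemma measurable_M_vol: "borel_measurable (M_vol R \<phi> :: (real^'n::finite) measure) = borel_measurable (lebesgue_on (ball 0 R))"
  by (rule measurable_cong_sets) (simp_all add: M_vol_def vol_def)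

lemma AE_lebesgue_on_ball: "(AE x in lebesgue_on (ball 0 R). P (x::real^'n::finite)) \<longleftrightarrow> (AE x in lborel. x \<in> ball 0 R \<longrightarrow> P x)"
  by (subst AE_restrict_space_iff) (auto simp: AE_completion_iff)

lemma AE_M: "AE x in lborel. (x::real^'n::finite) \<in> ball 0 R \<longrightarrow> x \<in> M"
  using AE_lborel_nonzero by eventually_elim (auto simp: M_def)

text \<open>The volume density is bounded below by a positive constant off the origin, so the volume
  has the same null sets as Lebesgue measure on the ball.\<close>

lemma AE_M_vol: "(AE x in M_vol R \<phi>. P (x::real^'n::finite)) \<longleftrightarrow> (AE x in lborel. x \<in> ball 0 R \<longrightarrow> P x)"
proof -
  obtain c1 where c1: "c1 > 0" "\<And>x::real^'n. x \<in> M \<Longrightarrow> c1 \<le> sqrt (det (warped_metric \<phi> x))"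
    using volume_density_bounds by blast
  have "(AE x in M_vol R \<phi>. P x) \<longleftrightarrow> (AE x in lborel. x \<in> ball 0 R \<longrightarrow> 0 < ennreal (sqrt (det (warped_metric \<phi> x))) \<longrightarrow> P x)"
    unfolding M_vol_def vol_def using ennreal_sqrt_det_measurable
    by (subst AE_density) (auto simp: AE_lebesgue_on_ball)
  also have "\<dots> \<longleftrightarrow> (AE x in lborel. x \<in> ball 0 R \<longrightarrow> P x)"
  proof
    assume "AE x in lborel. x \<in> ball 0 R \<longrightarrow> 0 < ennreal (sqrt (det (warped_metric \<phi> x))) \<longrightarrow> P x"
    then show "AE x in lborel. x \<in> ball 0 R \<longrightarrow> P x" using AE_M
    proof eventually_elim
      case (elim x)
      show ?case
      proof
        assume "x \<in> ball 0 R"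
        then have "x \<in> M" using elim by simp
        then have "0 < sqrt (det (warped_metric \<phi> x))" using less_le_trans[OF c1(1) c1(2)[of x]] by simp
        then show "P x" using elim \<open>x \<in> ball 0 R\<close> by (simp add: ennreal_zero_less_mult_iff)
      qed
    qed
  next
    assume "AE x in lborel. x \<in> ball 0 R \<longrightarrow> P x"
    then show "AE x in lborel. x \<in> ball 0 R \<longrightarrow> 0 < ennreal (sqrt (det (warped_metric \<phi> x))) \<longrightarrow> P x"
      by eventually_elim auto
  qed
  finally show ?thesis .
qed

lemma nn_integral_M_vol:
  fixes F :: "real^'n::finite \<Rightarrow> ennreal"
  assumes F: "F \<in> borel_measurable (lebesgue_on (ball 0 R))"
  shows "(\<integral>\<^sup>+x. F x \<partial>M_vol R \<phi>) = (\<integral>\<^sup>+x. ennreal (sqrt (det (warped_metric \<phi> x))) * F x * indicator (ball 0 R) x \<partial>lborel)"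
proof -
  have "(\<integral>\<^sup>+x. F x \<partial>M_vol R \<phi>) = (\<integral>\<^sup>+x. ennreal (sqrt (det (warped_metric \<phi> x))) * F x \<partial>lebesgue_on (ball 0 R))"
    unfolding M_vol_def vol_def using ennreal_sqrt_det_measurable F by (intro nn_integral_density) auto
  also have "\<dots> = (\<integral>\<^sup>+x. ennreal (sqrt (det (warped_metric \<phi> x))) * F x * indicator (ball 0 R) x \<partial>lebesgue)"
    by (intro nn_integral_restrict_space) simp
  finally show ?thesis by (simp add: nn_integral_completion)
qed

lemma nn_integral_cmult_ball:
  fixes F :: "real^'n::finite \<Rightarrow> ennreal"
  assumes F: "F \<in> borel_measurable (lebesgue_on (ball 0 R))"
  shows "(\<integral>\<^sup>+x. c * F x * indicator (ball 0 R) x \<partial>lborel) = c * (\<integral>\<^sup>+x. F x * indicator (ball 0 R) x \<partial>lborel)"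
proof -
  have "(\<integral>\<^sup>+x. c * F x * indicator (ball 0 R) x \<partial>lborel) = (\<integral>\<^sup>+x. c * F x * indicator (ball 0 R) x \<partial>lebesgue)"
    by (simp add: nn_integral_completion)
  also have "\<dots> = (\<integral>\<^sup>+x. c * F x \<partial>lebesgue_on (ball 0 R))"
    by (intro nn_integral_restrict_space[symmetric]) simp
  also have "\<dots> = c * (\<integral>\<^sup>+x. F x \<partial>lebesgue_on (ball 0 R))" by (rule nn_integral_cmult[OF F])
  also have "(\<integral>\<^sup>+x. F x \<partial>lebesgue_on (ball 0 R)) = (\<integral>\<^sup>+x. F x * indicator (ball 0 R) x \<partial>lebesgue)"
    by (intro nn_integral_restrict_space) simp
  finally show ?thesis by (simp add: nn_integral_completion)
qed

text \<open>Allows every later integral to be taken with respect to Lebesgue measure, and hence in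
  Euclidean polar coordinates.\<close>

lemma nn_integral_M_vol_bounds:
  obtains c1 c2 where "c1 > 0" "c2 > 0"
    "\<And>F. F \<in> borel_measurable (lebesgue_on (ball 0 R)) \<Longrightarrow>
      (\<integral>\<^sup>+x. F x * indicator (ball 0 R) x \<partial>lborel) \<le> ennreal c1 * (\<integral>\<^sup>+x. F x \<partial>(M_vol R \<phi> :: (real^'n::finite) measure))"
    "\<And>F. F \<in> borel_measurable (lebesgue_on (ball 0 R)) \<Longrightarrow>
      (\<integral>\<^sup>+x. F x \<partial>(M_vol R \<phi> :: (real^'n::finite) measure)) \<le> ennreal c2 * (\<integral>\<^sup>+x. F x * indicator (ball 0 R) x \<partial>lborel)"
proof -
  obtain c1 c2 where c: "c1 > 0" "c2 > 0" "\<And>x::real^'n. x \<in> M \<Longrightarrow> c1 \<le> sqrt (det (warped_metric \<phi> x)) \<and> sqrt (det (warped_metric \<phi> x)) \<le> c2"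
    using volume_density_bounds by blast
  show ?thesis
  proof (rule that[of "1 / c1" c2])
    fix F :: "real^'n \<Rightarrow> ennreal" assume F: "F \<in> borel_measurable (lebesgue_on (ball 0 R))"
    let ?D = "\<lambda>x::real^'n. ennreal (sqrt (det (warped_metric \<phi> x)))"
    have FD: "(\<lambda>x. ?D x * F x) \<in> borel_measurable (lebesgue_on (ball 0 R))"
      using F ennreal_sqrt_det_measurable by (intro borel_measurable_times_ennreal) auto
    have "(\<integral>\<^sup>+x. F x * indicator (ball 0 R) x \<partial>lborel) \<le> (\<integral>\<^sup>+x. ennreal (1 / c1) * (?D x * F x) * indicator (ball 0 R) x \<partial>lborel)"
    proof (rule nn_integral_mono_AE)
      show "AE x in lborel. F x * indicator (ball 0 R) x \<le> ennreal (1 / c1) * (?D x * F x) * indicator (ball 0 R) x"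
        using AE_M
      proof eventually_elim
        case (elim x)
        show ?case
        proof (cases "x \<in> ball 0 R")
          case True
          then have "1 \<le> 1 / c1 * sqrt (det (warped_metric \<phi> x))" using elim c(1) c(3)[of x] by (simp add: field_simps)
          then have "ennreal 1 \<le> ennreal (1 / c1) * ?D x" using c(1) by (subst ennreal_mult'[symmetric]) (auto intro: ennreal_leI)
          then have "1 * F x \<le> (ennreal (1 / c1) * ?D x) * F x" by (intro mult_right_mono) auto
          then show ?thesis using True by (simp add: mult.assoc)
        qed simp
      qed
    qed
    also have "\<dots> = ennreal (1 / c1) * (\<integral>\<^sup>+x. F x \<partial>M_vol R \<phi>)"
      unfolding nn_integral_M_vol[OF F] by (rule nn_integral_cmult_ball[OF FD])
    finally show "(\<integral>\<^sup>+x. F x * indicator (ball 0 R) x \<partial>lborel) \<le> ennreal (1 / c1) * (\<integral>\<^sup>+x. F x \<partial>M_vol R \<phi>)" .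
    have "(\<integral>\<^sup>+x. F x \<partial>M_vol R \<phi>) \<le> (\<integral>\<^sup>+x. ennreal c2 * F x * indicator (ball 0 R) x \<partial>lborel)"
      unfolding nn_integral_M_vol[OF F]
    proof (rule nn_integral_mono_AE)
      show "AE x in lborel. ?D x * F x * indicator (ball 0 R) x \<le> ennreal c2 * F x * indicator (ball 0 R) x"
        using AE_M
      proof eventually_elim
        case (elim x)
        then show ?case using c(3)[of x] by (auto split: split_indicator intro!: mult_right_mono ennreal_leI)
      qed
    qed
    also have "\<dots> = ennreal c2 * (\<integral>\<^sup>+x. F x * indicator (ball 0 R) x \<partial>lborel)" by (rule nn_integral_cmult_ball[OF F])
    finally show "(\<integral>\<^sup>+x. F x \<partial>M_vol R \<phi>) \<le> ennreal c2 * (\<integral>\<^sup>+x. F x * indicator (ball 0 R) x \<partial>lborel)" .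
  qed (use c in auto)
qed

section \<open>Smooth functions with finite Sobolev norm\<close>

abbreviation tn :: "nat \<Rightarrow> (real^'n::finite \<Rightarrow> real) \<Rightarrow> real^'n \<Rightarrow> real" where
  "tn j u \<equiv> tensor_norm (warped_metric \<phi>) j (nabla (warped_metric \<phi>) j u)"

abbreviation snorm :: "nat \<Rightarrow> real \<Rightarrow> (real^'n::finite \<Rightarrow> real) \<Rightarrow> real" where
  "snorm \<equiv> smooth_sobolev_norm (warped_metric \<phi>) (ball 0 R)"

abbreviation ssob :: "nat \<Rightarrow> real \<Rightarrow> (real^'n::finite \<Rightarrow> real) set" where
  "ssob \<equiv> smooth_sobolev (warped_metric \<phi>) (ball 0 R)"

lemma ssob_smooth:
  assumes "(u :: real^'n::finite \<Rightarrow> real) \<in> ssob k p"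
  shows "smooth_on M u" "continuous_on (ball 0 R) u"
proof -
  have "smooth_on (ball 0 R) u" "continuous_on (ball 0 R) u"
    using assms Ck_on_all_partials[of "ball 0 R" u] unfolding smooth_sobolev_def by auto
  then show "smooth_on M u" "continuous_on (ball 0 R) u" by (auto simp: smooth_on_def M_def)
qed

lemma ssob_integrable: "u \<in> ssob k p \<Longrightarrow> j \<le> k \<Longrightarrow> integrable (M_vol R \<phi>) (\<lambda>x. tn j u x powr p)"
  by (simp add: smooth_sobolev_def M_vol_def)

lemma tn_measurable:
  assumes "smooth_on M (u :: real^'n::finite \<Rightarrow> real)"
  shows "tn j u \<in> borel_measurable (lebesgue_on (ball 0 R))"
  by (rule measurable_of_continuous_on_M[OF continuous_on_tensor_norm[OF assms]])

lemma tn_0: "x \<in> M \<Longrightarrow> tn 0 u (x::real^'n::finite) = \<bar>u x\<bar>"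
proof -
  have "{I::'n list. length I = 0} = {[]}" by auto
  then show ?thesis by (simp add: tensor_norm_def)
qed

lemma tn_diff:
  assumes "smooth_on M u" "smooth_on M v" "x \<in> M"
  shows "tn j (\<lambda>x. u x - v x) (x::real^'n::finite) \<le> tn j u x + tn j v x"
  by (rule tensor_norm_diff[OF assms(3)]) (rule nabla_diff[OF assms])

lemma tn_diff_powr:
  assumes "smooth_on M u" "smooth_on M v" "x \<in> M" "p \<ge> 1"
  shows "tn j (\<lambda>x. u x - v x) (x::real^'n::finite) powr p \<le> 2 powr p * (tn j u x powr p + tn j v x powr p)"
proof -
  have "tn j (\<lambda>x. u x - v x) x powr p \<le> (tn j u x + tn j v x) powr p"
    using assms by (intro powr_mono2 tn_diff tensor_norm_nonneg) auto
  also have "\<dots> \<le> 2 powr p * (tn j u x powr p + tn j v x powr p)"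
    using assms by (intro powr_add_le tensor_norm_nonneg) auto
  finally show ?thesis .
qed

lemma AE_M_vol_M: "AE x in M_vol R \<phi>. (x::real^'n::finite) \<in> M"
  unfolding AE_M_vol by (rule AE_M)

text \<open>Integrability of the difference has to be shown along with the bound:
  \<open>LINT\<close> of a non-integrable function is 0, and a small norm would then say
  nothing.\<close>

lemma ssob_diff:
  assumes u: "(u :: real^'n::finite \<Rightarrow> real) \<in> ssob k p" and v: "v \<in> ssob k p" and p: "p \<ge> 1"
  shows "(\<lambda>x. u x - v x) \<in> ssob k p"
    and "j \<le> k \<Longrightarrow> (LINT x|M_vol R \<phi>. tn j (\<lambda>x. u x - v x) x powr p)
      \<le> 2 powr p * ((LINT x|M_vol R \<phi>. tn j u x powr p) + (LINT x|M_vol R \<phi>. tn j v x powr p))"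
proof -
  note su = ssob_smooth(1)[OF u] and sv = ssob_smooth(1)[OF v]
  have bound: "AE x in M_vol R \<phi>. tn j (\<lambda>x. u x - v x) x powr p \<le> 2 powr p * (tn j u x powr p + tn j v x powr p)" for j
    using AE_M_vol_M by eventually_elim (rule tn_diff_powr[OF su sv _ p])
  have int: "integrable (M_vol R \<phi>) (\<lambda>x. tn j (\<lambda>x. u x - v x) x powr p)" if "j \<le> k" for j
  proof (rule Bochner_Integration.integrable_bound)
    show "integrable (M_vol R \<phi>) (\<lambda>x. 2 powr p * (tn j u x powr p + tn j v x powr p))"
      using ssob_integrable[OF u that] ssob_integrable[OF v that] by auto
    show "(\<lambda>x. tn j (\<lambda>x. u x - v x) x powr p) \<in> borel_measurable (M_vol R \<phi>)"
    proof -
      note [measurable] = tn_measurable[OF smooth_on_diff[OF open_M su sv], of j]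
      show ?thesis unfolding measurable_M_vol by measurable
    qed
    show "AE x in M_vol R \<phi>. norm (tn j (\<lambda>x. u x - v x) x powr p) \<le> norm (2 powr p * (tn j u x powr p + tn j v x powr p))"
      using bound[of j] by eventually_elim simp
  qed
  show "(\<lambda>x. u x - v x) \<in> ssob k p"
    using u v int unfolding smooth_sobolev_def by (auto intro: Ck_on_diff simp: M_vol_def)
  assume j: "j \<le> k"
  have "(LINT x|M_vol R \<phi>. tn j (\<lambda>x. u x - v x) x powr p) \<le> (LINT x|M_vol R \<phi>. 2 powr p * (tn j u x powr p + tn j v x powr p))"
    using ssob_integrable[OF u j] ssob_integrable[OF v j] by (intro integral_mono_AE int j bound) auto
  also have "\<dots> = 2 powr p * ((LINT x|M_vol R \<phi>. tn j u x powr p) + (LINT x|M_vol R \<phi>. tn j v x powr p))"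
    using ssob_integrable[OF u j] ssob_integrable[OF v j] by simp
  finally show "(LINT x|M_vol R \<phi>. tn j (\<lambda>x. u x - v x) x powr p)
      \<le> 2 powr p * ((LINT x|M_vol R \<phi>. tn j u x powr p) + (LINT x|M_vol R \<phi>. tn j v x powr p))" .
qed

lemma snorm_eq: "snorm k p (u :: real^'n::finite \<Rightarrow> real) = (\<Sum>j\<le>k. (LINT x|M_vol R \<phi>. tn j u x powr p) powr (1 / p))"
  by (simp add: smooth_sobolev_norm_def M_vol_def)

lemma snorm_nonneg: "0 \<le> snorm k p u"
  unfolding snorm_eq by (intro sum_nonneg) simp

lemma LINT_le_snorm:
  assumes "j \<le> k" "p \<ge> 1"
  shows "(LINT x|M_vol R \<phi>. tn j (u :: real^'n::finite \<Rightarrow> real) x powr p) \<le> snorm k p u powr p"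
proof -
  let ?J = "LINT x|M_vol R \<phi>. tn j u x powr p"
  have J: "?J \<ge> 0" by (rule Bochner_Integration.integral_nonneg) simp
  have "?J powr (1 / p) \<le> snorm k p u"
    unfolding snorm_eq using assms by (intro member_le_sum) auto
  then have "(?J powr (1 / p)) powr p \<le> snorm k p u powr p" using assms by (intro powr_mono2) auto
  then show ?thesis using J assms by (simp add: powr_powr)
qed

text \<open>A crude substitute for Minkowski's inequality, sufficient for boundedness of the norms
  of a Cauchy sequence. One factor 2 is the p-th root of 2^p, the other bounds 2^(1/p).\<close>

lemma snorm_triangle:
  assumes u: "(u :: real^'n::finite \<Rightarrow> real) \<in> ssob k p" and v: "v \<in> ssob k p" and p: "p \<ge> 1"
  shows "snorm k p u \<le> 4 * (snorm k p (\<lambda>x. v x - u x) + snorm k p v)"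
proof -
  let ?d = "\<lambda>x. v x - u x"
  have d: "?d \<in> ssob k p" by (rule ssob_diff(1)[OF v u p])
  have "(LINT x|M_vol R \<phi>. tn j u x powr p) powr (1 / p)
    \<le> 4 * ((LINT x|M_vol R \<phi>. tn j ?d x powr p) powr (1 / p) + (LINT x|M_vol R \<phi>. tn j v x powr p) powr (1 / p))" if j: "j \<le> k" for j
  proof -
    let ?J = "\<lambda>u. LINT x|M_vol R \<phi>. tn j u x powr p"
    have J0: "?J u \<ge> 0" for u by (rule Bochner_Integration.integral_nonneg) simp
    have "?J u \<le> 2 powr p * (?J v + ?J ?d)" using ssob_diff(2)[OF v d p j] by simp
    then have "?J u powr (1 / p) \<le> (2 powr p * (?J v + ?J ?d)) powr (1 / p)" using J0 p by (intro powr_mono2) auto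
    also have "\<dots> = 2 * (?J v + ?J ?d) powr (1 / p)" using J0 p by (simp add: powr_mult powr_powr)
    also have "\<dots> \<le> 2 * (2 powr (1 / p) * (?J v powr (1 / p) + ?J ?d powr (1 / p)))"
      using J0 p by (intro mult_left_mono powr_add_le) auto
    also have "\<dots> \<le> 2 * (2 * (?J v powr (1 / p) + ?J ?d powr (1 / p)))"
    proof -
      have "2 powr (1 / p) \<le> 2 powr (1::real)" using p by (intro powr_mono) auto
      then show ?thesis by (intro mult_left_mono mult_right_mono) auto
    qed
    finally show ?thesis by simp
  qed
  then have "snorm k p u \<le> (\<Sum>j\<le>k. 4 * ((LINT x|M_vol R \<phi>. tn j ?d x powr p) powr (1 / p) + (LINT x|M_vol R \<phi>. tn j v x powr p) powr (1 / p)))"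
    unfolding snorm_eq by (intro sum_mono) auto
  then show ?thesis unfolding snorm_eq by (simp add: sum_distrib_left sum.distrib)
qed

lemma rad_deriv_measurable:
  assumes "smooth_on M (u :: real^'n::finite \<Rightarrow> real)"
  shows "rad_deriv j u \<in> borel_measurable (lebesgue_on (ball 0 R))"
  by (rule measurable_of_continuous_on_M[OF smooth_on_continuous_on[OF rad_deriv_smooth[OF assms]]])

lemma rad_deriv_Lp:
  obtains c where "c > 0" "\<And>(u :: real^'n::finite \<Rightarrow> real) k p j. u \<in> ssob k p \<Longrightarrow> p \<ge> 1 \<Longrightarrow> j \<le> k \<Longrightarrow>
    (\<integral>\<^sup>+x. ennreal (\<bar>rad_deriv j u x\<bar> powr p) * indicator (ball 0 R) x \<partial>lborel) \<le> ennreal (c * snorm k p u powr p)"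
proof -
  obtain c where c: "c > 0" "\<And>F. F \<in> borel_measurable (lebesgue_on (ball 0 R)) \<Longrightarrow>
      (\<integral>\<^sup>+x. F x * indicator (ball 0 R) x \<partial>lborel) \<le> ennreal c * (\<integral>\<^sup>+x. F x \<partial>(M_vol R \<phi> :: (real^'n) measure))"
    by (rule nn_integral_M_vol_bounds) (assumption | rule that)+
  show ?thesis
  proof (rule that[OF c(1)])
    fix u :: "real^'n \<Rightarrow> real" and k p j assume u: "u \<in> ssob k p" and p: "p \<ge> 1" and j: "j \<le> k"
    note su = ssob_smooth(1)[OF u]
    have "(\<integral>\<^sup>+x. ennreal (\<bar>rad_deriv j u x\<bar> powr p) * indicator (ball 0 R) x \<partial>lborel)
      \<le> ennreal c * (\<integral>\<^sup>+x. ennreal (\<bar>rad_deriv j u x\<bar> powr p) \<partial>M_vol R \<phi>)"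
      using rad_deriv_measurable[OF su, of j] by (intro c(2)) auto
    also have "\<dots> \<le> ennreal c * (\<integral>\<^sup>+x. ennreal (tn j u x powr p) \<partial>M_vol R \<phi>)"
    proof (intro mult_left_mono nn_integral_mono_AE)
      show "AE x in M_vol R \<phi>. ennreal (\<bar>rad_deriv j u x\<bar> powr p) \<le> ennreal (tn j u x powr p)"
        using AE_M_vol_M by eventually_elim (use p in \<open>auto intro!: ennreal_leI powr_mono2 rad_deriv_le\<close>)
    qed simp
    also have "(\<integral>\<^sup>+x. ennreal (tn j u x powr p) \<partial>M_vol R \<phi>) = ennreal (LINT x|M_vol R \<phi>. tn j u x powr p)"
      by (intro nn_integral_eq_integral ssob_integrable[OF u j]) auto
    also have "ennreal c * \<dots> \<le> ennreal c * ennreal (snorm k p u powr p)"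
      by (intro mult_left_mono ennreal_leI LINT_le_snorm j p) simp
    also have "\<dots> = ennreal (c * snorm k p u powr p)" using c(1) by (simp add: ennreal_mult)
    finally show "(\<integral>\<^sup>+x. ennreal (\<bar>rad_deriv j u x\<bar> powr p) * indicator (ball 0 R) x \<partial>lborel) \<le> ennreal (c * snorm k p u powr p)" .
  qed
qed

text \<open>Interpolation with threshold A on the ball of finite volume V gives a bound linear in A,
  which is what makes the increments summable.\<close>

lemma rad_deriv_L1:
  obtains c where "c > 0" "\<And>(u :: real^'n::finite \<Rightarrow> real) k p j A. u \<in> ssob k p \<Longrightarrow> p \<ge> 1 \<Longrightarrow> j \<le> k \<Longrightarrow> snorm k p u \<le> A \<Longrightarrow> A > 0 \<Longrightarrow>
    (\<integral>\<^sup>+x. ennreal \<bar>rad_deriv j u x\<bar> * indicator (ball 0 R) x \<partial>lborel) \<le> ennreal (c * A)"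
proof -
  obtain c where c: "c > 0" "\<And>(u :: real^'n \<Rightarrow> real) k p j. u \<in> ssob k p \<Longrightarrow> p \<ge> 1 \<Longrightarrow> j \<le> k \<Longrightarrow>
    (\<integral>\<^sup>+x. ennreal (\<bar>rad_deriv j u x\<bar> powr p) * indicator (ball 0 R) x \<partial>lborel) \<le> ennreal (c * snorm k p u powr p)"
    by (rule rad_deriv_Lp) (assumption | rule that)+
  define V where "V = measure lborel (ball (0::real^'n) R)"
  have V: "emeasure lborel (ball (0::real^'n) R) = ennreal V"
    unfolding V_def by (rule emeasure_eq_ennreal_measure) (use emeasure_lborel_ball_finite[of "0::real^'n" R] in \<open>simp add: less_top\<close>)
  show ?thesis
  proof (rule that[of "V + c"])
    show "V + c > 0" using c(1) by (simp add: V_def add_nonneg_pos)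
    fix u :: "real^'n \<Rightarrow> real" and k p j A assume u: "u \<in> ssob k p" and p: "p \<ge> 1" and j: "j \<le> k" and A: "snorm k p u \<le> A" "A > 0"
    note su = ssob_smooth(1)[OF u]
    have m: "(\<lambda>x. ennreal (\<bar>rad_deriv j u x\<bar> powr p)) \<in> borel_measurable (lebesgue_on (ball 0 R))"
      using rad_deriv_measurable[OF su, of j] by auto
    have "(\<integral>\<^sup>+x. ennreal \<bar>rad_deriv j u x\<bar> * indicator (ball 0 R) x \<partial>lborel)
      = (\<integral>\<^sup>+x. ennreal \<bar>rad_deriv j u x\<bar> \<partial>lebesgue_on (ball 0 R))"
      by (subst nn_integral_restrict_space) (auto simp: nn_integral_completion)
    also have "\<dots> \<le> (\<integral>\<^sup>+x. ennreal A + ennreal (A powr (1 - p)) * ennreal (\<bar>rad_deriv j u x\<bar> powr p) \<partial>lebesgue_on (ball 0 R))"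
    proof (rule nn_integral_mono)
      fix x
      have "\<bar>rad_deriv j u x\<bar> powr 1 \<le> A powr 1 + A powr (1 - p) * \<bar>rad_deriv j u x\<bar> powr p"
        using A p by (intro powr_interpolate) auto
      then have "ennreal \<bar>rad_deriv j u x\<bar> \<le> ennreal (A + A powr (1 - p) * \<bar>rad_deriv j u x\<bar> powr p)"
        using A by (intro ennreal_leI) simp
      then show "ennreal \<bar>rad_deriv j u x\<bar> \<le> ennreal A + ennreal (A powr (1 - p)) * ennreal (\<bar>rad_deriv j u x\<bar> powr p)"
        using A by (simp add: ennreal_mult)
    qed
    also have "\<dots> = (\<integral>\<^sup>+x. ennreal A \<partial>lebesgue_on (ball (0::real^'n) R)) + ennreal (A powr (1 - p)) * (\<integral>\<^sup>+x. ennreal (\<bar>rad_deriv j u x\<bar> powr p) \<partial>lebesgue_on (ball 0 R))"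
      using m by (subst nn_integral_add) (auto simp: nn_integral_cmult)
    also have "(\<integral>\<^sup>+x. ennreal A \<partial>lebesgue_on (ball (0::real^'n) R)) = ennreal A * ennreal V"
      using V by (simp add: emeasure_restrict_space)
    also have "(\<integral>\<^sup>+x. ennreal (\<bar>rad_deriv j u x\<bar> powr p) \<partial>lebesgue_on (ball 0 R))
      = (\<integral>\<^sup>+x. ennreal (\<bar>rad_deriv j u x\<bar> powr p) * indicator (ball 0 R) x \<partial>lborel)"
      by (subst nn_integral_restrict_space) (auto simp: nn_integral_completion)
    also have "ennreal A * ennreal V + ennreal (A powr (1 - p)) * \<dots> \<le> ennreal A * ennreal V + ennreal (A powr (1 - p)) * ennreal (c * A powr p)"
    proof (intro add_left_mono mult_left_mono)
      have "c * snorm k p u powr p \<le> c * A powr p"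
        using A c(1) p snorm_nonneg by (intro mult_left_mono powr_mono2) auto
      then show "(\<integral>\<^sup>+x. ennreal (\<bar>rad_deriv j u x\<bar> powr p) * indicator (ball 0 R) x \<partial>lborel) \<le> ennreal (c * A powr p)"
        using c(2)[OF u p j] by (meson ennreal_leI order_trans)
    qed simp
    also have "\<dots> = ennreal (A * V + A powr (1 - p) * (c * A powr p))"
      using A c(1) by (subst ennreal_plus) (auto simp: ennreal_mult V_def)
    also have "A powr (1 - p) * (c * A powr p) = c * A"
      using A by (simp add: powr_diff)
    finally show "(\<integral>\<^sup>+x. ennreal \<bar>rad_deriv j u x\<bar> * indicator (ball 0 R) x \<partial>lborel) \<le> ennreal ((V + c) * A)"
      by (simp add: algebra_simps)
  qed
qed

end

section \<open>Restriction to a ray\<close>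

lemma strict_mono_choice:
  assumes "\<And>n::nat. \<forall>\<^sub>F m::nat in sequentially. P n m"
  shows "\<exists>s. strict_mono s \<and> (\<forall>n. P n (s n))"
proof -
  have "\<exists>s. \<forall>n. P n (s n) \<and> s n < s (Suc n)"
  proof (rule dependent_nat_choice)
    show "\<exists>m. P 0 m" using assms[of 0] by (auto simp: eventually_sequentially)
    fix m n
    have "\<forall>\<^sub>F m' in sequentially. P (Suc n) m' \<and> m < m'"
      using assms[of "Suc n"] eventually_gt_at_top[of m] by eventually_elim simp
    then show "\<exists>m'. P (Suc n) m' \<and> m < m'" by (auto simp: eventually_sequentially)
  qed
  then show ?thesis by (auto simp: strict_mono_Suc_iff)
qed

context warped
begin

text \<open>The energy on the ray in direction w. \<open>sphere_measure\<close> lives on the whole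
  space, so the formula must be Borel for every w; the indicator of M cuts the integrand off where
  smoothness is not known and is harmless for unit vectors.\<close>

definition polar_wint :: "nat \<Rightarrow> (real^'n::finite \<Rightarrow> real) \<Rightarrow> real \<Rightarrow> real^'n \<Rightarrow> ennreal" where
  "polar_wint j u q w = (\<integral>\<^sup>+r. ennreal (r ^ (CARD('n) - 1)) * (ennreal (\<bar>rad_deriv j u (r *\<^sub>R w)\<bar> powr q) * indicator M (r *\<^sub>R w))
     * indicator {0<..<R} r \<partial>lborel)"

lemma polar_wint_integrand_measurable:
  assumes "smooth_on M (u :: real^'n::finite \<Rightarrow> real)"
  shows "(\<lambda>x. ennreal (\<bar>rad_deriv j u x\<bar> powr q) * indicator M x) \<in> borel_measurable borel"
proof -
  have [measurable]: "(\<lambda>x. indicator M x *\<^sub>R rad_deriv j u x) \<in> borel_measurable borel"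
    by (intro borel_measurable_continuous_on_indicator smooth_on_continuous_on rad_deriv_smooth assms) simp
  have [measurable]: "(M :: (real^'n) set) \<in> sets borel" by simp
  have "(\<lambda>x. ennreal (\<bar>indicator M x *\<^sub>R rad_deriv j u x\<bar> powr q) * indicator M x) \<in> borel_measurable borel"
    by measurable
  also have "(\<lambda>x. ennreal (\<bar>indicator M x *\<^sub>R rad_deriv j u x\<bar> powr q) * indicator M x)
    = (\<lambda>x. ennreal (\<bar>rad_deriv j u x\<bar> powr q) * indicator M x)"
    by (auto split: split_indicator)
  finally show ?thesis .
qed

lemma polar_wint_measurable:
  assumes "smooth_on M (u :: real^'n::finite \<Rightarrow> real)"
  shows "polar_wint j u q \<in> borel_measurable sphere_measure"
  using nn_integral_polar_measurable[OF R polar_wint_integrand_measurable[OF assms, of j q]]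
  by (simp add: polar_wint_def[abs_def] measurable_cong_sets[OF sets_sphere_measure refl])

lemma nn_integral_polar_wint:
  assumes "smooth_on M (u :: real^'n::finite \<Rightarrow> real)"
  shows "(\<integral>\<^sup>+w. polar_wint j u q w \<partial>sphere_measure)
    = (\<integral>\<^sup>+x. ennreal (\<bar>rad_deriv j u x\<bar> powr q) * indicator (ball 0 R) x \<partial>lborel)"
proof -
  have "(\<integral>\<^sup>+w. polar_wint j u q w \<partial>sphere_measure)
    = (\<integral>\<^sup>+x. ennreal (\<bar>rad_deriv j u x\<bar> powr q) * indicator M x * indicator (ball 0 R) x \<partial>lborel)"
    using nn_integral_polar(1)[OF R polar_wint_integrand_measurable[OF assms, of j q]]
    by (simp add: polar_wint_def)
  also have "\<dots> = (\<integral>\<^sup>+x. ennreal (\<bar>rad_deriv j u x\<bar> powr q) * indicator (ball 0 R) x \<partial>lborel)"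
    by (intro nn_integral_cong_AE) (use AE_M in \<open>auto elim!: eventually_mono split: split_indicator\<close>)
  finally show ?thesis .
qed

lemma polar_wint_eq:
  assumes w: "norm (w :: real^'n::finite) = 1"
  shows "polar_wint j u q w = wint R (real CARD('n) - 1) q (\<lambda>r. rad_deriv j u (r *\<^sub>R w))"
  unfolding polar_wint_def wint_def
proof (rule nn_integral_cong)
  fix r :: real
  have "r ^ (CARD('n) - 1) = r powr (real CARD('n) - 1)" if "0 < r"
    using that by (simp add: powr_realpow[symmetric] of_nat_diff Suc_leI)
  moreover have "r *\<^sub>R w \<in> M" if "0 < r" "r < R" using that w by (intro M_I) auto
  ultimately show "ennreal (r ^ (CARD('n) - 1)) * (ennreal (\<bar>rad_deriv j u (r *\<^sub>R w)\<bar> powr q) * indicator M (r *\<^sub>R w)) * indicator {0<..<R} r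
    = ennreal (r powr (real CARD('n) - 1) * \<bar>rad_deriv j u (r *\<^sub>R w)\<bar> powr q) * indicator {0<..<R} r"
    by (auto simp: ennreal_mult split: split_indicator)
qed

lemma ssob_Lp:
  assumes "(u :: real^'n::finite \<Rightarrow> real) \<in> ssob k p"
  shows "u \<in> borel_measurable (M_vol R \<phi>)" "integrable (M_vol R \<phi>) (\<lambda>x. \<bar>u x\<bar> powr p)"
proof -
  show m: "u \<in> borel_measurable (M_vol R \<phi>)" unfolding measurable_M_vol
    by (intro measurable_of_continuous_on_M smooth_on_continuous_on ssob_smooth(1)[OF assms])
  note [measurable] = m
  have "(\<lambda>x. \<bar>u x\<bar> powr p) \<in> borel_measurable (M_vol R \<phi>)" by measurable
  moreover have "AE x in M_vol R \<phi>. tn 0 u x powr p = \<bar>u x\<bar> powr p"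
    using AE_M_vol_M by eventually_elim (simp only: tn_0)
  ultimately show "integrable (M_vol R \<phi>) (\<lambda>x. \<bar>u x\<bar> powr p)"
    by (intro integrable_cong_AE_imp[OF ssob_integrable[OF assms, of 0]]) simp_all
qed

text \<open>The geometric rate makes the sum of the p-th powers integrable, so it is finite almost
  everywhere and its terms tend to 0.\<close>

lemma AE_tendsto_of_Lw_norm:
  fixes u :: "real^'n::finite \<Rightarrow> real"
  assumes p: "p \<ge> 1" and g: "\<And>n. g n \<in> ssob k p" and u: "u \<in> Lw_space (M_vol R \<phi>) (\<lambda>_. 1) p"
    and small: "\<And>n. Lw_norm (M_vol R \<phi>) (\<lambda>_. 1) p (\<lambda>x. g n x - u x) < (1 / 2) ^ n"
  shows "AE x in M_vol R \<phi>. (\<lambda>n. g n x) \<longlonglongrightarrow> u x"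
proof -
  have um: "u \<in> borel_measurable (M_vol R \<phi>)" and ui: "integrable (M_vol R \<phi>) (\<lambda>x. \<bar>u x\<bar> powr p)"
    using u by (simp_all add: Lw_space_def)
  note [measurable] = um ssob_Lp(1)[OF g]
  have m: "(\<lambda>x. \<bar>g n x - u x\<bar> powr p) \<in> borel_measurable (M_vol R \<phi>)" for n by measurable
  have int: "integrable (M_vol R \<phi>) (\<lambda>x. \<bar>g n x - u x\<bar> powr p)" for n
  proof (rule Bochner_Integration.integrable_bound[OF _ m])
    show "integrable (M_vol R \<phi>) (\<lambda>x. 2 powr p * (\<bar>g n x\<bar> powr p + \<bar>u x\<bar> powr p))"
      using ssob_Lp(2)[OF g] ui by auto
    have "\<bar>g n x - u x\<bar> powr p \<le> 2 powr p * (\<bar>g n x\<bar> powr p + \<bar>u x\<bar> powr p)" for x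
    proof -
      have "\<bar>g n x - u x\<bar> powr p \<le> (\<bar>g n x\<bar> + \<bar>u x\<bar>) powr p" using p by (intro powr_mono2) auto
      also have "\<dots> \<le> 2 powr p * (\<bar>g n x\<bar> powr p + \<bar>u x\<bar> powr p)" using p by (intro powr_add_le) auto
      finally show ?thesis .
    qed
    then show "AE x in M_vol R \<phi>. norm (\<bar>g n x - u x\<bar> powr p) \<le> norm (2 powr p * (\<bar>g n x\<bar> powr p + \<bar>u x\<bar> powr p))"
      by simp
  qed
  have le: "(\<integral>\<^sup>+x. ennreal (\<bar>g n x - u x\<bar> powr p) \<partial>M_vol R \<phi>) \<le> ennreal ((1 / 2) ^ n)" for n
  proof -
    let ?J = "LINT x|M_vol R \<phi>. \<bar>g n x - u x\<bar> powr p"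
    have J: "?J \<ge> 0" by (rule Bochner_Integration.integral_nonneg) simp
    have "?J powr (1 / p) < (1 / 2) ^ n" using small[of n] by (simp add: Lw_norm_def)
    then have "(?J powr (1 / p)) powr p \<le> ((1 / 2) ^ n) powr p" using p by (intro powr_mono2) auto
    also have "\<dots> \<le> ((1 / 2) ^ n) powr 1" using p by (intro powr_mono') (auto simp: power_le_one)
    finally have "?J \<le> (1 / 2) ^ n" using J p by (simp add: powr_powr)
    then show ?thesis using int[of n] by (subst nn_integral_eq_integral) (auto intro: ennreal_leI)
  qed
  have "(\<integral>\<^sup>+x. (\<Sum>n. ennreal (\<bar>g n x - u x\<bar> powr p)) \<partial>M_vol R \<phi>) = (\<Sum>n. \<integral>\<^sup>+x. ennreal (\<bar>g n x - u x\<bar> powr p) \<partial>M_vol R \<phi>)"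
    using m by (intro nn_integral_suminf) auto
  also have "\<dots> \<le> (\<Sum>n. ennreal ((1 / 2) ^ n))" by (intro suminf_le le) auto
  also have "\<dots> = ennreal (\<Sum>n. (1 / 2) ^ n)" by (intro suminf_ennreal2) (auto intro: summable_geometric)
  finally have fin: "(\<integral>\<^sup>+x. (\<Sum>n. ennreal (\<bar>g n x - u x\<bar> powr p)) \<partial>M_vol R \<phi>) \<noteq> \<infinity>" by (auto simp: top_unique)
  have "AE x in M_vol R \<phi>. (\<Sum>n. ennreal (\<bar>g n x - u x\<bar> powr p)) \<noteq> \<infinity>"
    by (rule nn_integral_PInf_AE[OF _ fin])
      (intro borel_measurable_suminf_order measurable_compose[OF m measurable_ennreal])
  then show ?thesis
  proof eventually_elim
    case (elim x)
    then have "summable (\<lambda>n. \<bar>g n x - u x\<bar> powr p)" by (intro summable_suminf_not_top) auto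
    then have "(\<lambda>n. \<bar>g n x - u x\<bar> powr p) \<longlonglongrightarrow> 0" by (rule summable_LIMSEQ_zero)
    then have "(\<lambda>n. (\<bar>g n x - u x\<bar> powr p) powr (1 / p)) \<longlonglongrightarrow> 0 powr (1 / p)"
      using p by (intro tendsto_powr') auto
    then have "(\<lambda>n. \<bar>g n x - u x\<bar>) \<longlonglongrightarrow> 0" using p by (simp add: powr_powr)
    then have "(\<lambda>n. g n x - u x) \<longlonglongrightarrow> 0" by (rule tendsto_rabs_zero_cancel)
    then show ?case by (simp add: LIM_zero_iff)
  qed
qed

text \<open>Turns membership in the completion into data on one ray. Several requirements hold for
  almost every direction; the energy bound holds for a set of directions of positive measure,
  because it cannot fail almost everywhere. Any direction with all properties will do, as u has the
  same profile on almost all rays.\<close>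

lemma W_rad_cauchy_chain:
  assumes p: "p \<ge> 1" and k: "k \<ge> 1"
  obtains C where "C > 0"
    "\<And>(u :: real^'n::finite \<Rightarrow> real) us A. u \<in> W_rad R \<phi> k p \<Longrightarrow> sobolev_rep (warped_metric \<phi>) (ball 0 R) k p us u \<Longrightarrow> A > 0 \<Longrightarrow>
      (\<forall>\<^sub>F n in sequentially. snorm k p (us n) < A) \<Longrightarrow>
      \<exists>h a. cauchy_chain R (real CARD('n)) k h a \<and>
        (\<exists>\<^sub>F n in sequentially. energy R (real CARD('n)) p k (h n) \<le> ennreal ((C * A) powr p)) \<and>
        (AE x in lborel. x \<in> ball 0 R \<longrightarrow> u x = cauchy_chain.w R h 0 (norm x)) \<and>
        (\<forall>n. \<exists>l. (h n 0 \<longlongrightarrow> l) (at_right 0))"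
proof -
  let ?N = "real CARD('n)" and ?\<sigma> = "sphere_measure :: (real^'n) measure"
  obtain c where c: "c > 0" "\<And>(u :: real^'n \<Rightarrow> real) k p j. u \<in> ssob k p \<Longrightarrow> p \<ge> 1 \<Longrightarrow> j \<le> k \<Longrightarrow>
    (\<integral>\<^sup>+x. ennreal (\<bar>rad_deriv j u x\<bar> powr p) * indicator (ball 0 R) x \<partial>lborel) \<le> ennreal (c * snorm k p u powr p)"
    by (rule rad_deriv_Lp) (assumption | rule that)+
  obtain c' where c': "c' > 0" "\<And>(u :: real^'n \<Rightarrow> real) k p j A. u \<in> ssob k p \<Longrightarrow> p \<ge> 1 \<Longrightarrow> j \<le> k \<Longrightarrow> snorm k p u \<le> A \<Longrightarrow> A > 0 \<Longrightarrow>
    (\<integral>\<^sup>+x. ennreal \<bar>rad_deriv j u x\<bar> * indicator (ball 0 R) x \<partial>lborel) \<le> ennreal (c' * A)"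
    by (rule rad_deriv_L1) (assumption | rule that)+
  interpret S: finite_measure ?\<sigma> by (rule finite_sphere_measure)
  define s0 where "s0 = measure ?\<sigma> UNIV"
  have s0: "emeasure ?\<sigma> UNIV = ennreal s0" unfolding s0_def by (rule S.emeasure_eq_measure)
  have s0pos: "s0 > 0" using sphere_measure_pos[where 'a="real^'n"] s0 by simp
  \<comment> \<open>Q A^p bounds the sum of the k + 1 energies integrated over the sphere. The
    factor 2 in C puts the threshold strictly above the mean energy per direction.\<close>
  define Q where "Q = (real k + 1) * c"
  have Q: "Q > 0" using c(1) by (simp add: Q_def add_nonneg_pos)
  define C where "C = (2 * Q / s0) powr (1 / p)"
  have C: "C > 0" using Q s0pos by (simp add: C_def)
  have Cp: "(C * A) powr p = 2 * Q / s0 * A powr p" if "A > 0" for A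
    using that Q s0pos p by (simp add: C_def powr_mult powr_powr)
  show ?thesis
  proof (rule that[OF C])
    fix u :: "real^'n \<Rightarrow> real" and us A
    assume uW: "u \<in> W_rad R \<phi> k p" and rep: "sobolev_rep (warped_metric \<phi>) (ball 0 R) k p us u"
      and A: "A > 0" and evA: "\<forall>\<^sub>F n in sequentially. snorm k p (us n) < A"
    have us: "us n \<in> ssob k p" for n using rep by (simp add: sobolev_rep_def)
    have cau: "\<exists>n0. \<forall>m\<ge>n0. \<forall>n\<ge>n0. snorm k p (\<lambda>x. us m x - us n x) < e" if "e > 0" for e
      using rep that by (simp add: sobolev_rep_def)
    have uL: "u \<in> Lw_space (M_vol R \<phi>) (\<lambda>_. 1) p"
      and Llim: "(\<lambda>n. Lw_norm (M_vol R \<phi>) (\<lambda>_. 1) p (\<lambda>x. us n x - u x)) \<longlonglongrightarrow> 0"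
      using rep by (simp_all add: sobolev_rep_def M_vol_def)
    \<comment> \<open>One increasing choice of indices secures the geometric rate in the Sobolev
      norm, the level A, and the geometric rate in L^p.\<close>
    define P where "P n m \<longleftrightarrow> (\<forall>i\<ge>m. \<forall>j\<ge>m. snorm k p (\<lambda>x. us i x - us j x) < (1 / 2) ^ n) \<and> snorm k p (us m) < A
      \<and> Lw_norm (M_vol R \<phi>) (\<lambda>_. 1) p (\<lambda>x. us m x - u x) < (1 / 2) ^ n" for n m
    have "\<forall>\<^sub>F m in sequentially. P n m" for n
    proof -
      obtain n0 where n0: "\<forall>i\<ge>n0. \<forall>j\<ge>n0. snorm k p (\<lambda>x. us i x - us j x) < (1 / 2) ^ n" using cau[of "(1/2)^n"] by auto
      have "\<forall>\<^sub>F m in sequentially. Lw_norm (M_vol R \<phi>) (\<lambda>_. 1) p (\<lambda>x. us m x - u x) < (1 / 2) ^ n"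
        by (rule order_tendstoD(2)[OF Llim]) simp
      with eventually_ge_at_top[of n0] evA show ?thesis
        by eventually_elim (use n0 in \<open>auto simp: P_def\<close>)
    qed
    then obtain s where s: "strict_mono s" "\<And>n. P n (s n)" using strict_mono_choice[of P] by blast
    define g where "g n = us (s n)" for n
    have g: "g n \<in> ssob k p" "snorm k p (g n) < A" for n using us s(2)[of n] by (auto simp: g_def P_def)
    have gL: "Lw_norm (M_vol R \<phi>) (\<lambda>_. 1) p (\<lambda>x. g n x - u x) < (1 / 2) ^ n" for n using s(2)[of n] by (auto simp: g_def P_def)
    define D where "D n x = g (Suc n) x - g n x" for n x
    have D: "D n \<in> ssob k p" "snorm k p (D n) \<le> (1 / 2) ^ n" for n
    proof -
      show "D n \<in> ssob k p" unfolding D_def[abs_def] by (rule ssob_diff(1)[OF g(1) g(1) p])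
      have "s n \<le> s (Suc n)" using s(1) by (simp add: strict_mono_Suc_iff less_imp_le)
      then show "snorm k p (D n) \<le> (1 / 2) ^ n" using s(2)[of n] unfolding P_def D_def[abs_def] g_def by (auto intro: less_imp_le)
    qed
    note sg = ssob_smooth(1)[OF g(1)] and sD = ssob_smooth(1)[OF D(1)]
    have int1: "(\<integral>\<^sup>+w. polar_wint j f 1 w \<partial>?\<sigma>) \<le> ennreal (c' * B)" if "f \<in> ssob k p" "snorm k p f \<le> B" "B > 0" "j \<le> k" for f j B
      unfolding nn_integral_polar_wint[OF ssob_smooth(1)[OF that(1)]] using c'(2)[OF that(1) p that(4,2,3)] by simp
    have AEa: "AE w in ?\<sigma>. (\<Sum>n. \<Sum>j\<le>k. polar_wint j (D n) 1 w) \<noteq> \<infinity>"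
    proof (rule nn_integral_PInf_AE)
      show "(\<lambda>w. \<Sum>n. \<Sum>j\<le>k. polar_wint j (D n) 1 w) \<in> borel_measurable ?\<sigma>"
        by (intro borel_measurable_suminf_order borel_measurable_sum polar_wint_measurable sD)
      have "(\<integral>\<^sup>+w. (\<Sum>n. \<Sum>j\<le>k. polar_wint j (D n) 1 w) \<partial>?\<sigma>) = (\<Sum>n. \<integral>\<^sup>+w. (\<Sum>j\<le>k. polar_wint j (D n) 1 w) \<partial>?\<sigma>)"
        by (intro nn_integral_suminf borel_measurable_sum polar_wint_measurable sD)
      also have "\<dots> = (\<Sum>n. \<Sum>j\<le>k. \<integral>\<^sup>+w. polar_wint j (D n) 1 w \<partial>?\<sigma>)"
        by (intro suminf_cong nn_integral_sum polar_wint_measurable sD)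
      also have "\<dots> \<le> (\<Sum>n. ennreal (\<Sum>j\<le>k. c' * (1 / 2) ^ n))"
      proof (intro suminf_le)
        fix n
        have "(\<Sum>j\<le>k. \<integral>\<^sup>+w. polar_wint j (D n) 1 w \<partial>?\<sigma>) \<le> (\<Sum>j\<le>k. ennreal (c' * (1 / 2) ^ n))"
          by (intro sum_mono int1 D) auto
        also have "\<dots> = ennreal (\<Sum>j\<le>k. c' * (1 / 2) ^ n)"
          using c'(1) by (intro sum_ennreal) auto
        finally show "(\<Sum>j\<le>k. \<integral>\<^sup>+w. polar_wint j (D n) 1 w \<partial>?\<sigma>) \<le> ennreal (\<Sum>j\<le>k. c' * (1 / 2) ^ n)" .
      qed auto
      also have "\<dots> = ennreal (\<Sum>n. \<Sum>j\<le>k. c' * (1 / 2) ^ n)"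
        using c'(1) by (intro suminf_ennreal2 summable_sum sum_nonneg summable_mult summable_geometric) auto
      finally show "(\<integral>\<^sup>+w. (\<Sum>n. \<Sum>j\<le>k. polar_wint j (D n) 1 w) \<partial>?\<sigma>) \<noteq> \<infinity>" by (auto simp: top_unique)
    qed
    have AEb: "AE w in ?\<sigma>. (\<Sum>j\<le>k. polar_wint j (g 0) 1 w) \<noteq> \<infinity>"
    proof (rule nn_integral_PInf_AE)
      show "(\<lambda>w. \<Sum>j\<le>k. polar_wint j (g 0) 1 w) \<in> borel_measurable ?\<sigma>"
        by (intro borel_measurable_sum polar_wint_measurable sg)
      have "(\<integral>\<^sup>+w. (\<Sum>j\<le>k. polar_wint j (g 0) 1 w) \<partial>?\<sigma>) = (\<Sum>j\<le>k. \<integral>\<^sup>+w. polar_wint j (g 0) 1 w \<partial>?\<sigma>)"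
        by (intro nn_integral_sum polar_wint_measurable sg)
      also have "\<dots> \<le> (\<Sum>j\<le>k. ennreal (c' * A))" using g[of 0] A by (intro sum_mono int1) auto
      also have "\<dots> = ennreal (\<Sum>j\<le>k. c' * A)" using c'(1) A by (intro sum_ennreal) auto
      finally show "(\<integral>\<^sup>+w. (\<Sum>j\<le>k. polar_wint j (g 0) 1 w) \<partial>?\<sigma>) \<noteq> \<infinity>" by (auto simp: top_unique)
    qed
    define E where "E n w = (\<Sum>l\<le>k. polar_wint l (g n) p w)" for n w
    have mE: "E n \<in> borel_measurable ?\<sigma>" for n
      unfolding E_def[abs_def] by (intro borel_measurable_sum polar_wint_measurable sg)
    have intE: "(\<integral>\<^sup>+w. E n w \<partial>?\<sigma>) \<le> ennreal (Q * A powr p)" for n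
    proof -
      have "(\<integral>\<^sup>+w. E n w \<partial>?\<sigma>) = (\<Sum>l\<le>k. \<integral>\<^sup>+w. polar_wint l (g n) p w \<partial>?\<sigma>)"
        unfolding E_def by (intro nn_integral_sum polar_wint_measurable sg)
      also have "\<dots> \<le> (\<Sum>l\<le>k. ennreal (c * A powr p))"
      proof (rule sum_mono)
        fix l assume "l \<in> {..k}"
        then have "(\<integral>\<^sup>+w. polar_wint l (g n) p w \<partial>?\<sigma>) \<le> ennreal (c * snorm k p (g n) powr p)"
          unfolding nn_integral_polar_wint[OF sg] using c(2)[OF g(1) p] by simp
        also have "\<dots> \<le> ennreal (c * A powr p)"
          using c(1) g(2)[of n] p snorm_nonneg by (intro ennreal_leI mult_left_mono powr_mono2) (auto intro: less_imp_le)
        finally show "(\<integral>\<^sup>+w. polar_wint l (g n) p w \<partial>?\<sigma>) \<le> ennreal (c * A powr p)" .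
      qed
      also have "\<dots> = ennreal (\<Sum>l\<le>k. c * A powr p)" using c(1) by (intro sum_ennreal) auto
      also have "(\<Sum>l\<le>k. c * A powr p) = Q * A powr p" by (simp add: Q_def algebra_simps)
      finally show ?thesis .
    qed
    let ?B = "ennreal ((C * A) powr p)"
    \<comment> \<open>By Fatou's lemma the lower limit of the energies has integral at most Q A^p
      over the sphere, while the constant on the left integrates to 2 Q A^p.\<close>
    have notAE: "\<not> (AE w in ?\<sigma>. ?B \<le> liminf (\<lambda>n. E n w))"
    proof
      assume "AE w in ?\<sigma>. ?B \<le> liminf (\<lambda>n. E n w)"
      then have "(\<integral>\<^sup>+w. ?B \<partial>?\<sigma>) \<le> (\<integral>\<^sup>+w. liminf (\<lambda>n. E n w) \<partial>?\<sigma>)" by (rule nn_integral_mono_AE)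
      also have "\<dots> \<le> liminf (\<lambda>n. \<integral>\<^sup>+w. E n w \<partial>?\<sigma>)" by (rule nn_integral_liminf[OF mE])
      also have "\<dots> \<le> ennreal (Q * A powr p)" by (rule liminf_frequently_le) (simp add: intE)
      also have "(\<integral>\<^sup>+w. ?B \<partial>?\<sigma>) = ennreal (2 * Q * A powr p)"
        unfolding Cp[OF A] using s0 s0pos Q by (simp add: ennreal_mult[symmetric])
      finally have "2 * Q * A powr p \<le> Q * A powr p" using Q by (subst (asm) ennreal_le_iff) auto
      then show False using Q A by simp
    qed
    obtain vv where vv: "AE x in M_vol R \<phi>. u x = vv (norm x)"
    proof -
      obtain rw where rw: "radial R rw" "AE x in M_vol R \<phi>. u x = rw x" using uW by (auto simp: W_rad_def)
      then obtain v where v: "\<forall>x\<in>M. rw x = v (norm x)" by (auto simp: radial_def M_def)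
      have "AE x in M_vol R \<phi>. u x = v (norm x)" using AE_M_vol_M rw(2) by eventually_elim (use v in auto)
      then show thesis using that[of v] by simp
    qed
    have "AE x in M_vol R \<phi>. (\<lambda>n. g n x) \<longlonglongrightarrow> u x" by (rule AE_tendsto_of_Lw_norm[OF p g(1) uL gL])
    then have "AE x in M_vol R \<phi>. (\<lambda>n. g n x) \<longlonglongrightarrow> vv (norm x)" using vv by eventually_elim simp
    \<comment> \<open>Radiality enters here: the limit along the ray is the same profile vv for
      almost every direction.\<close>
    then have AEd: "AE w in ?\<sigma>. AE r in lborel. 0 < r \<and> r < R \<longrightarrow> (\<lambda>n. g n (r *\<^sub>R w)) \<longlonglongrightarrow> vv (norm (r *\<^sub>R w))"
      unfolding AE_M_vol by (rule AE_polar[OF R])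
    define G where "G w \<longleftrightarrow> norm w = 1 \<and> (\<Sum>n. \<Sum>j\<le>k. polar_wint j (D n) 1 w) \<noteq> \<infinity> \<and> (\<Sum>j\<le>k. polar_wint j (g 0) 1 w) \<noteq> \<infinity> \<and>
        (AE r in lborel. 0 < r \<and> r < R \<longrightarrow> (\<lambda>n. g n (r *\<^sub>R w)) \<longlonglongrightarrow> vv (norm (r *\<^sub>R w)))" for w
    have AEG: "AE w in ?\<sigma>. G w"
      using AE_sphere_measure AEa AEb AEd unfolding G_def by eventually_elim simp
    have "\<exists>w. G w \<and> \<not> ?B \<le> liminf (\<lambda>n. E n w)"
    proof (rule ccontr)
      assume "\<not> (\<exists>w. G w \<and> \<not> ?B \<le> liminf (\<lambda>n. E n w))"
      then have "AE w in ?\<sigma>. ?B \<le> liminf (\<lambda>n. E n w)" using AEG by (auto elim: eventually_mono)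
      then show False using notAE by simp
    qed
    then obtain w where w: "norm w = 1" "(\<Sum>n. \<Sum>j\<le>k. polar_wint j (D n) 1 w) \<noteq> \<infinity>" "(\<Sum>j\<le>k. polar_wint j (g 0) 1 w) \<noteq> \<infinity>"
      "AE r in lborel. 0 < r \<and> r < R \<longrightarrow> (\<lambda>n. g n (r *\<^sub>R w)) \<longlonglongrightarrow> vv (norm (r *\<^sub>R w))"
      "\<not> ?B \<le> liminf (\<lambda>n. E n w)"
      unfolding G_def by blast
    define h where "h n j r = rad_deriv j (g n) (r *\<^sub>R w)" for n j r
    define a where "a n = enn2real (\<Sum>j\<le>k. polar_wint j (D n) 1 w)" for n
    have afin: "(\<Sum>j\<le>k. polar_wint j (D n) 1 w) \<noteq> \<infinity>" for n
    proof
      assume "(\<Sum>j\<le>k. polar_wint j (D n) 1 w) = \<infinity>"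
      moreover have "(\<Sum>j\<le>k. polar_wint j (D n) 1 w) \<le> (\<Sum>n. \<Sum>j\<le>k. polar_wint j (D n) 1 w)"
        using sum_le_suminf[of "\<lambda>n. \<Sum>j\<le>k. polar_wint j (D n) 1 w" "{n}"] by simp
      ultimately show False using w(2) by (simp only: infinity_ennreal_def top_unique)
    qed
    have aeq: "ennreal (a n) = (\<Sum>j\<le>k. polar_wint j (D n) 1 w)" for n
      unfolding a_def using afin[of n] by (simp add: less_top)
    have chain: "cauchy_chain R ?N k h a"
    proof
      show "0 < R" by (rule R)
      have "0 < CARD('n)" by (rule zero_less_card_finite)
      then show "1 \<le> ?N" by linarith
      show "deriv_chain R k (h n)" for n
        unfolding deriv_chain_def h_def using rad_deriv_has_derivative[OF sg w(1)] by blast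
      show "wint R (?N - 1) 1 (h 0 j) < \<infinity>" if "j \<le> k" for j
      proof -
        have "polar_wint j (g 0) 1 w \<le> (\<Sum>j\<le>k. polar_wint j (g 0) 1 w)" using that by (intro member_le_sum) auto
        also have "\<dots> < \<infinity>" using w(3) by (simp add: less_top)
        finally show ?thesis by (simp add: polar_wint_eq[OF w(1)] h_def[abs_def])
      qed
      show "wint R (?N - 1) 1 (\<lambda>r. h (Suc n) j r - h n j r) \<le> ennreal (a n)" if j: "j \<le> k" for n j
      proof -
        have "wint R (?N - 1) 1 (\<lambda>r. h (Suc n) j r - h n j r) = wint R (?N - 1) 1 (\<lambda>r. rad_deriv j (D n) (r *\<^sub>R w))"
          unfolding wint_def
        proof (rule nn_integral_cong)
          fix r :: real
          have "rad_deriv j (D n) (r *\<^sub>R w) = h (Suc n) j r - h n j r" if "0 < r" "r < R"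
            unfolding h_def D_def[abs_def] using that w(1) by (intro rad_deriv_diff sg M_I) auto
          then show "ennreal (r powr (?N - 1) * \<bar>h (Suc n) j r - h n j r\<bar> powr 1) * indicator {0<..<R} r
            = ennreal (r powr (?N - 1) * \<bar>rad_deriv j (D n) (r *\<^sub>R w)\<bar> powr 1) * indicator {0<..<R} r"
            by (auto split: split_indicator)
        qed
        also have "\<dots> = polar_wint j (D n) 1 w" by (simp add: polar_wint_eq[OF w(1)])
        also have "\<dots> \<le> ennreal (a n)" unfolding aeq using j by (intro member_le_sum) auto
        finally show ?thesis .
      qed
      show a0: "0 \<le> a n" for n by (simp add: a_def)
      show "summable a" by (rule summable_suminf_not_top[OF a0]) (use w(2) in \<open>simp add: aeq\<close>)
    qed
    interpret cc: cauchy_chain R ?N k h a by (rule chain)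
    \<comment> \<open>If the energies were eventually at least the threshold, so would be their
      lower limit, contrary to the choice of w.\<close>
    have freq: "\<exists>\<^sub>F n in sequentially. energy R ?N p k (h n) \<le> ?B"
    proof -
      have E: "E n w = energy R ?N p k (h n)" for n
        unfolding E_def energy_def h_def[abs_def] by (simp add: polar_wint_eq[OF w(1)])
      have "\<not> (\<forall>\<^sub>F n in sequentially. ?B \<le> E n w)"
        using w(5) Liminf_bounded[of ?B "\<lambda>n. E n w" sequentially] by blast
      then have "\<exists>\<^sub>F n in sequentially. \<not> ?B \<le> E n w" by (simp add: frequently_def)
      then show ?thesis unfolding E by (rule frequently_elim1) simp
    qed
    have AEv: "AE r in lborel. 0 < r \<and> r < R \<longrightarrow> vv r = cauchy_chain.w R h 0 r"
      using w(4)
    proof eventually_elim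
      case (elim r)
      show ?case
      proof
        assume r: "0 < r \<and> r < R"
        have "(\<lambda>n. h n 0 r) \<longlonglongrightarrow> vv r" using elim r w(1) by (simp add: h_def rad_deriv_0)
        moreover have "(\<lambda>n. h n 0 r) \<longlonglongrightarrow> cc.w 0 r" using cc.v_tendsto[of 0 r] r k by (simp add: cc.w_eq)
        ultimately show "vv r = cauchy_chain.w R h 0 r" by (rule LIMSEQ_unique)
      qed
    qed
    have "AE x in lborel. x \<in> ball 0 R \<longrightarrow> u x = vv (norm x)" using vv unfolding AE_M_vol .
    with AE_norm[OF R AEv, where 'a="real^'n"] have AEu: "AE x in lborel. x \<in> ball 0 R \<longrightarrow> u x = cauchy_chain.w R h 0 (norm x)"
      by eventually_elim simp
    \<comment> \<open>The approximants are continuous at the origin itself; this is kept for the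
      endpoint case, where the profile must extend continuously to r = 0.\<close>
    have lim0: "\<exists>l. (h n 0 \<longlongrightarrow> l) (at_right 0)" for n
    proof -
      have "continuous (at 0) (g n)"
        using ssob_smooth(2)[OF g(1)[of n]] R by (simp add: continuous_on_eq_continuous_at)
      then have c0: "(g n \<longlongrightarrow> g n 0) (at 0)" by (simp add: isCont_def)
      have f0: "filterlim (\<lambda>r::real. r *\<^sub>R w) (at 0) (at_right 0)"
      proof (rule filterlim_atI)
        have "((\<lambda>r::real. r *\<^sub>R w) \<longlongrightarrow> 0 *\<^sub>R w) (at_right 0)" by (intro tendsto_intros)
        then show "((\<lambda>r::real. r *\<^sub>R w) \<longlongrightarrow> 0) (at_right 0)" by simp
        show "\<forall>\<^sub>F r in at_right 0. r *\<^sub>R w \<noteq> 0"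
          using w(1) by (auto simp: eventually_at_right_field intro!: exI[of _ 1])
      qed
      have "((\<lambda>r. g n (r *\<^sub>R w)) \<longlongrightarrow> g n 0) (at_right 0)" by (rule filterlim_compose[OF c0 f0])
      then show ?thesis by (auto simp: h_def[abs_def] rad_deriv_0)
    qed
    show "\<exists>h a. cauchy_chain R ?N k h a \<and> (\<exists>\<^sub>F n in sequentially. energy R ?N p k (h n) \<le> ?B) \<and>
        (AE x in lborel. x \<in> ball 0 R \<longrightarrow> u x = cauchy_chain.w R h 0 (norm x)) \<and> (\<forall>n. \<exists>l. (h n 0 \<longlongrightarrow> l) (at_right 0))"
      using chain freq AEu lim0 by blast
  qed
qed

end

section \<open>Differentiability of radial functions\<close>

lemma has_real_derivative_partial:
  assumes "f differentiable (at x)"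
  shows "((\<lambda>t. f (x + t *\<^sub>R axis i 1)) has_real_derivative partial i f x) (at 0)"
proof -
  obtain E where E: "(f has_derivative E) (at x)" using assms by (auto simp: differentiable_def)
  show ?thesis using has_derivative_partial[OF E] by (simp add: partial_eq[OF E])
qed

text \<open>By the chain rule the derivative of \<open>w\<^sub>0(\<bar>x\<bar>)\<close> for the multi-index \<open>I\<close> is
  \<open>\<Sum>\<^sub>j w\<^sub>j(\<bar>x\<bar>) c\<^sub>I\<^sub>,\<^sub>j(x)\<close> with \<open>w\<^sub>j\<close> the \<open>j\<close>-th derivative of \<open>w\<^sub>0\<close>; the recursion
  below is the one for the coefficients \<open>c\<^sub>I\<^sub>,\<^sub>j\<close>.\<close>

primrec rad_coeff :: "'n::finite list \<Rightarrow> nat \<Rightarrow> real^'n \<Rightarrow> real" where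
  "rad_coeff [] j x = (if j = 0 then 1 else 0)"
| "rad_coeff (i # I) j x = partial i (rad_coeff I j) x + (if j = 0 then 0 else rad_coeff I (j - 1) x * (x $ i * (1 / norm x)))"

lemma open_punctured: "open (- {0::real^'n::finite})"
  by (simp add: open_Compl)

lemma smooth_rad_coeff: "smooth_on (- {0}) (rad_coeff I j :: real^'n::finite \<Rightarrow> real)"
proof (induction I arbitrary: j)
  case Nil
  then show ?case by (cases "j = 0") simp_all
next
  case (Cons i I)
  have n: "smooth_on (- {0}) (\<lambda>x::real^'n. x $ i * (1 / norm x))"
    by (intro smooth_on_mult smooth_on_component smooth_on_inverse smooth_on_norm open_punctured) auto
  show ?case
  proof (cases "j = 0")
    case True
    then have "rad_coeff (i # I) j = partial i (rad_coeff I j)" by (simp add: fun_eq_iff)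
    then show ?thesis using smooth_on_partial[OF Cons.IH] by simp
  next
    case False
    then have "rad_coeff (i # I) j = (\<lambda>x. partial i (rad_coeff I j) x + rad_coeff I (j - 1) x * (x $ i * (1 / norm x)))"
      by (simp add: fun_eq_iff)
    then show ?thesis
      using smooth_on_add[OF open_punctured smooth_on_partial[OF Cons.IH] smooth_on_mult[OF open_punctured Cons.IH n]] by simp
  qed
qed

lemma rad_coeff_zero: "length I < j \<Longrightarrow> x \<noteq> 0 \<Longrightarrow> rad_coeff I j (x::real^'n::finite) = 0"
proof (induction I arbitrary: j x)
  case (Cons i I)
  have "partial i (rad_coeff I j) x = partial i (\<lambda>_. 0) x"
    by (rule partial_cong[OF open_punctured]) (use Cons in auto)
  then show ?case using Cons by auto
qed simp

text \<open>Partial derivatives of order at most k - 1 involve only w_0 to w_(k-1), continuous up to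
  R. One order further only the differentiability of w_(k-1) is in question, and
  \<open>AE_norm\<close> carries it from almost all radii to almost all points.\<close>

lemma radial_Ck:
  fixes w :: "nat \<Rightarrow> real \<Rightarrow> real" and R :: real
  defines "U \<equiv> \<lambda>x::real^'n::finite. w 0 (norm x)"
  assumes R: "R > 0" and k: "k \<ge> 1"
    and cont: "\<And>j. j < k \<Longrightarrow> continuous_on {0<..R} (w j)"
    and der: "\<And>j r. Suc j < k \<Longrightarrow> 0 < r \<Longrightarrow> r < R \<Longrightarrow> (w j has_real_derivative w (Suc j) r) (at r)"
    and ae: "AE r in lborel. 0 < r \<and> r < R \<longrightarrow> w (k - 1) differentiable (at r)"
  shows "Ck_on (k - 1) (cball 0 R - {0}) U"
    and "AE x in lborel. x \<in> ball 0 R \<longrightarrow> (\<forall>I i. length I = k - 1 \<longrightarrow> has_partial i (partials I U) x)"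
proof -
  define B where "B = ball (0::real^'n) R - {0}"
  have B: "open B" by (simp add: B_def open_delete)
  have BD: "x \<noteq> 0" "0 < norm x" "norm x < R" "x \<in> - {0}" if "x \<in> B" for x using that by (auto simp: B_def)
  define D where "D I x = (\<Sum>j\<le>length I. w j (norm x) * rad_coeff I j x)" for I and x :: "real^'n"
  note cd = smooth_on_differentiable[OF smooth_rad_coeff]
  have Ddiff: "D I differentiable (at x)"
    if x: "x \<in> B" and w: "\<And>j. j \<le> length I \<Longrightarrow> w j differentiable (at (norm x))" for I x
    unfolding D_def[abs_def]
  proof (intro differentiable_sum ballI differentiable_mult cd BD(4)[OF x])
    fix j assume "j \<in> {..length I}"
    then obtain d where "(w j has_real_derivative d) (at (norm x))" using w[of j] by (auto simp: real_differentiable_def)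
    from has_derivative_compose_norm[OF BD(1)[OF x] this]
    show "(\<lambda>x. w j (norm x)) differentiable (at x)" unfolding differentiable_def by blast
  qed simp
  have wdiff: "w j differentiable (at (norm x))" if "Suc j < k" "x \<in> B" for j and x :: "real^'n"
    using der[OF that(1) BD(2,3)[OF that(2)]] by (auto simp: real_differentiable_def)
  have Dpart: "partial i (D I) x = D (i # I) x" if x: "x \<in> B" and I: "length I < k - 1" for I i x
  proof -
    have wj: "(\<lambda>x. w j (norm x)) differentiable (at x)" "partial i (\<lambda>x. w j (norm x)) x = w (Suc j) (norm x) * (x $ i * (1 / norm x))"
      if "j \<le> length I" for j
    proof -
      have "(w j has_real_derivative w (Suc j) (norm x)) (at (norm x))" using that I BD[OF x] by (intro der) auto
      from has_derivative_compose_norm[OF BD(1)[OF x] this] partial_compose_norm[OF BD(1)[OF x] this]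
      show "(\<lambda>x. w j (norm x)) differentiable (at x)" "partial i (\<lambda>x. w j (norm x)) x = w (Suc j) (norm x) * (x $ i * (1 / norm x))"
        unfolding differentiable_def by auto
    qed
    have "partial i (D I) x = (\<Sum>j\<le>length I. partial i (\<lambda>x. w j (norm x) * rad_coeff I j x) x)"
      unfolding D_def[abs_def] by (rule partial_sum) (intro differentiable_mult wj(1) cd BD(4)[OF x], simp)
    also have "\<dots> = (\<Sum>j\<le>length I. w j (norm x) * partial i (rad_coeff I j) x + w (Suc j) (norm x) * (rad_coeff I j x * (x $ i * (1 / norm x))))"
      by (intro sum.cong refl) (simp add: partial_mult[OF wj(1) cd[OF BD(4)[OF x]]] wj(2))
    also have "\<dots> = (\<Sum>j\<le>length I. w j (norm x) * partial i (rad_coeff I j) x)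
       + (\<Sum>j\<le>length I. w (Suc j) (norm x) * (rad_coeff I j x * (x $ i * (1 / norm x))))"
      by (rule sum.distrib)
    \<comment> \<open>The coefficient with index beyond the length of I vanishes, so a zero term may
      be added; both sums then run over the range belonging to the longer list i # I.\<close>
    also have "(\<Sum>j\<le>length I. w j (norm x) * partial i (rad_coeff I j) x) = (\<Sum>j\<le>Suc (length I). w j (norm x) * partial i (rad_coeff I j) x)"
    proof -
      have "partial i (rad_coeff I (Suc (length I))) x = partial i (\<lambda>_. 0) x"
        by (rule partial_cong[OF open_punctured BD(4)[OF x]]) (simp add: rad_coeff_zero)
      then show ?thesis by simp
    qed
    also have "(\<Sum>j\<le>length I. w (Suc j) (norm x) * (rad_coeff I j x * (x $ i * (1 / norm x))))
      = (\<Sum>j\<le>Suc (length I). w j (norm x) * (if j = 0 then 0 else rad_coeff I (j - 1) x * (x $ i * (1 / norm x))))"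
      by (subst sum.atMost_Suc_shift) simp
    finally show ?thesis unfolding D_def by (simp add: sum.distrib[symmetric] distrib_left del: sum.atMost_Suc)
  qed
  have D0: "D [] x = U x" for x by (simp add: D_def U_def)
  have partD: "length I \<le> k - 1 \<Longrightarrow> x \<in> B \<Longrightarrow> partials I U x = D I x" for I x
  proof (induction I arbitrary: x)
    case (Cons i I)
    have "partials (i # I) U x = partial i (D I) x"
      using Cons by (simp, intro partial_cong[OF B]) auto
    then show ?case using Dpart[OF Cons.prems(2), of I i] Cons.prems(1) by simp
  qed (simp add: D0)
  show "Ck_on (k - 1) (cball 0 R - {0}) U"
    unfolding Ck_on_def
  proof (intro exI[of _ D] conjI ballI allI impI)
    fix I :: "'n list" assume I: "length I \<le> k - 1"
    show "continuous_on (cball 0 R - {0}) (D I)"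
      unfolding D_def[abs_def]
    proof (intro continuous_on_sum continuous_on_mult)
      fix j assume "j \<in> {..length I}"
      then have "j < k" using I k by auto
      show "continuous_on (cball 0 R - {0}) (\<lambda>x::real^'n. w j (norm x))"
        by (rule continuous_on_compose2[OF cont[OF \<open>j < k\<close>] continuous_on_norm_id]) auto
      show "continuous_on (cball 0 R - {0}) (rad_coeff I j)"
        by (rule continuous_on_subset[OF smooth_on_continuous_on[OF smooth_rad_coeff]]) auto
    qed
  next
    fix I :: "'n list" and i x assume I: "length I < k - 1" and x: "x \<in> interior (cball 0 R - {0::real^'n})"
    have "x \<in> ball 0 R" using x interior_mono[of "cball 0 R - {0::real^'n}" "cball 0 R"] by (auto simp: interior_cball)
    moreover have "x \<noteq> 0" using x interior_subset by blast
    ultimately have xB: "x \<in> B" by (simp add: B_def)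
    have "D I differentiable (at x)" using I by (intro Ddiff[OF xB] wdiff[OF _ xB]) auto
    from has_real_derivative_partial[OF this, of i]
    show "((\<lambda>t. D I (x + t *\<^sub>R axis i 1)) has_real_derivative D (i # I) x) (at 0)"
      by (simp add: Dpart[OF xB I])
  qed (simp add: D0)
  have "AE x in lborel. (x::real^'n) \<noteq> 0" by (rule AE_lborel_nonzero)
  with AE_norm[OF R ae, where 'a="real^'n"]
  show "AE x in lborel. x \<in> ball 0 R \<longrightarrow> (\<forall>I i. length I = k - 1 \<longrightarrow> has_partial i (partials I U) x)"
  proof eventually_elim
    case (elim x)
    show ?case
    proof (intro impI allI)
      fix I :: "'n list" and i assume x: "x \<in> ball 0 R" and I: "length I = k - 1"
      have xB: "x \<in> B" using x elim(2) by (simp add: B_def)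
      have "D I differentiable (at x)"
      proof (rule Ddiff[OF xB])
        fix j assume "j \<le> length I"
        then show "w j differentiable (at (norm x))"
          using elim(1) x I wdiff[OF _ xB, of j] by (cases "j = k - 1") auto
      qed
      then have "partials I U differentiable (at x)"
        by (rule differentiable_cong_open[OF _ B xB]) (use partD I in auto)
      from has_real_derivative_partial[OF this, of i]
      show "has_partial i (partials I U) x"
        unfolding has_partial_def by (auto simp: real_differentiable_def)
    qed
  qed
qed

section \<open>The Sobolev norm\<close>

context warped
begin

abbreviation rep :: "nat \<Rightarrow> real \<Rightarrow> (nat \<Rightarrow> real^'n::finite \<Rightarrow> real) \<Rightarrow> (real^'n \<Rightarrow> real) \<Rightarrow> bool" where
  "rep \<equiv> sobolev_rep (warped_metric \<phi>) (ball 0 R)"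

definition norm_limits :: "nat \<Rightarrow> real \<Rightarrow> (real^'n::finite \<Rightarrow> real) \<Rightarrow> real set" where
  "norm_limits k p u = {c. \<exists>us. rep k p us u \<and> (\<lambda>n. snorm k p (us n)) \<longlonglongrightarrow> c}"

lemma W_norm_eq: "W_norm R \<phi> k p u = Inf (norm_limits k p u)"
  by (simp add: W_norm_def sobolev_norm_def norm_limits_def)

text \<open>The condition n \<le> s n covers a strictly increasing choice followed by a
  shift.\<close>

lemma sobolev_rep_subseq:
  fixes u :: "real^'n::finite \<Rightarrow> real"
  assumes rep: "rep k p us u" and s: "\<And>n. n \<le> s n"
  shows "rep k p (\<lambda>n. us (s n)) u"
proof -
  have "\<exists>n0. \<forall>m\<ge>n0. \<forall>n\<ge>n0. snorm k p (\<lambda>x. us (s m) x - us (s n) x) < e" if e: "e > 0" for e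
  proof -
    obtain n0 where "\<forall>m\<ge>n0. \<forall>n\<ge>n0. snorm k p (\<lambda>x. us m x - us n x) < e"
      using rep e unfolding sobolev_rep_def by blast
    then show ?thesis using s by (intro exI[of _ n0]) (meson order_trans)
  qed
  moreover have "(\<lambda>n. Lw_norm (vol (warped_metric \<phi>) (ball 0 R)) (\<lambda>_. 1) p (\<lambda>x. us (s n) x - u x)) \<longlonglongrightarrow> 0"
  proof -
    have "filterlim s at_top sequentially"
      by (rule filterlim_at_top_mono[OF filterlim_ident]) (simp add: s)
    then show ?thesis using rep unfolding sobolev_rep_def by (auto intro: filterlim_compose)
  qed
  ultimately show ?thesis using rep unfolding sobolev_rep_def by auto
qed

text \<open>The infimum of an empty set would carry no information. The norms of a Cauchy sequence
  are bounded by \<open>snorm_triangle\<close>, so a subsequence of them converges, and it still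
  represents u.\<close>

lemma norm_limits_nonempty:
  fixes u :: "real^'n::finite \<Rightarrow> real"
  assumes p: "p \<ge> 1" and u: "u \<in> sobolev_space (warped_metric \<phi>) (ball 0 R) k p"
  shows "norm_limits k p u \<noteq> {}"
proof -
  obtain us where rep: "rep k p us u" using u by (auto simp: sobolev_space_def)
  have us: "us n \<in> ssob k p" for n using rep by (simp add: sobolev_rep_def)
  obtain n0 where n0: "\<forall>m\<ge>n0. \<forall>n\<ge>n0. snorm k p (\<lambda>x. us m x - us n x) < 1"
    using rep zero_less_one unfolding sobolev_rep_def by blast
  define B where "B = 4 * (1 + snorm k p (us n0))"
  have "snorm k p (us (n + n0)) \<in> {0..B}" for n
  proof -
    have "snorm k p (us (n + n0)) \<le> 4 * (snorm k p (\<lambda>x. us n0 x - us (n + n0) x) + snorm k p (us n0))"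
      by (rule snorm_triangle[OF us us p])
    also have "\<dots> \<le> B" unfolding B_def using n0 by (intro mult_left_mono add_right_mono) (auto intro: less_imp_le)
    finally show ?thesis by (simp add: snorm_nonneg)
  qed
  then obtain l r where r: "strict_mono r" "((\<lambda>n. snorm k p (us (n + n0))) \<circ> r) \<longlonglongrightarrow> l"
    using compact_Icc[of 0 B] unfolding compact_eq_seq_compact_metric seq_compact_def by metis
  have "rep k p (\<lambda>n. us (r n + n0)) u"
    by (rule sobolev_rep_subseq[OF rep]) (use strict_mono_imp_increasing[OF r(1)] in \<open>simp add: trans_le_add1\<close>)
  then have "l \<in> norm_limits k p u" using r(2) by (auto simp: norm_limits_def o_def)
  then show ?thesis by auto
qed

lemma norm_limits_nonneg: "c \<in> norm_limits k p u \<Longrightarrow> 0 \<le> c"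
  unfolding norm_limits_def by (auto intro: LIMSEQ_le_const snorm_nonneg)

text \<open>A strict upper level of the norm, realized by one sequence. Estimates are proved for
  such A and the infimum is taken afterwards; positivity of A allows negative powers of it.\<close>

definition admissible :: "nat \<Rightarrow> real \<Rightarrow> (real^'n::finite \<Rightarrow> real) \<Rightarrow> real \<Rightarrow> bool" where
  "admissible k p u A \<longleftrightarrow> A > 0 \<and> (\<exists>us. rep k p us u \<and> (\<forall>\<^sub>F n in sequentially. snorm k p (us n) < A))"

lemma admissible_of_less:
  fixes u :: "real^'n::finite \<Rightarrow> real"
  assumes p: "p \<ge> 1" and u: "u \<in> W_rad R \<phi> k p" and A: "W_norm R \<phi> k p u < A"
  shows "admissible k p u A"
proof -
  have ne: "norm_limits k p u \<noteq> {}" using u by (intro norm_limits_nonempty[OF p]) (simp add: W_rad_def)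
  obtain c where c: "c \<in> norm_limits k p u" "c < A"
    using cInf_lessD[OF ne] A unfolding W_norm_eq by blast
  then obtain us where "rep k p us u" "(\<lambda>n. snorm k p (us n)) \<longlonglongrightarrow> c" by (auto simp: norm_limits_def)
  moreover then have "\<forall>\<^sub>F n in sequentially. snorm k p (us n) < A" using c(2) by (intro order_tendstoD(2))
  ultimately show ?thesis using norm_limits_nonneg[OF c(1)] c(2) by (auto simp: admissible_def)
qed

lemma le_W_norm:
  fixes u :: "real^'n::finite \<Rightarrow> real"
  assumes p: "p \<ge> 1" and u: "u \<in> W_rad R \<phi> k p" and K: "K \<ge> 0"
    and le: "\<And>A. admissible k p u A \<Longrightarrow> Y \<le> K * A"
  shows "Y \<le> K * W_norm R \<phi> k p u"
proof (rule field_le_epsilon)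
  fix e :: real assume e: "e > 0"
  \<comment> \<open>Dividing by K + 1 instead of K covers K = 0.\<close>
  have "admissible k p u (W_norm R \<phi> k p u + e / (K + 1))"
    using e K by (intro admissible_of_less[OF p u]) simp
  from le[OF this] have "Y \<le> K * W_norm R \<phi> k p u + K * (e / (K + 1))" by (simp add: distrib_left)
  also have "K * (e / (K + 1)) \<le> e" using e K by (simp add: field_simps)
  finally show "Y \<le> K * W_norm R \<phi> k p u + e" by simp
qed

text \<open>The profile f and the approximants may change with A; what ties them together is that
  each f gives u almost everywhere.\<close>

lemma W_rad_approx:
  assumes p: "p \<ge> 1" and k: "k \<ge> 1"
  obtains C where "C > 0"
    "\<And>(u :: real^'n::finite \<Rightarrow> real) A. u \<in> W_rad R \<phi> k p \<Longrightarrow> admissible k p u A \<Longrightarrow>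
      \<exists>f h. approx R (real CARD('n)) p k (C * A) f h \<and> continuous_on {0<..<R} f \<and>
        (AE x in lborel. x \<in> ball 0 R \<longrightarrow> u x = f (norm x))"
proof -
  obtain C where C: "C > 0" "\<And>(u :: real^'n::finite \<Rightarrow> real) us A. u \<in> W_rad R \<phi> k p \<Longrightarrow> rep k p us u \<Longrightarrow> A > 0 \<Longrightarrow>
      (\<forall>\<^sub>F n in sequentially. snorm k p (us n) < A) \<Longrightarrow>
      \<exists>h a. cauchy_chain R (real CARD('n)) k h a \<and>
        (\<exists>\<^sub>F n in sequentially. energy R (real CARD('n)) p k (h n) \<le> ennreal ((C * A) powr p)) \<and>
        (AE x in lborel. x \<in> ball 0 R \<longrightarrow> u x = cauchy_chain.w R h 0 (norm x)) \<and>
        (\<forall>n. \<exists>l. (h n 0 \<longlongrightarrow> l) (at_right 0))"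
    by (rule W_rad_cauchy_chain[OF p k]) (assumption | rule that)+
  show ?thesis
  proof (rule that[OF C(1)])
    fix u :: "real^'n \<Rightarrow> real" and A assume u: "u \<in> W_rad R \<phi> k p" and ad: "admissible k p u A"
    then obtain us where us: "A > 0" "rep k p us u" "\<forall>\<^sub>F n in sequentially. snorm k p (us n) < A"
      by (auto simp: admissible_def)
    obtain h a where h: "cauchy_chain R (real CARD('n)) k h a"
        "\<exists>\<^sub>F n in sequentially. energy R (real CARD('n)) p k (h n) \<le> ennreal ((C * A) powr p)"
        "AE x in lborel. x \<in> ball 0 R \<longrightarrow> u x = cauchy_chain.w R h 0 (norm x)"
      using C(2)[OF u us(2,1,3)] by blast
    interpret cc: cauchy_chain R "real CARD('n)" k h a by (rule h(1))
    have "approx R (real CARD('n)) p k (C * A) (cc.w 0) h"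
      unfolding approx_def using h(2) cc.chain cc.v_tendsto[of 0] k by (auto simp: cc.w_eq)
    moreover have "continuous_on {0<..<R} (cc.w 0)"
      by (rule continuous_on_subset[OF cc.continuous_w]) (use k in auto)
    ultimately show "\<exists>f h. approx R (real CARD('n)) p k (C * A) f h \<and> continuous_on {0<..<R} f \<and>
        (AE x in lborel. x \<in> ball 0 R \<longrightarrow> u x = f (norm x))"
      using h(3) by blast
  qed
qed

theorem radial_regularity:
  fixes u :: "real^'n::finite \<Rightarrow> real"
  assumes p: "p \<ge> 1" and k: "k \<ge> 1" and u: "u \<in> W_rad R \<phi> k p"
  shows "\<exists>U. (AE x in M_vol R \<phi>. u x = U x) \<and> Ck_on (k - 1) (cball 0 R - {0}) U \<and>
            (AE x in M_vol R \<phi>. \<forall>I i. length I = k - 1 \<longrightarrow> has_partial i (partials I U) x)"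
proof -
  obtain C where C: "C > 0" "\<And>(u :: real^'n::finite \<Rightarrow> real) us A. u \<in> W_rad R \<phi> k p \<Longrightarrow> rep k p us u \<Longrightarrow> A > 0 \<Longrightarrow>
      (\<forall>\<^sub>F n in sequentially. snorm k p (us n) < A) \<Longrightarrow>
      \<exists>h a. cauchy_chain R (real CARD('n)) k h a \<and>
        (\<exists>\<^sub>F n in sequentially. energy R (real CARD('n)) p k (h n) \<le> ennreal ((C * A) powr p)) \<and>
        (AE x in lborel. x \<in> ball 0 R \<longrightarrow> u x = cauchy_chain.w R h 0 (norm x)) \<and>
        (\<forall>n. \<exists>l. (h n 0 \<longlongrightarrow> l) (at_right 0))"
    by (rule W_rad_cauchy_chain[OF p k]) (assumption | rule that)+
  have "admissible k p u (W_norm R \<phi> k p u + 1)" by (rule admissible_of_less[OF p u]) simp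
  then obtain us A where us: "A > 0" "rep k p us u" "\<forall>\<^sub>F n in sequentially. snorm k p (us n) < A"
    by (auto simp: admissible_def)
  obtain h a where h: "cauchy_chain R (real CARD('n)) k h a"
        "AE x in lborel. x \<in> ball 0 R \<longrightarrow> u x = cauchy_chain.w R h 0 (norm x)"
    using C(2)[OF u us(2,1,3)] by blast
  interpret cc: cauchy_chain R "real CARD('n)" k h a by (rule h(1))
  have "AE r in lborel. 0 < r \<and> r < R \<longrightarrow> cc.w (k - 1) differentiable (at r)"
    using k by (intro cc.w_AE_differentiable) auto
  note rc = radial_Ck[OF R k cc.continuous_w cc.w_derivative this, where 'n='n]
  show ?thesis unfolding AE_M_vol
  proof (intro exI conjI)
    show "Ck_on (k - 1) (cball 0 R - {0}) (\<lambda>x::real^'n. cc.w 0 (norm x))" by (rule rc(1))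
    show "AE x in lborel. x \<in> ball 0 R \<longrightarrow>
        (\<forall>I i. length I = k - 1 \<longrightarrow> has_partial i (partials I (\<lambda>x::real^'n. cc.w 0 (norm x))) x)" by (rule rc(2))
  qed (rule h(2))
qed

section \<open>Weighted Lebesgue spaces\<close>

lemma phi_powr_measurable:
  "(\<lambda>x::real^'n::finite. \<phi> (norm x) powr \<theta>) \<in> borel_measurable (lebesgue_on (ball 0 R))"
proof (rule measurable_of_continuous_on_M)
  have "continuous_on M (\<lambda>x::real^'n. \<phi> (norm x))"
    by (rule continuous_on_compose2[OF continuous_on_phi continuous_on_norm_id]) (auto simp: M_def)
  moreover have "\<phi> (norm x) \<noteq> 0" if "x \<in> M" for x :: "real^'n"
    using phi_pos[OF M_D(2,3)[OF that]] by simp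
  ultimately show "continuous_on M (\<lambda>x::real^'n. \<phi> (norm x) powr \<theta>)"
    by (intro continuous_on_powr continuous_on_const ballI)
qed

text \<open>Reduction to one dimension: \<phi>(r) \<le> b2 r bounds the weight by a power of r, the
  volume is comparable to Lebesgue measure, and in polar coordinates the radial integrand gives the
  same \<open>wint\<close> in every direction. The constant does not depend on q.\<close>

lemma weighted_bound:
  assumes \<theta>: "\<theta> \<ge> 0"
  obtains K where "K \<ge> 0" "\<And>q f (u :: real^'n::finite \<Rightarrow> real). (\<lambda>r. indicator {0<..<R} r *\<^sub>R f r) \<in> borel_measurable borel \<Longrightarrow>
     u \<in> borel_measurable (M_vol R \<phi>) \<Longrightarrow> (AE x in lborel. x \<in> ball 0 R \<longrightarrow> u x = f (norm x)) \<Longrightarrow>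
     (\<integral>\<^sup>+x. ennreal (\<bar>u x\<bar> powr q * \<phi> (norm x) powr \<theta>) \<partial>M_vol R \<phi>) \<le> ennreal K * wint R (\<theta> + real CARD('n) - 1) q f"
proof -
  let ?N = "real CARD('n)"
  obtain c where c: "c > 0" "\<And>F. F \<in> borel_measurable (lebesgue_on (ball 0 R)) \<Longrightarrow>
      (\<integral>\<^sup>+x. F x \<partial>(M_vol R \<phi> :: (real^'n) measure)) \<le> ennreal c * (\<integral>\<^sup>+x. F x * indicator (ball 0 R) x \<partial>lborel)"
    by (rule nn_integral_M_vol_bounds) (assumption | rule that)+
  obtain b1 b2 where b: "b1 > 0" "b2 > 0" "\<And>r. 0 < r \<Longrightarrow> r < R \<Longrightarrow> b1 \<le> \<phi> r / r \<and> \<phi> r / r \<le> b2"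
    using phi_ratio_bounds by blast
  interpret S: finite_measure "sphere_measure :: (real^'n) measure" by (rule finite_sphere_measure)
  define s0 where "s0 = measure (sphere_measure :: (real^'n) measure) UNIV"
  have s0: "emeasure (sphere_measure :: (real^'n) measure) UNIV = ennreal s0" unfolding s0_def by (rule S.emeasure_eq_measure)
  show ?thesis
  proof (rule that[of "c * (b2 powr \<theta> * s0)"])
    show "0 \<le> c * (b2 powr \<theta> * s0)" using c(1) by (simp add: s0_def)
    fix q f and u :: "real^'n \<Rightarrow> real"
    assume fm: "(\<lambda>r. indicator {0<..<R} r *\<^sub>R f r) \<in> borel_measurable borel"
      and um: "u \<in> borel_measurable (M_vol R \<phi>)" and AEu: "AE x in lborel. x \<in> ball 0 R \<longrightarrow> u x = f (norm x)"
    \<comment> \<open>Cutting f off outside (0,R) makes G a Borel function on the whole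
      space.\<close>
    define f' where "f' r = indicator {0<..<R} r *\<^sub>R f r" for r
    have [measurable]: "f' \<in> borel_measurable borel" using fm by (simp add: f'_def[abs_def])
    define G where "G x = ennreal (norm x powr \<theta> * \<bar>f' (norm x)\<bar> powr q)" for x :: "real^'n"
    have G: "G \<in> borel_measurable borel" unfolding G_def[abs_def] by measurable
    have m: "(\<lambda>x. ennreal (\<bar>u x\<bar> powr q * \<phi> (norm x) powr \<theta>)) \<in> borel_measurable (lebesgue_on (ball 0 R))"
    proof -
      note [measurable] = um[unfolded measurable_M_vol] phi_powr_measurable[of \<theta>, where 'n='n]
      show ?thesis by measurable
    qed
    have "(\<integral>\<^sup>+x. ennreal (\<bar>u x\<bar> powr q * \<phi> (norm x) powr \<theta>) \<partial>M_vol R \<phi>)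
      \<le> ennreal c * (\<integral>\<^sup>+x. ennreal (\<bar>u x\<bar> powr q * \<phi> (norm x) powr \<theta>) * indicator (ball 0 R) x \<partial>lborel)"
      by (rule c(2)[OF m])
    also have "\<dots> \<le> ennreal c * (\<integral>\<^sup>+x. ennreal (b2 powr \<theta>) * (G x * indicator (ball 0 R) x) \<partial>lborel)"
    proof (intro mult_left_mono nn_integral_mono_AE)
      show "AE x in lborel. ennreal (\<bar>u x\<bar> powr q * \<phi> (norm x) powr \<theta>) * indicator (ball 0 R) x
        \<le> ennreal (b2 powr \<theta>) * (G x * indicator (ball 0 R) x)"
        using AEu AE_M
      proof eventually_elim
        case (elim x)
        have "\<bar>u x\<bar> powr q * \<phi> (norm x) powr \<theta> \<le> b2 powr \<theta> * (norm x powr \<theta> * \<bar>f' (norm x)\<bar> powr q)" if x: "x \<in> ball 0 R"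
        proof -
          have xM: "x \<in> M" using elim x by simp
          have "\<phi> (norm x) \<le> b2 * norm x" using b(3)[of "norm x"] M_D[OF xM] by (simp add: field_simps)
          then have "\<phi> (norm x) powr \<theta> \<le> (b2 * norm x) powr \<theta>"
            using \<theta> phi_pos[of "norm x"] M_D[OF xM] by (intro powr_mono2) auto
          then have "\<phi> (norm x) powr \<theta> \<le> b2 powr \<theta> * norm x powr \<theta>" using b by (simp add: powr_mult)
          then have "\<bar>f (norm x)\<bar> powr q * \<phi> (norm x) powr \<theta> \<le> \<bar>f (norm x)\<bar> powr q * (b2 powr \<theta> * norm x powr \<theta>)"
            by (rule mult_left_mono) simp
          then show ?thesis using elim x M_D[OF xM] by (simp add: f'_def mult_ac)
        qed
        then show ?case by (auto simp: G_def ennreal_mult[symmetric] intro!: ennreal_leI split: split_indicator)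
      qed
    qed simp
    also have "(\<integral>\<^sup>+x. ennreal (b2 powr \<theta>) * (G x * indicator (ball 0 R) x) \<partial>lborel) = ennreal (b2 powr \<theta>) * (\<integral>\<^sup>+x. G x * indicator (ball 0 R) x \<partial>lborel)"
      using G indicator_ball_measurable(2)[of R, where 'a="real^'n"] by (intro nn_integral_cmult borel_measurable_times_ennreal) simp_all
    also have "(\<integral>\<^sup>+x. G x * indicator (ball 0 R) x \<partial>lborel) = (\<integral>\<^sup>+w. wint R (\<theta> + ?N - 1) q f \<partial>(sphere_measure :: (real^'n) measure))"
      unfolding nn_integral_polar(1)[OF R G]
    proof (rule nn_integral_cong_AE)
      show "AE w in (sphere_measure :: (real^'n) measure).
        (\<integral>\<^sup>+r. ennreal (r ^ (DIM(real^'n) - 1)) * G (r *\<^sub>R w) * indicator {0<..<R} r \<partial>lborel) = wint R (\<theta> + ?N - 1) q f"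
        using AE_sphere_measure
      proof eventually_elim
        case (elim w)
        show ?case unfolding wint_def
        proof (rule nn_integral_cong)
          fix r :: real
          have "r ^ (CARD('n) - 1) * (r powr \<theta> * \<bar>f r\<bar> powr q) = r powr (\<theta> + ?N - 1) * \<bar>f r\<bar> powr q" if "0 < r"
          proof -
            have "r ^ (CARD('n) - 1) = r powr (?N - 1)"
              using that by (simp add: powr_realpow[symmetric] of_nat_diff Suc_leI)
            moreover have "r powr (?N - 1) * r powr \<theta> = r powr (\<theta> + ?N - 1)"
              by (simp add: powr_add[symmetric] algebra_simps)
            ultimately show ?thesis by (simp add: mult.assoc[symmetric])
          qed
          then show "ennreal (r ^ (DIM(real^'n) - 1)) * G (r *\<^sub>R w) * indicator {0<..<R} r
            = ennreal (r powr (\<theta> + ?N - 1) * \<bar>f r\<bar> powr q) * indicator {0<..<R} r"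
            using elim by (auto simp: G_def f'_def ennreal_mult[symmetric] split: split_indicator)
        qed
      qed
    qed
    also have "\<dots> = wint R (\<theta> + ?N - 1) q f * ennreal s0" by (simp add: s0)
    also have "ennreal c * (ennreal (b2 powr \<theta>) * (wint R (\<theta> + ?N - 1) q f * ennreal s0))
       = ennreal (c * (b2 powr \<theta> * s0)) * wint R (\<theta> + ?N - 1) q f"
      using c(1) by (simp add: ennreal_mult s0_def mult_ac)
    finally show "(\<integral>\<^sup>+x. ennreal (\<bar>u x\<bar> powr q * \<phi> (norm x) powr \<theta>) \<partial>M_vol R \<phi>)
      \<le> ennreal (c * (b2 powr \<theta> * s0)) * wint R (\<theta> + ?N - 1) q f" .
  qed
qed

lemma weighted_measurable:
  assumes "(u :: real^'n::finite \<Rightarrow> real) \<in> borel_measurable (M_vol R \<phi>)"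
  shows "(\<lambda>x. \<bar>u x\<bar> powr q * \<phi> (norm x) powr \<theta>) \<in> borel_measurable (M_vol R \<phi>)"
proof -
  note [measurable] = assms[unfolded measurable_M_vol] phi_powr_measurable[of \<theta>, where 'n='n]
  show ?thesis unfolding measurable_M_vol by measurable
qed

lemma L_weighted_of_bound:
  assumes q: "q \<ge> 1" and u: "(u :: real^'n::finite \<Rightarrow> real) \<in> borel_measurable (M_vol R \<phi>)" and B: "B \<ge> 0"
    and le: "(\<integral>\<^sup>+x. ennreal (\<bar>u x\<bar> powr q * \<phi> (norm x) powr \<theta>) \<partial>M_vol R \<phi>) \<le> ennreal B"
  shows "u \<in> L_weighted R \<phi> \<theta> q" "L_weighted_norm R \<phi> \<theta> q u \<le> B powr (1 / q)"
proof -
  let ?F = "\<lambda>x::real^'n. \<bar>u x\<bar> powr q * \<phi> (norm x) powr \<theta>"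
  have int: "integrable (M_vol R \<phi>) ?F"
    using le by (intro integrableI_bounded weighted_measurable u) (auto simp: top_unique less_top[symmetric])
  then show "u \<in> L_weighted R \<phi> \<theta> q" using u by (simp add: L_weighted_def Lw_space_def)
  have "ennreal (LINT x|M_vol R \<phi>. ?F x) \<le> ennreal B"
    using le nn_integral_eq_integral[OF int] by simp
  then have "(LINT x|M_vol R \<phi>. ?F x) \<le> B" using B by (subst (asm) ennreal_le_iff) auto
  moreover have "0 \<le> (LINT x|M_vol R \<phi>. ?F x)" by (rule Bochner_Integration.integral_nonneg) simp
  ultimately show "L_weighted_norm R \<phi> \<theta> q u \<le> B powr (1 / q)"
    unfolding L_weighted_norm_def Lw_norm_def using q by (intro powr_mono2) auto
qed

lemma W_rad_measurable: "(u :: real^'n::finite \<Rightarrow> real) \<in> W_rad R \<phi> k p \<Longrightarrow> u \<in> borel_measurable (M_vol R \<phi>)"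
  by (auto simp: W_rad_def sobolev_space_def sobolev_rep_def Lw_space_def M_vol_def)

lemma indicator_continuous_measurable:
  "continuous_on {0<..<R} f \<Longrightarrow> (\<lambda>r. indicator {0<..<R} r *\<^sub>R f r) \<in> borel_measurable borel" for f :: "real \<Rightarrow> real"
  by (rule borel_measurable_continuous_on_indicator) auto

text \<open>A bound homogeneous of degree q in A becomes linear in A after the q-th root;
  \<open>le_W_norm\<close> then replaces A by the norm.\<close>

lemma embedding_of_wint_bound:
  assumes p: "p \<ge> 1" and k: "k \<ge> 1" and \<theta>: "\<theta> \<ge> 0" and q: "q \<ge> 1" and C: "C \<ge> 0"
    and bound: "\<And>f h A. approx R (real CARD('n::finite)) p k A f h \<Longrightarrow> continuous_on {0<..<R} f \<Longrightarrow> A > 0 \<Longrightarrow>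
      wint R (\<theta> + real CARD('n) - 1) q f \<le> ennreal (C * A powr q)"
  shows "continuously_embedded (M_vol R \<phi>) (W_rad R \<phi> k p :: (real^'n \<Rightarrow> real) set) (W_norm R \<phi> k p)
             (L_weighted R \<phi> \<theta> q) (L_weighted_norm R \<phi> \<theta> q)"
proof -
  obtain C1 where C1: "C1 > 0"
    "\<And>(u :: real^'n::finite \<Rightarrow> real) A. u \<in> W_rad R \<phi> k p \<Longrightarrow> admissible k p u A \<Longrightarrow>
      \<exists>f h. approx R (real CARD('n)) p k (C1 * A) f h \<and> continuous_on {0<..<R} f \<and>
        (AE x in lborel. x \<in> ball 0 R \<longrightarrow> u x = f (norm x))"
    by (rule W_rad_approx[OF p k]) (assumption | rule that)+
  obtain K where K: "K \<ge> 0" "\<And>q f (u :: real^'n::finite \<Rightarrow> real). (\<lambda>r. indicator {0<..<R} r *\<^sub>R f r) \<in> borel_measurable borel \<Longrightarrow>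
     u \<in> borel_measurable (M_vol R \<phi>) \<Longrightarrow> (AE x in lborel. x \<in> ball 0 R \<longrightarrow> u x = f (norm x)) \<Longrightarrow>
     (\<integral>\<^sup>+x. ennreal (\<bar>u x\<bar> powr q * \<phi> (norm x) powr \<theta>) \<partial>M_vol R \<phi>) \<le> ennreal K * wint R (\<theta> + real CARD('n) - 1) q f"
    by (rule weighted_bound[OF \<theta>]) (assumption | rule that)+
  define E where "E = (K * C) powr (1 / q) * C1"
  have main: "u \<in> L_weighted R \<phi> \<theta> q \<and> L_weighted_norm R \<phi> \<theta> q u \<le> E * A"
    if u: "u \<in> W_rad R \<phi> k p" and A: "admissible k p u A" for u :: "real^'n \<Rightarrow> real" and A
  proof -
    have Apos: "A > 0" using A by (simp add: admissible_def)
    obtain f h where f: "approx R (real CARD('n)) p k (C1 * A) f h" "continuous_on {0<..<R} f"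
        "AE x in lborel. x \<in> ball 0 R \<longrightarrow> u x = f (norm x)"
      using C1(2)[OF u A] by blast
    have um: "u \<in> borel_measurable (M_vol R \<phi>)" by (rule W_rad_measurable[OF u])
    have "(\<integral>\<^sup>+x. ennreal (\<bar>u x\<bar> powr q * \<phi> (norm x) powr \<theta>) \<partial>M_vol R \<phi>) \<le> ennreal K * wint R (\<theta> + real CARD('n) - 1) q f"
      by (rule K(2)[OF indicator_continuous_measurable[OF f(2)] um f(3)])
    also have "\<dots> \<le> ennreal K * ennreal (C * (C1 * A) powr q)"
      using C1(1) Apos by (intro mult_left_mono bound[OF f(1,2)]) auto
    also have "\<dots> = ennreal (K * (C * (C1 * A) powr q))" using K(1) C by (simp add: ennreal_mult)
    finally have le: "(\<integral>\<^sup>+x. ennreal (\<bar>u x\<bar> powr q * \<phi> (norm x) powr \<theta>) \<partial>M_vol R \<phi>) \<le> ennreal (K * (C * (C1 * A) powr q))" .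
    have "0 \<le> K * (C * (C1 * A) powr q)" using K(1) C by simp
    from L_weighted_of_bound[OF q um this le]
    have "u \<in> L_weighted R \<phi> \<theta> q" "L_weighted_norm R \<phi> \<theta> q u \<le> (K * (C * (C1 * A) powr q)) powr (1 / q)" by auto
    moreover have "(K * (C * (C1 * A) powr q)) powr (1 / q) = E * A"
    proof -
      have "(K * (C * (C1 * A) powr q)) powr (1 / q) = (K * C) powr (1 / q) * ((C1 * A) powr q) powr (1 / q)"
        using K(1) C by (simp add: powr_mult mult.assoc)
      also have "((C1 * A) powr q) powr (1 / q) = C1 * A" using C1(1) Apos q by (simp add: powr_powr)
      finally show ?thesis by (simp add: E_def)
    qed
    ultimately show ?thesis by simp
  qed
  show ?thesis unfolding continuously_embedded_def
  proof (intro exI ballI)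
    fix u :: "real^'n \<Rightarrow> real" assume u: "u \<in> W_rad R \<phi> k p"
    have "L_weighted_norm R \<phi> \<theta> q u \<le> E * W_norm R \<phi> k p u"
      by (rule le_W_norm[OF p u]) (use main[OF u] C1(1) in \<open>auto simp: E_def\<close>)
    moreover have "u \<in> L_weighted R \<phi> \<theta> q"
      using main[OF u admissible_of_less[OF p u, of "W_norm R \<phi> k p u + 1"]] by simp
    ultimately show "\<exists>U\<in>L_weighted R \<phi> \<theta> q. (AE x in M_vol R \<phi>. u x = U x) \<and> L_weighted_norm R \<phi> \<theta> q U \<le> E * W_norm R \<phi> k p u"
      by auto
  qed
qed

end

section \<open>Compactness\<close>

text \<open>A diagonal argument on rational radii, applied to r^(1/q) f because the bound on f
  degenerates at 0. Equicontinuity at distance from 0 extends convergence to every radius; limits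
  need only be pointwise, as domination does the rest later.\<close>

lemma convergent_subsequence:
  fixes f :: "nat \<Rightarrow> real \<Rightarrow> real"
  assumes q: "q \<ge> 1" and p: "p > 1" and L: "L \<ge> 0"
    and bound: "\<And>n r. 0 < r \<Longrightarrow> r < R \<Longrightarrow> r * \<bar>f n r\<bar> powr q \<le> K"
    and equi: "\<And>n r s D. 0 < s \<Longrightarrow> s \<le> r \<Longrightarrow> r < R \<Longrightarrow> D > 0 \<Longrightarrow>
      \<bar>f n r - f n s\<bar> \<le> D * (r - s) + D powr (1 - p) * s powr (1 - p) * L"
  obtains \<rho> v where "strict_mono (\<rho> :: nat \<Rightarrow> nat)" "\<And>r. 0 < r \<Longrightarrow> r < R \<Longrightarrow> (\<lambda>n. f (\<rho> n) r) \<longlonglongrightarrow> v r"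
proof -
  define S where "S = {0<..<R} \<inter> \<rat>"
  have "countable S" by (simp add: S_def countable_rat)
  have "norm (r powr (1 / q) * f n r) \<le> K powr (1 / q)" if "r \<in> S" for n r
  proof -
    have r: "0 < r" "r < R" using that by (auto simp: S_def)
    have "(r * \<bar>f n r\<bar> powr q) powr (1 / q) \<le> K powr (1 / q)" using bound[OF r] r q by (intro powr_mono2) auto
    moreover have "(r * \<bar>f n r\<bar> powr q) powr (1 / q) = r powr (1 / q) * \<bar>f n r\<bar>"
      using r q by (simp add: powr_mult powr_powr)
    ultimately show ?thesis by (simp add: abs_mult)
  qed
  then obtain \<rho> :: "nat \<Rightarrow> nat" where \<rho>: "strict_mono \<rho>" "\<And>r. r \<in> S \<Longrightarrow> \<exists>l. (\<lambda>n. r powr (1 / q) * f (\<rho> n) r) \<longlonglongrightarrow> l"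
    using function_convergent_subsequence[OF \<open>countable S\<close>, of "\<lambda>n r. r powr (1 / q) * f n r" "K powr (1 / q)"] by metis
  have conv: "convergent (\<lambda>n. f (\<rho> n) r)" if r: "0 < r" "r < R" for r
  proof (rule Cauchy_convergent, rule metric_CauchyI)
    fix e :: real assume e: "e > 0"
    define Z where "Z = (r / 2) powr (1 - p) * L"
    have Z: "Z \<ge> 0" using L by (simp add: Z_def)
    define y where "y = e / 8 / (Z + 1)"
    have y: "y > 0" using e Z by (simp add: y_def)
    \<comment> \<open>Chosen so that D^(1-p) = y, a number small enough for the second term of the
      modulus; as p > 1, a large D does this.\<close>
    define D where "D = y powr (1 / (1 - p))"
    have D: "D > 0" "D powr (1 - p) = y" using y p by (simp_all add: D_def powr_powr)
    have yZ: "y * Z \<le> e / 8" using e Z by (simp add: y_def field_simps)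
    \<comment> \<open>A rational s this close to r makes D (r - s) at most e/8, and s > r/2 keeps
      the factor s^(1-p) below its value at r/2.\<close>
    have "max (r / 2) (r - e / (8 * D)) < r" using r e D by simp
    then obtain s where s: "s \<in> \<rat>" "max (r / 2) (r - e / (8 * D)) < s" "s < r"
      using Rats_dense_in_real by blast
    have sS: "s \<in> S" using s r by (auto simp: S_def)
    have fs: "\<bar>f n r - f n s\<bar> \<le> e / 4" for n
    proof -
      have "\<bar>f n r - f n s\<bar> \<le> D * (r - s) + D powr (1 - p) * s powr (1 - p) * L"
        using s r D by (intro equi) auto
      also have "\<dots> \<le> e / 8 + y * Z"
      proof (rule add_mono)
        have "r - s < e / (8 * D)" using s by simp
        then show "D * (r - s) \<le> e / 8" using D by (simp add: field_simps)
        have "s powr (1 - p) \<le> (r / 2) powr (1 - p)" using s r p by (intro powr_mono2') auto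
        then have "y * s powr (1 - p) * L \<le> y * (r / 2) powr (1 - p) * L"
          using y L by (intro mult_right_mono mult_left_mono) auto
        then show "D powr (1 - p) * s powr (1 - p) * L \<le> y * Z" by (simp add: D Z_def)
      qed
      finally show ?thesis using yZ by simp
    qed
    obtain l where "(\<lambda>n. s powr (1 / q) * f (\<rho> n) s) \<longlonglongrightarrow> l" using \<rho>(2)[OF sS] by blast
    then have "(\<lambda>n. s powr (1 / q) * f (\<rho> n) s / s powr (1 / q)) \<longlonglongrightarrow> l / s powr (1 / q)"
      using s r by (intro tendsto_divide tendsto_const) auto
    then have "(\<lambda>n. f (\<rho> n) s) \<longlonglongrightarrow> l / s powr (1 / q)" using s r by simp
    then have "Cauchy (\<lambda>n. f (\<rho> n) s)" by (rule LIMSEQ_imp_Cauchy)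
    then obtain n0 where n0: "\<And>m n. m \<ge> n0 \<Longrightarrow> n \<ge> n0 \<Longrightarrow> dist (f (\<rho> m) s) (f (\<rho> n) s) < e / 4"
      using e unfolding Cauchy_def by (metis zero_less_divide_iff zero_less_numeral)
    show "\<exists>n0. \<forall>m\<ge>n0. \<forall>n\<ge>n0. dist (f (\<rho> m) r) (f (\<rho> n) r) < e"
    proof (intro exI[of _ n0] allI impI)
      fix m n assume "n0 \<le> m" "n0 \<le> n"
      from n0[OF this] have "\<bar>f (\<rho> m) s - f (\<rho> n) s\<bar> < e / 4" by (simp add: dist_real_def)
      then show "dist (f (\<rho> m) r) (f (\<rho> n) r) < e"
        using fs[of "\<rho> m"] fs[of "\<rho> n"] e unfolding dist_real_def by linarith
    qed
  qed
  show ?thesis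
  proof (rule that[OF \<rho>(1), of "\<lambda>r. lim (\<lambda>n. f (\<rho> n) r)"])
    show "(\<lambda>n. f (\<rho> n) r) \<longlonglongrightarrow> lim (\<lambda>n. f (\<rho> n) r)" if "0 < r" "r < R" for r
      using conv[OF that] by (simp add: convergent_LIMSEQ_iff)
  qed
qed

context warped
begin

text \<open>Since N \<ge> 2, one power of r can be split off the weight and used up by the bound on
  r |f|^q, leaving a bounded power.\<close>

lemma wint_critical_bound:
  assumes N: "N \<ge> 2" and \<theta>: "\<theta> \<ge> 0" and K: "K \<ge> 0"
    and bound: "\<And>r. 0 < r \<Longrightarrow> r < R \<Longrightarrow> r * \<bar>f r\<bar> powr q \<le> K"
  shows "wint R (\<theta> + N - 1) q f \<le> ennreal (R powr (\<theta> + N - 2) * K * R)"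
proof (rule wint_const_le)
  fix r assume r: "0 < r" "r < R"
  have "r powr (\<theta> + N - 1) = r powr (\<theta> + N - 2) * r"
    using r by (simp add: powr_mult_base[symmetric] mult.commute) (simp add: powr_mult_base algebra_simps)
  then have "r powr (\<theta> + N - 1) * \<bar>f r\<bar> powr q = r powr (\<theta> + N - 2) * (r * \<bar>f r\<bar> powr q)" by simp
  also have "\<dots> \<le> R powr (\<theta> + N - 2) * K"
    using r N \<theta> K bound[OF r] by (intro mult_mono powr_mono2) auto
  finally show "r powr (\<theta> + N - 1) * \<bar>f r\<bar> powr q \<le> R powr (\<theta> + N - 2) * K" .
qed (use N \<theta> K R in auto)

text \<open>Dominated convergence along the pointwise convergent subsequence. The bound r |f|^q
  \<le> K0 holds uniformly for the target exponent q itself, so a multiple of 1/r is a majorant,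
  integrable against the weighted volume because N \<ge> 2.\<close>

theorem critical_compact_embedding:
  assumes p: "p > 1" and k: "k \<ge> 1" and \<theta>: "\<theta> \<ge> 0" and q: "q \<ge> 1"
    and N: "real CARD('n::finite) = real k * p" "CARD('n) \<ge> 2"
  shows "compactly_embedded (M_vol R \<phi>) (W_rad R \<phi> k p :: (real^'n \<Rightarrow> real) set) (W_norm R \<phi> k p)
             (L_weighted R \<phi> \<theta> q) (L_weighted_norm R \<phi> \<theta> q)"
proof -
  let ?N = "real CARD('n)"
  have p1: "p \<ge> 1" using p by simp
  have N2: "?N \<ge> 2" using N(2) by simp
  obtain C where C: "C \<ge> 0" "\<And>f h A r. approx R ?N p k A f h \<Longrightarrow> A > 0 \<Longrightarrow> 0 < r \<Longrightarrow> r < R \<Longrightarrow>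
    r * \<bar>f r\<bar> powr q \<le> C * A powr q"
    using approx_critical_pointwise[OF R p1 k N(1) q] by auto
  obtain C' where C': "C' \<ge> 0" "\<And>f h A s r D. approx R ?N p k A f h \<Longrightarrow> A > 0 \<Longrightarrow> 0 < s \<Longrightarrow> s \<le> r \<Longrightarrow> r < R \<Longrightarrow> D > 0 \<Longrightarrow>
    \<bar>f r - f s\<bar> \<le> D * (r - s) + D powr (1 - p) * s powr (1 - p) * (C' * A powr p)"
    using approx_critical_equicontinuous[OF R p1 k N(1)] by auto
  obtain C1 where C1: "C1 > 0"
    "\<And>(u :: real^'n::finite \<Rightarrow> real) A. u \<in> W_rad R \<phi> k p \<Longrightarrow> admissible k p u A \<Longrightarrow>
      \<exists>f h. approx R ?N p k (C1 * A) f h \<and> continuous_on {0<..<R} f \<and>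
        (AE x in lborel. x \<in> ball 0 R \<longrightarrow> u x = f (norm x))"
    by (rule W_rad_approx[OF p1 k]) (assumption | rule that)+
  obtain K where K: "K \<ge> 0" "\<And>q f (u :: real^'n::finite \<Rightarrow> real). (\<lambda>r. indicator {0<..<R} r *\<^sub>R f r) \<in> borel_measurable borel \<Longrightarrow>
     u \<in> borel_measurable (M_vol R \<phi>) \<Longrightarrow> (AE x in lborel. x \<in> ball 0 R \<longrightarrow> u x = f (norm x)) \<Longrightarrow>
     (\<integral>\<^sup>+x. ennreal (\<bar>u x\<bar> powr q * \<phi> (norm x) powr \<theta>) \<partial>M_vol R \<phi>) \<le> ennreal K * wint R (\<theta> + ?N - 1) q f"
    by (rule weighted_bound[OF \<theta>]) (assumption | rule that)+
  have cont: "continuously_embedded (M_vol R \<phi>) (W_rad R \<phi> k p :: (real^'n \<Rightarrow> real) set) (W_norm R \<phi> k p)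
             (L_weighted R \<phi> \<theta> q) (L_weighted_norm R \<phi> \<theta> q)"
  proof (rule embedding_of_wint_bound[OF p1 k \<theta> q])
    show "0 \<le> R powr (\<theta> + ?N - 2) * C * R" using C(1) R by simp
    fix f h A assume a: "approx R ?N p k A f h" "A > 0"
    have "wint R (\<theta> + ?N - 1) q f \<le> ennreal (R powr (\<theta> + ?N - 2) * (C * A powr q) * R)"
      using C(1) by (intro wint_critical_bound[OF N2 \<theta>] C(2)[OF a]) auto
    then show "wint R (\<theta> + ?N - 1) q f \<le> ennreal (R powr (\<theta> + ?N - 2) * C * R * A powr q)" by (simp add: mult_ac)
  qed
  have comp: "\<exists>r::nat \<Rightarrow> nat. \<exists>V\<in>L_weighted R \<phi> \<theta> q. strict_mono r \<and> (\<lambda>n. L_weighted_norm R \<phi> \<theta> q (\<lambda>x. Us (r n) x - V x)) \<longlonglongrightarrow> 0"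
    if H: "\<forall>n::nat. us n \<in> W_rad R \<phi> k p \<and> W_norm R \<phi> k p (us n) \<le> B \<and> Us n \<in> L_weighted R \<phi> \<theta> q \<and> (AE x in M_vol R \<phi>. us n x = Us n x)"
    for us Us :: "nat \<Rightarrow> real^'n \<Rightarrow> real" and B
  proof -
    \<comment> \<open>One common level above all the norms, positive whatever the sign of B.\<close>
    define A where "A = \<bar>B\<bar> + 1"
    define P where "P n f h \<longleftrightarrow> approx R ?N p k (C1 * A) f h \<and> continuous_on {0<..<R} f \<and>
      (AE x in lborel. x \<in> ball 0 R \<longrightarrow> us n x = f (norm x))" for n f h
    have "\<exists>f h. P n f h" for n
    proof -
      have "W_norm R \<phi> k p (us n) \<le> B" using H by blast
      then have "W_norm R \<phi> k p (us n) < A" by (simp add: A_def)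
      then show ?thesis
        unfolding P_def using H by (intro C1(2) admissible_of_less[OF p1]) auto
    qed
    then obtain f h where fh: "\<And>n. P n (f n) (h n)" by metis
    have f: "\<And>n. approx R ?N p k (C1 * A) (f n) (h n)" "\<And>n. continuous_on {0<..<R} (f n)"
      "\<And>n. AE x in lborel. x \<in> ball 0 R \<longrightarrow> us n x = f n (norm x)"
      using fh unfolding P_def by simp_all
    have CA: "C1 * A > 0" using C1(1) by (simp add: A_def)
    define K0 where "K0 = C * (C1 * A) powr q"
    have K0: "K0 \<ge> 0" using C(1) by (simp add: K0_def)
    have fb: "r * \<bar>f n r\<bar> powr q \<le> K0" if "0 < r" "r < R" for n r
      unfolding K0_def by (rule C(2)[OF f(1) CA that])
    have "0 \<le> C' * (C1 * A) powr p" using C'(1) by simp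
    then obtain \<rho> v where \<rho>: "strict_mono (\<rho> :: nat \<Rightarrow> nat)" and v: "\<And>r. 0 < r \<Longrightarrow> r < R \<Longrightarrow> (\<lambda>n. f (\<rho> n) r) \<longlonglongrightarrow> v r"
      by (rule convergent_subsequence[OF q p _ fb C'(2)[OF f(1) CA]]) (assumption | rule that)+
    have vb: "r * \<bar>v r\<bar> powr q \<le> K0" if r: "0 < r" "r < R" for r
    proof (rule LIMSEQ_le_const2)
      show "(\<lambda>n. r * \<bar>f (\<rho> n) r\<bar> powr q) \<longlonglongrightarrow> r * \<bar>v r\<bar> powr q"
        using q by (intro tendsto_intros tendsto_powr' v r) auto
    qed (use fb r in auto)
    have vm: "(\<lambda>r. indicator {0<..<R} r *\<^sub>R v r) \<in> borel_measurable borel"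
    proof (rule borel_measurable_LIMSEQ_real)
      show "(\<lambda>r. indicator {0<..<R} r *\<^sub>R f (\<rho> n) r) \<in> borel_measurable borel" for n
        by (rule indicator_continuous_measurable[OF f(2)])
      show "(\<lambda>n. indicator {0<..<R} r *\<^sub>R f (\<rho> n) r) \<longlonglongrightarrow> indicator {0<..<R} r *\<^sub>R v r" for r
        using v by (cases "r \<in> {0<..<R}") auto
    qed
    define V where "V x = indicator {0<..<R} (norm x) *\<^sub>R v (norm x)" for x :: "real^'n"
    have Vm: "V \<in> borel_measurable (M_vol R \<phi>)"
    proof -
      have "V \<in> borel_measurable borel"
        unfolding V_def[abs_def] by (rule measurable_compose[OF borel_measurable_continuous_onI[OF continuous_on_norm_id] vm])
      then have "V \<in> borel_measurable lborel" by simp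
      then show ?thesis unfolding measurable_M_vol by (intro measurable_restrict_space1 measurable_completion)
    qed
    have VL: "V \<in> L_weighted R \<phi> \<theta> q"
    proof (rule L_weighted_of_bound(1)[OF q Vm])
      have "AE x in lborel. x \<in> ball 0 R \<longrightarrow> V x = v (norm x)"
        using AE_M by eventually_elim (auto simp: V_def M_def)
      from K(2)[OF vm Vm this]
      have "(\<integral>\<^sup>+x. ennreal (\<bar>V x\<bar> powr q * \<phi> (norm x) powr \<theta>) \<partial>M_vol R \<phi>) \<le> ennreal K * wint R (\<theta> + ?N - 1) q v" .
      also have "\<dots> \<le> ennreal K * ennreal (R powr (\<theta> + ?N - 2) * K0 * R)"
        by (intro mult_left_mono wint_critical_bound[OF N2 \<theta> K0 vb]) auto
      also have "\<dots> = ennreal (K * (R powr (\<theta> + ?N - 2) * K0 * R))" using K(1) K0 R by (simp add: ennreal_mult)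
      finally show "(\<integral>\<^sup>+x. ennreal (\<bar>V x\<bar> powr q * \<phi> (norm x) powr \<theta>) \<partial>M_vol R \<phi>) \<le> ennreal (K * (R powr (\<theta> + ?N - 2) * K0 * R))" .
    qed (use K(1) K0 R in simp)
    \<comment> \<open>The q-th power of W is 1 / norm x; its membership in the weighted space is the
      integrability of the majorant.\<close>
    define W where "W x = norm x powr (- 1 / q)" for x :: "real^'n"
    have Wm: "W \<in> borel_measurable (M_vol R \<phi>)"
    proof -
      have "W \<in> borel_measurable borel" unfolding W_def[abs_def] by measurable
      then have "W \<in> borel_measurable lborel" by simp
      then show ?thesis unfolding measurable_M_vol by (intro measurable_restrict_space1 measurable_completion)
    qed
    have WL: "W \<in> L_weighted R \<phi> \<theta> q"
    proof (rule L_weighted_of_bound(1)[OF q Wm])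
      have wm: "(\<lambda>r. indicator {0<..<R} r *\<^sub>R (r powr (- 1 / q))) \<in> borel_measurable borel" by measurable
      have "(\<integral>\<^sup>+x. ennreal (\<bar>W x\<bar> powr q * \<phi> (norm x) powr \<theta>) \<partial>M_vol R \<phi>) \<le> ennreal K * wint R (\<theta> + ?N - 1) q (\<lambda>r. r powr (- 1 / q))"
        by (rule K(2)[OF wm Wm]) (simp add: W_def)
      also have "\<dots> \<le> ennreal K * ennreal (R powr (\<theta> + ?N - 2) * 1 * R)"
      proof (intro mult_left_mono wint_critical_bound[OF N2 \<theta>])
        show "r * \<bar>r powr (- 1 / q)\<bar> powr q \<le> 1" if "0 < r" "r < R" for r
        proof -
          have "(r powr (- 1 / q)) powr q = 1 / r"
            using that q by (simp only: powr_powr) (simp add: powr_minus_divide)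
          then show ?thesis using that by simp
        qed
      qed auto
      also have "\<dots> = ennreal (K * (R powr (\<theta> + ?N - 2) * 1 * R))" using K(1) R by (simp add: ennreal_mult)
      finally show "(\<integral>\<^sup>+x. ennreal (\<bar>W x\<bar> powr q * \<phi> (norm x) powr \<theta>) \<partial>M_vol R \<phi>) \<le> ennreal (K * (R powr (\<theta> + ?N - 2) * 1 * R))" .
    qed (use K(1) R in simp)
    have Usm: "Us n \<in> borel_measurable (M_vol R \<phi>)" for n
      using H by (auto simp: L_weighted_def Lw_space_def)
    have AEU: "AE x in M_vol R \<phi>. \<forall>n. Us n x = f n (norm x)"
    proof (subst AE_all_countable, rule allI)
      fix n
      have "AE x in M_vol R \<phi>. us n x = f n (norm x)" unfolding AE_M_vol by (rule f(3))
      moreover have "AE x in M_vol R \<phi>. us n x = Us n x" using H by blast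
      ultimately show "AE x in M_vol R \<phi>. Us n x = f n (norm x)" by eventually_elim simp
    qed
    let ?s = "\<lambda>n x. \<bar>Us (\<rho> n) x - V x\<bar> powr q * \<phi> (norm x) powr \<theta>"
    have lim: "(\<lambda>n. LINT x|M_vol R \<phi>. ?s n x) \<longlonglongrightarrow> integral\<^sup>L (M_vol R \<phi>) (\<lambda>x::real^'n. 0::real)"
    proof (rule integral_dominated_convergence)
      show "(\<lambda>x::real^'n. 0::real) \<in> borel_measurable (M_vol R \<phi>)" by simp
      show "?s n \<in> borel_measurable (M_vol R \<phi>)" for n
        by (rule weighted_measurable[OF borel_measurable_diff[OF Usm Vm]])
      show "integrable (M_vol R \<phi>) (\<lambda>x. (2 powr q * (K0 + K0)) * (\<bar>W x\<bar> powr q * \<phi> (norm x) powr \<theta>))"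
        using WL by (intro integrable_mult_right) (simp add: L_weighted_def Lw_space_def)
      show "AE x in M_vol R \<phi>. (\<lambda>n. ?s n x) \<longlonglongrightarrow> 0"
        using AEU AE_M_vol_M
      proof eventually_elim
        case (elim x)
        have "(\<lambda>n. f (\<rho> n) (norm x) - v (norm x)) \<longlonglongrightarrow> 0"
          using v[OF M_D(2,3)[OF elim(2)]] by (simp add: LIM_zero)
        then have "(\<lambda>n. \<bar>f (\<rho> n) (norm x) - v (norm x)\<bar> powr q * \<phi> (norm x) powr \<theta>) \<longlonglongrightarrow> \<bar>0\<bar> powr q * \<phi> (norm x) powr \<theta>"
          using q by (intro tendsto_mult tendsto_powr' tendsto_rabs tendsto_const) auto
        then show ?case using elim M_D[OF elim(2)] q by (simp add: V_def)
      qed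
      show "AE x in M_vol R \<phi>. norm (?s n x) \<le> (2 powr q * (K0 + K0)) * (\<bar>W x\<bar> powr q * \<phi> (norm x) powr \<theta>)" for n
        using AEU AE_M_vol_M
      proof eventually_elim
        case (elim x)
        let ?r = "norm x"
        have r: "0 < ?r" "?r < R" by (rule M_D[OF elim(2)])+
        have "(?r powr (- 1 / q)) powr q = 1 / ?r"
          using r q by (simp only: powr_powr) (simp add: powr_minus_divide)
        then have Wr: "\<bar>W x\<bar> powr q = 1 / ?r" by (simp add: W_def)
        have "\<bar>f (\<rho> n) ?r - v ?r\<bar> powr q \<le> (\<bar>f (\<rho> n) ?r\<bar> + \<bar>v ?r\<bar>) powr q" using q by (intro powr_mono2) auto
        also have "\<dots> \<le> 2 powr q * (\<bar>f (\<rho> n) ?r\<bar> powr q + \<bar>v ?r\<bar> powr q)" using q by (intro powr_add_le) auto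
        also have "\<dots> \<le> 2 powr q * (K0 / ?r + K0 / ?r)"
          using fb[OF r, of "\<rho> n"] vb[OF r] r by (intro mult_left_mono add_mono) (auto simp: field_simps)
        also have "\<dots> = (2 powr q * (K0 + K0)) * \<bar>W x\<bar> powr q" by (simp add: Wr add_divide_distrib)
        finally have "\<bar>f (\<rho> n) ?r - v ?r\<bar> powr q * \<phi> ?r powr \<theta> \<le> (2 powr q * (K0 + K0)) * \<bar>W x\<bar> powr q * \<phi> ?r powr \<theta>"
          by (rule mult_right_mono) simp
        then show ?case using elim r by (simp add: V_def mult.assoc)
      qed
    qed
    have "(\<lambda>n. (LINT x|M_vol R \<phi>. ?s n x) powr (1 / q)) \<longlonglongrightarrow> 0 powr (1 / q)"
    proof (rule tendsto_powr')
      show "(\<lambda>n. LINT x|M_vol R \<phi>. ?s n x) \<longlonglongrightarrow> 0" using lim by simp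
      show "0 \<noteq> (0::real) \<or> 0 < 1 / q \<and> (\<forall>\<^sub>F n in sequentially. 0 \<le> (LINT x|M_vol R \<phi>. ?s n x))"
        using q by (auto intro!: always_eventually Bochner_Integration.integral_nonneg)
    qed simp
    then have "(\<lambda>n. L_weighted_norm R \<phi> \<theta> q (\<lambda>x. Us (\<rho> n) x - V x)) \<longlonglongrightarrow> 0"
      by (simp add: L_weighted_norm_def Lw_norm_def)
    with \<rho> VL show ?thesis by blast
  qed
  show ?thesis unfolding compactly_embedded_def using cont comp by blast
qed

theorem subcritical_embedding:
  assumes p: "p \<ge> 1" and k: "k \<ge> 1" and \<theta>: "\<theta> \<ge> 0" and N: "real k * p < real CARD('n::finite)"
    and q: "1 \<le> q" "q \<le> (\<theta> + real CARD('n)) * p / (real CARD('n) - real k * p)"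
  shows "continuously_embedded (M_vol R \<phi>) (W_rad R \<phi> k p :: (real^'n \<Rightarrow> real) set) (W_norm R \<phi> k p)
             (L_weighted R \<phi> \<theta> q) (L_weighted_norm R \<phi> \<theta> q)"
proof -
  have "0 < CARD('n)" by (rule zero_less_card_finite)
  then have N1: "1 \<le> real CARD('n)" by linarith
  obtain C where "C \<ge> 0" "\<And>f h A. approx R (real CARD('n)) p k A f h \<Longrightarrow> continuous_on {0<..<R} f \<Longrightarrow> A > 0 \<Longrightarrow>
    wint R (\<theta> + real CARD('n) - 1) q f \<le> ennreal (C * A powr q)"
    using approx_subcritical[OF R p k N N1 \<theta> q] by auto
  then show ?thesis by (rule embedding_of_wint_bound[OF p k \<theta> q(1)])
qed

end

section \<open>The endpoint case\<close>

text \<open>With p = 1 and N = k, the k - 1 Hardy steps bring the derivative from weight k - 1 to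
  weight 0, so its plain integral bounds the oscillation of g on all of (0,R). The value at R/2,
  where the weight is harmless, anchors the bound.\<close>

lemma endpoint_bound:
  assumes R: "R > 0" and k: "k \<ge> 1"
  obtains C where "C \<ge> 0"
    "\<And>g r. deriv_chain R k g \<Longrightarrow> 0 < r \<Longrightarrow> r < R \<Longrightarrow> ennreal \<bar>g 0 r\<bar> \<le> ennreal C * energy R (real k) 1 k g"
proof -
  let ?s = "R / 2"
  let ?m = "?s powr (- real k)"
  have lt: "real (k - 1) * 1 < real k" using k by simp
  have ex: "real k - 1 - real (k - 1) * 1 = 0" using k by (simp add: of_nat_diff)
  obtain C1 where C1: "C1 \<ge> 0" "\<And>k' g j. deriv_chain R k' g \<Longrightarrow> j + (k - 1) \<le> k' \<Longrightarrow>
    wint R 0 1 (g j) \<le> ennreal C1 * (\<Sum>l\<le>k'. wint R (real k - 1) 1 (g l))"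
    using wint_hardy_iter[OF R order_refl lt] unfolding ex by blast
  obtain C2 where C2: "C2 \<ge> 0" "\<And>f f' r. (\<And>r. 0 < r \<Longrightarrow> r < R \<Longrightarrow> (f has_real_derivative f' r) (at r)) \<Longrightarrow>
    continuous_on {0<..<R} f' \<Longrightarrow> 0 < r \<Longrightarrow> r < R \<Longrightarrow>
    ennreal (r powr real k * \<bar>f r\<bar>) \<le> ennreal C2 * (wint R (real k - 1) 1 f + wint R (real k - 1) 1 f')"
    using wint_sup_bound[OF R, of "real k"] by auto
  show ?thesis
  proof (rule that[of "?m * C2 + C1"])
    fix g r assume g: "deriv_chain R k g" and r: "0 < r" "r < R"
    let ?E = "energy R (real k) 1 k g"
    have der: "\<And>r. 0 < r \<Longrightarrow> r < R \<Longrightarrow> (g 0 has_real_derivative g 1 r) (at r)"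
      using deriv_chainD[OF g, of 0] by simp
    have cont: "continuous_on {0<..<R} (g 1)" by (rule deriv_chain_continuous_on[OF g k])
    have E01: "wint R (real k - 1) 1 (g 0) + wint R (real k - 1) 1 (g 1) \<le> ?E"
    proof -
      have "(\<Sum>l\<in>{0, 1}. wint R (real k - 1) 1 (g l)) \<le> ?E"
        unfolding energy_def using k by (intro sum_mono2) auto
      then show ?thesis by simp
    qed
    have "?m * (?s powr real k * \<bar>g 0 ?s\<bar>) = \<bar>g 0 ?s\<bar>"
      using R by (simp add: mult.assoc[symmetric] powr_add[symmetric])
    then have "ennreal \<bar>g 0 ?s\<bar> = ennreal ?m * ennreal (?s powr real k * \<bar>g 0 ?s\<bar>)"
      by (simp add: ennreal_mult[symmetric])
    also have "\<dots> \<le> ennreal ?m * (ennreal C2 * ?E)"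
      using R by (intro mult_left_mono order_trans[OF C2(2)[OF der cont] mult_left_mono[OF E01]]) auto
    finally have mid: "ennreal \<bar>g 0 ?s\<bar> \<le> ennreal (?m * C2) * ?E" using C2(1) by (simp add: ennreal_mult mult.assoc)
    have osc: "ennreal \<bar>g 0 t - g 0 s\<bar> \<le> ennreal C1 * ?E" if st: "0 < s" "s \<le> t" "t < R" for s t
    proof -
      have "ennreal \<bar>g 0 t - g 0 s\<bar> \<le> (\<integral>\<^sup>+r. ennreal \<bar>g 1 r\<bar> * indicator {s..t} r \<partial>lborel)"
        by (rule ftc_bound(1)[OF der cont st])
      also have "\<dots> \<le> wint R 0 1 (g 1)"
        unfolding wint_def using st by (intro nn_integral_mono) (auto simp: indicator_def)
      also have "\<dots> \<le> ennreal C1 * ?E" unfolding energy_def using k by (intro C1(2)[OF g]) simp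
      finally show ?thesis .
    qed
    have "ennreal \<bar>g 0 r - g 0 ?s\<bar> \<le> ennreal C1 * ?E"
    proof (cases "r \<le> ?s")
      case True
      then show ?thesis using osc[of r ?s] r R by (simp add: abs_minus_commute)
    qed (use osc[of ?s r] r R in simp)
    then have "ennreal \<bar>g 0 ?s\<bar> + ennreal \<bar>g 0 r - g 0 ?s\<bar> \<le> ennreal (?m * C2) * ?E + ennreal C1 * ?E"
      by (intro add_mono mid)
    also have "\<dots> = ennreal (?m * C2 + C1) * ?E" using C1(1) C2(1) by (simp add: distrib_right)
    finally have "ennreal (\<bar>g 0 ?s\<bar> + \<bar>g 0 r - g 0 ?s\<bar>) \<le> ennreal (?m * C2 + C1) * ?E" by (simp add: ennreal_plus)
    then show "ennreal \<bar>g 0 r\<bar> \<le> ennreal (?m * C2 + C1) * ?E"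
      by (rule order_trans[rotated]) (intro ennreal_leI, linarith)
  qed (use C1 C2 in simp)
qed

text \<open>The endpoint bound applied to the increments makes the convergence uniform up to the
  origin, so the limits of the approximants at 0 pass to the profile.\<close>

lemma (in cauchy_chain) w_limit_origin:
  assumes k: "k \<ge> 1" and N: "N = real k" and lim: "\<And>n. \<exists>l. (h n 0 \<longlongrightarrow> l) (at_right 0)"
  shows "\<exists>L. (w 0 \<longlongrightarrow> L) (at_right 0)"
proof (rule tendsto_of_Cauchy_filter)
  obtain C where C: "C \<ge> 0"
    "\<And>g r. deriv_chain R k g \<Longrightarrow> 0 < r \<Longrightarrow> r < R \<Longrightarrow> ennreal \<bar>g 0 r\<bar> \<le> ennreal C * energy R (real k) 1 k g"
    using endpoint_bound[OF R k] by blast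
  define B where "B = C * real (Suc k)"
  have B: "B \<ge> 0" using C(1) by (simp add: B_def)
  have dB: "\<bar>d n 0 r\<bar> \<le> B * a n" if r: "0 < r" "r < R" for n r
  proof -
    have "ennreal \<bar>d n 0 r\<bar> \<le> ennreal C * energy R N 1 k (d n)" unfolding N by (rule C(2)[OF chain_d r])
    also have "energy R N 1 k (d n) \<le> (\<Sum>l\<le>k. ennreal (a n))" unfolding energy_def by (intro sum_mono small_d) simp
    also have "(\<Sum>l\<le>k. ennreal (a n)) = ennreal (real (Suc k) * a n)"
      using a(2) by (simp only: sum_constant card_atMost ennreal_of_nat_eq_real_of_nat ennreal_mult of_nat_0_le_iff)
    finally have "ennreal \<bar>d n 0 r\<bar> \<le> ennreal (C * (real (Suc k) * a n))"
      using C(1) a(2) by (simp add: ennreal_mult mult_left_mono)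
    then show ?thesis using C(1) a(2) by (subst (asm) ennreal_le_iff) (auto simp: B_def mult.assoc)
  qed
  show "at_right (0::real) \<noteq> bot" by simp
  fix e :: real assume e: "e > 0"
  have "(\<lambda>n. B * tl n) \<longlonglongrightarrow> B * 0" by (intro tendsto_intros tl_tendsto)
  then have "\<forall>\<^sub>F n in sequentially. B * tl n < e / 4" using e by (intro order_tendstoD(2)) auto
  then obtain n where n: "B * tl n < e / 4" by (rule eventually_happens'[OF sequentially_bot, THEN exE])
  obtain l where "(h n 0 \<longlongrightarrow> l) (at_right 0)" using lim by blast
  then have "\<forall>\<^sub>F r in at_right 0. dist (h n 0 r) l < e / 4" using e by (intro tendstoD) auto
  moreover have "\<forall>\<^sub>F r in at_right 0. 0 < r \<and> r < R"
    using eventually_at_right_real[OF R] by eventually_elim auto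
  ultimately have "\<forall>\<^sub>F r in at_right 0. (0 < r \<and> r < R) \<and> dist (h n 0 r) l < e / 4" by eventually_elim simp
  moreover have "\<bar>w 0 x - w 0 y\<bar> \<le> e" if x: "(0 < x \<and> x < R) \<and> dist (h n 0 x) l < e / 4" and y: "(0 < y \<and> y < R) \<and> dist (h n 0 y) l < e / 4" for x y
  proof -
    have "\<bar>v 0 x - h n 0 x\<bar> \<le> B * tl n" using x by (intro v_dist_le dB) auto
    moreover have "\<bar>v 0 y - h n 0 y\<bar> \<le> B * tl n" using y by (intro v_dist_le dB) auto
    moreover have "\<bar>h n 0 x - l\<bar> < e / 4" "\<bar>h n 0 y - l\<bar> < e / 4" using x y by (simp_all add: dist_real_def)
    ultimately have "\<bar>v 0 x - v 0 y\<bar> \<le> e" using n unfolding abs_le_iff abs_less_iff by linarith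
    then show ?thesis using x y by (simp add: w_eq)
  qed
  ultimately show "\<exists>P. eventually P (at_right 0) \<and> (\<forall>x y. P x \<longrightarrow> P y \<longrightarrow> \<bar>w 0 x - w 0 y\<bar> \<le> e)" by blast
qed

lemma continuous_on_radial_extension:
  fixes f :: "real \<Rightarrow> real"
  assumes R: "R > 0" and cont: "continuous_on {0<..R} f" and lim: "(f \<longlongrightarrow> L) (at_right 0)"
  shows "continuous_on (cball 0 R) (\<lambda>x::'a::real_normed_vector. if x = 0 then L else f (norm x))"
proof -
  define F where "F r = (if r \<le> 0 then L else f r)" for r
  have "continuous (at r within {0..R}) F" if r: "r \<in> {0..R}" for r
  proof (cases "r = 0")
    case True
    have "(F \<longlongrightarrow> L) (at_right 0)"
      by (rule Lim_transform_eventually[OF lim]) (auto simp: F_def eventually_at_filter)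
    then have "(F \<longlongrightarrow> L) (at 0 within {0..R})"
      using R by (simp add: at_within_Icc_at_right)
    then show ?thesis using True by (simp add: continuous_within F_def)
  next
    case False
    then have r0: "0 < r" "r \<le> R" using r by auto
    have "(f \<longlongrightarrow> f r) (at r within {0<..R})" using cont r0 by (simp add: continuous_on_def)
    then have "(F \<longlongrightarrow> f r) (at r within {0<..R})"
      by (rule Lim_transform_eventually) (auto simp: F_def eventually_at_filter)
    moreover have "at r within {0<..R} = at r within {0..R}"
      by (rule at_within_nhd[of _ "{0<..}"]) (use r0 in auto)
    ultimately show ?thesis using r0 by (simp add: continuous_within F_def)
  qed
  then have "continuous_on {0..R} F" by (simp add: continuous_on_eq_continuous_within)
  then have "continuous_on (cball 0 R) (\<lambda>x::'a. F (norm x))"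
    by (rule continuous_on_compose2) (auto intro: continuous_intros)
  then show ?thesis by (rule continuous_on_eq) (auto simp: F_def)
qed

text \<open>The set violating the bound is open in the ball and null, hence empty; continuity
  carries the bound to the boundary.\<close>

lemma continuous_on_cball_AE_le:
  fixes U :: "'a::euclidean_space \<Rightarrow> real"
  assumes R: "R > 0" and cont: "continuous_on (cball 0 R) U"
    and AE: "AE x in lborel. x \<in> ball 0 R \<longrightarrow> \<bar>U x\<bar> \<le> K" and x: "x \<in> cball 0 R"
  shows "\<bar>U x\<bar> \<le> K"
proof -
  define V where "V = {x \<in> ball 0 R. K < \<bar>U x\<bar>}"
  have "open V"
  proof -
    have "continuous_on (ball 0 R) (\<lambda>x. \<bar>U x\<bar>)"
      by (intro continuous_intros continuous_on_subset[OF cont]) auto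
    then have "open ((\<lambda>x. \<bar>U x\<bar>) -` {K<..} \<inter> ball 0 R)"
      by (subst (asm) continuous_on_open_vimage) auto
    moreover have "(\<lambda>x. \<bar>U x\<bar>) -` {K<..} \<inter> ball 0 R = V" by (auto simp: V_def)
    ultimately show ?thesis by simp
  qed
  then have "V \<in> sets lebesgue" by (intro sets_completionI_sets) simp
  moreover have "AE x in lebesgue. x \<notin> V" using AE_completion[OF AE] by eventually_elim (auto simp: V_def)
  ultimately have "negligible V" by (simp add: AE_iff_null_sets negligible_iff_null_sets)
  then have "V = {}" using open_not_negligible[OF \<open>open V\<close>] by blast
  then have "\<forall>x\<in>ball 0 R. norm (U x) \<le> K" by (force simp: V_def not_less)
  then have "norm (U x) \<le> K"
    using R cont x by (intro continuous_on_closure_norm_le[of "ball 0 R" U K x]) auto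
  then show ?thesis by simp
qed

context warped
begin

theorem endpoint_embedding:
  "continuously_embedded (M_vol R \<phi>) (W_rad R \<phi> CARD('n) 1 :: (real^'n::finite \<Rightarrow> real) set) (W_norm R \<phi> CARD('n) 1)
             (C_cball R) (C_cball_norm R)"
proof -
  let ?k = "CARD('n)"
  have k: "?k \<ge> 1" by (simp add: Suc_le_eq)
  obtain C where C: "C > 0" "\<And>(u :: real^'n::finite \<Rightarrow> real) us A. u \<in> W_rad R \<phi> ?k 1 \<Longrightarrow> rep ?k 1 us u \<Longrightarrow> A > 0 \<Longrightarrow>
      (\<forall>\<^sub>F n in sequentially. snorm ?k 1 (us n) < A) \<Longrightarrow>
      \<exists>h a. cauchy_chain R (real ?k) ?k h a \<and>
        (\<exists>\<^sub>F n in sequentially. energy R (real ?k) 1 ?k (h n) \<le> ennreal ((C * A) powr 1)) \<and>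
        (AE x in lborel. x \<in> ball 0 R \<longrightarrow> u x = cauchy_chain.w R h 0 (norm x)) \<and>
        (\<forall>n. \<exists>l. (h n 0 \<longlongrightarrow> l) (at_right 0))"
    by (rule W_rad_cauchy_chain[OF order_refl k]) (assumption | rule that)+
  obtain C1 where C1: "C1 \<ge> 0"
    "\<And>g r. deriv_chain R ?k g \<Longrightarrow> 0 < r \<Longrightarrow> r < R \<Longrightarrow> ennreal \<bar>g 0 r\<bar> \<le> ennreal C1 * energy R (real ?k) 1 ?k g"
    using endpoint_bound[OF R k] by blast
  have main: "\<exists>U. continuous_on (cball 0 R) U \<and> (AE x in lborel. x \<in> ball 0 R \<longrightarrow> u x = U x) \<and>
      (AE x in lborel. x \<in> ball 0 R \<longrightarrow> \<bar>U x\<bar> \<le> C1 * C * A)"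
    if u: "u \<in> W_rad R \<phi> ?k 1" and ad: "admissible ?k 1 u A" for u :: "real^'n \<Rightarrow> real" and A
  proof -
    obtain us where us: "A > 0" "rep ?k 1 us u" "\<forall>\<^sub>F n in sequentially. snorm ?k 1 (us n) < A"
      using ad by (auto simp: admissible_def)
    obtain h a where h: "cauchy_chain R (real ?k) ?k h a"
        "\<exists>\<^sub>F n in sequentially. energy R (real ?k) 1 ?k (h n) \<le> ennreal ((C * A) powr 1)"
        "AE x in lborel. x \<in> ball 0 R \<longrightarrow> u x = cauchy_chain.w R h 0 (norm x)"
        "\<And>n. \<exists>l. (h n 0 \<longlongrightarrow> l) (at_right 0)"
      using C(2)[OF u us(2,1,3)] by blast
    interpret cc: cauchy_chain R "real ?k" ?k h a by (rule h(1))
    obtain L where L: "(cc.w 0 \<longlongrightarrow> L) (at_right 0)" using cc.w_limit_origin[OF k refl h(4)] by blast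
    have ap: "approx R (real ?k) 1 ?k (C * A) (cc.w 0) h"
      unfolding approx_def using h(2) cc.chain cc.v_tendsto[of 0] k by (auto simp: cc.w_eq)
    have bd: "\<bar>cc.w 0 r\<bar> \<le> C1 * C * A" if r: "0 < r" "r < R" for r
    proof -
      have "1 * \<bar>cc.w 0 r\<bar> powr 1 \<le> C1 * (C * A) powr 1"
        by (rule approx_pointwise_transfer[OF ap r C1(1) order_refl]) (use C1(2) r in simp)
      then show ?thesis using C(1) us(1) by simp
    qed
    let ?U = "\<lambda>x::real^'n. if x = 0 then L else cc.w 0 (norm x)"
    have "continuous_on (cball 0 R) ?U"
      by (rule continuous_on_radial_extension[OF R cc.continuous_w L]) (use k in simp)
    moreover have "AE x in lborel. x \<in> ball 0 R \<longrightarrow> u x = ?U x"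
      using h(3) AE_lborel_nonzero by eventually_elim auto
    moreover have "AE x in lborel. x \<in> ball 0 R \<longrightarrow> \<bar>?U x\<bar> \<le> C1 * C * A"
      using AE_M by eventually_elim (auto simp: M_def intro!: bd)
    ultimately show ?thesis by blast
  qed
  show ?thesis unfolding continuously_embedded_def
  proof (intro exI ballI)
    fix u :: "real^'n \<Rightarrow> real" assume u: "u \<in> W_rad R \<phi> ?k 1"
    obtain U where U: "continuous_on (cball 0 R) U" "AE x in lborel. x \<in> ball 0 R \<longrightarrow> u x = U x"
      using main[OF u admissible_of_less[OF order_refl u, of "W_norm R \<phi> ?k 1 u + 1"]] by auto
    have "C_cball_norm R U \<le> (C1 * C) * W_norm R \<phi> ?k 1 u"
    proof (rule le_W_norm[OF order_refl u])
      show "0 \<le> C1 * C" using C1(1) C(1) by simp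
      \<comment> \<open>The representative U is fixed, while each level A yields its own U'. Both
        equal u almost everywhere, so U inherits the bound almost everywhere and, being continuous,
        everywhere.\<close>
      fix A assume "admissible ?k 1 u A"
      from main[OF u this] obtain U' where U': "AE x in lborel. x \<in> ball 0 R \<longrightarrow> u x = U' x"
        "AE x in lborel. x \<in> ball 0 R \<longrightarrow> \<bar>U' x\<bar> \<le> C1 * C * A" by blast
      have AE: "AE x in lborel. x \<in> ball 0 R \<longrightarrow> \<bar>U x\<bar> \<le> C1 * C * A"
        using U(2) U' by eventually_elim auto
      show "C_cball_norm R U \<le> C1 * C * A"
        unfolding C_cball_norm_def
        by (rule cSUP_least) (use R continuous_on_cball_AE_le[OF R U(1) AE] in auto)
    qed
    then show "\<exists>U\<in>C_cball R. (AE x in M_vol R \<phi>. u x = U x) \<and> C_cball_norm R U \<le> (C1 * C) * W_norm R \<phi> ?k 1 u"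
      using U unfolding AE_M_vol C_cball_def by blast
  qed
qed

end

theorem theorem1p3:
  fixes R \<theta> p :: real and k :: nat and \<phi> :: "real \<Rightarrow> real"
  assumes "CARD('n::finite) \<ge> 2"
    and "R > 0"
    and "warping_function R \<phi>"
    and "\<theta> \<ge> 0"
    and "p \<ge> 1"
    and "k \<ge> 1"
    and "\<forall>j. \<exists>L>0. (iter_deriv {0..<R} j \<phi> \<longlongrightarrow> L) (at_left R)"
  shows
    "(\<forall>u \<in> (W_rad R \<phi> k p :: (real^'n \<Rightarrow> real) set).
        \<exists>U. (AE x in M_vol R \<phi>. u x = U x) \<and> Ck_on (k - 1) (cball 0 R - {0}) U \<and>
            (AE x in M_vol R \<phi>. \<forall>I i. length I = k - 1 \<longrightarrow> has_partial i (partials I U) x))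
     \<and>
     (real CARD('n) > real k * p \<longrightarrow>
        (\<forall>q. 1 \<le> q \<and> q \<le> (\<theta> + real CARD('n)) * p / (real CARD('n) - real k * p) \<longrightarrow>
           continuously_embedded (M_vol R \<phi>)
             (W_rad R \<phi> k p :: (real^'n \<Rightarrow> real) set) (W_norm R \<phi> k p)
             (L_weighted R \<phi> \<theta> q) (L_weighted_norm R \<phi> \<theta> q)))
     \<and>
     (real CARD('n) = real k * p \<and> p > 1 \<longrightarrow>
        (\<forall>q\<ge>1. compactly_embedded (M_vol R \<phi>)
             (W_rad R \<phi> k p :: (real^'n \<Rightarrow> real) set) (W_norm R \<phi> k p)
             (L_weighted R \<phi> \<theta> q) (L_weighted_norm R \<phi> \<theta> q)))
     \<and>
     (real CARD('n) = real k * p \<and> p = 1 \<longrightarrow>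
        continuously_embedded (M_vol R \<phi>)
             (W_rad R \<phi> CARD('n) 1 :: (real^'n \<Rightarrow> real) set) (W_norm R \<phi> CARD('n) 1)
             (C_cball R) (C_cball_norm R))"
proof -
  interpret warped R \<phi> using assms(2,3,7) by unfold_locales auto
  show ?thesis
    using radial_regularity[OF assms(5,6)] subcritical_embedding[OF assms(5,6,4)]
      critical_compact_embedding[OF _ assms(6,4) _ _ assms(1)] endpoint_embedding
    by (intro conjI ballI impI allI) auto
qed

end
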